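(* Let $q^*:\mathbb{R}^d\to(0,\infty)$ be a continuous, strictly positive, bounded probability density, and let $\pi:\mathbb{R}^d\to(0,\infty)$ be a continuously differentiable, positive probability density such that $$\lim_{|x|\to\infty}\frac{x}{|x|}\cdot\nabla(\log\pi)(x)=-\infty\qquad\text{and}\qquad\limsup_{|x|\to\infty}\frac{x}{|x|}\cdot\frac{\nabla\pi(x)}{|\nabla\pi(x)|}<0 .$$ Let $P$ be the Metropolis-Hastings kernel with target density $\pi$ and proposal density $q(x,y)=q^*(y-x)$ (a Random walk Metropolis kernel), and let $\Phi$ be the Markov chain driven by $P$. Assume: (i) there exist a function $K_q:\mathbb{R}^d\to\mathbb{R}$ and $\epsilon_q>0$ such that $\int_{\mathbb{R}^d}K_q(z)\,dz<\infty$ and $|q^*(z)-q^*(\tilde z)|\le|z-\tilde z|K_q(z)$ for all $z,\tilde z\in\mathbb{R}^d$ with $|z-\tilde z|<\epsilon_q$; (ii) there exist constants $\beta\in(\frac12,1)$, $c_\beta>0$ and $\epsilon_\pi>0$ such that $|\nabla\pi(\tilde x)|<c_\beta\pi(x)^\beta$ for all $x,\tilde x\in\mathbb{R}^d$ with $|x-\tilde x|<\epsilon_\pi$. Fix $\gamma\in(0,\beta-\frac12)$ and let $V_\gamma=c_\gamma\pi^{-\gamma}$, where $c_\gamma$ is a constant ensuring $V_\gamma>1$. Let $(\mathbb{X}_n)_{n\in\mathbb{N}}$, with partitions $\{J^n_0,\dots,J^n_{m_n}\}$ and representatives $a^n_j\in J^n_j$, be a sequence of allotments exhaustive with respect to $V_\gamma$,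 and let $\delta_{\gamma,n}=\delta(\mathbb{X}_n,V_\gamma)$ be the $V_\gamma$-mesh. Let $F\in L^\infty_{V_\gamma}$ be a continuously differentiable function such that, for some constants $c_F,\epsilon_F>0$, $|\nabla F(\tilde x)|<c_F\,\pi^{\gamma-\frac12}(x)$ for all $x,\tilde x\in\mathbb{R}^d$ with $|x-\tilde x|<\epsilon_F$. For each $n$ let $\tilde F_n$ be the output of the Scheme with input $P$, $F$ and $\mathbb{X}_n$. Then there exists a constant $C_\gamma>0$ such that the asymptotic variance $\sigma_n^2$ in the central limit theorem for the ergodic averages of $F+P\tilde F_n-\tilde F_n$ along $\Phi$ satisfies $$\sigma_n^2\le C_\gamma\max\Big(\delta_{\gamma,n}^2,\int_{J^n_0}\pi^{1-2\gamma}(x)\,dx\Big)\qquad\text{for all }n\in\mathbb{N}.$$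
   Context: Metropolis-Hastings kernel: with target density $\pi$ (with respect to Lebesgue measure $\mu^{\mathrm{Leb}}$ on $\mathbb{R}^d$) and proposal transition density $q$, put $\alpha(x,y)=\min\left(1,\frac{\pi(y)q(y,x)}{\pi(x)q(x,y)}\right)$ (here $\pi(x)q(x,y)>0$ always) and $$P(x,dy)=\alpha(x,y)q(x,y)\,dy+\Big(1-\int_{\mathbb{R}^d}\alpha(x,z)q(x,z)\,dz\Big)\delta_x(dy),$$ where $\delta_x$ is the Dirac measure at $x$. The symbol $\pi$ also denotes the probability measure $\pi(x)dx$; $\pi(G)=\int G(x)\pi(x)dx$ and $PG(x)=\int G(y)P(x,dy)$. $|x|$ is the Euclidean norm. For $V:\mathbb{R}^d\to[1,\infty)$, $L^\infty_V$ is the space of measurable $G:\mathbb{R}^d\to\mathbb{R}$ with $\|G\|_V:=\sup_x |G(x)|/V(x)<\infty$. Asymptotic variance: for $H\in L^\infty_{V_\gamma}$ let $S_k(H)=\frac1k\sum_{i=1}^kH(\Phi_i)$. In the stated setting the function $V_\gamma$, $0<\gamma<\frac12$, is a geometric drift function for $P$ (i.e. $V_\gamma$ is continuous with bounded sublevel sets, $\pi(V_\gamma^2)<\infty$, and $PV_\gamma\le\lambda V_\gamma+\kappa1_C$ for some $\lambda\in(0,1)$, $\kappa>0$ and compact $C$), and the CLT $\sqrt{k}\,(S_k(H)-\pi(H))\to\sigma_H N(0,1)$ in distribution as $k\to\infty$ holds; $\sigma_H^2$ is the asymptotic variance. Allotments: an allotment $\mathbb{X}=(\mathbb{J},X)$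 of size $m$ consists of a partition $\mathbb{J}=\{J_0,\dots,J_m\}$ of $\mathbb{R}^d$ into measurable sets with $\bigcup_{j=1}^mJ_j$ bounded and $\mu^{\mathrm{Leb}}(J_j)>0$ for all $0\le j\le m$, and a set of representatives $X=\{a_0,\dots,a_m\}$ with $a_j\in J_j$. For measurable $W:\mathbb{R}^d\to[1,\infty)$ define $\mathrm{rad}(\mathbb{X},W)=\inf_{y\in J_0}W(y)$ and the $W$-mesh $$\delta(\mathbb{X},W)=\max\Big(\max_{1\le j\le m}\sup_{y\in J_j}|y-a_j|,\ \max_{0\le j\le m}\sup_{y\in J_j}\big(W(a_j)/W(y)-1\big)\Big).$$ A sequence $(\mathbb{X}_n)$ of allotments is exhaustive with respect to $W$ if $\mathrm{rad}(\mathbb{X}_n,W)\to\infty$ and $\delta(\mathbb{X}_n,W)\to0$ as $n\to\infty$. The Scheme with input $P$, $F$, $\mathbb{X}$: (I) let $(p_{\mathbb{X}})_{ij}=P(a_i,J_j)$, $0\le i,j\le m$, and $f_{\mathbb{X}}(a_j)=F(a_j)$; (II) let $\hat f_{\mathbb{X}}:X\to\mathbb{R}$ be a solution of $\hat f_{\mathbb{X}}-p_{\mathbb{X}}\hat f_{\mathbb{X}}=f_{\mathbb{X}}-\pi_{\mathbb{X}}(f_{\mathbb{X}})$, where $\pi_{\mathbb{X}}$ is the unique invariant probability measure of the stochastic matrix $p_{\mathbb{X}}$ on $X$ (all entries of $p_{\mathbb{X}}$ are strictly positive, so a solution exists and is unique up to an additive constant; any solution may be chosen); (III) output $\tilde F_{\mathbb{X}}=\sum_{j=0}^m\hat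 f_{\mathbb{X}}(a_j)1_{J_j}$. *)

theory Defs
  imports "HOL-Probability.Probability"
begin

section \<open>Gradients and densities\<close>

text \<open>The gradient is the (unique) vector of the library's \<open>GDERIV\<close>; it is an
  unspecified vector where the function is not differentiable.\<close>

definition grad :: "('a::euclidean_space \<Rightarrow> real) \<Rightarrow> 'a \<Rightarrow> 'a" where
  "grad f x = (THE D. GDERIV f x :> D)"

definition continuously_differentiable :: "('a::euclidean_space \<Rightarrow> real) \<Rightarrow> bool" where
  "continuously_differentiable f \<longleftrightarrow>
     (\<forall>x. \<exists>D. GDERIV f x :> D) \<and> continuous_on UNIV (grad f)"

definition probability_density :: "('a::euclidean_space \<Rightarrow> real) \<Rightarrow> bool" where
  "probability_density f \<longleftrightarrow>
     f \<in> borel_measurable borel \<and> (\<forall>x. 0 \<le> f x) \<and> prob_space (density lborel (\<lambda>x. ennreal (f x)))"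

definition L_infty_V :: "('a::euclidean_space \<Rightarrow> real) \<Rightarrow> ('a \<Rightarrow> real) set" where
  "L_infty_V V = {G \<in> borel_measurable borel. bdd_above (range (\<lambda>x. \<bar>G x\<bar> / V x))}"

section \<open>Metropolis-Hastings kernels\<close>

definition MH_acceptance ::
    "('a::euclidean_space \<Rightarrow> real) \<Rightarrow> ('a \<Rightarrow> 'a \<Rightarrow> real) \<Rightarrow> 'a \<Rightarrow> 'a \<Rightarrow> real" where
  "MH_acceptance p q x y = min 1 (p y * q y x / (p x * q x y))"

definition MH_kernel ::
    "('a::euclidean_space \<Rightarrow> real) \<Rightarrow> ('a \<Rightarrow> 'a \<Rightarrow> real) \<Rightarrow> 'a \<Rightarrow> 'a measure" where
  "MH_kernel p q x = measure_of UNIV (sets borel)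
     (\<lambda>A. (\<integral>\<^sup>+y\<in>A. ennreal (MH_acceptance p q x y * q x y) \<partial>lborel)
        + ennreal (1 - (\<integral>z. MH_acceptance p q x z * q x z \<partial>lborel)) * indicator A x)"

definition kernel_op :: "('a::euclidean_space \<Rightarrow> 'a measure) \<Rightarrow> ('a \<Rightarrow> real) \<Rightarrow> 'a \<Rightarrow> real" where
  "kernel_op P G x = (\<integral>y. G y \<partial>P x)"

definition density_mean :: "('a::euclidean_space \<Rightarrow> real) \<Rightarrow> ('a \<Rightarrow> real) \<Rightarrow> real" where
  "density_mean p G = (\<integral>x. G x * p x \<partial>lborel)"

section \<open>Markov chains and the asymptotic variance\<close>

text \<open>The initial distribution of the chain is arbitrary, and the Markov property is with respect
  to the natural filtration.\<close>

definition past_algebra :: "'w measure \<Rightarrow> (nat \<Rightarrow> 'w \<Rightarrow> 'a::euclidean_space) \<Rightarrow> nat \<Rightarrow> 'w measure" where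
  "past_algebra M \<Phi> n =
     vimage_algebra (space M) (\<lambda>\<omega>. \<lambda>i\<in>{..n}. \<Phi> i \<omega>) (\<Pi>\<^sub>M i\<in>{..n}. borel)"

definition markov_chain ::
    "'w measure \<Rightarrow> (nat \<Rightarrow> 'w \<Rightarrow> 'a::euclidean_space) \<Rightarrow> ('a \<Rightarrow> 'a measure) \<Rightarrow> bool" where
  "markov_chain M \<Phi> P \<longleftrightarrow>
     prob_space M \<and>
     (\<forall>n. \<Phi> n \<in> measurable M borel) \<and>
     (\<forall>n. \<forall>A\<in>sets borel. AE \<omega> in M.
        real_cond_exp M (past_algebra M \<Phi> n) (\<lambda>\<omega>. indicator A (\<Phi> (Suc n) \<omega>)) \<omega> =
        measure (P (\<Phi> n \<omega>)) A)"

definition ergodic_average :: "(nat \<Rightarrow> 'w \<Rightarrow> 'a) \<Rightarrow> ('a \<Rightarrow> real) \<Rightarrow> nat \<Rightarrow> 'w \<Rightarrow> real" where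
  "ergodic_average \<Phi> H k \<omega> = (\<Sum>i=1..k. H (\<Phi> i \<omega>)) / real k"

text \<open>The limit law is that of \<open>\<sigma>\<close> times a standard Gaussian rather than the Gaussian density with
  standard deviation \<open>\<sigma>\<close>, so that the degenerate case \<open>\<sigma> = 0\<close> is covered.\<close>

definition clt_with_variance ::
    "'w measure \<Rightarrow> (nat \<Rightarrow> 'w \<Rightarrow> 'a::euclidean_space) \<Rightarrow> ('a \<Rightarrow> real) \<Rightarrow> ('a \<Rightarrow> real) \<Rightarrow> real \<Rightarrow> bool" where
  "clt_with_variance M \<Phi> p H v \<longleftrightarrow>
     0 \<le> v \<and>
     weak_conv_m
       (\<lambda>k. distr M borel (\<lambda>\<omega>. sqrt (real k) * (ergodic_average \<Phi> H k \<omega> - density_mean p H)))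
       (distr std_normal_distribution borel (\<lambda>z. sqrt v * z))"

section \<open>Allotments\<close>

text \<open>An allotment of size \<open>m\<close> is given by its cells \<open>J 0, \<dots>, J m\<close> and representatives
  \<open>a 0, \<dots>, a m\<close>; values at indices above \<open>m\<close> are irrelevant.\<close>

definition allotment :: "nat \<Rightarrow> (nat \<Rightarrow> 'a::euclidean_space set) \<Rightarrow> (nat \<Rightarrow> 'a) \<Rightarrow> bool" where
  "allotment m J a \<longleftrightarrow>
     (\<Union>j\<le>m. J j) = UNIV \<and> disjoint_family_on J {..m} \<and>
     (\<forall>j\<le>m. J j \<in> sets borel \<and> 0 < emeasure lborel (J j) \<and> a j \<in> J j) \<and>
     bounded (\<Union>j\<in>{1..m}. J j)"

definition rad :: "(nat \<Rightarrow> 'a set) \<Rightarrow> ('a \<Rightarrow> real) \<Rightarrow> real" where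
  "rad J W = (INF y\<in>J 0. W y)"

text \<open>The two maxima over \<open>1 \<le> j \<le> m\<close> and \<open>0 \<le> j \<le> m\<close> are taken as one maximum over
  the union of the index families. For \<open>W \<ge> 1\<close> and an allotment, all suprema are finite.\<close>

definition mesh ::
    "nat \<Rightarrow> (nat \<Rightarrow> 'a::euclidean_space set) \<Rightarrow> (nat \<Rightarrow> 'a) \<Rightarrow> ('a \<Rightarrow> real) \<Rightarrow> real" where
  "mesh m J a W = Max ((\<lambda>j. SUP y\<in>J j. norm (y - a j)) ` {1..m}
                     \<union> (\<lambda>j. SUP y\<in>J j. W (a j) / W y - 1) ` {0..m})"

definition exhaustive ::
    "(nat \<Rightarrow> nat) \<Rightarrow> (nat \<Rightarrow> nat \<Rightarrow> 'a::euclidean_space set) \<Rightarrow> (nat \<Rightarrow> nat \<Rightarrow> 'a) \<Rightarrow> ('a \<Rightarrow> real) \<Rightarrow> bool" where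
  "exhaustive m J a W \<longleftrightarrow>
     filterlim (\<lambda>n. rad (J n) W) at_top sequentially \<and>
     (\<lambda>n. mesh (m n) (J n) (a n) W) \<longlonglongrightarrow> 0"

section \<open>The Scheme\<close>

definition allotment_matrix ::
    "('a::euclidean_space \<Rightarrow> 'a measure) \<Rightarrow> (nat \<Rightarrow> 'a set) \<Rightarrow> (nat \<Rightarrow> 'a) \<Rightarrow> nat \<Rightarrow> nat \<Rightarrow> real" where
  "allotment_matrix P J a i j = measure (P (a i)) (J j)"

definition invariant_probability :: "nat \<Rightarrow> (nat \<Rightarrow> nat \<Rightarrow> real) \<Rightarrow> (nat \<Rightarrow> real) \<Rightarrow> bool" where
  "invariant_probability m p w \<longleftrightarrow>
     (\<forall>j\<le>m. 0 \<le> w j) \<and> (\<Sum>j\<le>m. w j) = 1 \<and> (\<forall>j\<le>m. (\<Sum>i\<le>m. w i * p i j) = w j)"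

text \<open>The solution of the finite Poisson equation is only determined up to an additive constant,
  so the output is a relation: \<open>G\<close> is an output of the Scheme for some choice of the solution
  \<open>fhat\<close>. Only the values of \<open>fhat\<close> at the representatives matter.\<close>

definition scheme_output ::
    "('a::euclidean_space \<Rightarrow> 'a measure) \<Rightarrow> ('a \<Rightarrow> real) \<Rightarrow> nat \<Rightarrow> (nat \<Rightarrow> 'a set) \<Rightarrow> (nat \<Rightarrow> 'a)
      \<Rightarrow> ('a \<Rightarrow> real) \<Rightarrow> bool" where
  "scheme_output P F m J a G \<longleftrightarrow>
     (\<exists>w fhat. invariant_probability m (allotment_matrix P J a) w \<and>
        (\<forall>i\<le>m. fhat (a i) - (\<Sum>j\<le>m. allotment_matrix P J a i j * fhat (a j)) =
               F (a i) - (\<Sum>j\<le>m. w j * F (a j))) \<and>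
        G = (\<lambda>x. \<Sum>j\<le>m. fhat (a j) * indicator (J j) x))"

end

theory Submission
  imports Defs
begin

text \<open>
  The proof identifies the asymptotic variance with an \<open>L\<^sup>2\<close> norm of the error of the Scheme and bounds
  that norm. Let \<open>Fhat\<close> solve the Poisson equation \<open>Fhat - P Fhat = F - \<pi>(F)\<close>, and let \<open>u\<close> be
  \<open>Fhat - Ftilde\<close>, centred under \<open>\<pi>\<close>. Then \<open>F + P Ftilde - Ftilde - \<pi>(F) = u - P u\<close>, so that the ergodic
  sums of the corrected function are a martingale plus a boundary term, and their asymptotic variance
  is \<open>\<pi>(u\<^sup>2) - \<pi>((P u)\<^sup>2)\<close>, which is at most \<open>\<pi>(u\<^sup>2)\<close>. It remains to show that \<open>\<pi>(u\<^sup>2)\<close> is bounded by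
  a multiple of \<open>\<delta>\<^sup>2\<close>, where \<open>\<delta>\<close> is the mesh, plus a multiple of the integral of
  \<open>\<pi>\<^bsup>1 - 2\<gamma>\<^esup> = V\<^sup>2 \<pi>\<close> over the unbounded cell, where \<open>V = \<pi>\<^bsup>-\<gamma>\<^esup>\<close>.

  Functions are measured by powers of the target: \<open>growth s\<close> consists of the measurable functions
  bounded by a multiple of \<open>\<pi>\<^bsup>-s\<^esup>\<close>. The density \<open>k x y\<close> of accepted moves satisfies
  \<open>k x y \<pi>(y)\<^bsup>-s\<^esup> \<le> \<pi>(x)\<^bsup>-s\<^esup> (q(y - x) + q(x - y))\<close> for \<open>0 \<le> s \<le> 1\<close> (\<open>k_weight\<close>), and this controls
  all integrals against the kernel.

  Ergodicity. Far from the origin the level strips of \<open>\<pi>\<close> are thin, so that accepted moves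
  mostly increase \<open>\<pi>\<close> by a large factor. This makes \<open>\<pi>\<^bsup>-s\<^esup>\<close> a drift function for every \<open>0 < s < 1\<close>
  (\<open>jump_tail\<close>, \<open>drift\<close>). Drift and minorization contract a weighted oscillation
  (\<open>oscillation_contraction\<close>), hence the Neumann series of the Poisson equation converges, and
  reversibility turns the pointwise decay into a spectral gap in \<open>L\<^sup>2(\<pi>)\<close> (\<open>spectral_gap\<close>).

  Central limit theorem. The initial law is arbitrary. The characteristic functions of the martingale,
  restricted to initial states of bounded weight, satisfy a one-step recursion; the conditional
  variance is averaged by a second Poisson equation (\<open>one_step\<close>, \<open>chain_clt\<close>).

  Regularity. On small scales \<open>Fhat\<close> is Lipschitz with the weight \<open>w = \<pi>\<^bsup>-\<sigma>\<^esup>\<close> for some \<open>\<sigma> < 1 / 2\<close>, so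
  that \<open>\<pi>(w\<^sup>2)\<close> is finite. The transition operator maps a function with local Lipschitz constant \<open>L\<close>
  to one with constant \<open>C + \<rho> L\<close>, where \<open>\<rho> < 1\<close>, because the two states can be moved by the same increment
  (\<open>transop_lipschitz\<close>, \<open>poisson_solution_lipschitz\<close>).

  Stability. At the representatives the discrete equation is the equation for \<open>P\<close> itself, since
  \<open>Ftilde\<close> is constant on the cells. Hence \<open>u - P u\<close> is one and the same constant at all representatives,
  \<open>\<bar>u\<bar>\<close> is bounded by a multiple of \<open>V\<close>, and on a bounded cell \<open>u\<close> deviates from its value at the
  representative by at most a multiple of \<open>\<delta> w\<close>. A comparison of \<open>u - P u\<close> with this constant in
  \<open>L\<^sup>2(\<pi>)\<close> and the spectral gap give the bound of \<open>\<pi>(u\<^sup>2)\<close> as soon as the mesh is small and the unbounded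
  cell is far out (\<open>stability\<close>). The finitely many other allotments only affect the constant,
  because the integral over the unbounded cell is positive.
\<close>

section \<open>Elementary inequalities and integrals\<close>

lemma min_le_powr_mult:
  fixes a b s :: real
  assumes "0 < a" "0 < b" "0 \<le> s" "s \<le> 1"
  shows "min a b \<le> a powr (1 - s) * b powr s"
proof -
  have "min a b = min a b powr (1 - s) * min a b powr s"
    using assms by (simp flip: powr_add)
  also have "\<dots> \<le> a powr (1 - s) * b powr s"
    using assms by (intro mult_mono powr_mono2) auto
  finally show ?thesis .
qed

lemma powr_mult_le_add:
  fixes a b s :: real
  assumes "0 < a" "0 < b" "0 \<le> s" "s \<le> 1"
  shows "a powr (1 - s) * b powr s \<le> a + b"
proof -
  have "a powr (1 - s) * b powr s \<le> max a b powr (1 - s) * max a b powr s"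
    using assms by (intro mult_mono powr_mono2) auto
  also have "\<dots> = max a b" using assms by (simp flip: powr_add)
  also have "\<dots> \<le> a + b" using assms by auto
  finally show ?thesis .
qed

text \<open>The map \<open>min a\<close> is concave and nonnegative on the positive numbers, so that a chord between two
  points is less steep than the chord from the origin to the larger one.\<close>

lemma min_diff_le_relative:
  fixes a s t :: real
  assumes "0 < a" "0 < s" "0 < t"
  shows "\<bar>min a s - min a t\<bar> \<le> min a (max s t) * (\<bar>s - t\<bar> / max s t)"
proof -
  have *: "\<bar>min a s - min a t\<bar> \<le> min a t * ((t - s) / t)" if "0 < s" "s \<le> t" for s t
  proof (cases "t \<le> a")
    case True
    then show ?thesis using that by (simp add: min_def)
  next
    case False
    have "min a t - min a s \<le> a * ((t - s) / t)"
    proof (cases "a \<le> s")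
      case True
      then show ?thesis using that False assms by (simp add: min_def)
    next
      case f: False
      have "a * s \<le> s * t" using False that assms by (simp add: mult.commute)
      then have "a * (s / t) \<le> s" using that by (simp add: field_simps)
      then show ?thesis using that False f by (simp add: min_def field_simps)
    qed
    moreover have "min a s \<le> min a t" using that by auto
    ultimately show ?thesis using False by (simp add: min_def abs_if)
  qed
  show ?thesis
  proof (cases "s \<le> t")
    case True
    then have "max s t = t" "\<bar>s - t\<bar> = t - s" by auto
    then show ?thesis using *[of s t] assms True by metis
  next
    case False
    then have "\<bar>min a t - min a s\<bar> \<le> min a s * ((s - t) / s)" using *[of t s] assms by simp
    moreover have "max s t = s" "\<bar>s - t\<bar> = s - t" using False by auto
    ultimately show ?thesis by (simp add: abs_minus_commute)
  qed
qed

lemma lborel_distr_isometry: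
  fixes t :: "'a::euclidean_space"
  assumes "c = 1 \<or> c = - 1"
  shows "distr lborel borel (\<lambda>x. t + c *\<^sub>R x) = lborel"
proof -
  have "lborel = density (distr lborel borel (\<lambda>x. t + c *\<^sub>R x)) (\<lambda>_. 1)"
    using lborel_affine[of c t] assms by auto
  then show ?thesis by (simp add: density_1)
qed

lemma
  fixes f :: "'a::euclidean_space \<Rightarrow> real"
  assumes "integrable lborel f"
  shows integrable_translate: "integrable lborel (\<lambda>y. f (y - x))"
    and integrable_translate': "integrable lborel (\<lambda>y. f (x + y))"
    and integrable_reflect_at: "integrable lborel (\<lambda>y. f (x - y))"
    and integrable_reflect: "integrable lborel (\<lambda>y. f (- y))"
proof -
  have *: "integrable lborel (\<lambda>y. f (t + c *\<^sub>R y))" if "c = 1 \<or> c = - 1" for c t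
  proof -
    have "integrable (distr lborel borel (\<lambda>x. t + c *\<^sub>R x)) f"
      using assms lborel_distr_isometry[OF that, of t] by simp
    then show ?thesis by (rule integrable_distr[rotated]) simp
  qed
  show "integrable lborel (\<lambda>y. f (y - x))" using *[of 1 "-x"] by (simp add: add.commute)
  show "integrable lborel (\<lambda>y. f (x + y))" using *[of 1 "x"] by simp
  show "integrable lborel (\<lambda>y. f (x - y))" using *[of "-1" "x"] by simp
  show "integrable lborel (\<lambda>y. f (- y))" using *[of "-1" "0"] by simp
qed

lemma
  fixes f :: "'a::euclidean_space \<Rightarrow> real"
  assumes "f \<in> borel_measurable borel"
  shows integral_translate: "(\<integral>y. f (y - x) \<partial>lborel) = (\<integral>y. f y \<partial>lborel)"
    and integral_translate': "(\<integral>y. f (x + y) \<partial>lborel) = (\<integral>y. f y \<partial>lborel)"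
    and integral_reflect_at: "(\<integral>y. f (x - y) \<partial>lborel) = (\<integral>y. f y \<partial>lborel)"
    and integral_reflect: "(\<integral>y. f (- y) \<partial>lborel) = (\<integral>y. f y \<partial>lborel)"
proof -
  have *: "(\<integral>y. f (t + c *\<^sub>R y) \<partial>lborel) = (\<integral>y. f y \<partial>lborel)" if "c = 1 \<or> c = - 1" for c t
    using assms
    by (subst (2) lborel_distr_isometry[OF that, of t, symmetric]) (simp add: integral_distr)
  show "(\<integral>y. f (y - x) \<partial>lborel) = (\<integral>y. f y \<partial>lborel)" using *[of 1 "-x"] by (simp add: add.commute)
  show "(\<integral>y. f (x + y) \<partial>lborel) = (\<integral>y. f y \<partial>lborel)" using *[of 1 "x"] by simp
  show "(\<integral>y. f (x - y) \<partial>lborel) = (\<integral>y. f y \<partial>lborel)" using *[of "-1" "x"] by simp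
  show "(\<integral>y. f (- y) \<partial>lborel) = (\<integral>y. f y \<partial>lborel)" using *[of "-1" "0"] by simp
qed

lemma integrable_exp_neg_norm:
  fixes c :: real
  assumes "0 < c"
  shows "integrable lborel (\<lambda>x::'a::euclidean_space. exp (- c * norm x))"
proof (rule integrableI_bounded)
  let ?d = "DIM('a)"
  define g where "g k = exp (- c * real k) * (unit_ball_vol (real ?d) * (real k + 1) ^ ?d)" for k :: nat
  have g0: "0 \<le> g k" for k unfolding g_def by simp
  have le: "ennreal (norm (exp (- c * norm x)))
      \<le> (\<Sum>k. ennreal (exp (- c * real k)) * indicator (ball 0 (real k + 1)) x)" for x :: 'a
  proof -
    define k where "k = nat \<lfloor>norm x\<rfloor>"
    have k: "real k \<le> norm x" "norm x < real k + 1" unfolding k_def by (auto simp: of_nat_nat)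
    have "ennreal (norm (exp (- c * norm x)))
        \<le> ennreal (exp (- c * real k)) * indicator (ball 0 (real k + 1)) x"
      using k assms by (auto simp: indicator_def intro!: ennreal_leI)
    also have "\<dots> = (\<Sum>j\<in>{k}. ennreal (exp (- c * real j)) * indicator (ball 0 (real j + 1)) x)"
      by (simp only: sum.insert_if[OF finite.emptyI] sum.empty empty_iff if_False add_0_right)
    also have "\<dots> \<le> (\<Sum>k. ennreal (exp (- c * real k)) * indicator (ball 0 (real k + 1)) x)"
      by (rule sum_le_suminf) auto
    finally show ?thesis .
  qed
  have "(\<integral>\<^sup>+x. ennreal (norm (exp (- c * norm (x::'a)))) \<partial>lborel)
      \<le> (\<integral>\<^sup>+x. (\<Sum>k. ennreal (exp (- c * real k)) * indicator (ball (0::'a) (real k + 1)) x) \<partial>lborel)"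
    by (intro nn_integral_mono le)
  also have "\<dots> = (\<Sum>k. ennreal (exp (- c * real k)) * emeasure lborel (ball (0::'a) (real k + 1)))"
    by (subst nn_integral_suminf)
       (auto simp: nn_integral_cmult_indicator intro!: borel_measurable_times_ennreal borel_measurable_indicator)
  also have "\<dots> = (\<Sum>k. ennreal (g k))"
    by (intro suminf_cong) (simp add: g_def emeasure_ball ennreal_mult)
  also have "\<dots> < \<infinity>"
  proof -
    let ?n = "?d + 2"
    define D where "D = exp c * fact ?n / c ^ ?n * unit_ball_vol (real ?d)"
    have "g k \<le> D * inverse (real (Suc k) ^ 2)" for k
    proof -
      let ?t = "real (Suc k)"
      have "(\<Sum>i\<in>{?n}. (c * ?t) ^ i /\<^sub>R fact i) \<le> (\<Sum>i. (c * ?t) ^ i /\<^sub>R fact i)"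
        using assms by (intro sum_le_suminf summable_exp_generic) auto
      then have "(c * ?t) ^ ?n / fact ?n \<le> exp (c * ?t)"
        unfolding exp_def by (simp only: sum.insert_if[OF finite.emptyI] sum.empty empty_iff if_False add_0_right)
           (simp add: divide_inverse mult.commute)
      then have "inverse (exp (c * ?t)) \<le> inverse ((c * ?t) ^ ?n / fact ?n)"
        using assms by (intro le_imp_inverse_le) auto
      moreover have "exp (- c * real k) = exp c * inverse (exp (c * ?t))"
        by (simp add: exp_minus[symmetric] exp_add[symmetric] algebra_simps)
      ultimately have "exp (- c * real k) \<le> exp c * (fact ?n / (c * ?t) ^ ?n)"
        by (metis inverse_divide mult_left_mono exp_ge_zero)
      then have "g k \<le> exp c * (fact ?n / (c * ?t) ^ ?n) * (unit_ball_vol (real ?d) * ?t ^ ?d)"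
        unfolding g_def using assms by (intro mult_mono) (auto simp: add.commute)
      also have "\<dots> = D * inverse (?t ^ 2)"
        using assms unfolding D_def power_mult_distrib power_add
        by (simp add: divide_inverse mult_ac del: of_nat_Suc)
      finally show ?thesis .
    qed
    moreover have "summable (\<lambda>k. D * inverse (real (Suc k) ^ 2))"
      using inverse_power_summable[of 2, where 'a=real]
      by (intro summable_mult) (subst summable_Suc_iff, simp)
    ultimately have "summable g" using g0 by (intro summable_comparison_test'[of _ 0 g]) (auto simp only: real_norm_def abs_of_nonneg)
    then show ?thesis using g0 by (simp add: suminf_ennreal2)
  qed
  finally show "(\<integral>\<^sup>+x. ennreal (norm (exp (- c * norm (x::'a)))) \<partial>lborel) < \<infinity>" .
qed simp

lemma integral_tail_small:
  fixes f :: "'a::euclidean_space \<Rightarrow> real"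
  assumes f: "integrable lborel f" and e: "0 < \<epsilon>"
  shows "\<exists>Z>0. (\<integral>z. indicator {z. Z < norm z} z * f z \<partial>lborel) \<le> \<epsilon>"
proof -
  have [measurable]: "f \<in> borel_measurable borel" using f by simp
  have "(\<lambda>n. \<integral>z. indicator {z. real n < norm z} z * f z \<partial>lborel) \<longlonglongrightarrow> integral\<^sup>L lborel (\<lambda>z::'a. 0)"
  proof (rule integral_dominated_convergence[where w="\<lambda>z. \<bar>f z\<bar>"])
    show "AE z in lborel. (\<lambda>n. indicator {z. real n < norm z} z * f z) \<longlonglongrightarrow> 0"
    proof (rule AE_I2)
      fix z :: 'a
      obtain N where N: "norm z < real N" using reals_Archimedean2 by blast
      show "(\<lambda>n. indicator {z. real n < norm z} z * f z) \<longlonglongrightarrow> 0"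
        by (rule tendsto_eventually, rule eventually_sequentiallyI[of N]) (use N in \<open>auto simp: indicator_def\<close>)
    qed
  qed (use f in \<open>auto simp: indicator_def\<close>)
  then have "\<forall>\<^sub>F n in sequentially. (\<integral>z. indicator {z. real n < norm z} z * f z \<partial>lborel) < \<epsilon>"
    using e by (intro order_tendstoD) auto
  then obtain n where "(\<integral>z. indicator {z. real (Suc n) < norm z} z * f z \<partial>lborel) < \<epsilon>"
    unfolding eventually_sequentially by (meson le_Suc_eq order_refl)
  then show ?thesis by (intro exI[of _ "real (Suc n)"]) auto
qed

section \<open>The random walk Metropolis operator\<close>

text \<open>The last two assumptions are the tail conditions on the gradient of the target in integrated form,
  along rays and along steps towards the origin.\<close>

locale rwm =
  fixes q \<pi> :: "'a::euclidean_space \<Rightarrow> real"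
  assumes q_cont: "continuous_on UNIV q" and q_pos: "\<And>z. 0 < q z" and q_bounded: "bounded (range q)"
    and q_integrable: "integrable lborel q" and q_mass: "(\<integral>z. q z \<partial>lborel) = 1"
    and pi_cont: "continuous_on UNIV \<pi>" and pi_pos: "\<And>x. 0 < \<pi> x"
    and pi_integrable: "integrable lborel \<pi>" and pi_mass: "(\<integral>z. \<pi> z \<partial>lborel) = 1"
    and radial_decay: "\<And>L. \<exists>R. \<forall>x t. R \<le> norm x \<longrightarrow> 1 \<le> t \<longrightarrow>
       \<pi> (t *\<^sub>R x) \<le> \<pi> x * exp (- (L * (t - 1) * norm x))"
    and inward_ball: "\<exists>R. \<exists>\<epsilon>>0. \<forall>x z. R \<le> norm x \<longrightarrow> z \<in> ball (- (1 / (2 * norm x)) *\<^sub>R x) \<epsilon> \<longrightarrow>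
       \<pi> x \<le> \<pi> (x + z)"
begin

lemma q_meas[measurable]: "q \<in> borel_measurable borel"
  using q_cont by (rule borel_measurable_continuous_onI)

lemma pi_meas[measurable]: "\<pi> \<in> borel_measurable borel"
  using pi_cont by (rule borel_measurable_continuous_onI)

lemma pi_nz[simp]: "\<pi> x \<noteq> 0" using pi_pos[of x] by simp
lemma pi_nonneg[simp]: "0 \<le> \<pi> x" using pi_pos[of x] by simp
lemma q_nonneg[simp]: "0 \<le> q x" using q_pos[of x] by simp

text \<open>Accepted moves have the density \<open>k x\<close>; \<open>acc x\<close> is their total mass, and \<open>transop\<close> is the action of
  the Metropolis kernel on functions. Since \<open>q\<close> may be asymmetric, \<open>qq\<close> adds the two
  directions of a move.\<close>

definition k :: "'a \<Rightarrow> 'a \<Rightarrow> real" where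
  "k x y = min (q (y - x)) (\<pi> y * q (x - y) / \<pi> x)"

definition acc :: "'a \<Rightarrow> real" where
  "acc x = (\<integral>y. k x y \<partial>lborel)"

definition jump :: "('a \<Rightarrow> real) \<Rightarrow> 'a \<Rightarrow> real" where
  "jump f x = (\<integral>y. k x y * f y \<partial>lborel)"

definition transop :: "('a \<Rightarrow> real) \<Rightarrow> 'a \<Rightarrow> real" where
  "transop f x = jump f x + (1 - acc x) * f x"

definition qq :: "'a \<Rightarrow> real" where
  "qq z = q z + q (- z)"

definition growth :: "real \<Rightarrow> ('a \<Rightarrow> real) set" where
  "growth s = {f \<in> borel_measurable borel. \<exists>B. \<forall>x. \<bar>f x\<bar> \<le> B * \<pi> x powr (- s)}"

abbreviation Vs :: "real \<Rightarrow> 'a \<Rightarrow> real" where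
  "Vs s x \<equiv> \<pi> x powr (- s)"

lemma Vs_pos[simp]: "0 < Vs s x" by simp
lemma Vs_nonneg: "0 \<le> Vs s x" by simp

lemma growthE:
  assumes "f \<in> growth s"
  obtains B where "0 \<le> B" "\<And>x. \<bar>f x\<bar> \<le> B * Vs s x"
proof -
  obtain B where B: "\<And>x. \<bar>f x\<bar> \<le> B * Vs s x" using assms by (auto simp: growth_def)
  have "0 \<le> B * Vs s 0" using B[of 0] by linarith
  then have "0 \<le> B" using Vs_pos[where s=s and x=0] by (simp add: zero_le_mult_iff)
  then show ?thesis using B that by blast
qed

lemma growthI: "f \<in> borel_measurable borel \<Longrightarrow> (\<And>x. \<bar>f x\<bar> \<le> B * Vs s x) \<Longrightarrow> f \<in> growth s"
  by (auto simp: growth_def)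

lemma growth_meas: "f \<in> growth s \<Longrightarrow> f \<in> borel_measurable borel"
  by (auto simp: growth_def)

lemma k_pos: "0 < k x y"
  unfolding k_def using q_pos pi_pos by (simp add: min_def)

lemma k_nonneg[simp]: "0 \<le> k x y" using k_pos[of x y] by simp

lemma k_le_q: "k x y \<le> q (y - x)" by (simp add: k_def)

lemma k_reversible: "\<pi> x * k x y = \<pi> y * k y x"
  unfolding k_def using pi_pos[of x] pi_pos[of y] by (simp add: min_def field_simps)

lemma k_interpolate:
  assumes "0 \<le> s" "s \<le> 1"
  shows "k x y \<le> q (y - x) powr (1 - s) * q (x - y) powr s * \<pi> y powr s * \<pi> x powr (- s)"
proof -
  have "k x y \<le> q (y - x) powr (1 - s) * (\<pi> y * q (x - y) / \<pi> x) powr s"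
    unfolding k_def using assms q_pos pi_pos by (intro min_le_powr_mult) auto
  also have "\<dots> = q (y - x) powr (1 - s) * q (x - y) powr s * \<pi> y powr s * \<pi> x powr (- s)"
    by (simp add: powr_mult powr_divide powr_minus_divide mult_ac)
  finally show ?thesis .
qed

text \<open>This domination is the reason why every \<open>Vs s\<close> with \<open>0 \<le> s \<le> 1\<close> is integrable against
  accepted moves, however heavy the tails of the proposal are.\<close>

lemma k_weight:
  assumes "0 \<le> s" "s \<le> 1"
  shows "k x y * Vs s y \<le> Vs s x * qq (y - x)"
proof -
  have "k x y * Vs s y
     \<le> (q (y - x) powr (1 - s) * q (x - y) powr s * \<pi> y powr s * \<pi> x powr (- s)) * Vs s y"
    by (intro mult_right_mono k_interpolate assms) auto
  also have "\<dots> = Vs s x * (q (y - x) powr (1 - s) * q (x - y) powr s)"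
    using pi_pos[of y] by (simp add: powr_minus field_simps)
  also have "\<dots> \<le> Vs s x * (q (y - x) + q (x - y))"
    by (intro mult_left_mono powr_mult_le_add q_pos assms) auto
  finally show ?thesis by (simp add: qq_def)
qed

lemma k_continuous: "continuous_on UNIV (\<lambda>z. k (fst z) (snd z))"
  unfolding k_def
  by (intro continuous_intros continuous_on_compose2[OF q_cont] continuous_on_compose2[OF pi_cont]) auto

lemma k_meas[measurable (raw)]:
  "f \<in> borel_measurable M \<Longrightarrow> g \<in> borel_measurable M \<Longrightarrow> (\<lambda>x. k (f x) (g x)) \<in> borel_measurable M"
  unfolding k_def
  by (intro borel_measurable_min borel_measurable_divide borel_measurable_times
        measurable_compose[OF _ q_meas] measurable_compose[OF _ pi_meas] borel_measurable_diff)

lemma qq_meas[measurable]: "qq \<in> borel_measurable borel"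
  unfolding qq_def[abs_def] by measurable

lemma qq_nonneg[simp]: "0 \<le> qq z" by (simp add: qq_def)

lemma qq_integrable: "integrable lborel qq"
  unfolding qq_def[abs_def] by (intro Bochner_Integration.integrable_add q_integrable integrable_reflect)

lemma qq_mass: "(\<integral>z. qq z \<partial>lborel) = 2"
  unfolding qq_def by (simp add: q_integrable integrable_reflect integral_reflect q_mass)

lemma growth_integrable_k:
  assumes "f \<in> growth s" "0 \<le> s" "s \<le> 1"
  shows "integrable lborel (\<lambda>y. k x y * f y)"
proof -
  obtain B where B: "0 \<le> B" "\<And>x. \<bar>f x\<bar> \<le> B * Vs s x" using growthE[OF assms(1)] by metis
  have [measurable]: "f \<in> borel_measurable borel" by (rule growth_meas[OF assms(1)])
  have le: "norm (k x y * f y) \<le> norm (B * Vs s x * qq (y - x))" for y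
  proof -
    have "\<bar>k x y * f y\<bar> \<le> k x y * (B * Vs s y)"
      by (simp add: abs_mult mult_left_mono B)
    also have "\<dots> = B * (k x y * Vs s y)" by simp
    also have "\<dots> \<le> B * (Vs s x * qq (y - x))"
      by (intro mult_left_mono k_weight assms B)
    finally show ?thesis using B by simp
  qed
  show ?thesis
    by (rule Bochner_Integration.integrable_bound[OF integrable_mult_right[OF integrable_translate[OF qq_integrable]]])
       (use le in auto)
qed

lemma jump_abs_le:
  assumes f: "f \<in> borel_measurable borel" and B: "\<And>y. \<bar>f y\<bar> \<le> B * Vs s y" and s: "0 \<le> s" "s \<le> 1"
  shows "\<bar>jump f x\<bar> \<le> B * jump (Vs s) x"
proof -
  have V: "Vs s \<in> growth s" by (rule growthI[where B=1]) auto
  have fg: "f \<in> growth s" using f B by (rule growthI)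
  have "\<bar>jump f x\<bar> \<le> (\<integral>y. \<bar>k x y * f y\<bar> \<partial>lborel)" unfolding jump_def by (rule integral_abs_bound)
  also have "\<dots> \<le> (\<integral>y. B * (k x y * Vs s y) \<partial>lborel)"
  proof (rule integral_mono)
    show "integrable lborel (\<lambda>y. \<bar>k x y * f y\<bar>)" using growth_integrable_k[OF fg s] by (rule integrable_abs)
    show "integrable lborel (\<lambda>y. B * (k x y * Vs s y))"
      using growth_integrable_k[OF V s] by (rule integrable_mult_right)
    show "\<bar>k x y * f y\<bar> \<le> B * (k x y * Vs s y)" for y
      using mult_left_mono[OF B k_nonneg[of x y]] by (simp add: abs_mult mult.left_commute)
  qed
  finally show ?thesis by (simp add: jump_def)
qed

lemma jump_Vs_le:
  assumes "0 \<le> s" "s \<le> 1"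
  shows "jump (Vs s) x \<le> 2 * Vs s x"
proof -
  have V: "Vs s \<in> growth s" by (rule growthI[where B=1]) auto
  have "jump (Vs s) x \<le> (\<integral>y. Vs s x * qq (y - x) \<partial>lborel)"
    unfolding jump_def using growth_integrable_k[OF V assms] k_weight[OF assms]
    by (intro integral_mono integrable_mult_right integrable_translate qq_integrable) auto
  also have "\<dots> = 2 * Vs s x"
    by (simp add: integral_translate qq_mass)
  finally show ?thesis .
qed

lemma one_growth: "(\<lambda>_. c) \<in> growth 0" by (rule growthI[where B="\<bar>c\<bar>"]) auto

lemma k_integrable: "integrable lborel (k x)"
  using growth_integrable_k[OF one_growth[of 1], of x] by simp

lemma acc_le_1: "acc x \<le> 1"
proof -
  have "acc x \<le> (\<integral>y. q (y - x) \<partial>lborel)"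
    unfolding acc_def using k_le_q by (intro integral_mono k_integrable integrable_translate q_integrable) auto
  then show ?thesis by (simp add: integral_translate q_mass)
qed

lemma acc_nonneg: "0 \<le> acc x"
  unfolding acc_def by (intro integral_nonneg_AE) auto

lemma acc_meas[measurable]: "acc \<in> borel_measurable borel"
  unfolding acc_def[abs_def] by measurable

lemma jump_meas[measurable]:
  assumes [measurable]: "f \<in> borel_measurable borel"
  shows "jump f \<in> borel_measurable borel"
  unfolding jump_def[abs_def] by measurable

lemma transop_meas[measurable]:
  assumes [measurable]: "f \<in> borel_measurable borel"
  shows "transop f \<in> borel_measurable borel"
  unfolding transop_def[abs_def] by measurable

lemma transop_abs_le:
  assumes f: "f \<in> borel_measurable borel" and B: "\<And>y. \<bar>f y\<bar> \<le> B * Vs s y" and s: "0 \<le> s" "s \<le> 1"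
  shows "\<bar>transop f x\<bar> \<le> 3 * B * Vs s x"
proof -
  have "0 \<le> B * Vs s x" using B[of x] by linarith
  then have B0: "0 \<le> B" using Vs_pos[where s=s and x=x] by (simp add: zero_le_mult_iff)
  have "\<bar>transop f x\<bar> \<le> \<bar>jump f x\<bar> + \<bar>1 - acc x\<bar> * \<bar>f x\<bar>"
    unfolding transop_def by (metis abs_mult abs_triangle_ineq)
  also have "\<dots> \<le> B * (2 * Vs s x) + 1 * (B * Vs s x)"
    using acc_le_1[of x] acc_nonneg[of x] B[of x]
    by (intro add_mono mult_mono order_trans[OF jump_abs_le[OF f B s]] mult_left_mono[OF jump_Vs_le[OF s]] B0) auto
  finally show ?thesis by simp
qed

lemma transop_growth: "f \<in> growth s \<Longrightarrow> 0 \<le> s \<Longrightarrow> s \<le> 1 \<Longrightarrow> transop f \<in> growth s"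
  using growth_meas[of f s] growthE[of f s] growthI[OF transop_meas transop_abs_le, of f] by metis

lemma jump_growth: "f \<in> growth s \<Longrightarrow> 0 \<le> s \<Longrightarrow> s \<le> 1 \<Longrightarrow> jump f \<in> growth s"
proof -
  assume a: "f \<in> growth s" "0 \<le> s" "s \<le> 1"
  obtain B where B: "0 \<le> B" "\<And>x. \<bar>f x\<bar> \<le> B * Vs s x" using growthE[OF a(1)] by metis
  show ?thesis
  proof (rule growthI)
    show "\<bar>jump f x\<bar> \<le> (B * 2) * Vs s x" for x
      using order_trans[OF jump_abs_le[OF growth_meas[OF a(1)] B(2) a(2,3)] mult_left_mono[OF jump_Vs_le[OF a(2,3)] B(1)]]
      by (simp add: mult.assoc)
  qed (use growth_meas[OF a(1)] in measurable)
qed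

lemma jump_add: "f \<in> growth s \<Longrightarrow> g \<in> growth s \<Longrightarrow> 0 \<le> s \<Longrightarrow> s \<le> 1 \<Longrightarrow>
    jump (\<lambda>x. f x + g x) x = jump f x + jump g x"
  unfolding jump_def by (simp add: distrib_left growth_integrable_k)

lemma jump_diff: "f \<in> growth s \<Longrightarrow> g \<in> growth s \<Longrightarrow> 0 \<le> s \<Longrightarrow> s \<le> 1 \<Longrightarrow>
    jump (\<lambda>x. f x - g x) x = jump f x - jump g x"
  unfolding jump_def by (simp add: right_diff_distrib growth_integrable_k)

lemma jump_cmult: "jump (\<lambda>x. c * f x) x = c * jump f x"
proof -
  have "(\<integral>y. k x y * (c * f y) \<partial>lborel) = (\<integral>y. c * (k x y * f y) \<partial>lborel)"
    by (simp add: mult_ac)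
  then show ?thesis unfolding jump_def by simp
qed

lemma jump_const: "jump (\<lambda>_. c) x = c * acc x"
  unfolding jump_def acc_def by simp

lemma transop_add: "f \<in> growth s \<Longrightarrow> g \<in> growth s \<Longrightarrow> 0 \<le> s \<Longrightarrow> s \<le> 1 \<Longrightarrow>
    transop (\<lambda>x. f x + g x) x = transop f x + transop g x"
  unfolding transop_def by (simp add: jump_add algebra_simps)

lemma transop_diff: "f \<in> growth s \<Longrightarrow> g \<in> growth s \<Longrightarrow> 0 \<le> s \<Longrightarrow> s \<le> 1 \<Longrightarrow>
    transop (\<lambda>x. f x - g x) x = transop f x - transop g x"
  unfolding transop_def by (simp add: jump_diff algebra_simps)

lemma transop_cmult: "transop (\<lambda>x. c * f x) x = c * transop f x"
  unfolding transop_def by (simp add: jump_cmult algebra_simps)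

lemma transop_const: "transop (\<lambda>_. c) x = c"
  unfolding transop_def by (simp add: jump_const algebra_simps)

lemma jump_mono:
  assumes "f \<in> growth s" "g \<in> growth s" "0 \<le> s" "s \<le> 1" "\<And>y. f y \<le> g y"
  shows "jump f x \<le> jump g x"
  unfolding jump_def using assms
  by (intro integral_mono growth_integrable_k) (auto intro: mult_left_mono)

lemma transop_mono:
  assumes "f \<in> growth s" "g \<in> growth s" "0 \<le> s" "s \<le> 1" "\<And>y. f y \<le> g y"
  shows "transop f x \<le> transop g x"
  unfolding transop_def using assms acc_le_1[of x]
  by (intro add_mono jump_mono[OF assms] mult_left_mono) auto

lemma growth_abs: "f \<in> growth s \<Longrightarrow> (\<lambda>x. \<bar>f x\<bar>) \<in> growth s"
  by (auto simp: growth_def)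

lemma growth_add: "f \<in> growth s \<Longrightarrow> g \<in> growth s \<Longrightarrow> (\<lambda>x. f x + g x) \<in> growth s"
proof -
  assume a: "f \<in> growth s" "g \<in> growth s"
  obtain B where B: "\<And>x. \<bar>f x\<bar> \<le> B * Vs s x" using growthE[OF a(1)] by metis
  obtain C where C: "\<And>x. \<bar>g x\<bar> \<le> C * Vs s x" using growthE[OF a(2)] by metis
  show ?thesis
    by (rule growthI[where B="B + C"])
       (use a growth_meas B C in \<open>auto simp: distrib_right intro!: order_trans[OF abs_triangle_ineq] add_mono\<close>)
qed

lemma growth_cmult: "f \<in> growth s \<Longrightarrow> (\<lambda>x. c * f x) \<in> growth s"
proof -
  assume a: "f \<in> growth s"
  obtain B where B: "\<And>x. \<bar>f x\<bar> \<le> B * Vs s x" using growthE[OF a(1)] by metis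
  show ?thesis
    by (rule growthI[where B="\<bar>c\<bar> * B"])
       (use a growth_meas B in \<open>auto simp: abs_mult mult.assoc intro!: mult_left_mono\<close>)
qed

lemma growth_diff: "f \<in> growth s \<Longrightarrow> g \<in> growth s \<Longrightarrow> (\<lambda>x. f x - g x) \<in> growth s"
  using growth_add[OF _ growth_cmult[of g s "-1"], of f] by simp

lemma growth_mult: "f \<in> growth s \<Longrightarrow> g \<in> growth t \<Longrightarrow> (\<lambda>x. f x * g x) \<in> growth (s + t)"
proof -
  assume a: "f \<in> growth s" "g \<in> growth t"
  obtain B where B: "0 \<le> B" "\<And>x. \<bar>f x\<bar> \<le> B * Vs s x" using growthE[OF a(1)] by metis
  obtain C where C: "0 \<le> C" "\<And>x. \<bar>g x\<bar> \<le> C * Vs t x" using growthE[OF a(2)] by metis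
  show ?thesis
  proof (rule growthI)
    show "\<bar>f x * g x\<bar> \<le> (B * C) * Vs (s + t) x" for x
    proof -
      have "\<bar>f x * g x\<bar> \<le> (B * Vs s x) * (C * Vs t x)"
        unfolding abs_mult using B C by (intro mult_mono) auto
      also have "\<dots> = (B * C) * Vs (s + t) x" by (simp add: powr_add[symmetric] field_simps)
      finally show ?thesis .
    qed
  qed (use a growth_meas in auto)
qed

subsection \<open>The kernel measure\<close>

abbreviation P :: "'a \<Rightarrow> 'a measure" where
  "P \<equiv> MH_kernel \<pi> (\<lambda>x y. q (y - x))"

lemma acceptance_mult: "MH_acceptance \<pi> (\<lambda>x y. q (y - x)) x y * q (y - x) = k x y"
  unfolding MH_acceptance_def k_def using q_pos[of "y - x"] pi_pos[of x]
  by (simp add: min_mult_distrib_right)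

lemma sets_P[measurable_cong, simp]: "sets (P x) = sets borel"
  unfolding MH_kernel_def using sets.sigma_sets_eq[of "borel :: 'a measure"]
  by (simp only: sets_measure_of_conv space_borel Pow_UNIV subset_UNIV if_True)

lemma space_P[simp]: "space (P x) = UNIV"
  unfolding MH_kernel_def by (simp add: space_measure_of_conv)

lemma emeasure_P:
  assumes "A \<in> sets borel"
  shows "emeasure (P x) A = (\<integral>\<^sup>+y\<in>A. ennreal (k x y) \<partial>lborel) + ennreal (1 - acc x) * indicator A x"
proof -
  let ?\<mu> = "\<lambda>A. (\<integral>\<^sup>+y\<in>A. ennreal (k x y) \<partial>lborel) + ennreal (1 - acc x) * indicator A x"
  have eq: "P x = measure_of UNIV (sets borel) ?\<mu>"
    unfolding MH_kernel_def acceptance_mult acc_def by simp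
  have d: "?\<mu> A = emeasure (density lborel (k x)) A + ennreal (1 - acc x) * emeasure (return borel x) A"
    if "A \<in> sets borel" for A
    using that by (simp add: emeasure_density)
  have "countably_additive (sets borel) ?\<mu>"
  proof (rule countably_additiveI)
    fix A :: "nat \<Rightarrow> 'a set" assume A: "range A \<subseteq> sets borel" "disjoint_family A" "(\<Union>i. A i) \<in> sets borel"
    have "(\<Sum>i. ?\<mu> (A i)) = (\<Sum>i. emeasure (density lborel (k x)) (A i)) +
        ennreal (1 - acc x) * (\<Sum>i. emeasure (return borel x) (A i))"
      using A by (subst d) (auto simp: suminf_add[symmetric] image_subset_iff simp del: emeasure_return)
    also have "\<dots> = ?\<mu> (\<Union>i. A i)"
      using A by (subst d) (auto simp: suminf_emeasure simp del: emeasure_return)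
    finally show "(\<Sum>i. ?\<mu> (A i)) = ?\<mu> (\<Union>i. A i)" .
  qed
  moreover have "sigma_algebra UNIV (sets (borel :: 'a measure))"
    using sets.sigma_algebra_axioms[of "borel :: 'a measure"] by simp
  moreover have "positive (sets borel) ?\<mu>" by (simp add: positive_def)
  ultimately show ?thesis unfolding eq by (intro emeasure_measure_of_sigma assms)
qed

lemma nn_integral_P:
  assumes "f \<in> borel_measurable borel"
  shows "(\<integral>\<^sup>+y. f y \<partial>P x) = (\<integral>\<^sup>+y. ennreal (k x y) * f y \<partial>lborel) + ennreal (1 - acc x) * f x"
  using assms
proof (induction rule: borel_measurable_induct)
  case (cong f g)
  then have "f = g" by auto
  then show ?case using cong by simp
next
  case (set A)
  then show ?case by (simp add: emeasure_P)
next
  case (mult u c)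
  then show ?case
    by (simp add: nn_integral_cmult distrib_left mult.left_commute)
next
  case (add u v)
  then show ?case by (simp add: nn_integral_add distrib_left add_ac)
next
  case (seq U)
  note [measurable] = seq(1)
  have inc: "incseq (\<lambda>i. \<integral>\<^sup>+y. ennreal (k x y) * U i y \<partial>lborel)" "incseq (\<lambda>i. ennreal (1 - acc x) * U i x)"
    using seq(3) by (auto simp: incseq_def le_fun_def intro!: nn_integral_mono mult_left_mono)
  have "(\<integral>\<^sup>+y. (SUP i. U i) y \<partial>P x) = (SUP i. \<integral>\<^sup>+y. U i y \<partial>P x)"
    unfolding SUP_apply by (intro nn_integral_monotone_convergence_SUP seq) measurable
  also have "\<dots> = (SUP i. (\<integral>\<^sup>+y. ennreal (k x y) * U i y \<partial>lborel) + ennreal (1 - acc x) * U i x)"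
    by (simp add: seq)
  also have "\<dots> = (SUP i. \<integral>\<^sup>+y. ennreal (k x y) * U i y \<partial>lborel) + (SUP i. ennreal (1 - acc x) * U i x)"
    by (rule ennreal_SUP_add[OF inc])
  also have "(SUP i. ennreal (1 - acc x) * U i x) = ennreal (1 - acc x) * (SUP i. U i x)"
    by (rule SUP_mult_left_ennreal[symmetric])
  also have "(SUP i. \<integral>\<^sup>+y. ennreal (k x y) * U i y \<partial>lborel) = (\<integral>\<^sup>+y. (SUP i. ennreal (k x y) * U i y) \<partial>lborel)"
    using seq(3) by (intro nn_integral_monotone_convergence_SUP[symmetric])
       (auto simp: incseq_def le_fun_def intro!: mult_left_mono)
  also have "\<dots> = (\<integral>\<^sup>+y. ennreal (k x y) * (SUP i. U i y) \<partial>lborel)"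
    by (simp add: SUP_mult_left_ennreal)
  finally show ?case by (simp add: SUP_apply image_comp)
qed

lemma prob_space_P: "prob_space (P x)"
proof (rule prob_spaceI)
  have "emeasure (P x) (space (P x)) = ennreal (acc x) + ennreal (1 - acc x)"
    using nn_integral_eq_integral[OF k_integrable[of x]] by (simp add: emeasure_P acc_def)
  also have "\<dots> = 1" using acc_le_1[of x] acc_nonneg[of x] by (simp add: ennreal_plus[symmetric] del: ennreal_plus)
  finally show "emeasure (P x) (space (P x)) = 1" .
qed

lemma
  assumes "f \<in> growth s" "0 \<le> s" "s \<le> 1"
  shows integrable_P: "integrable (P x) f" and integral_P: "(\<integral>y. f y \<partial>P x) = transop f x"
proof -
  have [measurable]: "f \<in> borel_measurable borel" by (rule growth_meas[OF assms(1)])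
  have nn: "(\<integral>\<^sup>+y. ennreal (g y) \<partial>P x) = ennreal (transop g x)" if "g \<in> growth s" "\<And>y. 0 \<le> g y" for g
  proof -
    have [measurable]: "g \<in> borel_measurable borel" by (rule growth_meas[OF that(1)])
    have "(\<integral>\<^sup>+y. ennreal (g y) \<partial>P x) = (\<integral>\<^sup>+y. ennreal (k x y * g y) \<partial>lborel) + ennreal ((1 - acc x) * g x)"
      using acc_le_1[of x] that by (simp add: nn_integral_P ennreal_mult)
    also have "\<dots> = ennreal (jump g x) + ennreal ((1 - acc x) * g x)"
      unfolding jump_def using that by (subst nn_integral_eq_integral[OF growth_integrable_k[OF that(1) assms(2,3)]]) auto
    also have "\<dots> = ennreal (transop g x)"
      unfolding transop_def using acc_le_1[of x] that
      by (subst ennreal_plus[symmetric]) (auto simp: jump_def intro!: integral_nonneg_AE)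
    finally show ?thesis .
  qed
  define f1 where "f1 = (\<lambda>x. max 0 (f x))"
  define f2 where "f2 = (\<lambda>x. max 0 (- f x))"
  obtain B where B: "0 \<le> B" "\<And>x. \<bar>f x\<bar> \<le> B * Vs s x" using growthE[OF assms(1)] by metis
  have g: "f1 \<in> growth s" "f2 \<in> growth s"
    unfolding f1_def f2_def using B by (auto intro!: growthI[where B=B] simp: max_def) (meson abs_ge_self abs_le_D2 order_trans)+
  have i: "integrable (P x) g \<and> (\<integral>y. g y \<partial>P x) = transop g x" if "g \<in> growth s" "\<And>y. 0 \<le> g y" for g
  proof -
    have [measurable]: "g \<in> borel_measurable borel" by (rule growth_meas[OF that(1)])
    have t: "0 \<le> transop g x" unfolding transop_def using that acc_le_1[of x]
      by (auto simp: jump_def intro!: add_nonneg_nonneg integral_nonneg_AE)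
    show ?thesis using nn[OF that] that t
      by (auto intro!: integrableI_nonneg simp: integral_eq_nn_integral)
  qed
  have f: "f = (\<lambda>x. f1 x - f2 x)" by (auto simp: f1_def f2_def)
  have i1: "integrable (P x) f1 \<and> (\<integral>y. f1 y \<partial>P x) = transop f1 x"
    and i2: "integrable (P x) f2 \<and> (\<integral>y. f2 y \<partial>P x) = transop f2 x"
    by (rule i; use g in \<open>auto simp: f1_def f2_def\<close>)+
  show "integrable (P x) f" using i1 i2 by (subst f) (intro Bochner_Integration.integrable_diff; simp)
  show "(\<integral>y. f y \<partial>P x) = transop f x"
    using i1 i2 by (subst (1 2) f) (simp add: transop_diff[OF g assms(2,3)])
qed

lemma measure_P_meas[measurable]:
  assumes [measurable]: "A \<in> sets borel"
  shows "(\<lambda>x. measure (P x) A) \<in> borel_measurable borel"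
proof -
  have "indicator A \<in> growth 0"
    by (rule growthI[where B=1]) (auto simp: indicator_def)
  from integral_P[OF this] have "(\<lambda>x. measure (P x) A) = transop (indicator A)"
    by (auto simp: fun_eq_iff)
  then show ?thesis by simp
qed

section \<open>Drift and minorization\<close>

lemma pi_exp_bound: "\<exists>C>0. \<forall>x. \<pi> x \<le> C * exp (- norm x)"
proof -
  obtain R where R: "\<And>x t. R \<le> norm x \<Longrightarrow> 1 \<le> t \<Longrightarrow> \<pi> (t *\<^sub>R x) \<le> \<pi> x * exp (- (1 * (t - 1) * norm x))"
    using radial_decay[of 1] by blast
  define R' where "R' = max R 1"
  have R': "1 \<le> R'" "R \<le> R'" unfolding R'_def by auto
  have "bounded (\<pi> ` cball 0 R')"
    by (intro compact_imp_bounded compact_continuous_image continuous_on_subset[OF pi_cont]) auto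
  then obtain D where D: "\<And>x. norm x \<le> R' \<Longrightarrow> \<pi> x \<le> D" "0 < D"
    unfolding bounded_pos by (fastforce simp: abs_le_iff)
  have "\<pi> x \<le> D * exp R' * exp (- norm x)" for x
  proof (cases "norm x \<le> R'")
    case True
    then have "1 \<le> exp R' * exp (- norm x)" by (simp add: exp_add[symmetric])
    then have "D * 1 \<le> D * (exp R' * exp (- norm x))" using D by (intro mult_left_mono) auto
    then show ?thesis using D(1)[OF True] by simp
  next
    case False
    define y where "y = (R' / norm x) *\<^sub>R x"
    have y: "norm y = R'" "x = (norm x / R') *\<^sub>R y" using False R' unfolding y_def by auto
    have "\<pi> x \<le> \<pi> y * exp (- (1 * (norm x / R' - 1) * norm y))"
      using R[of y "norm x / R'"] y R' False by simp
    also have "\<dots> \<le> D * exp (- (1 * (norm x / R' - 1) * norm y))"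
      using D(1)[of y] y by (intro mult_right_mono) auto
    also have "1 * (norm x / R' - 1) * norm y = norm x - R'" using y R' by (simp add: field_simps)
    finally show ?thesis by (simp add: exp_diff exp_minus field_simps)
  qed
  then show ?thesis using D by (intro exI[of _ "D * exp R'"]) auto
qed

lemma pi_bounded: "\<exists>C>0. \<forall>x. \<pi> x \<le> C"
proof -
  obtain C where C: "C > 0" "\<And>x. \<pi> x \<le> C * exp (- norm x)" using pi_exp_bound by blast
  have "C * exp (- norm x) \<le> C" for x :: 'a using C(1) by simp
  then show ?thesis using C by (meson order_trans)
qed

lemma pi_powr_integrable:
  assumes "0 < s"
  shows "integrable lborel (\<lambda>x. \<pi> x powr s)"
proof -
  obtain C where C: "C > 0" "\<And>x. \<pi> x \<le> C * exp (- norm x)" using pi_exp_bound by blast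
  have "norm (\<pi> x powr s) \<le> norm (C powr s * exp (- s * norm x))" for x
  proof -
    have "\<pi> x powr s \<le> (C * exp (- norm x)) powr s" using C assms by (intro powr_mono2) auto
    also have "\<dots> = C powr s * exp (- s * norm x)"
      using C by (simp add: powr_mult powr_def[of "exp _"] mult.commute)
    finally show ?thesis by simp
  qed
  then show ?thesis
    by (intro Bochner_Integration.integrable_bound[OF
          integrable_mult_right[OF integrable_exp_neg_norm[OF assms], of "C powr s"]] AE_I2) simp_all
qed

lemma growth_integrable:
  assumes "f \<in> growth s" "s < 1"
  shows "integrable lborel (\<lambda>x. f x * \<pi> x)"
proof -
  obtain B where B: "0 \<le> B" "\<And>x. \<bar>f x\<bar> \<le> B * Vs s x" using growthE[OF assms(1)] by metis
  have [measurable]: "f \<in> borel_measurable borel" by (rule growth_meas[OF assms(1)])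
  have "norm (f x * \<pi> x) \<le> norm (B * \<pi> x powr (1 - s))" for x
  proof -
    have "\<bar>f x\<bar> * \<pi> x \<le> B * Vs s x * \<pi> x" using B by (intro mult_right_mono) auto
    also have "\<dots> = B * \<pi> x powr (1 - s)" using pi_pos[of x] by (simp add: powr_diff powr_minus field_simps)
    finally show ?thesis using B by (simp add: abs_mult)
  qed
  then show ?thesis using assms
    by (intro Bochner_Integration.integrable_bound[OF integrable_mult_right[OF pi_powr_integrable[of "1 - s"]]]) auto
qed

lemma Vs_growth: "Vs s \<in> growth s" by (rule growthI[where B=1]) auto

lemma growth_mono:
  assumes "f \<in> growth s" "s \<le> t"
  shows "f \<in> growth t"
proof -
  obtain B where B: "0 \<le> B" "\<And>x. \<bar>f x\<bar> \<le> B * Vs s x" using growthE[OF assms(1)] by metis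
  obtain C where C: "C > 0" "\<And>x. \<pi> x \<le> C" using pi_bounded by blast
  show ?thesis
  proof (rule growthI)
    show "\<bar>f x\<bar> \<le> (B * C powr (t - s)) * Vs t x" for x
    proof -
      have "Vs s x = \<pi> x powr (t - s) * Vs t x" by (simp add: powr_add[symmetric])
      also have "\<dots> \<le> C powr (t - s) * Vs t x"
        using C assms by (intro mult_right_mono powr_mono2) auto
      finally have "B * Vs s x \<le> B * (C powr (t - s) * Vs t x)" using B by (intro mult_left_mono) auto
      then show ?thesis using B(2)[of x] by (simp add: mult.assoc)
    qed
  qed (rule growth_meas[OF assms(1)])
qed

lemma const_growth: "0 \<le> s \<Longrightarrow> (\<lambda>_. c) \<in> growth s"
  by (rule growth_mono[OF one_growth])

text \<open>Far out, a level strip of \<open>\<pi>\<close> is thin: \<open>N\<close> radial dilations by factors \<open>1 + i / (N * norm x)\<close>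
  keep the strip inside a fixed ball around \<open>x\<close>, but move \<open>ln \<pi>\<close> by more than the width of the
  strip, so that the \<open>N\<close> images are disjoint.\<close>

lemma level_strip_small:
  assumes "0 < M" "0 < Z" "0 < \<epsilon>"
  shows "\<exists>R. \<forall>x. R \<le> norm x \<longrightarrow>
    measure lborel {y \<in> cball x Z. exp (- M) * \<pi> x \<le> \<pi> y \<and> \<pi> y \<le> exp M * \<pi> x} \<le> \<epsilon>"
proof -
  define v where "v = measure lebesgue (cball (0::'a) (Z + 2))"
  have v0: "0 \<le> v" unfolding v_def by simp
  obtain N :: nat where N: "v / \<epsilon> < real N" using reals_Archimedean2 by blast
  have N0: "0 < real N" using N v0 assms by (meson divide_nonneg_pos le_less_trans)
  \<comment> \<open>The factors of two dilations differ by a ratio of at least \<open>1 + 1 / (2 * N * norm x)\<close>, at points of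
    norm at least \<open>norm x / 2\<close>; this rate then separates the values of \<open>\<pi>\<close> by more than \<open>exp (2 * M)\<close>.\<close>
  define L where "L = 8 * M * real N + real N"
  obtain R where R: "\<And>x t. R \<le> norm x \<Longrightarrow> 1 \<le> t \<Longrightarrow> \<pi> (t *\<^sub>R x) \<le> \<pi> x * exp (- (L * (t - 1) * norm x))"
    using radial_decay[of L] by blast
  have "measure lborel {y \<in> cball x Z. exp (- M) * \<pi> x \<le> \<pi> y \<and> \<pi> y \<le> exp M * \<pi> x} \<le> \<epsilon>"
    if x: "max 1 (max (2 * Z) (R + Z)) \<le> norm x" for x
  proof -
    define S where "S = {y \<in> cball x Z. exp (- M) * \<pi> x \<le> \<pi> y \<and> \<pi> y \<le> exp M * \<pi> x}"
    have "S = cball x Z \<inter> {y. exp (- M) * \<pi> x \<le> \<pi> y} \<inter> {y. \<pi> y \<le> exp M * \<pi> x}"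
      unfolding S_def by auto
    moreover have "closed {y. exp (- M) * \<pi> x \<le> \<pi> y}" "closed {y. \<pi> y \<le> exp M * \<pi> x}"
      by (intro closed_Collect_le continuous_intros pi_cont)+
    ultimately have S: "compact S" by (simp add: compact_Int_closed)
    define c where "c i = 1 + real i / (real N * norm x)" for i
    define D where "D i = (\<lambda>y. c i *\<^sub>R y) ` S" for i :: nat
    have x0: "0 < norm x" using x by linarith
    have c: "1 \<le> c i" "i < N \<Longrightarrow> c i \<le> 1 + 1 / norm x" "i < N \<Longrightarrow> c i \<le> 2" for i
    proof -
      show "1 \<le> c i" unfolding c_def by simp
      show *: "c i \<le> 1 + 1 / norm x" if "i < N"
        using that x0 N0 unfolding c_def by (simp add: field_simps)
      have "1 / norm x \<le> 1" using x x0 by simp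
      then show "c i \<le> 2" if "i < N" using *[OF that] by linarith
    qed
    have D_comp: "compact (D i)" for i
      unfolding D_def by (intro compact_continuous_image continuous_intros S)
    have Sn: "norm y \<le> 2 * norm x" "norm x / 2 \<le> norm y" "R \<le> norm y" if "y \<in> S" for y
    proof -
      have "norm (x - y) \<le> Z" using that unfolding S_def by (auto simp: dist_norm)
      moreover have "norm x \<le> norm (x - y) + norm y" "norm y \<le> norm (x - y) + norm x"
        using norm_triangle_ineq[of "x - y" y] norm_triangle_ineq4[of x "x - y"] by auto
      ultimately show "norm y \<le> 2 * norm x" "norm x / 2 \<le> norm y" "R \<le> norm y" using x by auto
    qed
    have sub: "D i \<subseteq> cball x (Z + 2)" if "i < N" for i
    proof
      fix w assume "w \<in> D i"
      then obtain y where y: "y \<in> S" "w = c i *\<^sub>R y" unfolding D_def by auto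
      have "dist x w \<le> norm (x - y) + norm ((c i - 1) *\<^sub>R y)"
        using norm_triangle_ineq4[of "x - y" "(c i - 1) *\<^sub>R y"] unfolding y dist_norm
        by (simp add: algebra_simps)
      also have "norm ((c i - 1) *\<^sub>R y) \<le> (1 / norm x) * (2 * norm x)"
        using c(1)[of i] c(2)[OF that] Sn(1)[OF y(1)] unfolding norm_scaleR by (intro mult_mono) auto
      also have "\<dots> = 2" using x0 by simp
      also have "norm (x - y) \<le> Z" using y unfolding S_def by (auto simp: dist_norm)
      finally show "w \<in> cball x (Z + 2)" by simp
    qed
    have disj0: "D i \<inter> D j = {}" if ij: "i < j" "j < N" for i j
    proof (rule ccontr)
      assume "D i \<inter> D j \<noteq> {}"
      then obtain y y' where y: "y \<in> S" "y' \<in> S" "c i *\<^sub>R y = c j *\<^sub>R y'" unfolding D_def by auto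
      define t where "t = c j / c i"
      have "y = (1 / c i) *\<^sub>R (c i *\<^sub>R y)" using c(1)[of i] by simp
      also have "\<dots> = t *\<^sub>R y'" unfolding y t_def by simp
      finally have yt: "y = t *\<^sub>R y'" .
      have "1 / (real N * norm x) \<le> c j - c i"
        using ij x0 N0 divide_right_mono[of 1 "real j - real i" "real N * norm x"]
        unfolding c_def by (simp add: diff_divide_distrib)
      moreover have "t - 1 = (c j - c i) / c i" using c(1)[of i] unfolding t_def by (simp add: field_simps)
      moreover have "(c j - c i) / c i \<ge> (1 / (real N * norm x)) / 2"
      proof (rule frac_le)
        show "0 \<le> c j - c i" using ij unfolding c_def by (simp add: divide_right_mono)
        show "1 / (real N * norm x) \<le> c j - c i" by (rule calculation(1))
        show "0 < c i" using c(1)[of i] by linarith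
        show "c i \<le> 2" using c(3)[of i] ij by linarith
      qed
      ultimately have t: "1 / (2 * (real N * norm x)) \<le> t - 1" by (simp add: mult.commute)
      have "0 \<le> 1 / (2 * (real N * norm x))" by simp
      with t have t1: "1 \<le> t" by linarith
      have L0: "0 \<le> L" unfolding L_def using assms by simp
      have "L / (4 * real N) = L * (1 / (2 * (real N * norm x))) * (norm x / 2)"
        using x0 N0 by (simp add: field_simps)
      also have "\<dots> \<le> L * (t - 1) * norm y'"
        using t t1 Sn(2)[OF y(2)] L0 x0 N0 by (intro mult_mono) auto
      finally have "2 * M < L * (t - 1) * norm y'"
        using N0 unfolding L_def by (simp add: add_divide_distrib)
      then have "exp (- (L * (t - 1) * norm y')) < exp (- (2 * M))" by simp
      moreover have "\<pi> y \<le> \<pi> y' * exp (- (L * (t - 1) * norm y'))"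
        unfolding yt by (rule R[OF Sn(3)[OF y(2)] t1])
      ultimately have "\<pi> y < \<pi> y' * exp (- (2 * M))"
        using pi_pos[of y'] by (meson le_less_trans mult_strict_left_mono)
      also have "\<dots> \<le> (exp M * \<pi> x) * exp (- (2 * M))"
        using y unfolding S_def by (intro mult_right_mono) auto
      also have "\<dots> = exp (- M) * \<pi> x" by (simp add: exp_add[symmetric] mult_ac)
      also have "\<dots> \<le> \<pi> y" using y unfolding S_def by auto
      finally show False by simp
    qed
    have disj: "disjoint_family_on D {..<N}"
      unfolding disjoint_family_on_def
      by (metis disj0 Int_commute lessThan_iff linorder_neqE_nat)
    have "real N * measure lebesgue S = (\<Sum>i<N. measure lebesgue S)" by simp
    also have "\<dots> \<le> (\<Sum>i<N. measure lebesgue (D i))"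
    proof (rule sum_mono)
      fix i
      have "measure lebesgue (D i) = \<bar>c i\<bar> ^ DIM('a) * measure lebesgue S"
        using measure_lebesgue_affine[of "c i" 0 S] unfolding D_def by simp
      moreover have "1 \<le> \<bar>c i\<bar> ^ DIM('a)" using c(1)[of i] by (intro one_le_power) auto
      ultimately show "measure lebesgue S \<le> measure lebesgue (D i)"
        by (metis mult_right_mono mult_1 measure_nonneg)
    qed
    also have "\<dots> = measure lebesgue (\<Union>i<N. D i)"
      using lmeasurable_compact[OF D_comp] fmeasurableD2[OF lmeasurable_compact[OF D_comp]]
      by (intro measure_finite_Union[symmetric] disj) (auto simp: fmeasurableD)
    also have "\<dots> \<le> measure lebesgue (cball x (Z + 2))"
      using sub lmeasurable_compact[OF D_comp]
      by (intro measure_mono_fmeasurable) (auto intro!: sets.finite_UN)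
    also have "\<dots> = v" unfolding v_def using content_cball[of "Z + 2" x] content_cball[of "Z + 2" "0::'a"] assms
      by (simp add: measure_completion)
    finally have "real N * measure lebesgue S \<le> v" .
    moreover have "v < real N * \<epsilon>" using N assms by (simp add: field_simps)
    ultimately have "real N * measure lebesgue S \<le> real N * \<epsilon>" by linarith
    then have "measure lebesgue S \<le> \<epsilon>" using N0 by simp
    then show ?thesis using borel_compact[OF S] unfolding S_def[symmetric] by (simp add: measure_completion)
  qed
  then show ?thesis by blast
qed

lemma jump_shift: "f \<in> borel_measurable borel \<Longrightarrow> jump f x = (\<integral>z. k x (x + z) * f (x + z) \<partial>lborel)"
  unfolding jump_def by (rule integral_translate'[symmetric]) measurable

lemma growth_integrable_k_shift:
  "f \<in> growth s \<Longrightarrow> 0 \<le> s \<Longrightarrow> s \<le> 1 \<Longrightarrow> integrable lborel (\<lambda>z. k x (x + z) * f (x + z))"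
  by (rule integrable_translate'[OF growth_integrable_k])

lemma q_upper: obtains Q where "0 < Q" "\<And>z. q z \<le> Q"
  using q_bounded unfolding bounded_pos by (force simp: abs_le_iff)

text \<open>In the tails, accepted moves mostly lead to much larger values of \<open>\<pi>\<close>, because neither
  long moves nor moves inside a level strip carry much mass.\<close>

lemma jump_tail:
  assumes s: "0 < s" "s < 1" and "0 < \<eta>"
  shows "\<exists>R. \<forall>x. R \<le> norm x \<longrightarrow> jump (Vs s) x \<le> \<eta> * Vs s x"
proof -
  obtain Q where Q: "0 < Q" "\<And>z. q z \<le> Q" using q_upper by blast
  obtain Z where Z: "0 < Z" "(\<integral>z. indicator {z. Z < norm z} z * qq z \<partial>lborel) \<le> \<eta> / 3"
    using integral_tail_small[OF qq_integrable, of "\<eta> / 3"] assms by auto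
  \<comment> \<open>Outside the strip the ratio \<open>r = \<pi> y / \<pi> x\<close> contributes a factor \<open>r powr (1 - s)\<close> if it is small and
    \<open>r powr (- s)\<close> if it is large.\<close>
  define m where "m = min s (1 - s)"
  have m: "0 < m" using s unfolding m_def by auto
  define M where "M = max 1 (ln (6 / \<eta>) / m)"
  have M: "0 < M" "exp (- (m * M)) \<le> \<eta> / 6"
  proof -
    show "0 < M" unfolding M_def by simp
    have "ln (6 / \<eta>) \<le> m * M" using m unfolding M_def by (simp add: max_def field_simps)
    then have "exp (- (m * M)) \<le> exp (- ln (6 / \<eta>))" by simp
    also have "\<dots> = \<eta> / 6" using assms by (simp add: exp_minus)
    finally show "exp (- (m * M)) \<le> \<eta> / 6" .
  qed
  obtain R where R: "\<And>x. R \<le> norm x \<Longrightarrow>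
      measure lborel {y \<in> cball x Z. exp (- M) * \<pi> x \<le> \<pi> y \<and> \<pi> y \<le> exp M * \<pi> x} \<le> \<eta> / (6 * Q)"
    using level_strip_small[OF M(1) Z(1), of "\<eta> / (6 * Q)"] assms Q by auto
  have "jump (Vs s) x \<le> \<eta> * Vs s x" if x: "R \<le> norm x" for x
  proof -
    define S where "S = {y \<in> cball x Z. exp (- M) * \<pi> x \<le> \<pi> y \<and> \<pi> y \<le> exp M * \<pi> x}"
    have S[measurable]: "S \<in> sets borel" unfolding S_def by measurable
    have Sfin: "emeasure lborel S < \<infinity>"
      by (rule emeasure_bounded_finite[OF bounded_subset[OF bounded_cball[of x Z]]]) (auto simp: S_def)
    have "jump (Vs s) x \<le> (\<integral>y. Vs s x * (indicator {z. Z < norm z} (y - x) * qq (y - x)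
        + (2 * Q) * indicator S y + exp (- (m * M)) * qq (y - x)) \<partial>lborel)"
      unfolding jump_def
    proof (rule integral_mono)
      show "integrable lborel (\<lambda>y. k x y * Vs s y)"
        using growth_integrable_k[OF Vs_growth, of s x] s by simp
      have "integrable lborel (\<lambda>z. indicator {z. Z < norm z} z * qq z)"
        by (rule Bochner_Integration.integrable_bound[OF qq_integrable]) (auto simp: indicator_def)
      from integrable_translate[OF this] Sfin
      show "integrable lborel (\<lambda>y. Vs s x * (indicator {z. Z < norm z} (y - x) * qq (y - x)
        + (2 * Q) * indicator S y + exp (- (m * M)) * qq (y - x)))"
        by (intro integrable_mult_right Bochner_Integration.integrable_add integrable_translate[OF qq_integrable]) auto
      fix y
      have kw: "k x y * Vs s y \<le> Vs s x * qq (y - x)" using k_weight[of s x y] s by simp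
      have qQ: "qq (y - x) \<le> 2 * Q" using Q(2)[of "y - x"] Q(2)[of "x - y"] by (simp add: qq_def)
      consider "Z < norm (y - x)" | "norm (y - x) \<le> Z" "y \<in> S" | "norm (y - x) \<le> Z" "y \<notin> S" by fastforce
      then show "k x y * Vs s y \<le> Vs s x * (indicator {z. Z < norm z} (y - x) * qq (y - x)
        + (2 * Q) * indicator S y + exp (- (m * M)) * qq (y - x))"
      proof cases
        case 1
        have "Vs s x * qq (y - x) \<le> Vs s x * (indicator {z. Z < norm z} (y - x) * qq (y - x)
          + (2 * Q) * indicator S y + exp (- (m * M)) * qq (y - x))"
          using 1 Q by (intro mult_left_mono) auto
        then show ?thesis using kw by linarith
      next
        case 2
        have "Vs s x * qq (y - x) \<le> Vs s x * (indicator {z. Z < norm z} (y - x) * qq (y - x)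
          + (2 * Q) * indicator S y + exp (- (m * M)) * qq (y - x))"
          using 2 Q qQ by (intro mult_left_mono) (auto intro: add_increasing2)
        then show ?thesis using kw by linarith
      next
        case 3
        have "k x y * Vs s y \<le> Vs s x * (exp (- (m * M)) * qq (y - x))"
        proof -
          define r where "r = \<pi> y / \<pi> x"
          have r0: "0 < r" unfolding r_def using pi_pos by simp
          have rV: "Vs s y = Vs s x * r powr (- s)" unfolding r_def by (simp add: powr_divide)
          have "r < exp (- M) \<or> exp M < r"
            using 3 pi_pos[of x] unfolding S_def r_def by (auto simp: dist_norm norm_minus_commute field_simps not_le)
          then have "k x y * r powr (- s) \<le> exp (- (m * M)) * qq (y - x)"
          proof
            assume r: "r < exp (- M)"
            have "k x y * r powr (- s) \<le> (r * q (x - y)) * r powr (- s)"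
              by (intro mult_right_mono) (auto simp: k_def r_def)
            also have "\<dots> = r powr (1 - s) * q (x - y)"
              using r0 by (simp add: powr_diff powr_minus field_simps)
            also have "\<dots> \<le> exp (- M) powr (1 - s) * qq (y - x)"
              using r r0 s by (intro mult_mono powr_mono2) (auto simp: qq_def)
            also have "exp (- M) powr (1 - s) \<le> exp (- (m * M))"
              using M unfolding powr_def m_def by (auto simp: min_def mult.commute intro!: mult_right_mono)
            finally show ?thesis by (simp add: mult_right_mono)
          next
            assume r: "exp M < r"
            have "k x y * r powr (- s) \<le> q (y - x) * exp M powr (- s)"
              using r s by (intro mult_mono k_le_q powr_mono2') auto
            also have "\<dots> \<le> exp (- (m * M)) * qq (y - x)"
            proof -
              have "exp M powr (- s) \<le> exp (- (m * M))"
                using M s unfolding powr_def m_def by (auto simp: min_def mult.commute intro!: mult_right_mono)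
              then show ?thesis by (subst mult.commute, intro mult_mono) (auto simp: qq_def)
            qed
            finally show ?thesis .
          qed
          then have "Vs s x * (k x y * r powr (- s)) \<le> Vs s x * (exp (- (m * M)) * qq (y - x))"
            by (intro mult_left_mono) auto
          then show ?thesis unfolding rV by (simp add: mult_ac)
        qed
        also have "\<dots> \<le> Vs s x * (indicator {z. Z < norm z} (y - x) * qq (y - x)
          + (2 * Q) * indicator S y + exp (- (m * M)) * qq (y - x))"
          using Q by (intro mult_left_mono) (auto intro: add_increasing)
        finally show ?thesis .
      qed
    qed
    also have "\<dots> = Vs s x * ((\<integral>z. indicator {z. Z < norm z} z * qq z \<partial>lborel)
        + (2 * Q) * measure lborel S + exp (- (m * M)) * 2)"
    proof -
      have i1: "integrable lborel (\<lambda>z. indicator {z. Z < norm z} z * qq z)"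
        by (rule Bochner_Integration.integrable_bound[OF qq_integrable]) (auto simp: indicator_def)
      have "(\<integral>y. indicator {z. Z < norm z} (y - x) * qq (y - x) \<partial>lborel) =
          (\<integral>z. indicator {z. Z < norm z} z * qq z \<partial>lborel)"
        by (rule integral_translate) measurable
      moreover have "(\<integral>y. qq (y - x) \<partial>lborel) = 2" by (simp add: integral_translate qq_mass)
      ultimately show ?thesis
        using integrable_translate[OF i1, of x] integrable_translate[OF qq_integrable, of x] Sfin by simp
    qed
    also have "\<dots> \<le> Vs s x * (\<eta> / 3 + (2 * Q) * (\<eta> / (6 * Q)) + (\<eta> / 6) * 2)"
      using Z M R[OF x] Q unfolding S_def by (intro mult_left_mono add_mono mult_right_mono) auto
    also have "\<dots> = \<eta> * Vs s x" using Q by simp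
    finally show ?thesis .
  qed
  then show ?thesis by blast
qed

text \<open>In contrast to \<open>jump_tail\<close>, this holds for all exponents at once and uses only that long proposals are
  rare.\<close>

lemma jump_outside:
  assumes "0 < \<eta>"
  shows "\<exists>R'. \<forall>x s. norm x \<le> R \<longrightarrow> 0 \<le> s \<longrightarrow> s \<le> 1 \<longrightarrow>
    jump (\<lambda>y. indicator {y. R' < norm y} y * Vs s y) x \<le> \<eta> * Vs s x"
proof -
  obtain Z where Z: "0 < Z" "(\<integral>z. indicator {z. Z < norm z} z * qq z \<partial>lborel) \<le> \<eta>"
    using integral_tail_small[OF qq_integrable assms] by blast
  have "jump (\<lambda>y. indicator {y. R + Z < norm y} y * Vs s y) x \<le> \<eta> * Vs s x"
    if x: "norm x \<le> R" and s: "0 \<le> s" "s \<le> 1" for x s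
  proof -
    have g: "(\<lambda>y. indicator {y. R + Z < norm y} y * Vs s y) \<in> growth s"
      by (rule growthI[where B=1]) (auto simp: indicator_def)
    have i1: "integrable lborel (\<lambda>z. indicator {z. Z < norm z} z * qq z)"
      by (rule Bochner_Integration.integrable_bound[OF qq_integrable]) (auto simp: indicator_def)
    have "jump (\<lambda>y. indicator {y. R + Z < norm y} y * Vs s y) x
      \<le> (\<integral>y. Vs s x * (indicator {z. Z < norm z} (y - x) * qq (y - x)) \<partial>lborel)"
      unfolding jump_def
    proof (rule integral_mono[OF growth_integrable_k[OF g s]])
      fix y
      have "Z < norm (y - x)" if "R + Z < norm y" using that x norm_triangle_sub[of y x] by linarith
      then show "k x y * (indicator {y. R + Z < norm y} y * Vs s y) \<le>
          Vs s x * (indicator {z. Z < norm z} (y - x) * qq (y - x))"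
        using k_weight[OF s, of x y] by (auto simp: indicator_def)
    qed (use integrable_translate[OF i1] in auto)
    also have "\<dots> = Vs s x * (\<integral>z. indicator {z. Z < norm z} z * qq z \<partial>lborel)"
      using integral_translate[of "\<lambda>z. indicator {z. Z < norm z} z * qq z" x] by simp
    also have "\<dots> \<le> Vs s x * \<eta>" using Z by (intro mult_left_mono) auto
    finally show ?thesis by (simp add: mult.commute)
  qed
  then show ?thesis by blast
qed

lemma k_lower: "\<exists>m>0. \<forall>x y. norm x \<le> R \<longrightarrow> norm y \<le> R' \<longrightarrow> m \<le> k x y"
proof (cases "0 \<le> R \<and> 0 \<le> R'")
  case True
  have "\<exists>z\<in>cball 0 R \<times> cball 0 R'. \<forall>w\<in>cball (0::'a) R \<times> cball (0::'a) R'. k (fst z) (snd z) \<le> k (fst w) (snd w)"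
    using True by (intro continuous_attains_inf compact_Times continuous_on_subset[OF k_continuous]) auto
  then obtain z where "\<And>w. w\<in>cball (0::'a) R \<times> cball (0::'a) R' \<Longrightarrow> k (fst z) (snd z) \<le> k (fst w) (snd w)"
    by blast
  then show ?thesis using k_pos by (intro exI[of _ "k (fst z) (snd z)"]) auto
next
  case False
  then show ?thesis by (intro exI[of _ 1]) (use norm_ge_zero in \<open>auto dest: order_trans[OF norm_ge_zero]\<close>)
qed

text \<open>On a bounded set this is compactness. Farther out, all moves into a ball of fixed size that lies
  between the current state and the origin increase \<open>\<pi>\<close>, and \<open>k\<close> is then at least the minimum of the
  proposal densities in the two directions.\<close>

lemma acc_lower: "\<exists>A>0. \<forall>x. A \<le> acc x"
proof -
  obtain R \<epsilon> where R: "0 < \<epsilon>" "\<And>x z. R \<le> norm x \<Longrightarrow> z \<in> ball (- (1 / (2 * norm x)) *\<^sub>R x) \<epsilon> \<Longrightarrow> \<pi> x \<le> \<pi> (x + z)"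
    using inward_ball by blast
  define \<delta> where "\<delta> = min \<epsilon> 1"
  have \<delta>: "0 < \<delta>" "\<delta> \<le> \<epsilon>" "\<delta> \<le> 1" unfolding \<delta>_def using R by auto
  define R1 where "R1 = max R 1"
  define v where "v = measure lborel (ball (0::'a) \<delta>)"
  have v: "0 < v" unfolding v_def using content_ball_pos[OF \<delta>(1), of "0::'a"] by simp
  have vb: "measure lborel (ball (c::'a) \<delta>) = v" for c
    unfolding v_def using content_ball_conv_unit_ball \<delta> by (metis less_imp_le)
  have lower: "m * v \<le> acc x" if "\<And>z. z \<in> ball c \<delta> \<Longrightarrow> m \<le> k x (x + z)" "0 \<le> m" for m c x
  proof -
    have "acc x = (\<integral>z. k x (x + z) \<partial>lborel)"
      using jump_shift[of "\<lambda>_. 1" x] by (simp add: jump_const)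
    moreover have "(\<integral>z. m * indicator (ball c \<delta>) z \<partial>lborel) \<le> (\<integral>z. k x (x + z) \<partial>lborel)"
    proof (rule integral_mono)
      show "integrable lborel (\<lambda>z. m * indicator (ball c \<delta>) z :: real)"
        using emeasure_bounded_finite[OF bounded_ball[of c \<delta>]]
        by (intro integrable_mult_right integrable_real_indicator) auto
      show "integrable lborel (\<lambda>z. k x (x + z))" by (rule integrable_translate'[OF k_integrable])
    qed (use that in \<open>auto simp: indicator_def\<close>)
    ultimately show ?thesis using vb[of c] by simp
  qed
  obtain m1 where m1: "0 < m1" "\<And>x y. norm x \<le> R1 \<Longrightarrow> norm y \<le> R1 + 1 \<Longrightarrow> m1 \<le> k x y"
    using k_lower[of R1 "R1 + 1"] by blast
  have "\<exists>z\<in>cball 0 2. \<forall>w\<in>cball (0::'a) 2. min (q z) (q (- z)) \<le> min (q w) (q (- w))"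
    by (intro continuous_attains_inf continuous_on_min continuous_on_compose2[OF q_cont] continuous_intros) auto
  then obtain z0 where z0: "\<And>w. norm w \<le> 2 \<Longrightarrow> min (q z0) (q (- z0)) \<le> min (q w) (q (- w))"
    by (metis mem_cball_0)
  define m2 where "m2 = min (q z0) (q (- z0))"
  have m2: "0 < m2" unfolding m2_def using q_pos by simp
  have "min m1 m2 * v \<le> acc x" for x
  proof (cases "norm x \<le> R1")
    case True
    show ?thesis
    proof (rule lower[where c=0])
      fix z :: 'a assume "z \<in> ball 0 \<delta>"
      then have "norm (x + z) \<le> R1 + 1" using True \<delta> norm_triangle_ineq[of x z] by simp
      then show "min m1 m2 \<le> k x (x + z)" using m1(2)[OF True, of "x + z"] by simp
    qed (use m1 m2 in auto)
  next
    case False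
    define c where "c = - (1 / (2 * norm x)) *\<^sub>R x"
    have x0: "0 < norm x" "R \<le> norm x" using False unfolding R1_def by auto
    have nc: "norm c = 1 / 2" unfolding c_def using x0 by simp
    show ?thesis
    proof (rule lower[where c=c])
      fix z :: 'a assume z: "z \<in> ball c \<delta>"
      have "\<pi> x \<le> \<pi> (x + z)" using R(2)[OF x0(2), of z] z \<delta> unfolding c_def by auto
      then have "1 \<le> \<pi> (x + z) / \<pi> x" using pi_pos[of x] by simp
      then have "q (- z) \<le> \<pi> (x + z) / \<pi> x * q (- z)"
        using mult_right_mono[of 1 "\<pi> (x + z) / \<pi> x" "q (- z)"] by simp
      then have "min (q z) (q (- z)) \<le> k x (x + z)" unfolding k_def by (simp add: min_le_iff_disj)
      moreover have "norm z \<le> 2"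
        using z \<delta> nc norm_triangle_sub[of z c] by (auto simp: dist_norm norm_minus_commute)
      ultimately show "min m1 m2 \<le> k x (x + z)" using z0[of z] unfolding m2_def by linarith
    qed (use m1 m2 in auto)
  qed
  then show ?thesis using m1 m2 v by (intro exI[of _ "min m1 m2 * v"]) auto
qed

lemma Vs_bounded_on_ball: "\<exists>B>0. \<forall>x. norm x \<le> R \<longrightarrow> Vs s x \<le> B"
proof -
  have "bounded (Vs s ` cball 0 R)"
    by (intro compact_imp_bounded compact_continuous_image continuous_on_powr continuous_on_const
        continuous_on_subset[OF pi_cont]) auto
  then show ?thesis unfolding bounded_pos by (force simp: abs_le_iff)
qed

lemma drift:
  assumes s: "0 < s" "s < 1"
  shows "\<exists>l \<kappa>. 0 < l \<and> l < 1 \<and> 0 < \<kappa> \<and> (\<forall>x. transop (Vs s) x \<le> l * Vs s x + \<kappa>)"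
proof -
  obtain A where A: "0 < A" "\<And>x. A \<le> acc x" using acc_lower by blast
  have A1: "A \<le> 1" using A(2)[of 0] acc_le_1[of 0] by linarith
  obtain R where R: "\<And>x. R \<le> norm x \<Longrightarrow> jump (Vs s) x \<le> A / 2 * Vs s x"
    using jump_tail[OF s, of "A / 2"] A by auto
  obtain B where B: "0 < B" "\<And>x. norm x \<le> R \<Longrightarrow> Vs s x \<le> B" using Vs_bounded_on_ball by blast
  have "transop (Vs s) x \<le> (1 - A / 2) * Vs s x + 3 * B" for x
  proof (cases "norm x \<le> R")
    case True
    have "transop (Vs s) x \<le> 3 * 1 * Vs s x"
      using transop_abs_le[of "Vs s" 1 s x] s by auto
    also have "\<dots> \<le> 3 * B" using B(2)[OF True] by simp
    also have "\<dots> \<le> (1 - A / 2) * Vs s x + 3 * B" using A1 by simp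
    finally show ?thesis .
  next
    case False
    have "transop (Vs s) x \<le> A / 2 * Vs s x + (1 - A) * Vs s x"
      unfolding transop_def using R[of x] False A(2)[of x] by (intro add_mono mult_right_mono) auto
    also have "\<dots> = (1 - A / 2) * Vs s x" by (simp add: algebra_simps)
    also have "\<dots> \<le> (1 - A / 2) * Vs s x + 3 * B" using B by simp
    finally show ?thesis .
  qed
  then show ?thesis using A A1 B by (intro exI[of _ "1 - A / 2"] exI[of _ "3 * B"]) auto
qed

lemma sublevel_bounded:
  assumes "0 < s"
  shows "\<exists>R. \<forall>x. Vs s x \<le> T \<longrightarrow> norm x \<le> R"
proof -
  obtain C where C: "C > 0" "\<And>x. \<pi> x \<le> C * exp (- norm x)" using pi_exp_bound by blast
  have "norm x \<le> T * C powr s / s" if "Vs s x \<le> T" for x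
  proof -
    have "s * norm x \<le> exp (s * norm x)" using exp_ge_add_one_self[of "s * norm x"] by linarith
    also have "\<dots> = C powr s * (C * exp (- norm x)) powr (- s)"
    proof -
      have "exp (- norm x) powr (- s) = exp (s * norm x)" by (simp add: powr_def)
      then show ?thesis using C by (simp add: powr_mult powr_add[symmetric] mult.assoc[symmetric])
    qed
    also have "\<dots> \<le> C powr s * Vs s x"
      using C assms pi_pos by (intro mult_left_mono powr_mono2') auto
    also have "\<dots> \<le> C powr s * T" using that by (intro mult_left_mono) auto
    finally show ?thesis using assms by (simp add: field_simps)
  qed
  then show ?thesis by blast
qed

end

lemma cauchy_schwarz_from_quadratic:
  fixes A B C :: real
  assumes "\<And>t. 0 \<le> A - 2 * t * B + t\<^sup>2 * C" "0 \<le> C"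
  shows "B\<^sup>2 \<le> A * C"
proof (cases "C = 0")
  case True
  have "B = 0"
  proof (rule ccontr)
    assume "B \<noteq> 0"
    then have "A - 2 * ((A + 1) / (2 * B)) * B + ((A + 1) / (2 * B))\<^sup>2 * C = -1"
      using True by (simp add: field_simps)
    then show False using assms(1)[of "(A + 1) / (2 * B)"] by linarith
  qed
  then show ?thesis using True by simp
next
  case False
  have "0 \<le> (A - 2 * (B / C) * B + (B / C)\<^sup>2 * C) * C"
    using assms(1)[of "B / C"] assms(2) by (intro mult_nonneg_nonneg)
  also have "\<dots> = A * C - B\<^sup>2" using False by (simp add: power2_eq_square field_simps)
  finally show ?thesis by simp
qed

text \<open>A log-convex sequence that decays at some geometric rate decays at that rate from the first
  step on, because its successive quotients increase.\<close>

lemma log_convex_first_ratio: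
  fixes b :: "nat \<Rightarrow> real"
  assumes b0: "\<And>m. 0 \<le> b m" and conv: "\<And>m. (b (Suc m))\<^sup>2 \<le> b m * b (Suc (Suc m))"
    and decay: "\<And>m. b m \<le> C * \<rho> ^ m" and \<rho>: "0 < \<rho>"
  shows "b 1 \<le> \<rho> * b 0"
proof (rule ccontr)
  assume "\<not> b 1 \<le> \<rho> * b 0"
  then have gt: "\<rho> * b 0 < b 1" by simp
  have b00: "0 < b 0"
  proof (rule ccontr)
    assume "\<not> 0 < b 0"
    then have "b 0 = 0" using b0[of 0] by simp
    then show False using conv[of 0] gt by simp
  qed
  define r where "r = b 1 / b 0"
  have r: "\<rho> < r" unfolding r_def using gt b00 by (simp add: field_simps)
  have *: "0 < b m \<and> r * b m \<le> b (Suc m)" for m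
  proof (induction m)
    case 0
    show ?case using b00 by (simp add: r_def)
  next
    case (Suc m)
    have p: "0 < b (Suc m)" using Suc r \<rho> by (meson less_le_trans mult_pos_pos less_trans)
    have "r * b m * b (Suc m) \<le> b (Suc m) * b (Suc m)" using Suc p by (intro mult_right_mono) auto
    also have "\<dots> \<le> b m * b (Suc (Suc m))" using conv[of m] by (simp add: power2_eq_square)
    finally have "b m * (r * b (Suc m)) \<le> b m * b (Suc (Suc m))" by (simp add: mult_ac)
    then show ?case using p Suc by simp
  qed
  have low: "r ^ m * b 0 \<le> b m" for m
  proof (induction m)
    case (Suc m)
    have "r ^ Suc m * b 0 \<le> r * b m" using Suc r \<rho> by (simp add: mult.assoc)
    then show ?case using *[of m] by linarith
  qed simp
  have "(\<lambda>m. C * (\<rho> / r) ^ m) \<longlonglongrightarrow> C * 0"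
    using r \<rho> by (intro tendsto_mult tendsto_const LIMSEQ_power_zero) auto
  moreover have "b 0 \<le> C * (\<rho> / r) ^ m" for m
  proof -
    have "b 0 * r ^ m \<le> C * \<rho> ^ m" using low[of m] decay[of m] by (simp add: mult.commute)
    then show ?thesis using r \<rho> by (simp add: power_divide field_simps)
  qed
  ultimately have "b 0 \<le> 0" by (intro LIMSEQ_le_const[of _ "C * 0" "b 0", simplified]) auto
  then show False using b00 by simp
qed

context rwm begin

section \<open>Contraction in weighted oscillation\<close>

text \<open>Both cases of the estimate bound the oscillation of \<open>transop f\<close> by \<open>2 + \<beta> V x + \<beta> V y\<close> times a
  factor below 1. If \<open>V x + V y\<close> is large, this is the drift. Otherwise \<open>x\<close> and \<open>y\<close> lie in a ball from
  which the unit ball is reached with a density bounded below, so that the common part of the two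
  transition laws cancels; a small \<open>\<beta>\<close> makes this gain outweigh the additive constant of the drift.
  A constant shift of \<open>f\<close> turns the oscillation bound into a bound of \<open>\<bar>f\<bar>\<close>.\<close>

lemma oscillation_contraction:
  assumes s: "0 < s" "s < 1"
  shows "\<exists>\<beta> a. 0 < \<beta> \<and> 0 < a \<and> a < 1 \<and> (\<forall>f L. f \<in> borel_measurable borel \<longrightarrow>
    (\<forall>x y. \<bar>f x - f y\<bar> \<le> L * (2 + \<beta> * Vs s x + \<beta> * Vs s y)) \<longrightarrow>
    (\<forall>x y. \<bar>transop f x - transop f y\<bar> \<le> a * L * (2 + \<beta> * Vs s x + \<beta> * Vs s y)))"
proof -
  obtain l \<kappa> where dr: "0 < l" "l < 1" "0 < \<kappa>" "\<And>x. transop (Vs s) x \<le> l * Vs s x + \<kappa>"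
    using drift[OF s] by blast
  define T where "T = 4 * \<kappa> / (1 - l)"
  have T: "0 < T" unfolding T_def using dr by simp
  obtain R where R: "\<And>x. Vs s x \<le> T \<Longrightarrow> norm x \<le> R" using sublevel_bounded[OF s(1)] by blast
  obtain m where m: "0 < m" "\<And>x y. norm x \<le> R \<Longrightarrow> norm y \<le> 1 \<Longrightarrow> m \<le> k x y"
    using k_lower[of R 1] by blast
  define B where "B = cball (0::'a) 1"
  have B[measurable]: "B \<in> sets borel" unfolding B_def by simp
  have Bfin: "emeasure lborel B < \<infinity>" unfolding B_def by (intro emeasure_bounded_finite) auto
  define \<alpha> where "\<alpha> = m * measure lborel B"
  have \<alpha>: "0 < \<alpha>" unfolding \<alpha>_def B_def using m content_cball_pos[of 1 "0::'a"] by simp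
  define \<beta> where "\<beta> = \<alpha> / (2 * \<kappa>)"
  have \<beta>: "0 < \<beta>" "2 * \<beta> * \<kappa> = \<alpha>" unfolding \<beta>_def using \<alpha> dr by auto
  define l' where "l' = (1 + l) / 2"
  have l': "l \<le> l'" "l' < 1" "0 < l'" unfolding l'_def using dr by auto
  define a1 where "a1 = (2 + \<beta> * l' * T) / (2 + \<beta> * T)"
  have a1: "0 < a1" "a1 < 1"
  proof -
    have "0 < 2 + \<beta> * T" "0 < 2 + \<beta> * l' * T" using \<beta> T l' by (auto intro!: add_pos_pos)
    moreover have "\<beta> * l' * T < \<beta> * T" using \<beta> T l' by simp
    ultimately show "0 < a1" "a1 < 1" unfolding a1_def by auto
  qed
  define a where "a = max a1 (max (1 - \<alpha> / 2) l)"
  have a: "0 < a" "a < 1" "a1 \<le> a" "1 - \<alpha> / 2 \<le> a" "l \<le> a" unfolding a_def using a1 dr \<alpha> by auto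
  have "\<bar>transop f x - transop f y\<bar> \<le> a * L * (2 + \<beta> * Vs s x + \<beta> * Vs s y)"
    if f[measurable]: "f \<in> borel_measurable borel"
      and osc: "\<And>x y. \<bar>f x - f y\<bar> \<le> L * (2 + \<beta> * Vs s x + \<beta> * Vs s y)" for f L x y
  proof -
    have L0: "0 \<le> L"
    proof -
      have "0 \<le> L * (2 + \<beta> * Vs s x + \<beta> * Vs s x)" using osc[of x x] by simp
      moreover have "0 < 2 + \<beta> * Vs s x + \<beta> * Vs s x" using \<beta> by (intro add_pos_nonneg) auto
      ultimately show ?thesis by (simp add: zero_le_mult_iff)
    qed
    \<comment> \<open>The largest shift that keeps \<open>f + c\<close> below \<open>L * (1 + \<beta> V)\<close>.\<close>
    define c where "c = (INF x. L * (1 + \<beta> * Vs s x) - f x)"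
    have lb: "- f y - L * (1 + \<beta> * Vs s y) \<le> L * (1 + \<beta> * Vs s x) - f x" for x y
      using osc[of x y] by (simp add: abs_le_iff algebra_simps)
    have bdd: "bdd_below (range (\<lambda>x. L * (1 + \<beta> * Vs s x) - f x))"
      by (rule bdd_belowI[where m="- f 0 - L * (1 + \<beta> * Vs s 0)"]) (use lb in auto)
    have c1: "f x + c \<le> L * (1 + \<beta> * Vs s x)" for x
      using cINF_lower[OF bdd, of x] unfolding c_def by simp
    have c2: "- (L * (1 + \<beta> * Vs s y)) \<le> f y + c" for y
      using cINF_greatest[of UNIV "- f y - L * (1 + \<beta> * Vs s y)" "\<lambda>x. L * (1 + \<beta> * Vs s x) - f x"] lb
      unfolding c_def by simp
    define g where "g = (\<lambda>x. f x + c)"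
    have g_abs: "\<bar>g x\<bar> \<le> L * (1 + \<beta> * Vs s x)" for x
      using c1[of x] c2[of x] unfolding g_def by (simp add: abs_le_iff)
    have U: "(\<lambda>x. 1 + \<beta> * Vs s x) \<in> growth s"
      using s by (intro growth_add const_growth growth_cmult Vs_growth) auto
    have LU: "(\<lambda>x. L * (1 + \<beta> * Vs s x)) \<in> growth s" by (rule growth_cmult[OF U])
    have gg: "g \<in> growth s"
    proof -
      obtain D where D: "\<And>x. \<bar>L * (1 + \<beta> * Vs s x)\<bar> \<le> D * Vs s x" using growthE[OF LU] by metis
      have "\<bar>g x\<bar> \<le> D * Vs s x" for x using g_abs[of x] D[of x] by linarith
      then show ?thesis by (intro growthI) (auto simp: g_def)
    qed
    have fg: "f \<in> growth s" using growth_diff[OF gg const_growth[of s c]] s unfolding g_def by simp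
    have tg: "transop g x = transop f x + c" for x
      unfolding g_def using s by (subst transop_add[OF fg const_growth[of s c]]) (auto simp: transop_const)
    have tU: "transop (\<lambda>x. L * (1 + \<beta> * Vs s x)) x \<le> L * (1 + \<beta> * (l * Vs s x + \<kappa>))" for x
    proof -
      have "transop (\<lambda>x. L * (1 + \<beta> * Vs s x)) x = L * (1 + \<beta> * transop (Vs s) x)"
        using s by (simp add: transop_cmult transop_add[OF const_growth[of s 1] growth_cmult[OF Vs_growth]] transop_const)
      then show ?thesis using dr(4)[of x] L0 \<beta> by (simp add: mult_left_mono)
    qed
    have tg_abs: "\<bar>transop g x\<bar> \<le> L * (1 + \<beta> * (l * Vs s x + \<kappa>))" for x
    proof -
      have "transop g x \<le> transop (\<lambda>x. L * (1 + \<beta> * Vs s x)) x"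
        using g_abs s by (intro transop_mono[OF gg LU]) (auto simp: abs_le_iff)
      moreover have "transop (\<lambda>x. (-1) * g x) x \<le> transop (\<lambda>x. L * (1 + \<beta> * Vs s x)) x"
        using g_abs s by (intro transop_mono[OF growth_cmult[OF gg] LU]) (auto simp: abs_le_iff minus_le_iff)
      ultimately show ?thesis using tU[of x] by (simp add: transop_cmult[of "-1", simplified] abs_le_iff)
    qed
    have goal: "\<bar>transop f x - transop f y\<bar> = \<bar>transop g x - transop g y\<bar>" using tg by simp
    show ?thesis
    proof (cases "T \<le> Vs s x + Vs s y")
      case True
      let ?S = "Vs s x + Vs s y"
      have "\<bar>transop g x - transop g y\<bar> \<le> L * (1 + \<beta> * (l * Vs s x + \<kappa>)) + L * (1 + \<beta> * (l * Vs s y + \<kappa>))"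
        using tg_abs[of x] tg_abs[of y] by linarith
      also have "\<dots> = L * (2 + \<beta> * (l * ?S + 2 * \<kappa>))" by (simp add: algebra_simps)
      also have "\<dots> \<le> L * (2 + \<beta> * (l' * ?S))"
      proof -
        have "(1 - l) / 2 * T \<le> (1 - l) / 2 * ?S" using True dr by (intro mult_left_mono) auto
        moreover have "(1 - l) / 2 * T = 2 * \<kappa>" unfolding T_def using dr by simp
        ultimately have "l * ?S + 2 * \<kappa> \<le> l' * ?S" unfolding l'_def by (simp add: field_simps)
        then show ?thesis using L0 \<beta> by (intro mult_left_mono add_left_mono) auto
      qed
      also have "\<dots> \<le> L * (a * (2 + \<beta> * ?S))"
      proof (rule mult_left_mono[OF _ L0])
        have "0 \<le> 2 * \<beta> * (1 - l') * (?S - T)" using \<beta> l' True by (intro mult_nonneg_nonneg) auto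
        then have "(2 + \<beta> * (l' * ?S)) * (2 + \<beta> * T) \<le> (2 + \<beta> * l' * T) * (2 + \<beta> * ?S)"
          by (simp add: algebra_simps)
        moreover have "0 < 2 + \<beta> * T" using \<beta> T by (simp add: add_pos_pos)
        ultimately have "2 + \<beta> * (l' * ?S) \<le> a1 * (2 + \<beta> * ?S)"
          unfolding a1_def by (simp add: pos_le_divide_eq)
        also have "\<dots> \<le> a * (2 + \<beta> * ?S)" using a \<beta> by (intro mult_right_mono) auto
        finally show "2 + \<beta> * (l' * ?S) \<le> a * (2 + \<beta> * ?S)" .
      qed
      finally show ?thesis using goal by (simp add: algebra_simps)
    next
      case False
      then have xR: "norm x \<le> R" "norm y \<le> R"
        using R[of x] R[of y] Vs_nonneg[of x s] Vs_nonneg[of y s] by linarith+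
      define I where "I = (\<integral>z. m * indicator B z * g z \<partial>lborel)"
      have est: "\<bar>transop g w - I\<bar> \<le> L * (1 + \<beta> * (l * Vs s w + \<kappa>) - \<alpha>)" if w: "norm w \<le> R" for w
      proof -
        have mk: "m * indicator B z \<le> k w z" for z
          using m(2)[OF w, of z] unfolding B_def by (auto simp: indicator_def)
        have iI: "integrable lborel (\<lambda>z. m * indicator B z * h z)" if h: "h \<in> growth s" for h
        proof (rule Bochner_Integration.integrable_bound[OF growth_integrable_k[OF h, of w]])
          show "AE z in lborel. norm (m * indicator B z * h z) \<le> norm (k w z * h z)"
            using mk m by (auto simp: abs_mult intro!: mult_right_mono)
        qed (use s growth_meas[OF h] in auto)
        have ik: "integrable lborel (\<lambda>z. k w z * h z)" if h: "h \<in> growth s" for h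
          using growth_integrable_k[OF h, of w] s by simp
        have eq: "transop h w - (\<integral>z. m * indicator B z * h z \<partial>lborel)
            = (\<integral>z. (k w z - m * indicator B z) * h z \<partial>lborel) + (1 - acc w) * h w" if h: "h \<in> growth s" for h
          unfolding transop_def jump_def by (simp add: left_diff_distrib iI[OF h] ik[OF h])
        have iD: "integrable lborel (\<lambda>z. (k w z - m * indicator B z) * h z)" if h: "h \<in> growth s" for h
          by (simp add: left_diff_distrib iI[OF h] ik[OF h])
        have e1: "\<bar>transop g w - I\<bar> \<le> \<bar>\<integral>z. (k w z - m * indicator B z) * g z \<partial>lborel\<bar> + \<bar>(1 - acc w) * g w\<bar>"
          unfolding I_def eq[OF gg] by (rule abs_triangle_ineq)
        have e2: "\<bar>\<integral>z. (k w z - m * indicator B z) * g z \<partial>lborel\<bar>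
            \<le> (\<integral>z. \<bar>(k w z - m * indicator B z) * g z\<bar> \<partial>lborel)" by (rule integral_abs_bound)
        have e3: "(\<integral>z. \<bar>(k w z - m * indicator B z) * g z\<bar> \<partial>lborel) \<le> (\<integral>z. (k w z - m * indicator B z) * (L * (1 + \<beta> * Vs s z)) \<partial>lborel)"
        proof (rule integral_mono[OF integrable_abs[OF iD[OF gg]] iD[OF LU]])
          fix z
          show "\<bar>(k w z - m * indicator B z) * g z\<bar> \<le> (k w z - m * indicator B z) * (L * (1 + \<beta> * Vs s z))"
            using mk[of z] g_abs[of z] unfolding abs_mult by (intro mult_mono) auto
        qed
        have e4: "\<bar>(1 - acc w) * g w\<bar> \<le> (1 - acc w) * (L * (1 + \<beta> * Vs s w))"
          using acc_le_1[of w] g_abs[of w] unfolding abs_mult by (intro mult_mono) auto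
        have e5: "(\<integral>z. (k w z - m * indicator B z) * (L * (1 + \<beta> * Vs s z)) \<partial>lborel) + (1 - acc w) * (L * (1 + \<beta> * Vs s w))
            = transop (\<lambda>x. L * (1 + \<beta> * Vs s x)) w - (\<integral>z. m * indicator B z * (L * (1 + \<beta> * Vs s z)) \<partial>lborel)"
          using eq[OF LU] by simp
        have e6: "(\<integral>z. m * indicator B z * (L * (1 + \<beta> * Vs s z)) \<partial>lborel) \<ge> (\<integral>z. m * L * indicator B z \<partial>lborel)"
        proof (rule integral_mono[OF _ iI[OF LU]])
          show "integrable lborel (\<lambda>z. m * L * indicator B z)"
            using Bfin by (intro integrable_mult_right integrable_real_indicator) auto
          show "m * L * indicator B z \<le> m * indicator B z * (L * (1 + \<beta> * Vs s z))" for z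
          proof -
            have "L * 1 \<le> L * (1 + \<beta> * Vs s z)" using L0 \<beta> by (intro mult_left_mono) auto
            from mult_left_mono[OF this less_imp_le[OF m(1)]] show ?thesis
              by (cases "z \<in> B") (simp_all only: indicator_simps mult_1_right mult.assoc mult_zero_right mult_1_left mult_zero_left order_refl simp_thms)
          qed
        qed
        have e7: "(\<integral>z. m * L * indicator B z \<partial>lborel) = L * \<alpha>" using Bfin unfolding \<alpha>_def by simp
        have "\<bar>transop g w - I\<bar> \<le> L * (1 + \<beta> * (l * Vs s w + \<kappa>)) - L * \<alpha>"
          using e1 e2 e3 e4 e5 e6 e7 tU[of w] by linarith
        then show ?thesis by (simp add: algebra_simps)
      qed
      let ?S = "Vs s x + Vs s y"
      have "\<bar>transop g x - transop g y\<bar> \<le> L * (1 + \<beta> * (l * Vs s x + \<kappa>) - \<alpha>) + L * (1 + \<beta> * (l * Vs s y + \<kappa>) - \<alpha>)"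
        using est[OF xR(1)] est[OF xR(2)] by linarith
      also have "\<dots> = L * (2 * (1 - \<alpha> / 2) + l * (\<beta> * ?S))"
        using \<beta>(2) by (simp add: algebra_simps)
      also have "\<dots> \<le> L * (2 * a + a * (\<beta> * ?S))"
        using a \<beta> L0 by (intro mult_left_mono add_mono mult_right_mono) auto
      finally show ?thesis using goal by (simp add: algebra_simps)
    qed
  qed
  then show ?thesis using \<beta> a by (intro exI[of _ \<beta>] exI[of _ a]) blast
qed

section \<open>Reversibility and the spectral gap\<close>

abbreviation mean :: "('a \<Rightarrow> real) \<Rightarrow> real" where
  "mean f \<equiv> (\<integral>x. f x * \<pi> x \<partial>lborel)"

text \<open>Reversibility is the symmetry of \<open>\<pi> x * k x y\<close>; the growth condition on the product of \<open>f\<close> and \<open>g\<close>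
  justifies the exchange of the integrals.\<close>

lemma mean_jump_sym:
  assumes f: "f \<in> growth s" and g: "g \<in> growth t" and st: "0 \<le> s" "0 \<le> t" "s + t < 1"
  shows "mean (\<lambda>x. f x * jump g x) = mean (\<lambda>x. jump f x * g x)"
proof -
  have [measurable]: "f \<in> borel_measurable borel" "g \<in> borel_measurable borel"
    using f g by (auto intro: growth_meas)
  define h where "h x y = \<pi> x * k x y * f x * g y" for x y
  have [measurable]: "case_prod h \<in> borel_measurable (borel \<Otimes>\<^sub>M borel)"
    unfolding h_def[abs_def] by measurable
  have ag: "(\<lambda>x. \<bar>g x\<bar>) \<in> growth t" "(\<lambda>x. \<bar>f x\<bar>) \<in> growth s" using f g by (auto intro: growth_abs)
  have int: "integrable (lborel \<Otimes>\<^sub>M lborel) (case_prod h)"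
  proof (rule lborel_pair.Fubini_integrable)
    have "(\<integral>y. norm (case_prod h (x, y)) \<partial>lborel) = \<bar>f x\<bar> * jump (\<lambda>x. \<bar>g x\<bar>) x * \<pi> x" for x
    proof -
      have "(\<integral>y. norm (case_prod h (x, y)) \<partial>lborel) = (\<integral>y. (\<bar>f x\<bar> * \<pi> x) * (k x y * \<bar>g y\<bar>) \<partial>lborel)"
        by (intro Bochner_Integration.integral_cong) (auto simp: h_def abs_mult mult_ac)
      then show ?thesis unfolding jump_def by simp
    qed
    moreover have "integrable lborel (\<lambda>x. \<bar>f x\<bar> * jump (\<lambda>x. \<bar>g x\<bar>) x * \<pi> x)"
      using st by (intro growth_integrable[OF growth_mult[OF ag(2) jump_growth[OF ag(1)]]]) auto
    ultimately show "integrable lborel (\<lambda>x. \<integral>y. norm (case_prod h (x, y)) \<partial>lborel)" by simp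
    have "integrable lborel (\<lambda>y. (\<pi> x * f x) * (k x y * g y))" for x
      using growth_integrable_k[OF g, of x] st by (intro integrable_mult_right) auto
    then show "AE x in lborel. integrable lborel (\<lambda>y. case_prod h (x, y))"
      by (simp add: h_def mult_ac)
  qed simp
  have "mean (\<lambda>x. f x * jump g x) = (\<integral>x. (\<integral>y. h x y \<partial>lborel) \<partial>lborel)"
  proof (rule Bochner_Integration.integral_cong[OF refl])
    fix x
    have "(\<integral>y. h x y \<partial>lborel) = (\<integral>y. (\<pi> x * f x) * (k x y * g y) \<partial>lborel)"
      by (intro Bochner_Integration.integral_cong) (auto simp: h_def mult_ac)
    then show "f x * jump g x * \<pi> x = (\<integral>y. h x y \<partial>lborel)" unfolding jump_def by simp
  qed
  also have "\<dots> = (\<integral>y. (\<integral>x. h x y \<partial>lborel) \<partial>lborel)"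
    by (rule lborel_pair.Fubini_integral[OF int, symmetric])
  also have "\<dots> = mean (\<lambda>x. jump f x * g x)"
  proof (rule Bochner_Integration.integral_cong[OF refl])
    fix y
    have "(\<integral>x. h x y \<partial>lborel) = (\<integral>x. (\<pi> y * g y) * (k y x * f x) \<partial>lborel)"
    proof (intro Bochner_Integration.integral_cong refl)
      fix x
      have "h x y = (\<pi> x * k x y) * f x * g y" by (simp add: h_def)
      also have "\<pi> x * k x y = \<pi> y * k y x" by (rule k_reversible)
      finally show "h x y = (\<pi> y * g y) * (k y x * f x)" by (simp only: mult_ac)
    qed
    then show "(\<integral>x. h x y \<partial>lborel) = jump f y * g y * \<pi> y" unfolding jump_def by simp
  qed
  finally show ?thesis .
qed

lemma acc_growth: "acc \<in> growth 0"
  using acc_nonneg acc_le_1 by (intro growthI[where B=1]) (auto simp: abs_le_iff order_trans[OF _ acc_nonneg])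

lemma mean_transop_sym:
  assumes f: "f \<in> growth s" and g: "g \<in> growth t" and st: "0 \<le> s" "0 \<le> t" "s + t < 1"
  shows "mean (\<lambda>x. f x * transop g x) = mean (\<lambda>x. transop f x * g x)"
proof -
  have acc': "(\<lambda>x. 1 - acc x) \<in> growth 0" using growth_diff[OF one_growth[of 1] acc_growth] .
  have fg: "(\<lambda>x. (1 - acc x) * (f x * g x)) \<in> growth (s + t)"
    using growth_mult[OF acc' growth_mult[OF f g]] by simp
  have i: "integrable lborel (\<lambda>x. (1 - acc x) * (f x * g x) * \<pi> x)"
    by (rule growth_integrable[OF fg st(3)])
  have i1: "integrable lborel (\<lambda>x. f x * jump g x * \<pi> x)"
    using st by (intro growth_integrable[OF growth_mult[OF f jump_growth[OF g]]]) auto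
  have i2: "integrable lborel (\<lambda>x. jump f x * g x * \<pi> x)"
    using st by (intro growth_integrable[OF growth_mult[OF jump_growth[OF f] g]]) auto
  have "mean (\<lambda>x. f x * transop g x) = (\<integral>x. f x * jump g x * \<pi> x + (1 - acc x) * (f x * g x) * \<pi> x \<partial>lborel)"
    unfolding transop_def by (intro Bochner_Integration.integral_cong) (auto simp: algebra_simps)
  also have "\<dots> = (\<integral>x. jump f x * g x * \<pi> x + (1 - acc x) * (f x * g x) * \<pi> x \<partial>lborel)"
    using i i1 i2 mean_jump_sym[OF assms] by simp
  also have "\<dots> = mean (\<lambda>x. transop f x * g x)"
    unfolding transop_def by (intro Bochner_Integration.integral_cong) (auto simp: algebra_simps)
  finally show ?thesis .
qed

lemma mean_transop:
  assumes f: "f \<in> growth s" and st: "0 \<le> s" "s < 1"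
  shows "mean (transop f) = mean f"
proof -
  have "mean (\<lambda>x. 1 * transop f x) = mean (\<lambda>x. transop (\<lambda>_. 1) x * f x)"
    using st by (intro mean_transop_sym[OF one_growth f]) auto
  then show ?thesis by (simp add: transop_const)
qed

lemma mean_const: "mean (\<lambda>_. c) = c" by (simp add: pi_mass)

lemma mean_add: "f \<in> growth s \<Longrightarrow> g \<in> growth s \<Longrightarrow> s < 1 \<Longrightarrow> mean (\<lambda>x. f x + g x) = mean f + mean g"
  by (simp add: distrib_right growth_integrable)

lemma mean_diff: "f \<in> growth s \<Longrightarrow> g \<in> growth s \<Longrightarrow> s < 1 \<Longrightarrow> mean (\<lambda>x. f x - g x) = mean f - mean g"
  by (simp add: left_diff_distrib growth_integrable)

lemma mean_mono: "f \<in> growth s \<Longrightarrow> g \<in> growth s \<Longrightarrow> s < 1 \<Longrightarrow> (\<And>x. f x \<le> g x) \<Longrightarrow> mean f \<le> mean g"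
  by (intro integral_mono growth_integrable) (auto intro: mult_right_mono)

lemma mean_nonneg: "(\<And>x. 0 \<le> f x) \<Longrightarrow> 0 \<le> mean f"
  by (intro integral_nonneg_AE) auto

lemma growth_power2: "f \<in> growth s \<Longrightarrow> (\<lambda>x. (f x)\<^sup>2) \<in> growth (2 * s)"
  using growth_mult[of f s f s] by (simp add: power2_eq_square)

lemma mean_cauchy_schwarz:
  assumes f: "f \<in> growth s" and g: "g \<in> growth s" and s: "2 * s < 1"
  shows "(mean (\<lambda>x. f x * g x))\<^sup>2 \<le> mean (\<lambda>x. (f x)\<^sup>2) * mean (\<lambda>x. (g x)\<^sup>2)"
proof (rule cauchy_schwarz_from_quadratic)
  have fg: "(\<lambda>x. f x * g x) \<in> growth (2 * s)" using growth_mult[OF f g] by simp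
  have i: "integrable lborel (\<lambda>x. (f x)\<^sup>2 * \<pi> x)" "integrable lborel (\<lambda>x. (g x)\<^sup>2 * \<pi> x)"
    "integrable lborel (\<lambda>x. f x * g x * \<pi> x)"
    using s by (auto intro!: growth_integrable growth_power2 f g fg)
  fix t :: real
  have "0 \<le> mean (\<lambda>x. (f x - t * g x)\<^sup>2)" by (rule mean_nonneg) simp
  also have "\<dots> = (\<integral>x. (f x)\<^sup>2 * \<pi> x - 2 * t * (f x * g x * \<pi> x) + t\<^sup>2 * ((g x)\<^sup>2 * \<pi> x) \<partial>lborel)"
    by (intro Bochner_Integration.integral_cong) (auto simp: power2_eq_square algebra_simps)
  also have "\<dots> = mean (\<lambda>x. (f x)\<^sup>2) - 2 * t * mean (\<lambda>x. f x * g x) + t\<^sup>2 * mean (\<lambda>x. (g x)\<^sup>2)"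
    using i by simp
  finally show "0 \<le> mean (\<lambda>x. (f x)\<^sup>2) - 2 * t * mean (\<lambda>x. f x * g x) + t\<^sup>2 * mean (\<lambda>x. (g x)\<^sup>2)" .
qed (rule mean_nonneg, simp)

lemma iterate_growth:
  assumes "f \<in> growth s" "0 \<le> s" "s \<le> 1"
  shows "(transop ^^ m) f \<in> growth s"
  by (induction m) (auto intro: assms transop_growth)

lemma mean_iterate:
  assumes "f \<in> growth s" "0 \<le> s" "s < 1"
  shows "mean ((transop ^^ m) f) = mean f"
  by (induction m) (use assms in \<open>auto simp: mean_transop[OF iterate_growth]\<close>)

text \<open>A function of mean zero is the average of its own increments.\<close>

lemma osc_to_abs:
  assumes g: "g \<in> growth s" and s: "0 \<le> s" "s < 1" and mg: "mean g = 0"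
    and osc: "\<And>x y. \<bar>g x - g y\<bar> \<le> c * (2 + \<beta> * Vs s x + \<beta> * Vs s y)"
  shows "\<bar>g x\<bar> \<le> c * (2 + \<beta> * Vs s x + \<beta> * mean (Vs s))"
proof -
  have ig: "integrable lborel (\<lambda>y. g y * \<pi> y)" by (rule growth_integrable[OF g s(2)])
  have iV: "integrable lborel (\<lambda>y. Vs s y * \<pi> y)" by (rule growth_integrable[OF Vs_growth s(2)])
  have "g x = g x * mean (\<lambda>_. 1) - mean g" using mean_const[of 1] mg by simp
  also have "\<dots> = (\<integral>y. (g x - g y) * \<pi> y \<partial>lborel)"
    using ig pi_integrable by (simp add: left_diff_distrib)
  finally have "\<bar>g x\<bar> = \<bar>\<integral>y. (g x - g y) * \<pi> y \<partial>lborel\<bar>" by simp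
  also have "\<dots> \<le> (\<integral>y. \<bar>(g x - g y) * \<pi> y\<bar> \<partial>lborel)" by (rule integral_abs_bound)
  also have "\<dots> \<le> (\<integral>y. (c * (2 + \<beta> * Vs s x)) * \<pi> y + c * \<beta> * (Vs s y * \<pi> y) \<partial>lborel)"
  proof (rule integral_mono)
    show "integrable lborel (\<lambda>y. \<bar>(g x - g y) * \<pi> y\<bar>)"
      using ig pi_integrable by (intro integrable_abs) (simp add: left_diff_distrib)
    show "integrable lborel (\<lambda>y. (c * (2 + \<beta> * Vs s x)) * \<pi> y + c * \<beta> * (Vs s y * \<pi> y))"
      using iV pi_integrable by simp
    fix y
    have "\<bar>(g x - g y) * \<pi> y\<bar> \<le> (c * (2 + \<beta> * Vs s x + \<beta> * Vs s y)) * \<pi> y"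
      unfolding abs_mult using osc[of x y] by (simp add: mult_right_mono)
    then show "\<bar>(g x - g y) * \<pi> y\<bar> \<le> (c * (2 + \<beta> * Vs s x)) * \<pi> y + c * \<beta> * (Vs s y * \<pi> y)"
      by (simp add: algebra_simps)
  qed
  also have "\<dots> = c * (2 + \<beta> * Vs s x + \<beta> * mean (Vs s))"
    using iV pi_integrable pi_mass by (simp add: algebra_simps)
  finally show ?thesis .
qed

lemma geometric_ergodicity:
  assumes s: "0 < s" "s < 1"
  shows "\<exists>a. 0 < a \<and> a < 1 \<and> (\<forall>f\<in>growth s. mean f = 0 \<longrightarrow> (\<exists>C\<ge>0. \<forall>m x. \<bar>(transop ^^ m) f x\<bar> \<le> C * a ^ m * Vs s x))"
proof -
  obtain \<beta> a where ba: "0 < \<beta>" "0 < a" "a < 1" and contr: "\<And>f L x y. f \<in> borel_measurable borel \<Longrightarrow>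
    (\<And>x y. \<bar>f x - f y\<bar> \<le> L * (2 + \<beta> * Vs s x + \<beta> * Vs s y)) \<Longrightarrow>
    \<bar>transop f x - transop f y\<bar> \<le> a * L * (2 + \<beta> * Vs s x + \<beta> * Vs s y)"
    using oscillation_contraction[OF s] by blast
  have "\<exists>C\<ge>0. \<forall>m x. \<bar>(transop ^^ m) f x\<bar> \<le> C * a ^ m * Vs s x" if f: "f \<in> growth s" and mf: "mean f = 0" for f
  proof -
    obtain B where B: "0 \<le> B" "\<And>x. \<bar>f x\<bar> \<le> B * Vs s x" using growthE[OF f] by metis
    have osc: "\<bar>(transop ^^ m) f x - (transop ^^ m) f y\<bar> \<le> a ^ m * (B / \<beta>) * (2 + \<beta> * Vs s x + \<beta> * Vs s y)" for m x y
    proof (induction m arbitrary: x y)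
      case 0
      have "\<bar>f x - f y\<bar> \<le> B * Vs s x + B * Vs s y" using B(2)[of x] B(2)[of y] by linarith
      also have "\<dots> \<le> (B / \<beta>) * (2 + \<beta> * Vs s x + \<beta> * Vs s y)" using B ba by (simp add: field_simps)
      finally show ?case by simp
    next
      case (Suc m)
      show ?case
        using contr[OF growth_meas[OF iterate_growth[OF f, of m]] Suc.IH, of x y] s by (simp add: mult_ac)
    qed
    obtain D where D: "0 \<le> D" "\<And>x. \<bar>2 + \<beta> * mean (Vs s)\<bar> \<le> D * Vs s x"
      using growthE[OF const_growth[of s "2 + \<beta> * mean (Vs s)"]] s by (metis less_imp_le)
    have "\<bar>(transop ^^ m) f x\<bar> \<le> (B / \<beta> * (D + \<beta>)) * a ^ m * Vs s x" for m x
    proof -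
      have "\<bar>(transop ^^ m) f x\<bar> \<le> (a ^ m * (B / \<beta>)) * (2 + \<beta> * Vs s x + \<beta> * mean (Vs s))"
        using s mf by (intro osc_to_abs osc iterate_growth f) (auto simp: mean_iterate[OF f])
      also have "\<dots> \<le> (a ^ m * (B / \<beta>)) * ((D + \<beta>) * Vs s x)"
        using D(2)[of x] B ba by (intro mult_left_mono) (auto simp: algebra_simps)
      finally show ?thesis by (simp add: mult_ac)
    qed
    then show ?thesis using B D ba by (intro exI[of _ "B / \<beta> * (D + \<beta>)"]) auto
  qed
  then show ?thesis using ba by blast
qed

text \<open>The \<open>L\<^sup>2\<close> gap costs nothing beyond the pointwise decay: reversibility makes
  \<open>m \<mapsto> mean (((transop ^^ m) f)\<^sup>2)\<close> log-convex.\<close>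

lemma spectral_gap:
  assumes s: "0 < s" "2 * s < 1"
  shows "\<exists>\<rho>. 0 < \<rho> \<and> \<rho> < 1 \<and> (\<forall>f\<in>growth s. mean f = 0 \<longrightarrow> mean (\<lambda>x. (transop f x)\<^sup>2) \<le> \<rho>\<^sup>2 * mean (\<lambda>x. (f x)\<^sup>2))"
proof -
  obtain a where a: "0 < a" "a < 1" and erg: "\<And>f. f \<in> growth s \<Longrightarrow> mean f = 0 \<Longrightarrow>
      \<exists>C\<ge>0. \<forall>m x. \<bar>(transop ^^ m) f x\<bar> \<le> C * a ^ m * Vs s x"
    using geometric_ergodicity[of s] s by (auto; blast)
  have "mean (\<lambda>x. (transop f x)\<^sup>2) \<le> a\<^sup>2 * mean (\<lambda>x. (f x)\<^sup>2)" if f: "f \<in> growth s" and mf: "mean f = 0" for f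
  proof -
    obtain C where C: "0 \<le> C" "\<And>m x. \<bar>(transop ^^ m) f x\<bar> \<le> C * a ^ m * Vs s x" using erg[OF f mf] by blast
    define b where "b m = mean (\<lambda>x. ((transop ^^ m) f x)\<^sup>2)" for m
    have g: "(transop ^^ m) f \<in> growth s" for m using iterate_growth[OF f] s by simp
    have "b 1 \<le> a\<^sup>2 * b 0"
    proof (rule log_convex_first_ratio)
      show "0 \<le> b m" for m unfolding b_def by (rule mean_nonneg) simp
      show "(b (Suc m))\<^sup>2 \<le> b m * b (Suc (Suc m))" for m
      proof -
        have "mean (\<lambda>x. (transop ^^ m) f x * transop ((transop ^^ Suc m) f) x) =
            mean (\<lambda>x. transop ((transop ^^ m) f) x * (transop ^^ Suc m) f x)"
          using s by (intro mean_transop_sym[OF g g]) auto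
        then have "b (Suc m) = mean (\<lambda>x. (transop ^^ m) f x * (transop ^^ Suc (Suc m)) f x)"
          unfolding b_def by (simp add: power2_eq_square)
        then show ?thesis unfolding b_def using mean_cauchy_schwarz[OF g g s(2), of m "Suc (Suc m)"] by simp
      qed
      show "b m \<le> (C\<^sup>2 * mean (Vs (2 * s))) * (a\<^sup>2) ^ m" for m
      proof -
        have "((transop ^^ m) f x)\<^sup>2 \<le> (C\<^sup>2 * (a\<^sup>2) ^ m) * Vs (2 * s) x" for x
        proof -
          have "\<bar>(transop ^^ m) f x\<bar>\<^sup>2 \<le> (C * a ^ m * Vs s x)\<^sup>2" by (intro power_mono C) auto
          moreover have "(Vs s x)\<^sup>2 = Vs (2 * s) x" by (simp add: powr_add[symmetric] power2_eq_square)
          moreover have "(a ^ m)\<^sup>2 = (a\<^sup>2) ^ m" by (simp add: power_mult[symmetric] mult.commute)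
          ultimately show ?thesis by (simp add: power_mult_distrib)
        qed
        then have "b m \<le> mean (\<lambda>x. (C\<^sup>2 * (a\<^sup>2) ^ m) * Vs (2 * s) x)"
          unfolding b_def by (intro mean_mono[OF growth_power2[OF g] growth_cmult[OF Vs_growth] s(2)])
        then show ?thesis by (simp add: mult.assoc mult.commute[of "mean (Vs (2 * s))"])
      qed
    qed (use a in auto)
    then show ?thesis unfolding b_def by simp
  qed
  then show ?thesis using a by blast
qed

section \<open>The Poisson equation\<close>

lemma transop_limit:
  assumes S: "\<And>n. S n \<in> borel_measurable borel" and B: "\<And>n x. \<bar>S n x\<bar> \<le> B * Vs s x" and s: "0 \<le> s" "s \<le> 1"
    and lim: "\<And>x. (\<lambda>n. S n x) \<longlonglongrightarrow> u x"
  shows "u \<in> growth s" "(\<lambda>n. transop (S n) x) \<longlonglongrightarrow> transop u x"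
proof -
  have um: "u \<in> borel_measurable borel" by (rule borel_measurable_LIMSEQ_real[OF lim S])
  have uB: "\<bar>u x\<bar> \<le> B * Vs s x" for x
    by (rule LIMSEQ_le_const2[OF tendsto_rabs[OF lim]]) (use B in auto)
  show u: "u \<in> growth s" using um uB by (rule growthI)
  have "(\<lambda>n. \<integral>y. k x y * S n y \<partial>lborel) \<longlonglongrightarrow> (\<integral>y. k x y * u y \<partial>lborel)"
  proof (rule integral_dominated_convergence[where w="\<lambda>y. B * (k x y * Vs s y)"])
    show "integrable lborel (\<lambda>y. B * (k x y * Vs s y))"
      using growth_integrable_k[OF Vs_growth, of s x] s by simp
    show "AE y in lborel. norm (k x y * S n y) \<le> B * (k x y * Vs s y)" for n
      using mult_left_mono[OF B k_nonneg] by (auto simp: abs_mult mult.left_commute)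
    show "AE y in lborel. (\<lambda>n. k x y * S n y) \<longlonglongrightarrow> k x y * u y"
      by (intro AE_I2 tendsto_mult tendsto_const lim)
  qed (use S um in measurable)
  then show "(\<lambda>n. transop (S n) x) \<longlonglongrightarrow> transop u x"
    unfolding transop_def jump_def by (intro tendsto_add tendsto_mult tendsto_const lim)
qed

text \<open>The partial sums \<open>S\<close> of the Neumann series are part of the conclusion, because the regularity of \<open>u\<close>
  is proved for them by induction and then passes to the limit.\<close>

lemma poisson_equation:
  assumes s: "0 < s" "s < 1" and f: "f \<in> growth s" and mf: "mean f = 0"
  obtains u S B where "u \<in> growth s" "\<And>x. u x - transop u x = f x"
    "\<And>x. S 0 x = 0" "\<And>n x. S (Suc n) x = f x + transop (S n) x" "\<And>n. S n \<in> growth s"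
    "\<And>n x. \<bar>S n x\<bar> \<le> B * Vs s x" "\<And>x. (\<lambda>n. S n x) \<longlonglongrightarrow> u x"
proof -
  obtain a where a: "0 < a" "a < 1" and erg: "\<And>f. f \<in> growth s \<Longrightarrow> mean f = 0 \<Longrightarrow>
      \<exists>C\<ge>0. \<forall>m x. \<bar>(transop ^^ m) f x\<bar> \<le> C * a ^ m * Vs s x"
    using geometric_ergodicity[of s] s by (auto; blast)
  obtain C where C: "0 \<le> C" "\<And>m x. \<bar>(transop ^^ m) f x\<bar> \<le> C * a ^ m * Vs s x" using erg[OF f mf] by blast
  define S where "S n x = (\<Sum>m<n. (transop ^^ m) f x)" for n x
  define u where "u x = (\<Sum>m. (transop ^^ m) f x)" for x
  have sm: "summable (\<lambda>m. C * a ^ m * Vs s x)" for x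
    using a by (intro summable_mult2 summable_mult summable_geometric) auto
  have sum: "summable (\<lambda>m. (transop ^^ m) f x)" for x
    by (rule summable_comparison_test'[OF sm[of x], of 0]) (use C in auto)
  have S0: "S 0 x = 0" for x by (simp add: S_def)
  have Sg: "S n \<in> growth s" for n
  proof (induction n)
    case 0 then show ?case using const_growth[of s 0] s unfolding S_def by simp
  next
    case (Suc n)
    have "S (Suc n) = (\<lambda>x. S n x + (transop ^^ n) f x)" by (auto simp: S_def)
    then show ?case using growth_add[OF Suc iterate_growth[OF f]] s by simp
  qed
  have SS: "S (Suc n) x = f x + transop (S n) x" for n x
  proof (induction n arbitrary: x)
    case 0
    have "S 0 = (\<lambda>_. 0)" by (auto simp: S_def)
    then show ?case by (simp add: S_def transop_const)
  next
    case (Suc n)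
    have "S (Suc n) = (\<lambda>x. S n x + (transop ^^ n) f x)" by (auto simp: S_def)
    then have "transop (S (Suc n)) x = transop (S n) x + (transop ^^ Suc n) f x"
      using transop_add[OF Sg[of n] iterate_growth[OF f, of n], of x] s by simp
    moreover have "S (Suc (Suc n)) x = S (Suc n) x + (transop ^^ Suc n) f x" by (simp add: S_def)
    ultimately show ?case using Suc.IH[of x] by simp
  qed
  have SB: "\<bar>S n x\<bar> \<le> (C / (1 - a)) * Vs s x" for n x
  proof -
    have "\<bar>S n x\<bar> \<le> (\<Sum>m<n. C * a ^ m * Vs s x)"
      unfolding S_def by (rule order_trans[OF sum_abs]) (intro sum_mono C)
    also have "\<dots> \<le> (\<Sum>m. C * a ^ m * Vs s x)"
      using C a by (intro sum_le_suminf sm) auto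
    also have "\<dots> = (C / (1 - a)) * Vs s x"
      using a by (simp add: suminf_mult2[symmetric] suminf_mult suminf_geometric summable_geometric summable_mult)
    finally show ?thesis .
  qed
  have lim: "(\<lambda>n. S n x) \<longlonglongrightarrow> u x" for x
    unfolding S_def u_def using summable_LIMSEQ[OF sum[of x]] .
  have u: "u \<in> growth s" "\<And>x. (\<lambda>n. transop (S n) x) \<longlonglongrightarrow> transop u x"
    using transop_limit[of S, OF growth_meas[OF Sg] SB _ _ lim] s by auto
  have eq: "u x - transop u x = f x" for x
  proof -
    have "(\<lambda>n. f x + transop (S n) x) \<longlonglongrightarrow> f x + transop u x" by (intro tendsto_add tendsto_const u)
    moreover have "(\<lambda>n. f x + transop (S n) x) \<longlonglongrightarrow> u x" using LIMSEQ_Suc[OF lim[of x]] by (simp add: SS)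
    ultimately show ?thesis using LIMSEQ_unique by fastforce
  qed
  show ?thesis by (rule that[OF u(1) eq S0 SS Sg SB lim])
qed

end

section \<open>The Markov property for functions\<close>

locale kernel_chain =
  fixes M :: "'w measure" and \<Phi> :: "nat \<Rightarrow> 'w \<Rightarrow> 'a::euclidean_space" and P :: "'a \<Rightarrow> 'a measure"
  assumes chain: "markov_chain M \<Phi> P"
    and kernel[measurable]: "P \<in> borel \<rightarrow>\<^sub>M subprob_algebra borel"
    and prob_P: "\<And>x. prob_space (P x)"
begin

sublocale prob_space M using chain by (simp add: markov_chain_def)

abbreviation past :: "nat \<Rightarrow> 'w measure" where "past \<equiv> past_algebra M \<Phi>"

lemma Phi_meas[measurable]: "\<Phi> n \<in> M \<rightarrow>\<^sub>M borel" using chain by (simp add: markov_chain_def)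

lemma sets_P: "sets (P x) = sets borel"
  using measurable_space[OF kernel, of x] by (auto simp: space_subprob_algebra)

lemma measurable_P_iff: "measurable (P x) N = measurable borel N"
  by (rule measurable_cong_sets[OF sets_P refl])

lemma space_past[simp]: "space (past n) = space M" by (simp add: past_algebra_def)

lemma subalgebra_past: "subalgebra M (past n)"
proof -
  have "(\<lambda>\<omega>. \<lambda>i\<in>{..n}. \<Phi> i \<omega>) \<in> M \<rightarrow>\<^sub>M (\<Pi>\<^sub>M i\<in>{..n}. borel)"
    by (intro measurable_restrict) simp
  then have "{(\<lambda>\<omega>. \<lambda>i\<in>{..n}. \<Phi> i \<omega>) -` A \<inter> space M |A. A \<in> sets (\<Pi>\<^sub>M i\<in>{..n}. borel)} \<subseteq> sets M"
    by (auto intro: measurable_sets)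
  then have "sets (past n) \<subseteq> sets M"
    unfolding past_algebra_def sets_vimage_algebra by (rule sets.sigma_sets_subset)
  then show ?thesis by (simp add: subalgebra_def)
qed

lemma past_meas_M: "f \<in> past n \<rightarrow>\<^sub>M N \<Longrightarrow> f \<in> M \<rightarrow>\<^sub>M N"
  by (rule measurable_from_subalg[OF subalgebra_past])

lemma Phi_past: "i \<le> n \<Longrightarrow> \<Phi> i \<in> past n \<rightarrow>\<^sub>M borel"
proof -
  assume "i \<le> n"
  have "(\<lambda>\<omega>. \<lambda>i\<in>{..n}. \<Phi> i \<omega>) \<in> past n \<rightarrow>\<^sub>M (\<Pi>\<^sub>M i\<in>{..n}. borel)"
    unfolding past_algebra_def by (rule measurable_vimage_algebra1) (auto simp: space_PiM)
  then have "(\<lambda>\<omega>. (\<lambda>i\<in>{..n}. \<Phi> i \<omega>) i) \<in> past n \<rightarrow>\<^sub>M borel"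
    by (rule measurable_compose[OF _ measurable_component_singleton]) (use \<open>i \<le> n\<close> in auto)
  then show ?thesis using \<open>i \<le> n\<close> by simp
qed

lemma nn_P_meas[measurable]:
  assumes [measurable]: "f \<in> borel_measurable borel"
  shows "(\<lambda>x. \<integral>\<^sup>+y. f y \<partial>P x) \<in> borel_measurable borel"
  by (rule measurable_compose[OF kernel]) measurable

lemma integral_P_meas[measurable]:
  fixes f :: "'a \<Rightarrow> 'b::{banach, second_countable_topology}"
  assumes [measurable]: "f \<in> borel_measurable borel"
  shows "(\<lambda>x. \<integral>y. f y \<partial>P x) \<in> borel_measurable borel"
  by (rule measurable_compose[OF kernel]) measurable

lemma markov_sets:
  assumes E: "E \<in> sets (past n)" and A[measurable]: "A \<in> sets borel"
  shows "(\<integral>\<^sup>+\<omega>. indicator E \<omega> * indicator A (\<Phi> (Suc n) \<omega>) \<partial>M) = (\<integral>\<^sup>+\<omega>. indicator E \<omega> * emeasure (P (\<Phi> n \<omega>)) A \<partial>M)"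
proof -
  interpret F: finite_measure_subalgebra M "past n"
    by unfold_locales (rule subalgebra_past)
  have [measurable]: "E \<in> sets M" using E subalgebra_past[of n] by (auto simp: subalgebra_def)
  have Pm: "(\<lambda>x. measure (P x) A) \<in> borel_measurable borel"
    using measurable_compose[OF kernel measurable_measure_subprob_algebra[OF A]] by simp
  have [measurable]: "(\<lambda>\<omega>. measure (P (\<Phi> n \<omega>)) A) \<in> borel_measurable M"
    by (rule measurable_compose[OF Phi_meas Pm])
  have le1: "measure (P x) A \<le> 1" for x using prob_P[of x] by (simp add: prob_space.prob_le_1)
  have int: "integrable M (\<lambda>\<omega>. indicator A (\<Phi> (Suc n) \<omega>) :: real)"
    by (intro integrable_const_bound[where B=1]) (auto simp: indicator_def)
  have "(\<integral>\<omega>\<in>E. indicator A (\<Phi> (Suc n) \<omega>) \<partial>M)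
     = (\<integral>\<omega>\<in>E. real_cond_exp M (past n) (\<lambda>\<omega>. indicator A (\<Phi> (Suc n) \<omega>)) \<omega> \<partial>M)"
    by (rule F.real_cond_exp_intA[OF int E])
  also have "\<dots> = (\<integral>\<omega>\<in>E. measure (P (\<Phi> n \<omega>)) A \<partial>M)"
  proof -
    have "AE \<omega> in M. real_cond_exp M (past n) (\<lambda>\<omega>. indicator A (\<Phi> (Suc n) \<omega>)) \<omega> = measure (P (\<Phi> n \<omega>)) A"
      using chain A by (simp add: markov_chain_def)
    then have "AE \<omega> in M. indicator E \<omega> *\<^sub>R real_cond_exp M (past n) (\<lambda>\<omega>. indicator A (\<Phi> (Suc n) \<omega>)) \<omega>
        = indicator E \<omega> *\<^sub>R measure (P (\<Phi> n \<omega>)) A" by eventually_elim simp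
    then show ?thesis unfolding set_lebesgue_integral_def by (intro integral_cong_AE) auto
  qed
  finally have eq: "(\<integral>\<omega>. indicator E \<omega> * indicator A (\<Phi> (Suc n) \<omega>) \<partial>M) = (\<integral>\<omega>. indicator E \<omega> * measure (P (\<Phi> n \<omega>)) A \<partial>M)"
    by (simp add: set_lebesgue_integral_def)
  have i1: "integrable M (\<lambda>\<omega>. indicator E \<omega> * indicator A (\<Phi> (Suc n) \<omega>) :: real)"
    by (intro integrable_const_bound[where B=1]) (auto simp: indicator_def)
  have i2: "integrable M (\<lambda>\<omega>. indicator E \<omega> * measure (P (\<Phi> n \<omega>)) A :: real)"
    by (intro integrable_const_bound[where B=1]) (auto simp: indicator_def le1)
  have "(\<integral>\<^sup>+\<omega>. ennreal (indicator E \<omega> * indicator A (\<Phi> (Suc n) \<omega>)) \<partial>M) = (\<integral>\<^sup>+\<omega>. ennreal (indicator E \<omega> * measure (P (\<Phi> n \<omega>)) A) \<partial>M)"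
    using eq by (subst (1 2) nn_integral_eq_integral) (auto intro: i1 i2)
  moreover have "emeasure (P x) A = ennreal (measure (P x) A)" for x
    using prob_P[of x] by (simp add: finite_measure.emeasure_eq_measure prob_space.finite_measure)
  ultimately show ?thesis by (simp add: ennreal_mult' ennreal_indicator)
qed

lemma markov_nn:
  assumes Y: "Y \<in> borel_measurable (past n)" and f: "f \<in> borel_measurable borel"
  shows "(\<integral>\<^sup>+\<omega>. Y \<omega> * f (\<Phi> (Suc n) \<omega>) \<partial>M) = (\<integral>\<^sup>+\<omega>. Y \<omega> * (\<integral>\<^sup>+y. f y \<partial>P (\<Phi> n \<omega>)) \<partial>M)"
proof -
  have A: "(\<integral>\<^sup>+\<omega>. Y \<omega> * indicator A (\<Phi> (Suc n) \<omega>) \<partial>M) = (\<integral>\<^sup>+\<omega>. Y \<omega> * emeasure (P (\<Phi> n \<omega>)) A \<partial>M)"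
    if A[measurable]: "A \<in> sets borel" for A
    using Y
  proof (induction rule: borel_measurable_induct)
    case (cong f g)
    then show ?case by (simp cong: nn_integral_cong)
  next
    case (set E)
    then show ?case using markov_sets A by blast
  next
    case (mult u c)
    note [measurable] = past_meas_M[OF mult(2)]
    have "(\<lambda>x. emeasure (P x) A) \<in> borel_measurable borel"
      using measurable_compose[OF kernel measurable_emeasure_subprob_algebra[OF A]] by simp
    then have [measurable]: "(\<lambda>\<omega>. emeasure (P (\<Phi> n \<omega>)) A) \<in> borel_measurable M" by measurable
    show ?case using mult by (simp add: mult.assoc nn_integral_cmult)
  next
    case (add u v)
    note [measurable] = past_meas_M[OF add(1)] past_meas_M[OF add(3)]
    have "(\<lambda>x. emeasure (P x) A) \<in> borel_measurable borel"
      using measurable_compose[OF kernel measurable_emeasure_subprob_algebra[OF A]] by simp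
    then have [measurable]: "(\<lambda>\<omega>. emeasure (P (\<Phi> n \<omega>)) A) \<in> borel_measurable M" by measurable
    show ?case using add by (simp add: distrib_right nn_integral_add)
  next
    case (seq U)
    note [measurable] = past_meas_M[OF seq(1)]
    have "(\<lambda>x. emeasure (P x) A) \<in> borel_measurable borel"
      using measurable_compose[OF kernel measurable_emeasure_subprob_algebra[OF A]] by simp
    then have [measurable]: "(\<lambda>\<omega>. emeasure (P (\<Phi> n \<omega>)) A) \<in> borel_measurable M" by measurable
    have inc: "incseq (\<lambda>i \<omega>. U i \<omega> * g \<omega>)" for g
      using seq(3) by (auto simp: incseq_def le_fun_def intro: mult_right_mono)
    show ?case
      unfolding SUP_apply SUP_mult_right_ennreal
      by (subst (1 2) nn_integral_monotone_convergence_SUP[OF inc]) (use seq in auto)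
  qed
  note [measurable] = past_meas_M[OF Y]
  show ?thesis using f
  proof (induction rule: borel_measurable_induct)
    case (cong f g)
    then have "f = g" by auto
    then show ?case using cong by simp
  next
    case (set B)
    then show ?case using A[of B] by (simp add: nn_integral_indicator sets_P)
  next
    case (mult u c)
    note [measurable] = mult(2)
    show ?case using mult
      by (simp add: mult.left_commute[of _ c] nn_integral_cmult measurable_P_iff)
  next
    case (add u v)
    note [measurable] = add(1) add(3)
    show ?case using add by (simp add: distrib_left nn_integral_add measurable_P_iff)
  next
    case (seq U)
    note [measurable] = seq(1)
    have inc: "incseq (\<lambda>i \<omega>. Y \<omega> * U i (\<Phi> (Suc n) \<omega>))" "incseq (\<lambda>i \<omega>. Y \<omega> * (\<integral>\<^sup>+y. U i y \<partial>P (\<Phi> n \<omega>)))"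
      using seq(3) by (auto simp: incseq_def le_fun_def intro!: mult_left_mono nn_integral_mono)
    have "(\<integral>\<^sup>+\<omega>. Y \<omega> * (SUP i. U i) (\<Phi> (Suc n) \<omega>) \<partial>M) = (SUP i. \<integral>\<^sup>+\<omega>. Y \<omega> * U i (\<Phi> (Suc n) \<omega>) \<partial>M)"
      unfolding SUP_apply SUP_mult_left_ennreal by (rule nn_integral_monotone_convergence_SUP[OF inc(1)]) measurable
    also have "\<dots> = (SUP i. \<integral>\<^sup>+\<omega>. Y \<omega> * (\<integral>\<^sup>+y. U i y \<partial>P (\<Phi> n \<omega>)) \<partial>M)" by (simp add: seq)
    also have "\<dots> = (\<integral>\<^sup>+\<omega>. Y \<omega> * (SUP i. \<integral>\<^sup>+y. U i y \<partial>P (\<Phi> n \<omega>)) \<partial>M)"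
      unfolding SUP_mult_left_ennreal by (rule nn_integral_monotone_convergence_SUP[OF inc(2), symmetric]) measurable
    also have "\<dots> = (\<integral>\<^sup>+\<omega>. Y \<omega> * (\<integral>\<^sup>+y. (SUP i. U i) y \<partial>P (\<Phi> n \<omega>)) \<partial>M)"
      unfolding SUP_apply using seq(3)
      by (subst nn_integral_monotone_convergence_SUP) (auto simp: measurable_P_iff)
    finally show ?case .
  qed
qed

lemma markov_nonneg:
  fixes f :: "'a \<Rightarrow> real"
  assumes Y: "Y \<in> borel_measurable (past n)" "\<And>\<omega>. 0 \<le> Y \<omega>" and f: "f \<in> borel_measurable borel" "\<And>x. 0 \<le> f x"
    and fP: "\<And>x. integrable (P x) f" and fin: "(\<integral>\<^sup>+\<omega>. ennreal (Y \<omega> * f (\<Phi> (Suc n) \<omega>)) \<partial>M) < \<infinity>"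
  shows "integrable M (\<lambda>\<omega>. Y \<omega> * f (\<Phi> (Suc n) \<omega>)) \<and> integrable M (\<lambda>\<omega>. Y \<omega> * (\<integral>y. f y \<partial>P (\<Phi> n \<omega>)))
     \<and> (\<integral>\<omega>. Y \<omega> * f (\<Phi> (Suc n) \<omega>) \<partial>M) = (\<integral>\<omega>. Y \<omega> * (\<integral>y. f y \<partial>P (\<Phi> n \<omega>)) \<partial>M)"
proof -
  note [measurable] = past_meas_M[OF Y(1)] f(1)
  have eP: "(\<integral>\<^sup>+y. ennreal (f y) \<partial>P x) = ennreal (\<integral>y. f y \<partial>P x)" for x
    by (rule nn_integral_eq_integral[OF fP]) (use f in auto)
  have p0: "0 \<le> (\<integral>y. f y \<partial>P x)" for x using f by (intro integral_nonneg_AE) auto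
  have eq: "(\<integral>\<^sup>+\<omega>. ennreal (Y \<omega> * f (\<Phi> (Suc n) \<omega>)) \<partial>M) = (\<integral>\<^sup>+\<omega>. ennreal (Y \<omega> * (\<integral>y. f y \<partial>P (\<Phi> n \<omega>))) \<partial>M)"
    using markov_nn[of "\<lambda>\<omega>. ennreal (Y \<omega>)" n "\<lambda>x. ennreal (f x)"] Y f p0 by (simp add: ennreal_mult eP)
  have 1: "integrable M (\<lambda>\<omega>. Y \<omega> * f (\<Phi> (Suc n) \<omega>))"
    using fin Y f by (intro integrableI_nonneg) auto
  have 2: "integrable M (\<lambda>\<omega>. Y \<omega> * (\<integral>y. f y \<partial>P (\<Phi> n \<omega>)))"
    using fin Y p0 unfolding eq by (intro integrableI_nonneg) auto
  show ?thesis using 1 2 eq Y f p0 by (simp add: integral_eq_nn_integral)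
qed

text \<open>The decomposition \<open>Y = (Y + X) - X\<close> into nonnegative weights, both dominated by \<open>2 X\<close>, reduces the claim
  to nonnegative integrands.\<close>

lemma markov_real:
  fixes f :: "'a \<Rightarrow> real"
  assumes X: "X \<in> borel_measurable (past n)" and Y: "Y \<in> borel_measurable (past n)" "\<And>\<omega>. \<bar>Y \<omega>\<bar> \<le> X \<omega>"
    and f: "f \<in> borel_measurable borel" and fP: "\<And>x. integrable (P x) f"
    and fin: "integrable M (\<lambda>\<omega>. X \<omega> * f (\<Phi> (Suc n) \<omega>))"
  shows "integrable M (\<lambda>\<omega>. Y \<omega> * f (\<Phi> (Suc n) \<omega>)) \<and> integrable M (\<lambda>\<omega>. Y \<omega> * (\<integral>y. f y \<partial>P (\<Phi> n \<omega>)))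
     \<and> (\<integral>\<omega>. Y \<omega> * f (\<Phi> (Suc n) \<omega>) \<partial>M) = (\<integral>\<omega>. Y \<omega> * (\<integral>y. f y \<partial>P (\<Phi> n \<omega>)) \<partial>M)"
proof -
  note [measurable] = f past_meas_M[OF X] past_meas_M[OF Y(1)]
  have X0: "0 \<le> X \<omega>" for \<omega> using Y(2)[of \<omega>] by linarith
  define f1 where "f1 x = max 0 (f x)" for x
  define f2 where "f2 x = max 0 (- f x)" for x
  have [measurable]: "f1 \<in> borel_measurable borel" "f2 \<in> borel_measurable borel"
    unfolding f1_def[abs_def] f2_def[abs_def] by measurable
  have iP: "integrable (P x) f1" "integrable (P x) f2" for x
    unfolding f1_def[abs_def] f2_def[abs_def]
    using fP[of x] by (auto intro!: integrable_max)
  have f12: "f x = f1 x - f2 x" for x by (simp add: f1_def f2_def)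
  define Q where "Q Y g \<longleftrightarrow> integrable M (\<lambda>\<omega>. Y \<omega> * g (\<Phi> (Suc n) \<omega>)) \<and> integrable M (\<lambda>\<omega>. Y \<omega> * (\<integral>y. g y \<partial>P (\<Phi> n \<omega>)))
     \<and> (\<integral>\<omega>. Y \<omega> * g (\<Phi> (Suc n) \<omega>) \<partial>M) = (\<integral>\<omega>. Y \<omega> * (\<integral>y. g y \<partial>P (\<Phi> n \<omega>)) \<partial>M)"
    for Y :: "'w \<Rightarrow> real" and g :: "'a \<Rightarrow> real"
  have Qd: "Q (\<lambda>\<omega>. Y \<omega> - X \<omega>) g" if "Q Y g" "Q X g" for X Y g
    using that unfolding Q_def by (simp add: left_diff_distrib)
  have Qf: "Q Y f" if "Q Y f1" "Q Y f2" for Y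
    using that unfolding Q_def f12 by (simp add: iP right_diff_distrib)
  have QX: "Q Y g" if Y: "Y \<in> borel_measurable (past n)" "\<And>\<omega>. 0 \<le> Y \<omega>" "\<And>\<omega>. Y \<omega> \<le> 2 * X \<omega>"
     and g: "g \<in> borel_measurable borel" "\<And>x. 0 \<le> g x" "\<And>x. g x \<le> \<bar>f x\<bar>" "\<And>x. integrable (P x) g" for Y g
    unfolding Q_def
  proof (rule markov_nonneg[OF Y(1,2) g(1,2,4)])
    note [measurable] = past_meas_M[OF Y(1)] g(1)
    have "integrable M (\<lambda>\<omega>. Y \<omega> * g (\<Phi> (Suc n) \<omega>))"
    proof (rule Bochner_Integration.integrable_bound[OF integrable_mult_right[OF fin, of 2]])
      show "AE \<omega> in M. norm (Y \<omega> * g (\<Phi> (Suc n) \<omega>)) \<le> norm (2 * (X \<omega> * f (\<Phi> (Suc n) \<omega>)))"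
      proof (rule AE_I2)
        fix \<omega>
        have "Y \<omega> * g (\<Phi> (Suc n) \<omega>) \<le> (2 * X \<omega>) * \<bar>f (\<Phi> (Suc n) \<omega>)\<bar>"
          using Y g X0 by (intro mult_mono) auto
        then show "norm (Y \<omega> * g (\<Phi> (Suc n) \<omega>)) \<le> norm (2 * (X \<omega> * f (\<Phi> (Suc n) \<omega>)))"
          using Y g X0 by (simp add: abs_mult)
      qed
    qed simp
    then show "(\<integral>\<^sup>+\<omega>. ennreal (Y \<omega> * g (\<Phi> (Suc n) \<omega>)) \<partial>M) < \<infinity>"
      using Y g by (simp add: integrable_iff_bounded)
  qed
  have b: "f1 x \<le> \<bar>f x\<bar>" "f2 x \<le> \<bar>f x\<bar>" "0 \<le> f1 x" "0 \<le> f2 x" for x by (auto simp: f1_def f2_def)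
  have XY: "(\<lambda>\<omega>. Y \<omega> + X \<omega>) \<in> borel_measurable (past n)" using X Y by measurable
  have p: "0 \<le> Y \<omega> + X \<omega>" "Y \<omega> + X \<omega> \<le> 2 * X \<omega>" "X \<omega> \<le> 2 * X \<omega>" for \<omega>
    using Y(2)[of \<omega>] X0[of \<omega>] by linarith+
  have fm: "f1 \<in> borel_measurable borel" "f2 \<in> borel_measurable borel" by measurable
  have "Q (\<lambda>\<omega>. Y \<omega> + X \<omega>) f"
    by (rule Qf; rule QX[OF XY p(1,2) fm(1) b(3,1) iP(1)] QX[OF XY p(1,2) fm(2) b(4,2) iP(2)])
  moreover have "Q X f"
    by (rule Qf; rule QX[OF X X0 p(3) fm(1) b(3,1) iP(1)] QX[OF X X0 p(3) fm(2) b(4,2) iP(2)])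
  ultimately have "Q (\<lambda>\<omega>. (Y \<omega> + X \<omega>) - X \<omega>) f" by (rule Qd)
  then have "Q Y f" by simp
  then show ?thesis unfolding Q_def .
qed

lemma markov_complex_weight:
  fixes f :: "'a \<Rightarrow> real" and Y :: "'w \<Rightarrow> complex"
  assumes X: "X \<in> borel_measurable (past n)" and Y: "Y \<in> borel_measurable (past n)" "\<And>\<omega>. norm (Y \<omega>) \<le> X \<omega>"
    and f: "f \<in> borel_measurable borel" and fP: "\<And>x. integrable (P x) f"
    and fin: "integrable M (\<lambda>\<omega>. X \<omega> * f (\<Phi> (Suc n) \<omega>))"
  shows "integrable M (\<lambda>\<omega>. Y \<omega> * f (\<Phi> (Suc n) \<omega>)) \<and> integrable M (\<lambda>\<omega>. Y \<omega> * complex_of_real (\<integral>y. f y \<partial>P (\<Phi> n \<omega>)))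
     \<and> (\<integral>\<omega>. Y \<omega> * f (\<Phi> (Suc n) \<omega>) \<partial>M) = (\<integral>\<omega>. Y \<omega> * complex_of_real (\<integral>y. f y \<partial>P (\<Phi> n \<omega>)) \<partial>M)"
proof -
  have m: "(\<lambda>\<omega>. Re (Y \<omega>)) \<in> borel_measurable (past n)" "(\<lambda>\<omega>. Im (Y \<omega>)) \<in> borel_measurable (past n)"
    using Y by measurable
  have b: "\<bar>Re (Y \<omega>)\<bar> \<le> X \<omega>" "\<bar>Im (Y \<omega>)\<bar> \<le> X \<omega>" for \<omega>
    using Y(2)[of \<omega>] abs_Re_le_cmod[of "Y \<omega>"] abs_Im_le_cmod[of "Y \<omega>"] by linarith+
  note r = markov_real[OF X m(1) b(1) f fP fin] and i = markov_real[OF X m(2) b(2) f fP fin]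
  have dec: "Y \<omega> * complex_of_real c = complex_of_real (Re (Y \<omega>) * c) + \<i> * complex_of_real (Im (Y \<omega>) * c)" for \<omega> c
    by (simp add: complex_eq_iff)
  have ic: "integrable M (\<lambda>\<omega>. complex_of_real (g \<omega>) + \<i> * complex_of_real (h \<omega>))"
    "(\<integral>\<omega>. complex_of_real (g \<omega>) + \<i> * complex_of_real (h \<omega>) \<partial>M) = complex_of_real (\<integral>\<omega>. g \<omega> \<partial>M) + \<i> * complex_of_real (\<integral>\<omega>. h \<omega> \<partial>M)"
    if "integrable M g" "integrable M h" for g h
    using that by simp_all
  show ?thesis unfolding dec using r i by (simp add: ic del: of_real_mult)
qed

lemma markov_complex:
  fixes f :: "'a \<Rightarrow> complex" and Y :: "'w \<Rightarrow> complex"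
  assumes Y: "Y \<in> borel_measurable (past n)" "\<And>\<omega>. norm (Y \<omega>) \<le> 1"
    and f: "f \<in> borel_measurable borel" "\<And>x. norm (f x) \<le> 1"
  shows "(\<integral>\<omega>. Y \<omega> * f (\<Phi> (Suc n) \<omega>) \<partial>M) = (\<integral>\<omega>. Y \<omega> * (\<integral>y. f y \<partial>P (\<Phi> n \<omega>)) \<partial>M)"
proof -
  note [measurable] = f(1)
  have ReP: "integrable (P x) (\<lambda>y. Re (f y))" and ImP: "integrable (P x) (\<lambda>y. Im (f y))" for x
  proof -
    interpret Px: prob_space "P x" by (rule prob_P)
    have [measurable]: "(\<lambda>y. Re (f y)) \<in> borel_measurable (P x)" "(\<lambda>y. Im (f y)) \<in> borel_measurable (P x)"
      by (simp_all add: measurable_P_iff)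
    show "integrable (P x) (\<lambda>y. Re (f y))" "integrable (P x) (\<lambda>y. Im (f y))"
      using order_trans[OF abs_Re_le_cmod f(2)] order_trans[OF abs_Im_le_cmod f(2)]
      by (auto intro!: Px.integrable_const_bound[where B=1])
  qed
  have int: "integrable M (\<lambda>\<omega>. 1 * g (\<Phi> (Suc n) \<omega>))" if g[measurable]: "g \<in> borel_measurable borel"
      and b: "\<And>x. \<bar>g x\<bar> \<le> norm (f x)" for g :: "'a \<Rightarrow> real"
  proof (rule integrable_const_bound[where B=1])
    show "AE \<omega> in M. norm (1 * g (\<Phi> (Suc n) \<omega>)) \<le> 1"
      using order_trans[OF b f(2)] by auto
  qed measurable
  note r = markov_complex_weight[where X="\<lambda>_. 1", OF _ Y _ ReP int] and i = markov_complex_weight[where X="\<lambda>_. 1", OF _ Y _ ImP int]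
  have fe: "f x = complex_of_real (Re (f x)) + \<i> * complex_of_real (Im (f x))" for x
    by (simp add: complex_eq_iff)
  have Pf: "(\<integral>y. f y \<partial>P x) = complex_of_real (\<integral>y. Re (f y) \<partial>P x) + \<i> * complex_of_real (\<integral>y. Im (f y) \<partial>P x)" for x
    by (subst fe) (use ReP ImP in simp)
  show ?thesis
    unfolding Pf by (subst fe) (use r i in \<open>simp add: distrib_left mult.left_commute[of _ \<i>] abs_Re_le_cmod abs_Im_le_cmod\<close>)
qed

end

section \<open>The central limit theorem from an arbitrary initial law\<close>

lemma powr_add_le:
  fixes a b p :: real
  assumes "0 \<le> a" "0 \<le> b" "0 \<le> p" "p \<le> 3"
  shows "(a + b) powr p \<le> 8 * (a powr p + b powr p)"
proof -
  have "(a + b) powr p \<le> (2 * max a b) powr p" using assms by (intro powr_mono2) auto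
  also have "\<dots> = 2 powr p * max a b powr p" using assms by (simp add: powr_mult)
  also have "\<dots> \<le> 2 powr 3 * (a powr p + b powr p)"
    using assms by (intro mult_mono powr_mono) (auto simp: max_def)
  finally show ?thesis by simp
qed

lemma borel_measurable_iexp[measurable (raw)]:
  assumes "f \<in> borel_measurable N"
  shows "(\<lambda>x. iexp (f x)) \<in> borel_measurable N"
  by (rule measurable_compose[OF assms borel_measurable_continuous_onI]) (intro continuous_intros)

lemma norm_iexp_minus_1_le:
  fixes x \<eta> :: real
  assumes "0 < \<eta>" "\<eta> \<le> 1"
  shows "norm (iexp x - 1) \<le> 2 * \<bar>x\<bar> powr \<eta>"
proof (cases "\<bar>x\<bar> \<le> 1")
  case True
  have "norm (iexp x - 1) \<le> \<bar>x\<bar>" using iexp_approx1[of x 0] by simp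
  also have "\<bar>x\<bar> \<le> \<bar>x\<bar> powr \<eta>"
  proof (cases "x = 0")
    case False
    then show ?thesis using powr_mono'[of \<eta> 1 "\<bar>x\<bar>"] True assms by simp
  qed simp
  also have "\<dots> \<le> 2 * \<bar>x\<bar> powr \<eta>" by simp
  finally show ?thesis .
next
  case False
  have "norm (iexp x - 1) \<le> 2" using norm_triangle_ineq4[of "iexp x" 1] by simp
  moreover have "1 \<le> \<bar>x\<bar> powr \<eta>" using False assms by (intro ge_one_powr_ge_zero) auto
  ultimately show ?thesis by linarith
qed

text \<open>The fractional exponent accounts for the moments of the increments, which are controlled up to
  an order slightly above 2.\<close>

lemma norm_iexp_taylor2_le:
  fixes x \<eta> :: real
  assumes "0 < \<eta>" "\<eta> \<le> 1"
  shows "norm (iexp x - (1 + \<i> * x - complex_of_real (x\<^sup>2) / 2)) \<le> \<bar>x\<bar> powr (2 + \<eta>)"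
proof -
  have eq: "(\<Sum>k\<le>2. (\<i> * x) ^ k / fact k) = 1 + \<i> * x - complex_of_real (x\<^sup>2) / 2"
  proof -
    have "{..2::nat} = {0, 1, 2}" by auto
    moreover have "(\<i> * complex_of_real x)\<^sup>2 = - (complex_of_real x)\<^sup>2" by (simp add: power_mult_distrib)
    ultimately show ?thesis by (simp add: fact_numeral)
  qed
  show ?thesis
  proof (cases "\<bar>x\<bar> \<le> 1")
    case True
    have "norm (iexp x - (1 + \<i> * x - complex_of_real (x\<^sup>2) / 2)) \<le> \<bar>x\<bar> ^ 3 / fact 3"
      using iexp_approx1[of x 2] unfolding eq by (simp add: eval_nat_numeral)
    also have "\<dots> \<le> \<bar>x\<bar> ^ 3" by (simp add: fact_numeral)
    also have "\<dots> \<le> \<bar>x\<bar> powr (2 + \<eta>)"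
    proof (cases "x = 0")
      case False
      have "\<bar>x\<bar> powr 3 \<le> \<bar>x\<bar> powr (2 + \<eta>)" using True False assms by (intro powr_mono') auto
      then show ?thesis using False by simp
    qed simp
    finally show ?thesis .
  next
    case False
    have "norm (iexp x - (1 + \<i> * x - complex_of_real (x\<^sup>2) / 2)) \<le> 2 * \<bar>x\<bar> ^ 2 / fact 2"
      using iexp_approx2[of x 2] unfolding eq .
    also have "\<dots> = \<bar>x\<bar> powr 2" using False by (simp add: fact_numeral)
    also have "\<dots> \<le> \<bar>x\<bar> powr (2 + \<eta>)" using False assms by (intro powr_mono) auto
    finally show ?thesis .
  qed
qed

lemma recursion_error:
  fixes a :: "nat \<Rightarrow> complex" and r :: real
  assumes "\<And>j. norm (a (Suc j) - r * a j) \<le> \<epsilon>" "\<bar>r\<bar> \<le> 1"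
  shows "norm (a n - r ^ n * a 0) \<le> n * \<epsilon>"
proof (induction n)
  case (Suc n)
  have "a (Suc n) - r ^ Suc n * a 0 = (a (Suc n) - r * a n) + r * (a n - r ^ n * a 0)"
    by (simp add: algebra_simps)
  then have "norm (a (Suc n) - r ^ Suc n * a 0) \<le> norm (a (Suc n) - r * a n) + norm (r * (a n - r ^ n * a 0))"
    using norm_triangle_ineq by metis
  also have "norm (r * (a n - r ^ n * a 0)) \<le> 1 * norm (a n - r ^ n * a 0)"
    unfolding norm_mult using assms by (intro mult_right_mono) auto
  finally show ?case using Suc assms(1)[of n] by (simp add: algebra_simps)
qed simp

text \<open>Here \<open>\<Upsilon>\<close> dominates \<open>u\<close> and its image, and the drift of \<open>\<Upsilon> powr (2 + \<eta>)\<close> bounds moments of order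
  \<open>2 + \<eta>\<close> uniformly in time. The function \<open>w\<close> solves the Poisson equation for the conditional variance of
  the martingale increments, whose stationary mean is \<open>v\<close>.\<close>

locale clt_chain = kernel_chain +
  fixes u w \<Upsilon> :: "'b \<Rightarrow> real" and v l \<kappa> \<eta> :: real
  assumes u_meas[measurable]: "u \<in> borel_measurable borel" and w_meas[measurable]: "w \<in> borel_measurable borel"
    and U_meas[measurable]: "\<Upsilon> \<in> borel_measurable borel" and U_nonneg: "\<And>x. 0 \<le> \<Upsilon> x"
    and u_le: "\<And>x. \<bar>u x\<bar> \<le> \<Upsilon> x" and Pu_le: "\<And>x. \<bar>\<integral>y. u y \<partial>P x\<bar> \<le> \<Upsilon> x" and w_le: "\<And>x. \<bar>w x\<bar> \<le> (\<Upsilon> x)\<^sup>2"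
    and eta: "0 < \<eta>" "\<eta> \<le> 1"
    and W_int: "\<And>x. integrable (P x) (\<lambda>y. \<Upsilon> y powr (2 + \<eta>))"
    and W_drift: "\<And>x. (\<integral>y. \<Upsilon> y powr (2 + \<eta>) \<partial>P x) \<le> l * \<Upsilon> x powr (2 + \<eta>) + \<kappa>"
    and l: "0 \<le> l" "l < 1" and kappa: "0 \<le> \<kappa>" and v: "0 \<le> v"
    and poisson: "\<And>x. w x - (\<integral>y. w y \<partial>P x) = (\<integral>y. (u y)\<^sup>2 \<partial>P x) - (\<integral>y. u y \<partial>P x)\<^sup>2 - v"
begin

abbreviation W :: "'b \<Rightarrow> real" where "W x \<equiv> \<Upsilon> x powr (2 + \<eta>)"
abbreviation Pu :: "'b \<Rightarrow> real" where "Pu x \<equiv> (\<integral>y. u y \<partial>P x)"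

lemma W_nonneg: "0 \<le> W x" by simp

lemma U2_le: "(\<Upsilon> x)\<^sup>2 \<le> 1 + W x"
proof (cases "\<Upsilon> x \<le> 1")
  case True
  then have "(\<Upsilon> x)\<^sup>2 \<le> 1" using U_nonneg[of x] by (simp add: power_le_one)
  then show ?thesis using W_nonneg[of x] by linarith
next
  case False
  then have "\<Upsilon> x powr 2 \<le> W x" using eta by (intro powr_mono) auto
  then show ?thesis using False by simp
qed

lemma U_le: "\<Upsilon> x \<le> 1 + W x"
proof (cases "\<Upsilon> x \<le> 1")
  case False
  then have "\<Upsilon> x powr 1 \<le> W x" using eta by (intro powr_mono) auto
  then show ?thesis using False by simp
qed (simp add: add_increasing2)

lemma P_integrable:
  fixes f :: "'b \<Rightarrow> 'c::{banach, second_countable_topology}"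
  assumes f: "f \<in> borel_measurable borel" and le: "\<And>y. norm (f y) \<le> c + d * W y"
  shows "integrable (P x) f"
proof -
  interpret Px: prob_space "P x" by (rule prob_P)
  have "integrable (P x) (\<lambda>y. c + d * W y)" using W_int[of x] by simp
  then show ?thesis
    by (rule Bochner_Integration.integrable_bound) (use f le in \<open>auto simp: measurable_P_iff intro: order_trans[OF _ abs_ge_self]\<close>)
qed

lemma P_int_u: "integrable (P x) u"
  using order_trans[OF u_le U_le] by (intro P_integrable[where c=1 and d=1]) auto

lemma P_int_u2: "integrable (P x) (\<lambda>y. (u y)\<^sup>2)"
proof (rule P_integrable[where c=1 and d=1])
  fix y
  have "(u y)\<^sup>2 \<le> (\<Upsilon> y)\<^sup>2" using u_le[of y] by (simp add: abs_le_square_iff[symmetric] U_nonneg)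
  then show "norm ((u y)\<^sup>2) \<le> 1 + 1 * W y" using U2_le[of y] by simp
qed simp

lemma P_int_w: "integrable (P x) w"
  using order_trans[OF w_le U2_le] by (intro P_integrable[where c=1 and d=1]) auto

text \<open>A second-order expansion of the transform of one martingale increment, with conditional
  variance expressed through \<open>w\<close>.\<close>

lemma increment_expansion:
  "norm ((\<integral>y. iexp (s * (u y - Pu x)) \<partial>P x) - 1 + s\<^sup>2 / 2 * (v + w x - (\<integral>y. w y \<partial>P x)))
     \<le> \<bar>s\<bar> powr (2 + \<eta>) * (16 * W x + 8 * \<kappa>)"
proof -
  interpret Px: prob_space "P x" by (rule prob_P)
  let ?z = "\<lambda>y. u y - Pu x"
  have i1: "integrable (P x) ?z" using P_int_u[of x] by simp
  have z2: "(?z y)\<^sup>2 = (u y)\<^sup>2 - 2 * Pu x * u y + (Pu x)\<^sup>2" for y by (simp add: power2_eq_square algebra_simps)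
  have i2: "integrable (P x) (\<lambda>y. (?z y)\<^sup>2)" unfolding z2 using P_int_u[of x] P_int_u2[of x] by simp
  have e1: "(\<integral>y. ?z y \<partial>P x) = 0" using P_int_u[of x] by (simp add: Px.prob_space)
  have e2: "(\<integral>y. (?z y)\<^sup>2 \<partial>P x) = v + w x - (\<integral>y. w y \<partial>P x)"
    unfolding z2 using P_int_u[of x] P_int_u2[of x] poisson[of x]
    by (simp add: Px.prob_space power2_eq_square)
  have ie: "integrable (P x) (\<lambda>y. iexp (s * ?z y))"
  proof (rule P_integrable[where c=1 and d=0])
    show "(\<lambda>y. iexp (s * ?z y)) \<in> borel_measurable borel" by (intro borel_measurable_iexp) measurable
    show "norm (iexp (s * ?z y)) \<le> 1 + 0 * W y" for y by (simp only: norm_exp_i_times)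
  qed
  let ?h = "\<lambda>y. iexp (s * ?z y) - (1 + \<i> * complex_of_real (s * ?z y) - complex_of_real ((s * ?z y)\<^sup>2) / 2)"
  have hh: "?h y = iexp (s * ?z y) - (1 + (\<i> * complex_of_real s) * complex_of_real (?z y) - complex_of_real (s\<^sup>2 / 2) * complex_of_real ((?z y)\<^sup>2))" for y
    by (simp add: power_mult_distrib)
  have c1: "integrable (P x) (\<lambda>y. complex_of_real (?z y))" "integrable (P x) (\<lambda>y. complex_of_real ((?z y)\<^sup>2))"
    by (rule integrable_of_real[OF i1] integrable_of_real[OF i2])+
  have ih: "integrable (P x) ?h"
    unfolding hh
    by (intro Bochner_Integration.integrable_diff Bochner_Integration.integrable_add integrable_mult_right ie c1 Px.integrable_const)
  have eq: "(\<integral>y. iexp (s * ?z y) \<partial>P x) - 1 + s\<^sup>2 / 2 * (v + w x - (\<integral>y. w y \<partial>P x)) = (\<integral>y. ?h y \<partial>P x)"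
  proof -
    have "(\<integral>y. ?h y \<partial>P x) = (\<integral>y. iexp (s * ?z y) - (1 + (\<i> * complex_of_real s) * complex_of_real (?z y) - complex_of_real (s\<^sup>2 / 2) * complex_of_real ((?z y)\<^sup>2)) \<partial>P x)"
      by (simp only: hh)
    also have "\<dots> = (\<integral>y. iexp (s * ?z y) \<partial>P x) - (1 + (\<i> * complex_of_real s) * complex_of_real (\<integral>y. ?z y \<partial>P x)
        - complex_of_real (s\<^sup>2 / 2) * complex_of_real (\<integral>y. (?z y)\<^sup>2 \<partial>P x))"
      using ie c1
      by (simp add: Px.prob_space del: of_real_diff of_real_power of_real_mult of_real_divide)
    finally show ?thesis unfolding e1 e2 by simp
  qed
  have "norm (\<integral>y. ?h y \<partial>P x) \<le> (\<integral>y. norm (?h y) \<partial>P x)" by (rule integral_norm_bound)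
  also have "\<dots> \<le> (\<integral>y. \<bar>s\<bar> powr (2 + \<eta>) * (8 * (W y + W x)) \<partial>P x)"
  proof (rule integral_mono[OF integrable_norm[OF ih]])
    show "integrable (P x) (\<lambda>y. \<bar>s\<bar> powr (2 + \<eta>) * (8 * (W y + W x)))" using W_int[of x] by simp
    fix y
    have "norm (?h y) \<le> \<bar>s * ?z y\<bar> powr (2 + \<eta>)" using norm_iexp_taylor2_le[OF eta, of "s * ?z y"] by simp
    also have "\<dots> = \<bar>s\<bar> powr (2 + \<eta>) * \<bar>?z y\<bar> powr (2 + \<eta>)" by (simp add: abs_mult powr_mult)
    also have "\<bar>?z y\<bar> powr (2 + \<eta>) \<le> (\<Upsilon> y + \<Upsilon> x) powr (2 + \<eta>)"
      using u_le[of y] Pu_le[of x] eta by (intro powr_mono2) auto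
    also have "\<dots> \<le> 8 * (W y + W x)" using eta by (intro powr_add_le U_nonneg) auto
    finally show "norm (?h y) \<le> \<bar>s\<bar> powr (2 + \<eta>) * (8 * (W y + W x))" by (simp add: mult_left_mono)
  qed
  also have "\<dots> = \<bar>s\<bar> powr (2 + \<eta>) * (8 * ((\<integral>y. W y \<partial>P x) + W x))"
    using W_int[of x] by (simp add: Px.prob_space)
  also have "\<dots> \<le> \<bar>s\<bar> powr (2 + \<eta>) * (16 * W x + 8 * \<kappa>)"
  proof (rule mult_left_mono)
    have "l * W x \<le> 1 * W x" using l by (intro mult_right_mono) auto
    then have "(\<integral>y. W y \<partial>P x) \<le> W x + \<kappa>" using W_drift[of x] by (simp only: mult_1_left)
    then show "8 * ((\<integral>y. W y \<partial>P x) + W x) \<le> 16 * W x + 8 * \<kappa>" by (simp add: distrib_left)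
  qed simp
  finally show ?thesis unfolding eq .
qed

text \<open>The initial law is arbitrary, so that moments are only available after restriction to the event
  \<open>W (\<Phi> 0 \<omega>) \<le> R\<close>; its probability tends to 1 as \<open>R\<close> grows. The sum \<open>T\<close> is the martingale.\<close>

definition start :: "real \<Rightarrow> 'a \<Rightarrow> real" where "start R \<omega> = indicator {\<omega>. W (\<Phi> 0 \<omega>) \<le> R} \<omega>"
definition T :: "nat \<Rightarrow> 'a \<Rightarrow> real" where "T j \<omega> = (\<Sum>i<j. u (\<Phi> (Suc i) \<omega>) - Pu (\<Phi> i \<omega>))"

lemma start_past: "start R \<in> borel_measurable (past n)"
proof -
  have [measurable]: "\<Phi> 0 \<in> past n \<rightarrow>\<^sub>M borel" by (rule Phi_past) simp
  have "(\<lambda>\<omega>. if W (\<Phi> 0 \<omega>) \<le> R then 1 else (0::real)) \<in> borel_measurable (past n)" by measurable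
  moreover have "start R = (\<lambda>\<omega>. if W (\<Phi> 0 \<omega>) \<le> R then 1 else 0)"
    by (auto simp: start_def indicator_def fun_eq_iff)
  ultimately show ?thesis by simp
qed

lemma start_01: "0 \<le> start R \<omega>" "start R \<omega> \<le> 1" by (auto simp: start_def indicator_def)

lemma start_meas[measurable]: "start R \<in> borel_measurable M"
  by (rule past_meas_M[OF start_past[of R 0]])

lemma T_past: "T n \<in> borel_measurable (past n)"
proof -
  have 1: "(\<lambda>\<omega>. u (\<Phi> (Suc i) \<omega>)) \<in> borel_measurable (past n)" if "i < n" for i
    using that by (intro measurable_compose[OF Phi_past u_meas]) auto
  have 2: "(\<lambda>\<omega>. Pu (\<Phi> i \<omega>)) \<in> borel_measurable (past n)" if "i < n" for i
    using that by (intro measurable_compose[OF Phi_past integral_P_meas[OF u_meas]]) auto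
  show ?thesis unfolding T_def[abs_def] by (intro borel_measurable_sum borel_measurable_diff 1 2) auto
qed

lemma T_meas[measurable]: "T n \<in> borel_measurable M" by (rule past_meas_M[OF T_past])

text \<open>The drift recursion preserves this bound, because it is at least the fixed point \<open>\<kappa> / (1 - l)\<close>; at time 0 it
  is at least the value \<open>R\<close> that \<open>start R\<close> allows.\<close>

definition K :: "real \<Rightarrow> real" where "K R = max R 0 + \<kappa> / (1 - l)"

lemma K_nonneg: "0 \<le> K R" unfolding K_def using kappa l by simp

lemma moments: "integrable M (\<lambda>\<omega>. start R \<omega> * W (\<Phi> j \<omega>))" "(\<integral>\<omega>. start R \<omega> * W (\<Phi> j \<omega>) \<partial>M) \<le> K R"
proof -
  have nn: "(\<integral>\<^sup>+\<omega>. ennreal (start R \<omega> * W (\<Phi> j \<omega>)) \<partial>M) \<le> ennreal (K R)"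
  proof (induction j)
    case 0
    have "(\<integral>\<^sup>+\<omega>. ennreal (start R \<omega> * W (\<Phi> 0 \<omega>)) \<partial>M) \<le> (\<integral>\<^sup>+\<omega>. ennreal (K R) \<partial>M)"
    proof (intro nn_integral_mono ennreal_leI)
      fix \<omega>
      have "start R \<omega> * W (\<Phi> 0 \<omega>) \<le> max R 0" by (auto simp: start_def indicator_def)
      moreover have "0 \<le> \<kappa> / (1 - l)" using kappa l by simp
      ultimately show "start R \<omega> * W (\<Phi> 0 \<omega>) \<le> K R" unfolding K_def by linarith
    qed
    then show ?case by (simp add: emeasure_space_1)
  next
    case (Suc j)
    have eP: "(\<integral>\<^sup>+y. ennreal (W y) \<partial>P x) = ennreal (\<integral>y. W y \<partial>P x)" for x
      by (rule nn_integral_eq_integral[OF W_int]) auto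
    have "(\<integral>\<^sup>+\<omega>. ennreal (start R \<omega> * W (\<Phi> (Suc j) \<omega>)) \<partial>M)
       = (\<integral>\<^sup>+\<omega>. ennreal (start R \<omega>) * (\<integral>\<^sup>+y. ennreal (W y) \<partial>P (\<Phi> j \<omega>)) \<partial>M)"
      using markov_nn[of "\<lambda>\<omega>. ennreal (start R \<omega>)" j "\<lambda>x. ennreal (W x)"] start_past[of R j]
      by (simp add: ennreal_mult start_01)
    also have "\<dots> \<le> (\<integral>\<^sup>+\<omega>. ennreal l * ennreal (start R \<omega> * W (\<Phi> j \<omega>)) + ennreal \<kappa> \<partial>M)"
    proof (rule nn_integral_mono)
      fix \<omega>
      have "start R \<omega> * (\<integral>y. W y \<partial>P (\<Phi> j \<omega>)) \<le> start R \<omega> * (l * W (\<Phi> j \<omega>) + \<kappa>)"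
        by (intro mult_left_mono W_drift start_01)
      also have "\<dots> \<le> l * (start R \<omega> * W (\<Phi> j \<omega>)) + \<kappa>"
        using mult_right_mono[OF start_01(2) kappa, of R \<omega>] by (simp add: algebra_simps)
      finally have "ennreal (start R \<omega> * (\<integral>y. W y \<partial>P (\<Phi> j \<omega>))) \<le> ennreal (l * (start R \<omega> * W (\<Phi> j \<omega>)) + \<kappa>)"
        by (rule ennreal_leI)
      then show "ennreal (start R \<omega>) * (\<integral>\<^sup>+y. ennreal (W y) \<partial>P (\<Phi> j \<omega>)) \<le> ennreal l * ennreal (start R \<omega> * W (\<Phi> j \<omega>)) + ennreal \<kappa>"
        unfolding eP using l kappa start_01[of R \<omega>]
        by (simp add: ennreal_mult[symmetric] ennreal_plus[symmetric] integral_nonneg_AE del: ennreal_plus)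
    qed
    also have "\<dots> = ennreal l * (\<integral>\<^sup>+\<omega>. ennreal (start R \<omega> * W (\<Phi> j \<omega>)) \<partial>M) + ennreal \<kappa>"
      by (simp add: nn_integral_add nn_integral_cmult emeasure_space_1)
    also have "\<dots> \<le> ennreal l * ennreal (K R) + ennreal \<kappa>" by (intro add_mono mult_left_mono Suc.IH) auto
    also have "\<dots> = ennreal (l * K R + \<kappa>)" using l kappa K_nonneg[of R] by (simp add: ennreal_mult)
    also have "\<dots> \<le> ennreal (K R)"
    proof (rule ennreal_leI)
      have "(1 - l) * K R \<ge> (1 - l) * (\<kappa> / (1 - l))" unfolding K_def using l by (intro mult_left_mono) auto
      moreover have "(1 - l) * (\<kappa> / (1 - l)) = \<kappa>" using l by simp
      ultimately have "\<kappa> \<le> (1 - l) * K R" by simp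
      then show "l * K R + \<kappa> \<le> K R" by (simp add: algebra_simps)
    qed
    finally show ?case .
  qed
  show i: "integrable M (\<lambda>\<omega>. start R \<omega> * W (\<Phi> j \<omega>))"
    using nn by (intro integrableI_nonneg) (auto simp: start_01 intro: le_less_trans)
  show "(\<integral>\<omega>. start R \<omega> * W (\<Phi> j \<omega>) \<partial>M) \<le> K R"
    using nn i K_nonneg[of R] by (simp add: nn_integral_eq_integral start_01)
qed

lemma start_integrable:
  fixes f :: "'a \<Rightarrow> 'c::{banach, second_countable_topology}"
  assumes f: "f \<in> borel_measurable M" and le: "\<And>\<omega>. norm (f \<omega>) \<le> start R \<omega> * (c + d * W (\<Phi> j \<omega>) + e * W (\<Phi> j' \<omega>))"
  shows "integrable M f" "norm (\<integral>\<omega>. f \<omega> \<partial>M) \<le> c * (\<integral>\<omega>. start R \<omega> \<partial>M) + d * (\<integral>\<omega>. start R \<omega> * W (\<Phi> j \<omega>) \<partial>M) + e * (\<integral>\<omega>. start R \<omega> * W (\<Phi> j' \<omega>) \<partial>M)"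
proof -
  let ?g = "\<lambda>\<omega>. start R \<omega> * (c + d * W (\<Phi> j \<omega>) + e * W (\<Phi> j' \<omega>))"
  have ist: "integrable M (start R)"
    by (intro integrable_const_bound[where B=1]) (auto simp: start_01)
  have g: "?g = (\<lambda>\<omega>. c * start R \<omega> + d * (start R \<omega> * W (\<Phi> j \<omega>)) + e * (start R \<omega> * W (\<Phi> j' \<omega>)))"
    by (auto simp: algebra_simps)
  have ig: "integrable M ?g" unfolding g using ist moments(1)[of R] by simp
  show i: "integrable M f"
    by (rule Bochner_Integration.integrable_bound[OF ig]) (use f le in \<open>auto intro: order_trans[OF _ abs_ge_self]\<close>)
  have "norm (\<integral>\<omega>. f \<omega> \<partial>M) \<le> (\<integral>\<omega>. norm (f \<omega>) \<partial>M)" by (rule integral_norm_bound)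
  also have "\<dots> \<le> (\<integral>\<omega>. ?g \<omega> \<partial>M)" by (rule integral_mono[OF integrable_norm[OF i] ig le])
  also have "\<dots> = c * (\<integral>\<omega>. start R \<omega> \<partial>M) + d * (\<integral>\<omega>. start R \<omega> * W (\<Phi> j \<omega>) \<partial>M) + e * (\<integral>\<omega>. start R \<omega> * W (\<Phi> j' \<omega>) \<partial>M)"
    unfolding g using ist moments(1)[of R] by simp
  finally show "norm (\<integral>\<omega>. f \<omega> \<partial>M) \<le> c * (\<integral>\<omega>. start R \<omega> \<partial>M) + d * (\<integral>\<omega>. start R \<omega> * W (\<Phi> j \<omega>) \<partial>M) + e * (\<integral>\<omega>. start R \<omega> * W (\<Phi> j' \<omega>) \<partial>M)" .
qed

lemma start_mean_le: "(\<integral>\<omega>. start R \<omega> \<partial>M) \<le> 1"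
proof -
  have "(\<integral>\<omega>. start R \<omega> \<partial>M) \<le> (\<integral>\<omega>. 1 \<partial>M)"
    by (intro integral_mono integrable_const_bound[where B=1]) (auto simp: start_01)
  then show ?thesis by (simp add: prob_space)
qed

text \<open>\<open>A\<close> is the characteristic function of \<open>T\<close> on the start event, and \<open>B\<close> is the corrector by which the
  fluctuations of the conditional variance are removed from the recursion.\<close>

definition A :: "real \<Rightarrow> real \<Rightarrow> nat \<Rightarrow> complex" where
  "A R s j = (\<integral>\<omega>. complex_of_real (start R \<omega>) * iexp (s * T j \<omega>) \<partial>M)"
definition B :: "real \<Rightarrow> real \<Rightarrow> nat \<Rightarrow> complex" where
  "B R s j = (\<integral>\<omega>. complex_of_real (start R \<omega>) * iexp (s * T j \<omega>) * complex_of_real (w (\<Phi> j \<omega>)) \<partial>M)"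

lemma norm_start_iexp: "norm (complex_of_real (start R \<omega>) * iexp x) = start R \<omega>"
  by (simp add: norm_mult start_01)

lemma B_le: "norm (B R s j) \<le> 1 + K R"
proof -
  have "norm (B R s j) \<le> 1 * (\<integral>\<omega>. start R \<omega> \<partial>M) + 1 * (\<integral>\<omega>. start R \<omega> * W (\<Phi> j \<omega>) \<partial>M) + 0 * (\<integral>\<omega>. start R \<omega> * W (\<Phi> j \<omega>) \<partial>M)"
    unfolding B_def
  proof (rule start_integrable)
    fix \<omega>
    show "norm (complex_of_real (start R \<omega>) * iexp (s * T j \<omega>) * complex_of_real (w (\<Phi> j \<omega>)))
        \<le> start R \<omega> * (1 + 1 * W (\<Phi> j \<omega>) + 0 * W (\<Phi> j \<omega>))"
      using order_trans[OF w_le U2_le, of "\<Phi> j \<omega>"] start_01[of R \<omega>]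
      unfolding norm_mult[of _ "complex_of_real (w (\<Phi> j \<omega>))"] norm_start_iexp by (simp add: mult_left_mono)
  qed measurable
  then show ?thesis using start_mean_le[of R] moments(2)[of R j] by linarith
qed

text \<open>Conditioning on the past replaces the last factor of the exponential by its second-order expansion.
  The image of \<open>w\<close> that occurs there is the conditional expectation of \<open>w\<close> at the next state, and to
  replace \<open>T j\<close> by \<open>T (Suc j)\<close> next to it costs only a term of higher order.\<close>

lemma one_step:
  "norm (A R s (Suc j) - A R s j + s\<^sup>2 / 2 * (v * A R s j + B R s j - B R s (Suc j)))
     \<le> \<bar>s\<bar> powr (2 + \<eta>) * (32 * K R + 8 * \<kappa>)"
proof -
  let ?X = "\<lambda>\<omega>. complex_of_real (start R \<omega>)"
  let ?E = "\<lambda>j \<omega>. ?X \<omega> * iexp (s * T j \<omega>)"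
  let ?\<psi> = "\<lambda>x. (\<integral>y. iexp (s * (u y - Pu x)) \<partial>P x)"
  let ?Pw = "\<lambda>x. (\<integral>y. w y \<partial>P x)"
  have split: "iexp (a + b) = iexp a * iexp b" for a b by (simp add: exp_add distrib_left)
  have TS: "T (Suc j) \<omega> = T j \<omega> + (u (\<Phi> (Suc j) \<omega>) - Pu (\<Phi> j \<omega>))" for \<omega> by (simp add: T_def)
  have Ep: "?E j \<in> borel_measurable (past j)"
    using start_past[of R j] T_past[of j] by measurable
  have Pup: "(\<lambda>\<omega>. Pu (\<Phi> j \<omega>)) \<in> borel_measurable (past j)"
    by (intro measurable_compose[OF Phi_past integral_P_meas[OF u_meas]]) auto
  have psi_eq: "?\<psi> x = iexp (- (s * Pu x)) * (\<integral>y. iexp (s * u y) \<partial>P x)" for x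
  proof -
    have "iexp (s * (u y - Pu x)) = iexp (- (s * Pu x)) * iexp (s * u y)" for y
      using split[of "- (s * Pu x)" "s * u y"] by (simp only: right_diff_distrib uminus_add_conv_diff)
    then show ?thesis by (simp only: integral_mult_right_zero)
  qed
  have psi_meas[measurable]: "?\<psi> \<in> borel_measurable borel" unfolding psi_eq by measurable
  have psi_le: "norm (?\<psi> x) \<le> 1" for x
  proof -
    interpret Px: prob_space "P x" by (rule prob_P)
    have "norm (?\<psi> x) \<le> (\<integral>y. norm (iexp (s * (u y - Pu x))) \<partial>P x)" by (rule integral_norm_bound)
    then show ?thesis by (simp add: Px.prob_space)
  qed
  have A1: "A R s (Suc j) = (\<integral>\<omega>. ?E j \<omega> * ?\<psi> (\<Phi> j \<omega>) \<partial>M)"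
  proof -
    let ?Y = "\<lambda>\<omega>. ?E j \<omega> * iexp (- (s * Pu (\<Phi> j \<omega>)))"
    have "A R s (Suc j) = (\<integral>\<omega>. ?Y \<omega> * iexp (s * u (\<Phi> (Suc j) \<omega>)) \<partial>M)"
    proof -
      have "iexp (s * (t + (a - b))) = iexp (s * t) * iexp (- (s * b)) * iexp (s * a)" for t a b
        unfolding split[symmetric] by (simp add: algebra_simps)
      then show ?thesis unfolding A_def TS by (simp only: mult.assoc)
    qed
    also have "\<dots> = (\<integral>\<omega>. ?Y \<omega> * (\<integral>y. iexp (s * u y) \<partial>P (\<Phi> j \<omega>)) \<partial>M)"
    proof (rule markov_complex)
      show "?Y \<in> borel_measurable (past j)" using Ep Pup by measurable
      show "norm (?Y \<omega>) \<le> 1" for \<omega> unfolding norm_mult[of "?E j \<omega>"] norm_start_iexp by (simp add: start_01)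
    qed (auto simp: norm_exp_i_times)
    finally show ?thesis unfolding psi_eq by (simp add: mult.assoc)
  qed
  have w1: "integrable M (\<lambda>\<omega>. start R \<omega> * w (\<Phi> i \<omega>))" for i
  proof (rule start_integrable[where c=1 and d=1 and e=0 and j=i and j'=i])
    show "norm (start R \<omega> * w (\<Phi> i \<omega>)) \<le> start R \<omega> * (1 + 1 * W (\<Phi> i \<omega>) + 0 * W (\<Phi> i \<omega>))" for \<omega>
      using order_trans[OF w_le U2_le, of "\<Phi> i \<omega>"] start_01[of R \<omega>] by (simp add: abs_mult mult_left_mono)
  qed measurable
  have i_w: "integrable M (\<lambda>\<omega>. ?E i \<omega> * complex_of_real (w (\<Phi> i' \<omega>)))" for i i'
    by (rule Bochner_Integration.integrable_bound[OF w1[of i']]) (auto simp: norm_mult start_01 abs_mult)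
  have i_E: "integrable M (?E i)" for i
  proof (intro integrable_const_bound[where B=1] AE_I2)
    show "norm (?E i \<omega>) \<le> 1" for \<omega> unfolding norm_start_iexp by (rule start_01)
  qed measurable
  have i_psi: "integrable M (\<lambda>\<omega>. ?E j \<omega> * ?\<psi> (\<Phi> j \<omega>))"
  proof (intro integrable_const_bound[where B=1] AE_I2)
    show "norm (?E j \<omega> * ?\<psi> (\<Phi> j \<omega>)) \<le> 1" for \<omega>
      unfolding norm_mult[of "?E j \<omega>"] norm_start_iexp using start_01[of R \<omega>] psi_le by (intro mult_le_one) auto
  qed measurable
  have e2: "norm (\<integral>\<omega>. (?E (Suc j) \<omega> - ?E j \<omega>) * complex_of_real (w (\<Phi> (Suc j) \<omega>)) \<partial>M) \<le> 32 * \<bar>s\<bar> powr \<eta> * K R"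
  proof -
    have "norm (\<integral>\<omega>. (?E (Suc j) \<omega> - ?E j \<omega>) * complex_of_real (w (\<Phi> (Suc j) \<omega>)) \<partial>M)
      \<le> 0 * (\<integral>\<omega>. start R \<omega> \<partial>M) + (16 * \<bar>s\<bar> powr \<eta>) * (\<integral>\<omega>. start R \<omega> * W (\<Phi> j \<omega>) \<partial>M) + (16 * \<bar>s\<bar> powr \<eta>) * (\<integral>\<omega>. start R \<omega> * W (\<Phi> (Suc j) \<omega>) \<partial>M)"
    proof (rule start_integrable)
      fix \<omega>
      let ?z = "u (\<Phi> (Suc j) \<omega>) - Pu (\<Phi> j \<omega>)"
      let ?a = "\<Upsilon> (\<Phi> j \<omega>)" and ?b = "\<Upsilon> (\<Phi> (Suc j) \<omega>)"
      have z: "\<bar>?z\<bar> \<le> ?a + ?b" using u_le[of "\<Phi> (Suc j) \<omega>"] Pu_le[of "\<Phi> j \<omega>"] by linarith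
      have "?E (Suc j) \<omega> - ?E j \<omega> = ?E j \<omega> * (iexp (s * ?z) - 1)"
        unfolding TS distrib_left split by (simp add: algebra_simps)
      then have n: "norm ((?E (Suc j) \<omega> - ?E j \<omega>) * complex_of_real (w (\<Phi> (Suc j) \<omega>)))
          = start R \<omega> * (norm (iexp (s * ?z) - 1) * \<bar>w (\<Phi> (Suc j) \<omega>)\<bar>)"
        by (simp only: norm_mult norm_start_iexp[unfolded norm_mult] norm_of_real mult.assoc) (simp add: norm_exp_i_times start_01)
      have "norm (iexp (s * ?z) - 1) * \<bar>w (\<Phi> (Suc j) \<omega>)\<bar> \<le> (2 * \<bar>s * ?z\<bar> powr \<eta>) * ?b\<^sup>2"
        by (intro mult_mono norm_iexp_minus_1_le eta w_le) auto
      also have "\<dots> \<le> (2 * (\<bar>s\<bar> powr \<eta> * (?a + ?b) powr \<eta>)) * (?a + ?b) powr 2"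
      proof (intro mult_mono)
        show "\<bar>s * ?z\<bar> powr \<eta> \<le> \<bar>s\<bar> powr \<eta> * (?a + ?b) powr \<eta>"
          unfolding abs_mult powr_mult using z eta by (intro mult_left_mono powr_mono2) auto
        have "?b powr 2 \<le> (?a + ?b) powr 2" using U_nonneg by (intro powr_mono2) auto
        then show "?b\<^sup>2 \<le> (?a + ?b) powr 2" using U_nonneg[of "\<Phi> (Suc j) \<omega>"] by (cases "?b = 0") auto
      qed auto
      also have "\<dots> = 2 * \<bar>s\<bar> powr \<eta> * (?a + ?b) powr (2 + \<eta>)" by (simp add: powr_add mult_ac)
      also have "\<dots> \<le> 2 * \<bar>s\<bar> powr \<eta> * (8 * (?a powr (2 + \<eta>) + ?b powr (2 + \<eta>)))"
        using eta by (intro mult_left_mono powr_add_le U_nonneg) auto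
      also have "\<dots> = 0 + (16 * \<bar>s\<bar> powr \<eta>) * W (\<Phi> j \<omega>) + (16 * \<bar>s\<bar> powr \<eta>) * W (\<Phi> (Suc j) \<omega>)"
        by (simp add: distrib_left)
      finally show "norm ((?E (Suc j) \<omega> - ?E j \<omega>) * complex_of_real (w (\<Phi> (Suc j) \<omega>)))
        \<le> start R \<omega> * (0 + (16 * \<bar>s\<bar> powr \<eta>) * W (\<Phi> j \<omega>) + (16 * \<bar>s\<bar> powr \<eta>) * W (\<Phi> (Suc j) \<omega>))"
        unfolding n by (rule mult_left_mono[OF _ start_01(1)])
    qed measurable
    also have "\<dots> \<le> 0 + (16 * \<bar>s\<bar> powr \<eta>) * K R + (16 * \<bar>s\<bar> powr \<eta>) * K R"
      using moments(2) by (intro add_mono mult_left_mono) auto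
    also have "\<dots> = 32 * \<bar>s\<bar> powr \<eta> * K R" by simp
    finally show ?thesis .
  qed
  let ?r = "\<lambda>x. ?\<psi> x - 1 + complex_of_real (s\<^sup>2 / 2 * (v + w x - ?Pw x))"
  have e1: "norm (\<integral>\<omega>. ?E j \<omega> * ?r (\<Phi> j \<omega>) \<partial>M) \<le> \<bar>s\<bar> powr (2 + \<eta>) * (16 * K R + 8 * \<kappa>)"
  proof -
    let ?s = "\<bar>s\<bar> powr (2 + \<eta>)"
    have "norm (\<integral>\<omega>. ?E j \<omega> * ?r (\<Phi> j \<omega>) \<partial>M)
      \<le> (?s * (8 * \<kappa>)) * (\<integral>\<omega>. start R \<omega> \<partial>M) + (?s * 16) * (\<integral>\<omega>. start R \<omega> * W (\<Phi> j \<omega>) \<partial>M) + 0 * (\<integral>\<omega>. start R \<omega> * W (\<Phi> j \<omega>) \<partial>M)"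
    proof (rule start_integrable)
      fix \<omega>
      have "norm (?r (\<Phi> j \<omega>)) \<le> ?s * (16 * W (\<Phi> j \<omega>) + 8 * \<kappa>)"
        using increment_expansion[where s=s and x="\<Phi> j \<omega>"] by simp
      then have "start R \<omega> * norm (?r (\<Phi> j \<omega>)) \<le> start R \<omega> * (?s * (16 * W (\<Phi> j \<omega>) + 8 * \<kappa>))"
        by (intro mult_left_mono start_01)
      then show "norm (?E j \<omega> * ?r (\<Phi> j \<omega>)) \<le> start R \<omega> * (?s * (8 * \<kappa>) + (?s * 16) * W (\<Phi> j \<omega>) + 0 * W (\<Phi> j \<omega>))"
        unfolding norm_mult[of "?E j \<omega>"] norm_start_iexp by (simp add: algebra_simps)
    qed measurable
    also have "\<dots> \<le> (?s * (8 * \<kappa>)) * 1 + (?s * 16) * K R + 0"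
      using moments(2) start_mean_le kappa by (intro add_mono mult_left_mono) auto
    finally show ?thesis by (simp add: algebra_simps)
  qed
  have main: "A R s (Suc j) - A R s j + s\<^sup>2 / 2 * (v * A R s j + B R s j - B R s (Suc j))
      = (\<integral>\<omega>. ?E j \<omega> * ?r (\<Phi> j \<omega>) \<partial>M) - complex_of_real (s\<^sup>2 / 2) * (\<integral>\<omega>. (?E (Suc j) \<omega> - ?E j \<omega>) * complex_of_real (w (\<Phi> (Suc j) \<omega>)) \<partial>M)"
  proof -
    have mkE: "integrable M (\<lambda>\<omega>. ?E j \<omega> * complex_of_real (?Pw (\<Phi> j \<omega>)))"
      "(\<integral>\<omega>. ?E j \<omega> * complex_of_real (w (\<Phi> (Suc j) \<omega>)) \<partial>M) = (\<integral>\<omega>. ?E j \<omega> * complex_of_real (?Pw (\<Phi> j \<omega>)) \<partial>M)"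
      using markov_complex_weight[OF start_past Ep eq_refl[OF norm_start_iexp] w_meas P_int_w w1] by blast+
    have r: "?E j \<omega> * ?r (\<Phi> j \<omega>) = ?E j \<omega> * ?\<psi> (\<Phi> j \<omega>) - ?E j \<omega> + complex_of_real (s\<^sup>2 / 2) *
        (complex_of_real v * ?E j \<omega> + ?E j \<omega> * complex_of_real (w (\<Phi> j \<omega>)) - ?E j \<omega> * complex_of_real (?Pw (\<Phi> j \<omega>)))" for \<omega>
      by (simp add: algebra_simps)
    define Y where "Y = (\<integral>\<omega>. ?E j \<omega> * complex_of_real (?Pw (\<Phi> j \<omega>)) \<partial>M)"
    have m1: "(\<integral>\<omega>. ?E j \<omega> * ?r (\<Phi> j \<omega>) \<partial>M) = A R s (Suc j) - A R s j + complex_of_real (s\<^sup>2 / 2) *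
        (complex_of_real v * A R s j + B R s j - Y)"
      unfolding r A1 Y_def using i_psi i_E[of j] i_w[of j j] mkE(1)
      by (simp only: Bochner_Integration.integral_add Bochner_Integration.integral_diff Bochner_Integration.integrable_add
         Bochner_Integration.integrable_diff integrable_mult_right integral_mult_right_zero A_def B_def)
    have m2: "(\<integral>\<omega>. (?E (Suc j) \<omega> - ?E j \<omega>) * complex_of_real (w (\<Phi> (Suc j) \<omega>)) \<partial>M)
        = B R s (Suc j) - Y"
      unfolding B_def left_diff_distrib Y_def mkE(2)[symmetric] using i_w[of "Suc j" "Suc j"] i_w[of j "Suc j"]
      by (rule Bochner_Integration.integral_diff)
    show ?thesis unfolding m1 m2 by (simp add: algebra_simps diff_divide_distrib add_divide_distrib)
  qed
  have "norm (A R s (Suc j) - A R s j + s\<^sup>2 / 2 * (v * A R s j + B R s j - B R s (Suc j)))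
     \<le> \<bar>s\<bar> powr (2 + \<eta>) * (16 * K R + 8 * \<kappa>) + s\<^sup>2 / 2 * (32 * \<bar>s\<bar> powr \<eta> * K R)"
    unfolding main
  proof (rule order_trans[OF norm_triangle_ineq4 add_mono[OF e1]])
    show "norm (complex_of_real (s\<^sup>2 / 2) * (\<integral>\<omega>. (?E (Suc j) \<omega> - ?E j \<omega>) * complex_of_real (w (\<Phi> (Suc j) \<omega>)) \<partial>M))
       \<le> s\<^sup>2 / 2 * (32 * \<bar>s\<bar> powr \<eta> * K R)"
      unfolding norm_mult norm_of_real using e2 by (intro mult_mono) auto
  qed
  also have "s\<^sup>2 = \<bar>s\<bar> powr 2" by (cases "s = 0") auto
  also have "\<bar>s\<bar> powr 2 / 2 * (32 * \<bar>s\<bar> powr \<eta> * K R) = \<bar>s\<bar> powr (2 + \<eta>) * (16 * K R)"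
    by (simp add: powr_add)
  finally show ?thesis by (simp add: algebra_simps)
qed

text \<open>Up to errors of higher order, \<open>A - s\<^sup>2 / 2 * B\<close> is multiplied by \<open>1 - s\<^sup>2 * v / 2\<close> in each step.\<close>

lemma A_approx:
  assumes "s\<^sup>2 * v \<le> 4"
  shows "norm (A R s n - complex_of_real ((1 - s\<^sup>2 * v / 2) ^ n) * complex_of_real (\<integral>\<omega>. start R \<omega> \<partial>M))
     \<le> real n * (\<bar>s\<bar> powr (2 + \<eta>) * (32 * K R + 8 * \<kappa>) + (s\<^sup>2)\<^sup>2 * (v / 4 * (1 + K R))) + s\<^sup>2 * (1 + K R)"
proof -
  let ?r = "1 - s\<^sup>2 * v / 2"
  let ?\<epsilon> = "\<bar>s\<bar> powr (2 + \<eta>) * (32 * K R + 8 * \<kappa>) + (s\<^sup>2)\<^sup>2 * (v / 4 * (1 + K R))"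
  define a where "a j = A R s j - complex_of_real (s\<^sup>2 / 2) * B R s j" for j
  have r1: "\<bar>?r\<bar> \<le> 1" using assms v by (simp add: abs_le_iff)
  have rn: "\<bar>?r ^ n\<bar> \<le> 1" using r1 by (simp add: power_abs power_le_one)
  have "norm (a n - ?r ^ n * a 0) \<le> n * ?\<epsilon>"
  proof (rule recursion_error[OF _ r1])
    fix j
    have "a (Suc j) - ?r * a j = (A R s (Suc j) - A R s j + s\<^sup>2 / 2 * (v * A R s j + B R s j - B R s (Suc j)))
        - complex_of_real ((s\<^sup>2)\<^sup>2 * v / 4) * B R s j"
      unfolding a_def by (simp add: algebra_simps power2_eq_square diff_divide_distrib add_divide_distrib)
    moreover have "norm (complex_of_real ((s\<^sup>2)\<^sup>2 * v / 4) * B R s j) \<le> ((s\<^sup>2)\<^sup>2 * v / 4) * (1 + K R)"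
      unfolding norm_mult norm_of_real using B_le[of R s j] v by (intro mult_mono) auto
    ultimately show "norm (a (Suc j) - ?r * a j) \<le> ?\<epsilon>"
      using norm_triangle_ineq4[of "A R s (Suc j) - A R s j + s\<^sup>2 / 2 * (v * A R s j + B R s j - B R s (Suc j))"
          "complex_of_real ((s\<^sup>2)\<^sup>2 * v / 4) * B R s j"] one_step[of R s j]
      by simp
  qed
  moreover have "A R s 0 = complex_of_real (\<integral>\<omega>. start R \<omega> \<partial>M)"
    unfolding A_def T_def by simp
  then have "A R s n - complex_of_real (?r ^ n) * complex_of_real (\<integral>\<omega>. start R \<omega> \<partial>M) = (a n - ?r ^ n * a 0)
     + (complex_of_real (s\<^sup>2 / 2) * B R s n - complex_of_real (?r ^ n) * (complex_of_real (s\<^sup>2 / 2) * B R s 0))"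
    unfolding a_def by (simp add: algebra_simps)
  moreover have b: "norm (complex_of_real (s\<^sup>2 / 2) * B R s j) \<le> s\<^sup>2 / 2 * (1 + K R)" for j
    unfolding norm_mult norm_of_real using B_le[of R s j] by (intro mult_mono) auto
  have "norm (complex_of_real (?r ^ n) * (complex_of_real (s\<^sup>2 / 2) * B R s 0)) \<le> 1 * (s\<^sup>2 / 2 * (1 + K R))"
    unfolding norm_mult[of "complex_of_real (?r ^ n)"] norm_of_real using rn b[of 0] by (intro mult_mono) auto
  then have "norm (complex_of_real (s\<^sup>2 / 2) * B R s n - complex_of_real (?r ^ n) * (complex_of_real (s\<^sup>2 / 2) * B R s 0)) \<le> s\<^sup>2 * (1 + K R)"
    using norm_triangle_ineq4[of "complex_of_real (s\<^sup>2 / 2) * B R s n" "complex_of_real (?r ^ n) * (complex_of_real (s\<^sup>2 / 2) * B R s 0)"] b[of n]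
    by simp
  ultimately show ?thesis
    using norm_triangle_ineq[of "a n - ?r ^ n * a 0" "complex_of_real (s\<^sup>2 / 2) * B R s n - complex_of_real (?r ^ n) * (complex_of_real (s\<^sup>2 / 2) * B R s 0)"]
    by simp
qed

definition S :: "nat \<Rightarrow> 'a \<Rightarrow> real" where "S n \<omega> = (\<Sum>i=1..n. u (\<Phi> i \<omega>) - Pu (\<Phi> i \<omega>))"

lemma S_meas[measurable]: "S n \<in> borel_measurable M" unfolding S_def[abs_def] by measurable

lemma S_eq: "S n \<omega> = T n \<omega> + Pu (\<Phi> 0 \<omega>) - Pu (\<Phi> n \<omega>)"
  by (induction n) (auto simp: S_def T_def)

lemma norm_iexp_diff_le: "norm (iexp a - iexp b) \<le> \<bar>a - b\<bar>"
proof -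
  have "iexp a - iexp b = iexp b * (iexp (a - b) - 1)"
    by (simp add: exp_add[symmetric] right_diff_distrib)
  then have "norm (iexp a - iexp b) = norm (iexp (a - b) - 1)" by (simp only: norm_mult norm_exp_i_times mult_1_left)
  then show ?thesis using iexp_approx1[of "a - b" 0] by simp
qed

text \<open>The sums \<open>S\<close> and \<open>T\<close> differ by the boundary term \<open>Pu (\<Phi> 0) - Pu (\<Phi> n)\<close>, whose moments are bounded on the
  start event.\<close>

lemma S_approx:
  "norm ((\<integral>\<omega>. iexp (s * S n \<omega>) \<partial>M) - A R s n) \<le> (1 - (\<integral>\<omega>. start R \<omega> \<partial>M)) + \<bar>s\<bar> * (2 + 2 * K R)"
proof -
  have ist: "integrable M (start R)" by (intro integrable_const_bound[where B=1]) (auto simp: start_01)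
  have iS: "integrable M (\<lambda>\<omega>. iexp (s * S n \<omega>))"
    by (intro integrable_const_bound[where B=1] AE_I2) (simp_all only: norm_exp_i_times order_refl, measurable)
  have i1: "integrable M (\<lambda>\<omega>. complex_of_real (start R \<omega>) * iexp (f \<omega>))" if [measurable]: "f \<in> borel_measurable M" for f
    by (rule Bochner_Integration.integrable_bound[OF ist]) (auto simp only: norm_start_iexp start_01 real_norm_def abs_of_nonneg intro!: AE_I2, measurable)
  let ?g = "\<lambda>\<omega>. complex_of_real (start R \<omega>) * iexp (s * S n \<omega>) - complex_of_real (start R \<omega>) * iexp (s * T n \<omega>)"
  have "norm (\<integral>\<omega>. ?g \<omega> \<partial>M) \<le> (2 * \<bar>s\<bar>) * (\<integral>\<omega>. start R \<omega> \<partial>M) + \<bar>s\<bar> * (\<integral>\<omega>. start R \<omega> * W (\<Phi> 0 \<omega>) \<partial>M) + \<bar>s\<bar> * (\<integral>\<omega>. start R \<omega> * W (\<Phi> n \<omega>) \<partial>M)"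
  proof (rule start_integrable)
    fix \<omega>
    have ng: "norm (?g \<omega>) = start R \<omega> * norm (iexp (s * S n \<omega>) - iexp (s * T n \<omega>))"
      unfolding right_diff_distrib[symmetric] norm_mult using start_01[of R \<omega>] by simp
    have "norm (iexp (s * S n \<omega>) - iexp (s * T n \<omega>)) \<le> \<bar>s\<bar> * (\<Upsilon> (\<Phi> 0 \<omega>) + \<Upsilon> (\<Phi> n \<omega>))"
    proof (rule order_trans[OF norm_iexp_diff_le])
      have "\<bar>S n \<omega> - T n \<omega>\<bar> \<le> \<Upsilon> (\<Phi> 0 \<omega>) + \<Upsilon> (\<Phi> n \<omega>)"
        unfolding S_eq using Pu_le[of "\<Phi> 0 \<omega>"] Pu_le[of "\<Phi> n \<omega>"] by linarith
      then show "\<bar>s * S n \<omega> - s * T n \<omega>\<bar> \<le> \<bar>s\<bar> * (\<Upsilon> (\<Phi> 0 \<omega>) + \<Upsilon> (\<Phi> n \<omega>))"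
        unfolding right_diff_distrib[symmetric] abs_mult by (intro mult_left_mono) auto
    qed
    also have "\<bar>s\<bar> * (\<Upsilon> (\<Phi> 0 \<omega>) + \<Upsilon> (\<Phi> n \<omega>)) \<le> \<bar>s\<bar> * (2 + W (\<Phi> 0 \<omega>) + W (\<Phi> n \<omega>))"
      using U_le[of "\<Phi> 0 \<omega>"] U_le[of "\<Phi> n \<omega>"] by (intro mult_left_mono) auto
    also have "\<dots> = 2 * \<bar>s\<bar> + \<bar>s\<bar> * W (\<Phi> 0 \<omega>) + \<bar>s\<bar> * W (\<Phi> n \<omega>)" by (simp add: distrib_left)
    finally show "norm (?g \<omega>) \<le> start R \<omega> * (2 * \<bar>s\<bar> + \<bar>s\<bar> * W (\<Phi> 0 \<omega>) + \<bar>s\<bar> * W (\<Phi> n \<omega>))"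
      unfolding ng by (rule mult_left_mono[OF _ start_01(1)])
  qed measurable
  also have "\<dots> \<le> (2 * \<bar>s\<bar>) * 1 + \<bar>s\<bar> * K R + \<bar>s\<bar> * K R"
    using start_mean_le moments(2) by (intro add_mono mult_left_mono) auto
  finally have 1: "norm (\<integral>\<omega>. ?g \<omega> \<partial>M) \<le> \<bar>s\<bar> * (2 + 2 * K R)" by (simp add: algebra_simps)
  let ?h = "\<lambda>\<omega>. iexp (s * S n \<omega>) - complex_of_real (start R \<omega>) * iexp (s * S n \<omega>)"
  have "norm (\<integral>\<omega>. ?h \<omega> \<partial>M) \<le> (\<integral>\<omega>. norm (?h \<omega>) \<partial>M)" by (rule integral_norm_bound)
  also have "\<dots> = (\<integral>\<omega>. 1 - start R \<omega> \<partial>M)"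
  proof (intro Bochner_Integration.integral_cong refl)
    fix \<omega>
    have "?h \<omega> = complex_of_real (1 - start R \<omega>) * iexp (s * S n \<omega>)" by (simp add: algebra_simps)
    then show "norm (?h \<omega>) = 1 - start R \<omega>" using start_01[of R \<omega>]
      by (simp only: norm_mult norm_exp_i_times norm_of_real) simp
  qed
  also have "\<dots> = 1 - (\<integral>\<omega>. start R \<omega> \<partial>M)" using ist by (simp add: prob_space)
  finally have 2: "norm (\<integral>\<omega>. ?h \<omega> \<partial>M) \<le> 1 - (\<integral>\<omega>. start R \<omega> \<partial>M)" .
  have "(\<integral>\<omega>. iexp (s * S n \<omega>) \<partial>M) - A R s n = (\<integral>\<omega>. ?h \<omega> \<partial>M) + (\<integral>\<omega>. ?g \<omega> \<partial>M)"
    unfolding A_def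
    using iS i1[of "\<lambda>\<omega>. s * S n \<omega>"] i1[of "\<lambda>\<omega>. s * T n \<omega>"] by (simp add: Bochner_Integration.integral_diff del: of_real_mult)
  then show ?thesis using 1 2 norm_triangle_ineq[of "\<integral>\<omega>. ?h \<omega> \<partial>M" "\<integral>\<omega>. ?g \<omega> \<partial>M"] by simp
qed

lemma start_mean_limit: "0 < \<epsilon> \<Longrightarrow> \<exists>R. 1 - (\<integral>\<omega>. start R \<omega> \<partial>M) < \<epsilon>"
proof -
  assume e: "0 < \<epsilon>"
  have "(\<lambda>n. \<integral>\<omega>. start (real n) \<omega> \<partial>M) \<longlonglongrightarrow> (\<integral>\<omega>. 1 \<partial>M)"
  proof (rule integral_dominated_convergence[where w="\<lambda>_. 1"])
    show "AE \<omega> in M. (\<lambda>n. start (real n) \<omega>) \<longlonglongrightarrow> 1"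
    proof (rule AE_I2)
      fix \<omega>
      obtain N where N: "W (\<Phi> 0 \<omega>) < real N" using reals_Archimedean2 by blast
      show "(\<lambda>n. start (real n) \<omega>) \<longlonglongrightarrow> 1"
        by (rule tendsto_eventually, rule eventually_sequentiallyI[of N]) (use N in \<open>auto simp: start_def indicator_def\<close>)
    qed
  qed (auto simp: start_01)
  then have "(\<lambda>n. \<integral>\<omega>. start (real n) \<omega> \<partial>M) \<longlonglongrightarrow> 1" by (simp add: prob_space)
  then have "\<forall>\<^sub>F n in sequentially. 1 - \<epsilon> < (\<integral>\<omega>. start (real n) \<omega> \<partial>M)" using e by (intro order_tendstoD) auto
  then obtain n where "1 - \<epsilon> < (\<integral>\<omega>. start (real n) \<omega> \<partial>M)" by (auto simp: eventually_sequentially)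
  then show ?thesis by (intro exI[of _ "real n"]) simp
qed

lemma char_limit: "(\<lambda>n. \<integral>\<omega>. iexp (t / sqrt n * S n \<omega>) \<partial>M) \<longlonglongrightarrow> complex_of_real (exp (- (t\<^sup>2 * v) / 2))"
proof (rule LIMSEQ_I)
  fix \<epsilon> :: real assume e: "0 < \<epsilon>"
  obtain R where R: "1 - (\<integral>\<omega>. start R \<omega> \<partial>M) < \<epsilon> / 4" using start_mean_limit[of "\<epsilon> / 4"] e by auto
  let ?p = "\<integral>\<omega>. start R \<omega> \<partial>M"
  let ?L = "exp (- (t\<^sup>2 * v) / 2)"
  have p: "0 \<le> ?p" "?p \<le> 1" using start_mean_le by (auto intro!: integral_nonneg_AE simp: start_01)
  have L: "0 \<le> ?L" "?L \<le> 1" using v by auto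
  define C1 where "C1 = \<bar>t\<bar> powr (2 + \<eta>) * (32 * K R + 8 * \<kappa>)"
  define C2 where "C2 = (t\<^sup>2)\<^sup>2 * (v / 4 * (1 + K R)) + t\<^sup>2 * (1 + K R)"
  define C3 where "C3 = \<bar>t\<bar> * (2 + 2 * K R)"
  define E where "E n = C1 * real n powr (- \<eta> / 2) + C2 * inverse (real n) + C3 * inverse (sqrt (real n))" for n
  define D where "D n = (1 + (- (t\<^sup>2 * v / 2)) / real n) ^ n" for n
  have "E \<longlonglongrightarrow> C1 * 0 + C2 * 0 + C3 * 0"
    unfolding E_def
  proof (intro tendsto_intros)
    show "(\<lambda>n. real n powr (- \<eta> / 2)) \<longlonglongrightarrow> 0"
      using eta by (intro tendsto_neg_powr filterlim_real_sequentially) auto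
    show "(\<lambda>n. inverse (real n)) \<longlonglongrightarrow> 0" by (rule lim_inverse_n)
    show "(\<lambda>n. inverse (sqrt (real n))) \<longlonglongrightarrow> 0"
      by (intro tendsto_inverse_0_at_top filterlim_compose[OF sqrt_at_top filterlim_real_sequentially])
  qed
  then have E: "\<forall>\<^sub>F n in sequentially. E n < \<epsilon> / 4" using e by (intro order_tendstoD) auto
  have "D \<longlonglongrightarrow> ?L" unfolding D_def using tendsto_exp_limit_sequentially[of "- (t\<^sup>2 * v / 2)"] by simp
  then have D: "\<forall>\<^sub>F n in sequentially. \<bar>D n - ?L\<bar> < \<epsilon> / 4"
    using e tendstoD[of D ?L sequentially "\<epsilon> / 4"] by (simp add: dist_real_def)
  obtain N0 :: nat where N0: "t\<^sup>2 * v < real N0" using reals_Archimedean2 by blast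
  have "\<forall>\<^sub>F n in sequentially. norm ((\<integral>\<omega>. iexp (t / sqrt n * S n \<omega>) \<partial>M) - complex_of_real ?L) < \<epsilon>"
    using E D eventually_ge_at_top[of "max N0 1"]
  proof eventually_elim
    case (elim n)
    define s where "s = t / sqrt (real n)"
    have n: "0 < real n" "real N0 \<le> real n" using elim by auto
    have s2: "s\<^sup>2 = t\<^sup>2 / real n" unfolding s_def using n by (simp add: power_divide)
    have "t\<^sup>2 * v \<le> 4 * real n" using N0 n by linarith
    then have s4: "s\<^sup>2 * v \<le> 4" unfolding s2 using n by (simp add: field_simps)
    have rD: "(1 - s\<^sup>2 * v / 2) ^ n = D n" unfolding D_def s2 by (simp add: field_simps)
    have sp: "real n * \<bar>s\<bar> powr (2 + \<eta>) = \<bar>t\<bar> powr (2 + \<eta>) * real n powr (- \<eta> / 2)"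
    proof -
      have "\<bar>s\<bar> = \<bar>t\<bar> * real n powr (- (1 / 2))"
      proof -
        have "real n powr (- (1 / 2)) = inverse (sqrt (real n))"
          by (simp only: powr_minus powr_half_sqrt of_nat_0_le_iff)
        moreover have "\<bar>s\<bar> = \<bar>t\<bar> * inverse (sqrt (real n))"
          unfolding s_def by (simp only: abs_mult divide_inverse abs_inverse real_sqrt_abs2 abs_of_nonneg[OF real_sqrt_ge_zero[OF of_nat_0_le_iff]])
        ultimately show ?thesis by simp
      qed
      then have "\<bar>s\<bar> powr (2 + \<eta>) = \<bar>t\<bar> powr (2 + \<eta>) * real n powr (- (1 / 2) * (2 + \<eta>))"
        by (simp add: powr_mult powr_powr)
      moreover have "real n * real n powr (- (1 / 2) * (2 + \<eta>)) = real n powr (- \<eta> / 2)"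
        using n powr_add[of "real n" 1 "- (1 / 2) * (2 + \<eta>)"] by (simp add: field_simps)
      ultimately show ?thesis by (metis mult.left_commute)
    qed
    have sE: "real n * (\<bar>s\<bar> powr (2 + \<eta>) * (32 * K R + 8 * \<kappa>) + (s\<^sup>2)\<^sup>2 * (v / 4 * (1 + K R))) + s\<^sup>2 * (1 + K R)
       + \<bar>s\<bar> * (2 + 2 * K R) = E n"
    proof -
      have "real n * (\<bar>s\<bar> powr (2 + \<eta>) * (32 * K R + 8 * \<kappa>)) = C1 * real n powr (- \<eta> / 2)"
        unfolding C1_def mult.assoc[symmetric] sp by (simp add: mult_ac)
      moreover have "real n * ((s\<^sup>2)\<^sup>2 * (v / 4 * (1 + K R))) + s\<^sup>2 * (1 + K R) = C2 * inverse (real n)"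
        unfolding C2_def s2 using n by (simp add: power2_eq_square field_simps)
      moreover have "\<bar>s\<bar> * (2 + 2 * K R) = C3 * inverse (sqrt (real n))"
        unfolding C3_def s_def by (simp add: abs_mult divide_inverse)
      ultimately show ?thesis unfolding E_def distrib_left[of "real n"] by linarith
    qed
    let ?I = "\<integral>\<omega>. iexp (s * S n \<omega>) \<partial>M"
    have "norm (?I - complex_of_real ?L) \<le> norm (?I - A R s n) + norm (A R s n - complex_of_real (D n) * complex_of_real ?p)
        + norm (complex_of_real (D n) * complex_of_real ?p - complex_of_real ?L)"
      using norm_triangle_ineq[of "?I - A R s n" "A R s n - complex_of_real ?L"]
         norm_triangle_ineq[of "A R s n - complex_of_real (D n) * complex_of_real ?p" "complex_of_real (D n) * complex_of_real ?p - complex_of_real ?L"]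
      by simp
    also have "\<dots> \<le> (1 - ?p) + E n + norm (complex_of_real (D n) * complex_of_real ?p - complex_of_real ?L)"
      using S_approx[of s n R] A_approx[OF s4, of R n] unfolding rD sE[symmetric] by linarith
    also have "norm (complex_of_real (D n) * complex_of_real ?p - complex_of_real ?L) = \<bar>D n * ?p - ?L\<bar>"
      by (simp flip: of_real_mult of_real_diff add: norm_of_real)
    also have "\<bar>D n * ?p - ?L\<bar> \<le> \<bar>D n - ?L\<bar> + (1 - ?p)"
    proof -
      have "D n * ?p - ?L = (D n - ?L) * ?p - ?L * (1 - ?p)" by (simp add: algebra_simps)
      then have "\<bar>D n * ?p - ?L\<bar> \<le> \<bar>D n - ?L\<bar> * \<bar>?p\<bar> + \<bar>?L * (1 - ?p)\<bar>"
        using abs_triangle_ineq4[of "(D n - ?L) * ?p" "?L * (1 - ?p)"] by (simp add: abs_mult)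
      also have "\<dots> \<le> \<bar>D n - ?L\<bar> * 1 + 1 * (1 - ?p)"
      proof (intro add_mono)
        show "\<bar>D n - ?L\<bar> * \<bar>?p\<bar> \<le> \<bar>D n - ?L\<bar> * 1" using p by (intro mult_left_mono) auto
        have "?L * (1 - ?p) \<le> 1 * (1 - ?p)" using p L by (intro mult_right_mono) auto
        then show "\<bar>?L * (1 - ?p)\<bar> \<le> 1 * (1 - ?p)" using p L by (simp only: abs_mult abs_of_nonneg diff_ge_0_iff_ge)
      qed
      finally show ?thesis by simp
    qed
    finally show ?case unfolding s_def[symmetric] using R elim by linarith
  qed
  then show "\<exists>no. \<forall>n\<ge>no. norm ((\<integral>\<omega>. iexp (t / sqrt n * S n \<omega>) \<partial>M) - complex_of_real ?L) < \<epsilon>"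
    by (simp add: eventually_sequentially)
qed

lemma chain_clt:
  "weak_conv_m (\<lambda>n. distr M borel (\<lambda>\<omega>. S n \<omega> / sqrt n)) (distr std_normal_distribution borel (\<lambda>z. sqrt v * z))"
proof (rule levy_continuity)
  interpret N: real_distribution std_normal_distribution by (rule real_dist_normal_dist)
  show "real_distribution (distr M borel (\<lambda>\<omega>. S n \<omega> / sqrt n))" for n
    by (intro real_distribution_distr) measurable
  show "real_distribution (distr std_normal_distribution borel (\<lambda>z. sqrt v * z))"
    by (intro N.real_distribution_distr) measurable
  fix t
  have 1: "char (distr M borel (\<lambda>\<omega>. S n \<omega> / sqrt n)) t = (\<integral>\<omega>. iexp (t / sqrt n * S n \<omega>) \<partial>M)" for n
    unfolding char_def by (subst integral_distr) (auto intro!: borel_measurable_iexp)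
  have 2: "char (distr std_normal_distribution borel (\<lambda>z. sqrt v * z)) t = complex_of_real (exp (- (t\<^sup>2 * v) / 2))"
  proof -
    have "char (distr std_normal_distribution borel (\<lambda>z. sqrt v * z)) t = char std_normal_distribution (t * sqrt v)"
      unfolding char_def by (subst integral_distr) (auto intro!: borel_measurable_iexp simp: mult.assoc)
    then show ?thesis using v by (simp add: char_std_normal_distribution power_mult_distrib)
  qed
  show "(\<lambda>n. char (distr M borel (\<lambda>\<omega>. S n \<omega> / sqrt n)) t) \<longlonglongrightarrow> char (distr std_normal_distribution borel (\<lambda>z. sqrt v * z)) t"
    unfolding 1 2 by (rule char_limit)
qed

end

section \<open>Local Lipschitz bounds for the Poisson solution\<close>

text \<open>The gradient bound on the target enters only through increments.\<close>

locale rwm_smooth = rwm +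
  fixes Kq :: "'a \<Rightarrow> real" and \<epsilon>q \<beta> cb \<epsilon>p \<gamma> :: real
  assumes eq_pos: "0 < \<epsilon>q" and Kq_int: "integrable lborel Kq"
    and q_lip: "\<And>z z'. norm (z - z') < \<epsilon>q \<Longrightarrow> \<bar>q z - q z'\<bar> \<le> norm (z - z') * Kq z"
    and beta: "1 / 2 < \<beta>" "\<beta> < 1" and cb: "0 < cb" and ep_pos: "0 < \<epsilon>p"
    and pi_lip: "\<And>x x'. norm (x - x') < \<epsilon>p \<Longrightarrow> \<bar>\<pi> x - \<pi> x'\<bar> \<le> norm (x - x') * (cb * \<pi> x powr \<beta>)"
    and gamma: "0 < \<gamma>" "\<gamma> < \<beta> - 1 / 2"
begin

text \<open>The first term arises from increments of the acceptance ratio, the second one from the gradient of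
  the integrand; \<open>2 * \<sigma> < 1\<close> makes the weight square integrable under \<open>\<pi>\<close>.\<close>

definition \<sigma> :: real where "\<sigma> = max (1 + \<gamma> - \<beta>) (1 / 2 - \<gamma>)"

lemma sigma: "0 < \<sigma>" "2 * \<sigma> < 1" "\<sigma> < 1" "\<gamma> \<le> \<sigma>" "1 + \<gamma> - \<beta> \<le> \<sigma>" "1 / 2 - \<gamma> \<le> \<sigma>"
  unfolding \<sigma>_def using beta gamma by (auto simp: max_def)

lemma gamma2: "2 * \<gamma> < 1" "\<gamma> < 1" "0 \<le> \<gamma>" "\<gamma> \<le> 1" using beta gamma by auto

abbreviation w :: "'a \<Rightarrow> real" where "w \<equiv> Vs \<sigma>"

lemma Vs_le_w: obtains D where "0 < D" "\<And>t x. 0 \<le> t \<Longrightarrow> t \<le> \<sigma> \<Longrightarrow> Vs t x \<le> D * w x"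
proof -
  obtain C where C: "C > 0" "\<And>x. \<pi> x \<le> C" using pi_bounded by blast
  define D where "D = max 1 C"
  have "Vs t x \<le> D * w x" if t: "0 \<le> t" "t \<le> \<sigma>" for t x
  proof -
    have "Vs t x = \<pi> x powr (\<sigma> - t) * w x" by (simp add: powr_add[symmetric])
    also have "\<pi> x powr (\<sigma> - t) \<le> D powr (\<sigma> - t)"
      using C(2)[of x] t unfolding D_def by (intro powr_mono2) auto
    also have "D powr (\<sigma> - t) \<le> D powr 1" using t sigma unfolding D_def by (intro powr_mono) auto
    finally show ?thesis unfolding D_def by (simp add: mult_right_mono)
  qed
  moreover have "0 < D" unfolding D_def by simp
  ultimately show ?thesis using that by blast
qed

lemma Kq_nonneg: "0 \<le> Kq z"
proof -
  obtain e :: 'a where e: "e \<in> Basis" using nonempty_Basis by blast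
  define z' where "z' = z + (\<epsilon>q / 2) *\<^sub>R e"
  have n: "norm (z - z') = \<epsilon>q / 2" unfolding z'_def using e eq_pos by simp
  have "\<bar>q z - q z'\<bar> \<le> (\<epsilon>q / 2) * Kq z" using q_lip[of z z'] n eq_pos by simp
  then have "0 \<le> (\<epsilon>q / 2) * Kq z" by (rule order_trans[OF abs_ge_zero])
  then show ?thesis using eq_pos by (simp add: zero_le_mult_iff)
qed

lemma Kq_meas[measurable]: "Kq \<in> borel_measurable borel" using Kq_int by simp

text \<open>Only the smoothness of \<open>\<pi>\<close> enters, because the increment \<open>z\<close> is kept fixed. The minimum in
  \<open>k\<close> is estimated by its geometric interpolation with the exponent that makes the powers of
  \<open>\<pi> (x + z)\<close> cancel.\<close>

lemma k_shift_diff: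
  assumes h: "norm (x - x') < \<epsilon>p" and g: "0 \<le> g" "g \<le> \<gamma>" and p: "\<pi> (x' + z) \<le> \<pi> (x + z)"
  shows "\<bar>k x (x + z) - k x' (x' + z)\<bar> * Vs g (x + z)
    \<le> 2 * cb * norm (x - x') * qq z * (Vs (1 + g - \<beta>) x + Vs (1 + g - \<beta>) x')"
proof -
  define a where "a = q z"
  define c where "c = q (- z)"
  define p where "p = \<pi> (x + z)"
  define p' where "p' = \<pi> (x' + z)"
  define m where "m = min (\<pi> x) (\<pi> x')"
  define \<theta> where "\<theta> = 1 + g - \<beta>"
  let ?h = "norm (x - x')"
  have th: "0 < \<theta>" "\<theta> < 1" unfolding \<theta>_def using g beta gamma by auto
  have pos: "0 < a" "0 < c" "0 < p" "0 < p'" "0 < m" "p' \<le> p"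
    unfolding a_def c_def p_def p'_def m_def using q_pos pi_pos assms by auto
  have qq: "qq z = a + c" unfolding qq_def a_def c_def by simp
  have kx: "k x (x + z) = min a (p * c / \<pi> x)" "k x' (x' + z) = min a (p' * c / \<pi> x')"
    unfolding k_def a_def c_def p_def p'_def by auto
  have mV: "m powr (- \<theta>) \<le> Vs \<theta> x + Vs \<theta> x'" unfolding m_def by (auto simp: min_def)
  have pp: "\<bar>p - p'\<bar> \<le> ?h * (cb * p powr \<beta>)"
    using pi_lip[of "x + z" "x' + z"] h unfolding p_def p'_def by simp
  \<comment> \<open>The kernel changes with the density at the endpoint, here, and at the starting point, in \<open>t2\<close>.\<close>
  have t1: "\<bar>min a (p * c / \<pi> x) - min a (p' * c / \<pi> x)\<bar> * p powr (- g) \<le> cb * ?h * qq z * Vs \<theta> x"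
  proof -
    have s: "0 < p * c / \<pi> x" "0 < p' * c / \<pi> x" "p' * c / \<pi> x \<le> p * c / \<pi> x"
      using pos pi_pos[of x] by (auto intro!: divide_right_mono mult_right_mono)
    have "\<bar>p * c / \<pi> x - p' * c / \<pi> x\<bar> / (p * c / \<pi> x) = \<bar>p - p'\<bar> / p"
    proof -
      have "p * c / \<pi> x - p' * c / \<pi> x = (p - p') * (c / \<pi> x)" by (simp add: algebra_simps diff_divide_distrib)
      then have "\<bar>p * c / \<pi> x - p' * c / \<pi> x\<bar> = \<bar>p - p'\<bar> * (c / \<pi> x)" using pos by (simp add: abs_mult)
      then show ?thesis using pos pi_pos[of x] by simp
    qed
    then have "\<bar>min a (p * c / \<pi> x) - min a (p' * c / \<pi> x)\<bar> \<le> min a (p * c / \<pi> x) * (\<bar>p - p'\<bar> / p)"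
      using min_diff_le_relative[OF pos(1) s(1,2)] s(3) by (simp only: max_absorb1)
    also have "\<dots> \<le> (a powr (1 - \<theta>) * (p * c / \<pi> x) powr \<theta>) * (?h * (cb * p powr \<beta>) / p)"
      using pos s th pp by (intro mult_mono min_le_powr_mult divide_right_mono) auto
    finally have "\<bar>min a (p * c / \<pi> x) - min a (p' * c / \<pi> x)\<bar> * p powr (- g)
       \<le> (a powr (1 - \<theta>) * (p * c / \<pi> x) powr \<theta>) * (?h * (cb * p powr \<beta>) / p) * p powr (- g)"
      by (rule mult_right_mono) simp
    also have "\<dots> = cb * ?h * (a powr (1 - \<theta>) * c powr \<theta>) * Vs \<theta> x * (p powr \<theta> * p powr \<beta> / p * p powr (- g))"
      by (simp add: powr_mult powr_divide powr_minus_divide mult_ac)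
    also have "p powr \<theta> * p powr \<beta> / p * p powr (- g) = 1"
    proof -
      have "p powr \<theta> * p powr \<beta> / p * p powr (- g) = p powr (\<theta> + \<beta> + (- 1) + (- g))"
        unfolding powr_add using pos by (simp add: powr_minus_divide)
      also have "\<theta> + \<beta> + (- 1) + (- g) = 0" unfolding \<theta>_def by simp
      finally show ?thesis using pos by simp
    qed
    also have "cb * ?h * (a powr (1 - \<theta>) * c powr \<theta>) * Vs \<theta> x * 1 \<le> cb * ?h * qq z * Vs \<theta> x"
      unfolding qq using pos th cb by (simp only: mult_1_right) (intro mult_right_mono mult_left_mono powr_mult_le_add, auto)
    finally show ?thesis .
  qed
  have t2: "\<bar>min a (p' * c / \<pi> x) - min a (p' * c / \<pi> x')\<bar> * p powr (- g) \<le> cb * ?h * qq z * m powr (- \<theta>)"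
  proof -
    have s: "0 < p' * c / \<pi> x" "0 < p' * c / \<pi> x'" using pos pi_pos by auto
    have mx: "max (p' * c / \<pi> x) (p' * c / \<pi> x') = p' * c / m"
    proof (cases "\<pi> x \<le> \<pi> x'")
      case True
      then have "p' * c / \<pi> x' \<le> p' * c / \<pi> x" using pos pi_pos by (intro divide_left_mono) auto
      then show ?thesis using True unfolding m_def by (simp add: max_absorb1 min_absorb1)
    next
      case False
      then have "p' * c / \<pi> x \<le> p' * c / \<pi> x'" using pos pi_pos by (intro divide_left_mono) auto
      then show ?thesis using False unfolding m_def by (simp add: max_absorb2 min_absorb2)
    qed
    define Om where "Om = max (\<pi> x) (\<pi> x')"
    have Om: "0 < Om" "m \<le> Om" "m * Om = \<pi> x * \<pi> x'"
      unfolding Om_def m_def using pi_pos by (auto simp: max_def min_def)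
    have oo: "\<bar>\<pi> x - \<pi> x'\<bar> \<le> ?h * (cb * Om powr \<beta>)"
      using pi_lip[of x x'] pi_lip[of x' x] h unfolding Om_def by (auto simp: max_def norm_minus_commute abs_minus_commute)
    have "\<bar>p' * c / \<pi> x - p' * c / \<pi> x'\<bar> / (p' * c / m) = \<bar>\<pi> x - \<pi> x'\<bar> / Om"
    proof -
      have "p' * c / \<pi> x - p' * c / \<pi> x' = (p' * c) * ((\<pi> x' - \<pi> x) / (\<pi> x * \<pi> x'))"
        by (simp add: diff_divide_distrib right_diff_distrib)
      then have "\<bar>p' * c / \<pi> x - p' * c / \<pi> x'\<bar> = (p' * c) * (\<bar>\<pi> x - \<pi> x'\<bar> / (m * Om))"
        unfolding Om(3) using pos by (simp add: abs_mult abs_minus_commute)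
      then show ?thesis using pos Om(1) by (simp only: times_divide_eq_left) (simp add: field_simps)
    qed
    then have "\<bar>min a (p' * c / \<pi> x) - min a (p' * c / \<pi> x')\<bar> \<le> min a (p' * c / m) * (\<bar>\<pi> x - \<pi> x'\<bar> / Om)"
      using min_diff_le_relative[OF pos(1) s] unfolding mx by simp
    also have "\<dots> \<le> (a powr (1 - g) * (p' * c / m) powr g) * (?h * (cb * Om powr \<beta>) / Om)"
      using pos g gamma2 oo Om by (intro mult_mono min_le_powr_mult divide_right_mono) auto
    also have "?h * (cb * Om powr \<beta>) / Om = ?h * cb * Om powr (\<beta> - 1)" using Om by (simp add: powr_diff)
    finally have "\<bar>min a (p' * c / \<pi> x) - min a (p' * c / \<pi> x')\<bar> * p powr (- g)
       \<le> (a powr (1 - g) * (p' * c / m) powr g) * (?h * cb * Om powr (\<beta> - 1)) * p powr (- g)"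
      by (rule mult_right_mono) simp
    also have "\<dots> \<le> (a powr (1 - g) * (p' * c / m) powr g) * (?h * cb * m powr (\<beta> - 1)) * p' powr (- g)"
      using pos Om g cb beta by (intro mult_mono powr_mono2' mult_left_mono) auto
    also have "\<dots> = cb * ?h * (a powr (1 - g) * c powr g) * (m powr (\<beta> - 1) * m powr (- g)) * (p' powr g * p' powr (- g))"
      by (simp add: powr_mult powr_divide powr_minus_divide mult_ac)
    also have "m powr (\<beta> - 1) * m powr (- g) = m powr (- \<theta>)" unfolding \<theta>_def by (simp add: powr_add[symmetric] algebra_simps)
    also have "p' powr g * p' powr (- g) = 1" using pos by (simp add: powr_add[symmetric])
    also have "cb * ?h * (a powr (1 - g) * c powr g) * m powr (- \<theta>) * 1 \<le> cb * ?h * qq z * m powr (- \<theta>)"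
      unfolding qq using pos g gamma2 cb by (simp only: mult_1_right) (intro mult_right_mono mult_left_mono powr_mult_le_add, auto)
    finally show ?thesis .
  qed
  have "\<bar>k x (x + z) - k x' (x' + z)\<bar> * p powr (- g) \<le>
     (\<bar>min a (p * c / \<pi> x) - min a (p' * c / \<pi> x)\<bar> + \<bar>min a (p' * c / \<pi> x) - min a (p' * c / \<pi> x')\<bar>) * p powr (- g)"
  proof -
    have "\<bar>r - t\<bar> \<le> \<bar>r - s\<bar> + \<bar>s - t\<bar>" for r s t :: real by linarith
    then show ?thesis unfolding kx by (intro mult_right_mono powr_ge_zero)
  qed
  also have "\<dots> \<le> cb * ?h * qq z * Vs \<theta> x + cb * ?h * qq z * m powr (- \<theta>)"
    using t1 t2 by (simp add: distrib_right)
  also have "\<dots> \<le> cb * ?h * qq z * (Vs \<theta> x + Vs \<theta> x') + cb * ?h * qq z * (Vs \<theta> x + Vs \<theta> x')"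
    using mV cb by (intro add_mono mult_left_mono) auto
  finally show ?thesis unfolding \<theta>_def p_def by (simp add: algebra_simps)
qed

text \<open>In each increment the difference of the two kernels is paired with the value of \<open>f\<close> at the
  point of larger density, and the increment of \<open>f\<close> with the kernel at the other point.\<close>

lemma jump_shift_lipschitz:
  assumes h: "norm (x - x') < \<epsilon>p" and f: "f \<in> borel_measurable borel" "\<And>y. \<bar>f y\<bar> \<le> B * Vs \<gamma> y" and B: "0 \<le> B"
    and phi: "\<phi> \<in> growth s" "0 \<le> s" "s \<le> 1" "\<And>y. 0 \<le> \<phi> y"
    and fphi: "\<And>y y'. norm (y - y') = norm (x - x') \<Longrightarrow> \<pi> y \<le> \<pi> y' \<Longrightarrow> \<bar>f y - f y'\<bar> \<le> norm (x - x') * \<phi> y"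
  shows "\<bar>jump f x - jump f x'\<bar> \<le> norm (x - x') * (jump \<phi> x + jump \<phi> x')
     + 4 * cb * B * norm (x - x') * (Vs (1 + \<gamma> - \<beta>) x + Vs (1 + \<gamma> - \<beta>) x')"
proof -
  let ?h = "norm (x - x')"
  let ?M = "Vs (1 + \<gamma> - \<beta>) x + Vs (1 + \<gamma> - \<beta>) x'"
  have fg: "f \<in> growth \<gamma>" using f by (rule growthI)
  have pm: "\<phi> \<in> borel_measurable borel" by (rule growth_meas[OF phi(1)])
  have key: "\<bar>k x (x + z) * f (x + z) - k x' (x' + z) * f (x' + z)\<bar>
      \<le> norm (x - x') * (k x' (x' + z) * \<phi> (x' + z)) + 2 * cb * B * norm (x - x') * (Vs (1 + \<gamma> - \<beta>) x + Vs (1 + \<gamma> - \<beta>) x') * qq z"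
    if h: "norm (x - x') < \<epsilon>p" and p: "\<pi> (x' + z) \<le> \<pi> (x + z)"
      and fp: "\<bar>f (x' + z) - f (x + z)\<bar> \<le> norm (x - x') * \<phi> (x' + z)" for x x' z
  proof -
    let ?h = "norm (x - x')"
    let ?M = "Vs (1 + \<gamma> - \<beta>) x + Vs (1 + \<gamma> - \<beta>) x'"
    have "k x (x + z) * f (x + z) - k x' (x' + z) * f (x' + z) =
       (k x (x + z) - k x' (x' + z)) * f (x + z) + k x' (x' + z) * (f (x + z) - f (x' + z))" by (simp add: algebra_simps)
    then have "\<bar>k x (x + z) * f (x + z) - k x' (x' + z) * f (x' + z)\<bar> \<le>
       \<bar>k x (x + z) - k x' (x' + z)\<bar> * \<bar>f (x + z)\<bar> + k x' (x' + z) * \<bar>f (x + z) - f (x' + z)\<bar>"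
      using abs_triangle_ineq[of "(k x (x + z) - k x' (x' + z)) * f (x + z)" "k x' (x' + z) * (f (x + z) - f (x' + z))"]
      by (simp add: abs_mult)
    also have "\<dots> \<le> \<bar>k x (x + z) - k x' (x' + z)\<bar> * (B * Vs \<gamma> (x + z)) + k x' (x' + z) * (?h * \<phi> (x' + z))"
      using f(2)[of "x + z"] fp by (intro add_mono mult_left_mono) (auto simp: abs_minus_commute)
    also have "\<dots> \<le> B * (2 * cb * ?h * qq z * ?M) + k x' (x' + z) * (?h * \<phi> (x' + z))"
      using mult_left_mono[OF k_shift_diff[OF h gamma2(3) order_refl p] B] by (intro add_right_mono) (simp only: mult_ac)
    also have "\<dots> = ?h * (k x' (x' + z) * \<phi> (x' + z)) + 2 * cb * B * ?h * ?M * qq z"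
    proof -
      have "B * (2 * cb * h * c * M) + d * (h * e) = h * (d * e) + 2 * cb * B * h * M * c" for h c M d e :: real
        by (simp add: algebra_simps)
      then show ?thesis .
    qed
    finally show ?thesis .
  qed
  have pt: "\<bar>k x (x + z) * f (x + z) - k x' (x' + z) * f (x' + z)\<bar>
      \<le> ?h * (k x (x + z) * \<phi> (x + z)) + ?h * (k x' (x' + z) * \<phi> (x' + z)) + 2 * cb * B * ?h * ?M * qq z" for z
  proof (cases "\<pi> (x' + z) \<le> \<pi> (x + z)")
    case True
    have "\<bar>f (x' + z) - f (x + z)\<bar> \<le> ?h * \<phi> (x' + z)"
      by (rule fphi) (use True in \<open>auto simp: norm_minus_commute\<close>)
    from key[OF h True this] show ?thesis using phi(4) by (auto intro: order_trans simp: add_increasing)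
  next
    case False
    have "\<bar>f (x + z) - f (x' + z)\<bar> \<le> ?h * \<phi> (x + z)"
      by (rule fphi) (use False in auto)
    then have 1: "\<bar>f (x + z) - f (x' + z)\<bar> \<le> norm (x' - x) * \<phi> (x + z)" by (simp add: norm_minus_commute)
    have 2: "norm (x' - x) < \<epsilon>p" using h by (simp add: norm_minus_commute)
    from key[OF 2 _ 1] False
    have "\<bar>k x' (x' + z) * f (x' + z) - k x (x + z) * f (x + z)\<bar> \<le> ?h * (k x (x + z) * \<phi> (x + z)) + 2 * cb * B * ?h * ?M * qq z"
      by (simp add: norm_minus_commute add.commute)
    moreover have "0 \<le> ?h * (k x' (x' + z) * \<phi> (x' + z))" using phi(4) by simp
    ultimately show ?thesis by (simp add: abs_minus_commute)
  qed
  have i: "integrable lborel (\<lambda>z. k x (x + z) * f (x + z))" "integrable lborel (\<lambda>z. k x' (x' + z) * f (x' + z))"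
    by (rule growth_integrable_k_shift[OF fg gamma2(3,4)])+
  have ip: "integrable lborel (\<lambda>z. k x (x + z) * \<phi> (x + z))" "integrable lborel (\<lambda>z. k x' (x' + z) * \<phi> (x' + z))"
    by (rule growth_integrable_k_shift[OF phi(1-3)])+
  have "\<bar>jump f x - jump f x'\<bar> = \<bar>\<integral>z. k x (x + z) * f (x + z) - k x' (x' + z) * f (x' + z) \<partial>lborel\<bar>"
    using i by (simp add: jump_shift[OF f(1)])
  also have "\<dots> \<le> (\<integral>z. \<bar>k x (x + z) * f (x + z) - k x' (x' + z) * f (x' + z)\<bar> \<partial>lborel)" by (rule integral_abs_bound)
  also have "\<dots> \<le> (\<integral>z. ?h * (k x (x + z) * \<phi> (x + z)) + ?h * (k x' (x' + z) * \<phi> (x' + z)) + 2 * cb * B * ?h * ?M * qq z \<partial>lborel)"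
    using i ip qq_integrable by (intro integral_mono pt) auto
  also have "\<dots> = ?h * jump \<phi> x + ?h * jump \<phi> x' + 2 * cb * B * ?h * ?M * 2"
    using ip qq_integrable by (simp add: jump_shift[OF pm] qq_mass)
  finally show ?thesis by (simp add: algebra_simps)
qed

lemma acc_lipschitz:
  assumes h: "norm (x - x') < \<epsilon>p"
  shows "\<bar>acc x - acc x'\<bar> \<le> 4 * cb * norm (x - x') * (Vs (1 - \<beta>) x + Vs (1 - \<beta>) x')"
proof -
  let ?h = "norm (x - x')"
  let ?M = "Vs (1 - \<beta>) x + Vs (1 - \<beta>) x'"
  have pt: "\<bar>k x (x + z) - k x' (x' + z)\<bar> \<le> 2 * cb * ?h * ?M * qq z" for z
  proof (cases "\<pi> (x' + z) \<le> \<pi> (x + z)")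
    case True
    then show ?thesis using k_shift_diff[OF h order_refl gamma2(3) True] by (simp add: mult_ac)
  next
    case False
    have 2: "norm (x' - x) < \<epsilon>p" using h by (simp add: norm_minus_commute)
    show ?thesis using k_shift_diff[OF 2 order_refl gamma2(3), of z] False
      by (simp add: mult_ac norm_minus_commute abs_minus_commute add.commute)
  qed
  have i: "integrable lborel (\<lambda>z. k x (x + z))" for x by (rule integrable_translate'[OF k_integrable])
  have acc_eq: "acc x = (\<integral>z. k x (x + z) \<partial>lborel)" for x
    using jump_shift[of "\<lambda>_. 1" x] by (simp add: jump_const)
  have "\<bar>acc x - acc x'\<bar> = \<bar>\<integral>z. k x (x + z) - k x' (x' + z) \<partial>lborel\<bar>"
    using i by (simp add: acc_eq)
  also have "\<dots> \<le> (\<integral>z. \<bar>k x (x + z) - k x' (x' + z)\<bar> \<partial>lborel)" by (rule integral_abs_bound)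
  also have "\<dots> \<le> (\<integral>z. 2 * cb * ?h * ?M * qq z \<partial>lborel)"
    using i qq_integrable by (intro integral_mono pt) auto
  also have "\<dots> = 4 * cb * ?h * ?M" by (simp add: qq_mass)
  finally show ?thesis .
qed

lemma diag_lipschitz:
  assumes h: "norm (x - x') < \<epsilon>p" and B: "0 \<le> B" "\<And>y. \<bar>f y\<bar> \<le> B * Vs \<gamma> y"
    and A: "\<And>x. A \<le> acc x" and fl: "\<bar>f x - f x'\<bar> \<le> L"
  shows "\<bar>(1 - acc x) * f x - (1 - acc x') * f x'\<bar> \<le> (1 - A) * L
     + 8 * cb * B * norm (x - x') * (Vs (1 + \<gamma> - \<beta>) x + Vs (1 + \<gamma> - \<beta>) x')"
proof -
  have key: "\<bar>(1 - acc x) * f x - (1 - acc x') * f x'\<bar> \<le> (1 - A) * L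
     + 8 * cb * B * norm (x - x') * (Vs (1 + \<gamma> - \<beta>) x + Vs (1 + \<gamma> - \<beta>) x')"
    if h: "norm (x - x') < \<epsilon>p" and p: "\<pi> x' \<le> \<pi> x" and fl: "\<bar>f x - f x'\<bar> \<le> L" for x x'
  proof -
    let ?h = "norm (x - x')"
    have V: "Vs \<gamma> x \<le> Vs \<gamma> x'" using p gamma pi_pos by (intro powr_mono2') auto
    have mult: "Vs (1 - \<beta>) y * Vs \<gamma> y = Vs (1 + \<gamma> - \<beta>) y" for y
      by (simp add: powr_add[symmetric] algebra_simps)
    have "(1 - acc x) * f x - (1 - acc x') * f x' = (1 - acc x') * (f x - f x') - (acc x - acc x') * f x"
      by (simp add: algebra_simps)
    then have "\<bar>(1 - acc x) * f x - (1 - acc x') * f x'\<bar> \<le> \<bar>1 - acc x'\<bar> * \<bar>f x - f x'\<bar> + \<bar>acc x - acc x'\<bar> * \<bar>f x\<bar>"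
      using abs_triangle_ineq4[of "(1 - acc x') * (f x - f x')" "(acc x - acc x') * f x"] by (simp add: abs_mult)
    also have "\<bar>1 - acc x'\<bar> * \<bar>f x - f x'\<bar> \<le> (1 - A) * L"
      using acc_le_1[of x'] A[of x'] fl by (intro mult_mono) auto
    also have "\<bar>acc x - acc x'\<bar> * \<bar>f x\<bar> \<le> (4 * cb * ?h * (Vs (1 - \<beta>) x + Vs (1 - \<beta>) x')) * (B * Vs \<gamma> x)"
      using acc_lipschitz[OF h] B(2)[of x] cb by (intro mult_mono) auto
    also have "\<dots> = 4 * cb * B * ?h * (Vs (1 - \<beta>) x * Vs \<gamma> x + Vs (1 - \<beta>) x' * Vs \<gamma> x)"
      by (simp add: algebra_simps)
    also have "\<dots> \<le> 4 * cb * B * ?h * (Vs (1 - \<beta>) x * Vs \<gamma> x + Vs (1 - \<beta>) x' * Vs \<gamma> x')"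
      using V cb B by (intro mult_left_mono add_left_mono) auto
    also have "\<dots> \<le> 8 * cb * B * ?h * (Vs (1 + \<gamma> - \<beta>) x + Vs (1 + \<gamma> - \<beta>) x')"
      unfolding mult using cb B by (intro mult_right_mono) auto
    finally show ?thesis by simp
  qed
  show ?thesis
  proof (cases "\<pi> x' \<le> \<pi> x")
    case True
    then show ?thesis by (rule key[OF h _ fl])
  next
    case False
    have 1: "norm (x' - x) < \<epsilon>p" "\<bar>f x' - f x\<bar> \<le> L" using h fl by (simp_all add: norm_minus_commute abs_minus_commute)
    show ?thesis using key[OF 1(1) _ 1(2)] False
      by (simp only: norm_minus_commute[of x' x] abs_minus_commute[of "(1 - acc x') * f x'"] add.commute[of "Vs (1 + \<gamma> - \<beta>) x'"] not_le less_imp_le)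
  qed
qed

text \<open>In the tails all increments are shifted; the contraction factor comes from the smallness of
  \<open>jump w\<close> there. In a bounded region only the part of \<open>f\<close> far away is shifted, and the part of \<open>f\<close>
  near the origin is integrated against the difference of the kernels, where the proposal density
  supplies the smoothness.\<close>

lemma transop_lipschitz:
  obtains \<rho> C \<epsilon> where "0 \<le> \<rho>" "\<rho> < 1" "0 \<le> C" "0 < \<epsilon>" "\<epsilon> \<le> 1"
    "\<And>\<delta> f B Om x x'. \<delta> \<le> \<epsilon> \<Longrightarrow> f \<in> borel_measurable borel \<Longrightarrow> 0 \<le> B \<Longrightarrow> 0 \<le> Om \<Longrightarrow> (\<And>y. \<bar>f y\<bar> \<le> B * Vs \<gamma> y) \<Longrightarrow>
       (\<And>y y'. norm (y - y') < \<delta> \<Longrightarrow> \<bar>f y - f y'\<bar> \<le> Om * norm (y - y') * (w y + w y')) \<Longrightarrow>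
       norm (x - x') < \<delta> \<Longrightarrow> \<bar>transop f x - transop f x'\<bar> \<le> (C * B + \<rho> * Om) * norm (x - x') * (w x + w x')"
proof -
  let ?\<theta> = "1 + \<gamma> - \<beta>"
  have th: "0 \<le> ?\<theta>" "?\<theta> \<le> \<sigma>" using sigma beta gamma by auto
  obtain D where D: "0 < D" "\<And>t x. 0 \<le> t \<Longrightarrow> t \<le> \<sigma> \<Longrightarrow> Vs t x \<le> D * w x" using Vs_le_w by blast
  obtain A where A: "0 < A" "\<And>x. A \<le> acc x" using acc_lower by blast
  have A1: "A \<le> 1" using A(2)[of 0] acc_le_1[of 0] by linarith
  obtain R where R: "\<And>x. R \<le> norm x \<Longrightarrow> jump w x \<le> A / 4 * w x"
    using jump_tail[of \<sigma> "A / 4"] sigma A by auto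
  define R0 where "R0 = max R 0 + 1"
  obtain R' where R': "\<And>x s. norm x \<le> R0 + 1 \<Longrightarrow> 0 \<le> s \<Longrightarrow> s \<le> 1 \<Longrightarrow>
      jump (\<lambda>y. indicator {y. R' < norm y} y * Vs s y) x \<le> A / 4 * Vs s x"
    using jump_outside[of "A / 4" "R0 + 1"] A by auto
  obtain Cp where Cp: "Cp > 0" "\<And>x. \<pi> x \<le> Cp" using pi_bounded by blast
  obtain Vm where Vm: "0 < Vm" "\<And>x. norm x \<le> max (R' + 1) 0 \<Longrightarrow> Vs \<gamma> x \<le> Vm" using Vs_bounded_on_ball by blast
  obtain Im where Im: "0 < Im" "\<And>x. norm x \<le> R0 + 1 \<Longrightarrow> Vs 1 x \<le> Im" using Vs_bounded_on_ball by blast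
  define \<epsilon> where "\<epsilon> = min 1 (min \<epsilon>q \<epsilon>p)"
  have e: "0 < \<epsilon>" "\<epsilon> \<le> 1" "\<epsilon> \<le> \<epsilon>q" "\<epsilon> \<le> \<epsilon>p" unfolding \<epsilon>_def using eq_pos ep_pos by auto
  define IK where "IK = (\<integral>z. Kq z \<partial>lborel)"
  have IK: "0 \<le> IK" unfolding IK_def by (intro integral_nonneg_AE) (auto simp: Kq_nonneg)
  define G where "G = IK + Cp * Im * IK + Cp * (cb * Cp powr \<beta>) * Im * Im"
  have G: "0 \<le> G" unfolding G_def using IK Cp Im cb by simp
  define C where "C = Vm * G * D + 2 * D + 12 * cb * D"
  have C: "0 \<le> C" unfolding C_def using Vm G D cb by simp
  \<comment> \<open>Holding contributes \<open>1 - A\<close> and the jumps contribute at most \<open>A / 2\<close>.\<close>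
  define \<rho> where "\<rho> = 1 - A / 2"
  have near: "(\<integral>y. \<bar>k x y - k x' y\<bar> \<partial>lborel) \<le> G * norm (x - x') \<and> integrable lborel (\<lambda>y. \<bar>k x y - k x' y\<bar>)"
    if h: "norm (x - x') < \<epsilon>" and x: "norm x \<le> R0 + 1" "norm x' \<le> R0 + 1" for x x'
  proof -
    let ?h = "norm (x - x')"
    have I: "1 / \<pi> x \<le> Im" "1 / \<pi> x' \<le> Im" using Im(2)[of x] Im(2)[of x'] x by (auto simp: powr_minus_divide)
    have pt: "\<bar>k x y - k x' y\<bar> \<le> ?h * Kq (y - x) + Cp * Im * ?h * Kq (x - y) + Cp * (?h * (cb * Cp powr \<beta>)) * Im * Im * q (x' - y)" for y
    proof -
      have mm: "\<bar>min a b - min a' b'\<bar> \<le> \<bar>a - a'\<bar> + \<bar>b - b'\<bar>" for a b a' b' :: real by (auto simp: min_def)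
      have 1: "\<bar>q (y - x) - q (y - x')\<bar> \<le> ?h * Kq (y - x)"
        using q_lip[of "y - x" "y - x'"] h e by (simp add: norm_minus_commute)
      have 2: "\<bar>q (x - y) - q (x' - y)\<bar> \<le> ?h * Kq (x - y)"
        using q_lip[of "x - y" "x' - y"] h e by simp
      have 3: "\<bar>\<pi> x - \<pi> x'\<bar> \<le> ?h * (cb * Cp powr \<beta>)"
      proof -
        have "\<bar>\<pi> x - \<pi> x'\<bar> \<le> ?h * (cb * \<pi> x powr \<beta>)" using pi_lip[of x x'] h e by simp
        also have "\<dots> \<le> ?h * (cb * Cp powr \<beta>)" using Cp cb beta by (intro mult_left_mono powr_mono2) auto
        finally show ?thesis .
      qed
      have "\<pi> y * q (x - y) / \<pi> x - \<pi> y * q (x' - y) / \<pi> x' =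
         \<pi> y * (1 / \<pi> x) * (q (x - y) - q (x' - y)) + \<pi> y * (\<pi> x' - \<pi> x) * (1 / \<pi> x) * (1 / \<pi> x') * q (x' - y)"
        by (simp add: field_simps)
      then have "\<bar>\<pi> y * q (x - y) / \<pi> x - \<pi> y * q (x' - y) / \<pi> x'\<bar> \<le>
         \<pi> y * (1 / \<pi> x) * \<bar>q (x - y) - q (x' - y)\<bar> + \<pi> y * \<bar>\<pi> x - \<pi> x'\<bar> * (1 / \<pi> x) * (1 / \<pi> x') * q (x' - y)"
        using abs_triangle_ineq[of "\<pi> y * (1 / \<pi> x) * (q (x - y) - q (x' - y))" "\<pi> y * (\<pi> x' - \<pi> x) * (1 / \<pi> x) * (1 / \<pi> x') * q (x' - y)"]
        by (simp add: abs_mult abs_minus_commute)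
      also have "\<dots> \<le> Cp * Im * (?h * Kq (x - y)) + Cp * (?h * (cb * Cp powr \<beta>)) * Im * Im * q (x' - y)"
        using 2 3 I Cp(2)[of y] Cp(1) Im(1) cb by (intro add_mono mult_mono mult_nonneg_nonneg) auto
      finally show ?thesis unfolding k_def using mm[of "q (y - x)" "\<pi> y * q (x - y) / \<pi> x" "q (y - x')" "\<pi> y * q (x' - y) / \<pi> x'"] 1
        by (simp add: mult.assoc)
    qed
    have i: "integrable lborel (\<lambda>y. \<bar>k x y - k x' y\<bar>)" by (intro integrable_abs Bochner_Integration.integrable_diff k_integrable)
    note ik = integrable_translate[OF Kq_int, of x] integrable_reflect_at[OF Kq_int, of x] integrable_reflect_at[OF q_integrable, of x']
    have "(\<integral>y. \<bar>k x y - k x' y\<bar> \<partial>lborel) \<le> (\<integral>y. ?h * Kq (y - x) + Cp * Im * ?h * Kq (x - y) + Cp * (?h * (cb * Cp powr \<beta>)) * Im * Im * q (x' - y) \<partial>lborel)"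
      using i ik by (intro integral_mono pt) auto
    also have "\<dots> = ?h * IK + Cp * Im * ?h * IK + Cp * (?h * (cb * Cp powr \<beta>)) * Im * Im"
      using ik by (simp add: IK_def integral_translate integral_reflect_at q_mass)
    also have "\<dots> = G * ?h" unfolding G_def by (simp add: algebra_simps)
    finally show ?thesis using i by blast
  qed
  have main: "\<bar>transop f x - transop f x'\<bar> \<le> (C * B + \<rho> * Om) * norm (x - x') * (w x + w x')"
    if de: "\<delta> \<le> \<epsilon>" and f[measurable]: "f \<in> borel_measurable borel" and B: "0 \<le> B" and Om: "0 \<le> Om" and fB: "\<And>y. \<bar>f y\<bar> \<le> B * Vs \<gamma> y"
      and lip: "\<And>y y'. norm (y - y') < \<delta> \<Longrightarrow> \<bar>f y - f y'\<bar> \<le> Om * norm (y - y') * (w y + w y')"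
      and hd: "norm (x - x') < \<delta>" for \<delta> f B Om x x'
  proof -
    let ?h = "norm (x - x')"
    let ?W = "w x + w x'"
    have h: "?h < \<epsilon>" using hd de by simp
    have hp: "?h < \<epsilon>p" using h e by simp
    have Mth: "Vs ?\<theta> x + Vs ?\<theta> x' \<le> D * ?W" using D(2)[OF th, of x] D(2)[OF th, of x'] by (simp add: distrib_left)
    have lip2: "\<bar>f y - f y'\<bar> \<le> ?h * (2 * Om * w y)" if "norm (y - y') = ?h" "\<pi> y \<le> \<pi> y'" for y y'
    proof -
      have "w y' \<le> w y" using that pi_pos sigma by (intro powr_mono2') auto
      then have "Om * ?h * (w y + w y') \<le> Om * ?h * (2 * w y)" using Om by (intro mult_left_mono) auto
      then show ?thesis using lip[of y y'] that hd by (simp add: mult_ac)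
    qed
    have diag: "\<bar>(1 - acc x) * f x - (1 - acc x') * f x'\<bar> \<le> (1 - A) * (Om * ?h * ?W) + 8 * cb * B * ?h * (D * ?W)"
    proof (rule order_trans[OF diag_lipschitz[OF hp B fB A(2) lip[OF hd]] add_left_mono])
      show "8 * cb * B * ?h * (Vs ?\<theta> x + Vs ?\<theta> x') \<le> 8 * cb * B * ?h * (D * ?W)"
        using Mth cb B by (intro mult_left_mono) auto
    qed
    have jmp: "\<bar>jump f x - jump f x'\<bar> \<le> (Vm * G * D * B + 2 * D * B + 4 * cb * D * B + A / 2 * Om) * ?h * ?W"
    proof (cases "norm x \<le> R0")
      case False
      have h1: "?h < 1" using h e by simp
      have "norm x \<le> norm x' + ?h" using norm_triangle_sub[of x x'] by simp
      then have xR: "R \<le> norm x" "R \<le> norm x'" using False h1 unfolding R0_def by auto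
      have pg: "(\<lambda>y. 2 * Om * w y) \<in> growth \<sigma>" by (rule growth_cmult[OF Vs_growth])
      have "\<bar>jump f x - jump f x'\<bar> \<le> ?h * (jump (\<lambda>y. 2 * Om * w y) x + jump (\<lambda>y. 2 * Om * w y) x')
          + 4 * cb * B * ?h * (Vs ?\<theta> x + Vs ?\<theta> x')"
        by (rule jump_shift_lipschitz[OF hp f fB B pg _ _ _ lip2]) (use sigma Om in auto)
      also have "\<dots> \<le> ?h * (2 * Om * (A / 4 * ?W)) + 4 * cb * B * ?h * (D * ?W)"
      proof (intro add_mono mult_left_mono Mth)
        have "jump (\<lambda>y. 2 * Om * w y) x + jump (\<lambda>y. 2 * Om * w y) x' = 2 * Om * (jump w x + jump w x')"
          by (simp add: jump_cmult distrib_left)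
        also have "\<dots> \<le> 2 * Om * (A / 4 * w x + A / 4 * w x')" using R[OF xR(1)] R[OF xR(2)] Om by (intro mult_left_mono add_mono) auto
        finally show "jump (\<lambda>y. 2 * Om * w y) x + jump (\<lambda>y. 2 * Om * w y) x' \<le> 2 * Om * (A / 4 * ?W)" by (simp add: distrib_left)
      qed (use cb B in auto)
      also have "\<dots> = (4 * cb * D * B + A / 2 * Om) * (?h * ?W)" by (simp add: field_simps)
      also have "\<dots> \<le> (Vm * G * D * B + 2 * D * B + 4 * cb * D * B + A / 2 * Om) * (?h * ?W)"
        using Vm G D B by (intro mult_right_mono) auto
      finally show ?thesis by (simp add: mult.assoc)
    next
      case True
      have h1: "?h < 1" using h e by simp
      have "norm x' \<le> norm x + ?h" using norm_triangle_sub[of x' x] by (simp add: norm_minus_commute)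
      then have xR: "norm x \<le> R0 + 1" "norm x' \<le> R0 + 1" using True h1 by auto
      \<comment> \<open>A cutoff with Lipschitz constant 1 that separates the part of \<open>f\<close> near the origin.\<close>
      define ct where "ct y = max 0 (min 1 (R' + 1 - norm y))" for y :: 'a
      have [measurable]: "ct \<in> borel_measurable borel" unfolding ct_def[abs_def] by measurable
      have chi: "0 \<le> ct y" "ct y \<le> 1" "R' + 1 < norm y \<Longrightarrow> ct y = 0" "norm y \<le> R' \<Longrightarrow> ct y = 1" for y
        unfolding ct_def by auto
      have chil: "\<bar>ct y - ct y'\<bar> \<le> norm (y - y')" for y y'
        using norm_triangle_ineq3[of y y'] unfolding ct_def by (auto simp: max_def min_def abs_if split: if_splits)
      define f1 where "f1 = (\<lambda>y. ct y * f y)"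
      define f2 where "f2 = (\<lambda>y. (1 - ct y) * f y)"
      have fm[measurable]: "f1 \<in> borel_measurable borel" "f2 \<in> borel_measurable borel" unfolding f1_def f2_def by measurable
      have f1B: "\<bar>f1 y\<bar> \<le> B * Vs \<gamma> y" and f2B: "\<bar>f2 y\<bar> \<le> B * Vs \<gamma> y" for y
        using fB[of y] chi[of y] mult_left_le_one_le[of "\<bar>f y\<bar>" "ct y"] mult_left_le_one_le[of "\<bar>f y\<bar>" "1 - ct y"]
        unfolding f1_def f2_def by (auto simp: abs_mult)
      have f12: "f = (\<lambda>y. f1 y + f2 y)" unfolding f1_def f2_def by (auto simp: algebra_simps)
      have fgs: "f1 \<in> growth \<gamma>" "f2 \<in> growth \<gamma>" using growthI[OF fm(1) f1B] growthI[OF fm(2) f2B] by auto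
      have f1V: "\<bar>f1 y\<bar> \<le> B * Vm" for y
      proof (cases "norm y \<le> R' + 1")
        case True
        then have "norm y \<le> max (R' + 1) 0" by simp
        from Vm(2)[OF this] f1B[of y] mult_left_mono[OF _ B] show ?thesis by (meson order_trans)
      next
        case False
        then show ?thesis using B Vm by (simp add: f1_def chi(3))
      qed
      have j1: "\<bar>jump f1 x - jump f1 x'\<bar> \<le> (B * Vm) * (G * ?h)"
      proof -
        have "\<bar>jump f1 x - jump f1 x'\<bar> = \<bar>\<integral>y. (k x y - k x' y) * f1 y \<partial>lborel\<bar>"
          unfolding jump_def using growth_integrable_k[OF fgs(1) gamma2(3,4)] by (simp add: left_diff_distrib)
        also have "\<dots> \<le> (\<integral>y. \<bar>(k x y - k x' y) * f1 y\<bar> \<partial>lborel)" by (rule integral_abs_bound)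
        also have "\<dots> \<le> (\<integral>y. (B * Vm) * \<bar>k x y - k x' y\<bar> \<partial>lborel)"
        proof (rule integral_mono)
          show "integrable lborel (\<lambda>y. \<bar>(k x y - k x' y) * f1 y\<bar>)"
            using growth_integrable_k[OF fgs(1) gamma2(3,4)] by (intro integrable_abs) (simp add: left_diff_distrib)
          show "integrable lborel (\<lambda>y. (B * Vm) * \<bar>k x y - k x' y\<bar>)" using near[OF h xR] by (intro integrable_mult_right) blast
          show "\<bar>(k x y - k x' y) * f1 y\<bar> \<le> (B * Vm) * \<bar>k x y - k x' y\<bar>" for y
            using mult_left_mono[OF f1V[of y], of "\<bar>k x y - k x' y\<bar>"] by (simp add: abs_mult mult.commute)
        qed
        also have "\<dots> = (B * Vm) * (\<integral>y. \<bar>k x y - k x' y\<bar> \<partial>lborel)" by simp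
        also have "\<dots> \<le> (B * Vm) * (G * ?h)" using near[OF h xR] B Vm by (intro mult_left_mono) auto
        finally show ?thesis .
      qed
      define \<phi> where "\<phi> = (\<lambda>y. 2 * Om * (indicator {y. R' < norm y} y * w y) + B * Vs \<gamma> y)"
      have ig: "(\<lambda>y. indicator {y. R' < norm y} y * w y) \<in> growth \<sigma>"
        by (rule growthI[where B=1]) (auto simp: indicator_def)
      have pg: "\<phi> \<in> growth \<sigma>" unfolding \<phi>_def
        by (intro growth_add growth_cmult ig growth_mono[OF Vs_growth sigma(4)])
      have p0: "0 \<le> \<phi> y" for y unfolding \<phi>_def using Om B by simp
      have f2l: "\<bar>f2 y - f2 y'\<bar> \<le> ?h * \<phi> y" if yy: "norm (y - y') = ?h" "\<pi> y \<le> \<pi> y'" for y y'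
      proof -
        have "f2 y - f2 y' = (1 - ct y) * (f y - f y') + (ct y' - ct y) * f y'"
          unfolding f2_def by (simp add: algebra_simps)
        then have "\<bar>f2 y - f2 y'\<bar> \<le> (1 - ct y) * \<bar>f y - f y'\<bar> + \<bar>ct y' - ct y\<bar> * \<bar>f y'\<bar>"
          using abs_triangle_ineq[of "(1 - ct y) * (f y - f y')" "(ct y' - ct y) * f y'"] chi[of y] by (simp add: abs_mult)
        also have "(1 - ct y) * \<bar>f y - f y'\<bar> \<le> indicator {y. R' < norm y} y * (?h * (2 * Om * w y))"
          using chi[of y] lip2[OF yy] by (intro mult_mono) (auto simp: indicator_def)
        also have "\<bar>ct y' - ct y\<bar> * \<bar>f y'\<bar> \<le> ?h * (B * Vs \<gamma> y)"
        proof (intro mult_mono)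
          show "\<bar>ct y' - ct y\<bar> \<le> ?h" using chil[of y y'] yy by (simp add: abs_minus_commute)
          have "Vs \<gamma> y' \<le> Vs \<gamma> y" using yy pi_pos gamma by (intro powr_mono2') auto
          then show "\<bar>f y'\<bar> \<le> B * Vs \<gamma> y" using fB[of y'] mult_left_mono[OF _ B] by (meson order_trans)
        qed auto
        finally show ?thesis unfolding \<phi>_def by (simp add: algebra_simps)
      qed
      have jphi: "jump \<phi> u \<le> (A / 2 * Om) * w u + 2 * B * (D * w u)" if u: "norm u \<le> R0 + 1" for u
      proof -
        have "jump \<phi> u = 2 * Om * jump (\<lambda>y. indicator {y. R' < norm y} y * w y) u + B * jump (Vs \<gamma>) u"
          unfolding \<phi>_def
          using sigma by (subst jump_add[OF growth_cmult[OF ig] growth_cmult[OF growth_mono[OF Vs_growth sigma(4)]]]) (auto simp: jump_cmult)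
        also have "\<dots> \<le> 2 * Om * (A / 4 * w u) + B * (2 * Vs \<gamma> u)"
          using Om B sigma by (intro add_mono mult_left_mono R'[OF u] jump_Vs_le gamma2) auto
        also have "\<dots> \<le> 2 * Om * (A / 4 * w u) + B * (2 * (D * w u))"
          using D(2)[OF gamma2(3) sigma(4), of u] B Om A by (intro add_mono mult_left_mono) auto
        finally show ?thesis by (simp add: algebra_simps)
      qed
      have "\<bar>jump f2 x - jump f2 x'\<bar> \<le> ?h * (jump \<phi> x + jump \<phi> x') + 4 * cb * B * ?h * (Vs ?\<theta> x + Vs ?\<theta> x')"
        by (rule jump_shift_lipschitz[OF hp fm(2) f2B B pg _ _ p0 f2l]) (use sigma in auto)
      also have "\<dots> \<le> ?h * (((A / 2 * Om) * w x + 2 * B * (D * w x)) + ((A / 2 * Om) * w x' + 2 * B * (D * w x'))) + 4 * cb * B * ?h * (D * ?W)"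
        using jphi[OF xR(1)] jphi[OF xR(2)] cb B by (intro add_mono mult_left_mono Mth) auto
      also have "\<dots> = (2 * D * B + 4 * cb * D * B + A / 2 * Om) * ?h * ?W" by (simp add: algebra_simps)
      finally have j2: "\<bar>jump f2 x - jump f2 x'\<bar> \<le> (2 * D * B + 4 * cb * D * B + A / 2 * Om) * ?h * ?W" .
      have "1 \<le> D * ?W" using D(2)[of 0 x] sigma D(1) by (simp add: distrib_left add_increasing2)
      then have "(B * Vm) * (G * ?h) * 1 \<le> (B * Vm) * (G * ?h) * (D * ?W)" using B Vm G by (intro mult_left_mono) auto
      moreover have "jump f x - jump f x' = (jump f1 x - jump f1 x') + (jump f2 x - jump f2 x')"
        by (subst (1 2) f12) (simp add: jump_add[OF fgs gamma2(3,4)])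
      ultimately have "\<bar>jump f x - jump f x'\<bar> \<le> (B * Vm) * (G * ?h) * (D * ?W) + (2 * D * B + 4 * cb * D * B + A / 2 * Om) * ?h * ?W"
        using j1 j2 by linarith
      also have "\<dots> = (Vm * G * D * B + 2 * D * B + 4 * cb * D * B + A / 2 * Om) * ?h * ?W" by (simp add: algebra_simps)
      finally show ?thesis .
    qed
    have "transop f x - transop f x' = (jump f x - jump f x') + ((1 - acc x) * f x - (1 - acc x') * f x')"
      unfolding transop_def by simp
    then have "\<bar>transop f x - transop f x'\<bar> \<le> (Vm * G * D * B + 2 * D * B + 4 * cb * D * B + A / 2 * Om) * ?h * ?W
        + ((1 - A) * (Om * ?h * ?W) + 8 * cb * B * ?h * (D * ?W))"
      using jmp diag by linarith
    also have "\<dots> = (C * B + \<rho> * Om) * ?h * ?W" unfolding C_def \<rho>_def by (simp add: field_simps)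
    finally show ?thesis .
  qed
  have "0 \<le> \<rho>" "\<rho> < 1" unfolding \<rho>_def using A A1 by auto
  then show ?thesis by (rule that[OF _ _ C e(1,2) main])
qed

text \<open>The constant \<open>L\<close> in the proof is the fixed point of the affine recursion that \<open>transop_lipschitz\<close> gives
  for the Lipschitz constants of the partial sums.\<close>

lemma poisson_solution_lipschitz:
  assumes f: "f \<in> growth \<gamma>" and mf: "mean f = 0" and ef: "0 < \<epsilon>f" and cf: "0 \<le> cf"
    and fl: "\<And>x x'. norm (x - x') < \<epsilon>f \<Longrightarrow> \<bar>f x - f x'\<bar> \<le> norm (x - x') * (cf * \<pi> x powr (\<gamma> - 1 / 2))"
  obtains u C \<epsilon> where "u \<in> growth \<gamma>" "\<And>x. u x - transop u x = f x" "0 \<le> C" "0 < \<epsilon>"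
    "\<And>x x'. norm (x - x') < \<epsilon> \<Longrightarrow> \<bar>u x - u x'\<bar> \<le> C * norm (x - x') * (w x + w x')"
proof -
  obtain u S B where u: "u \<in> growth \<gamma>" "\<And>x. u x - transop u x = f x"
    and S: "\<And>x. S 0 x = 0" "\<And>n x. S (Suc n) x = f x + transop (S n) x" "\<And>n. S n \<in> growth \<gamma>"
      "\<And>n x. \<bar>S n x\<bar> \<le> B * Vs \<gamma> x" "\<And>x. (\<lambda>n. S n x) \<longlonglongrightarrow> u x"
    using poisson_equation[OF gamma(1) gamma2(2) f mf] by metis
  obtain \<rho> C \<epsilon> where tl: "0 \<le> \<rho>" "\<rho> < 1" "0 \<le> C" "0 < \<epsilon>" "\<epsilon> \<le> 1"
    "\<And>\<delta> f B Om x x'. \<delta> \<le> \<epsilon> \<Longrightarrow> f \<in> borel_measurable borel \<Longrightarrow> 0 \<le> B \<Longrightarrow> 0 \<le> Om \<Longrightarrow> (\<And>y. \<bar>f y\<bar> \<le> B * Vs \<gamma> y) \<Longrightarrow>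
       (\<And>y y'. norm (y - y') < \<delta> \<Longrightarrow> \<bar>f y - f y'\<bar> \<le> Om * norm (y - y') * (w y + w y')) \<Longrightarrow>
       norm (x - x') < \<delta> \<Longrightarrow> \<bar>transop f x - transop f x'\<bar> \<le> (C * B + \<rho> * Om) * norm (x - x') * (w x + w x')"
    using transop_lipschitz by blast
  obtain D where D: "0 < D" "\<And>t x. 0 \<le> t \<Longrightarrow> t \<le> \<sigma> \<Longrightarrow> Vs t x \<le> D * w x" using Vs_le_w by blast
  have B0: "0 \<le> B"
  proof -
    have "0 \<le> B * Vs \<gamma> 0" using S(4)[of 0 0] by linarith
    then show ?thesis by (simp add: zero_le_mult_iff)
  qed
  define \<epsilon>' where "\<epsilon>' = min \<epsilon> \<epsilon>f"
  have e': "0 < \<epsilon>'" "\<epsilon>' \<le> \<epsilon>" "\<epsilon>' \<le> \<epsilon>f" unfolding \<epsilon>'_def using tl ef by auto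
  define L where "L = (cf * D + C * B) / (1 - \<rho>)"
  have L: "0 \<le> L" "cf * D + C * B + \<rho> * L = L"
    unfolding L_def using tl cf D B0 by (auto simp: field_simps)
  have lipS: "\<bar>S n x - S n x'\<bar> \<le> L * norm (x - x') * (w x + w x')" if "norm (x - x') < \<epsilon>'" for n x x'
    using that
  proof (induction n arbitrary: x x')
    case 0
    then show ?case using L by (simp add: S(1))
  next
    case (Suc n)
    have 1: "\<bar>transop (S n) x - transop (S n) x'\<bar> \<le> (C * B + \<rho> * L) * norm (x - x') * (w x + w x')"
      by (rule tl(6)[OF e'(2) growth_meas[OF S(3)] B0 L(1) S(4) Suc.IH Suc.prems])
    have "\<bar>f x - f x'\<bar> \<le> norm (x - x') * (cf * \<pi> x powr (\<gamma> - 1 / 2))" using fl[of x x'] Suc.prems e' by simp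
    also have "\<dots> \<le> norm (x - x') * (cf * (D * (w x + w x')))"
    proof (intro mult_left_mono)
      have "\<pi> x powr (\<gamma> - 1 / 2) \<le> D * w x" using D(2)[of "1 / 2 - \<gamma>" x] sigma gamma beta by simp
      also have "\<dots> \<le> D * (w x + w x')" using D by (intro mult_left_mono) auto
      finally show "\<pi> x powr (\<gamma> - 1 / 2) \<le> D * (w x + w x')" .
    qed (use cf in auto)
    finally have 2: "\<bar>f x - f x'\<bar> \<le> (cf * D) * norm (x - x') * (w x + w x')" by (simp add: mult_ac)
    have "\<bar>S (Suc n) x - S (Suc n) x'\<bar> \<le> (cf * D) * norm (x - x') * (w x + w x') + (C * B + \<rho> * L) * norm (x - x') * (w x + w x')"
      unfolding S(2) using 1 2 by linarith
    also have "\<dots> = (cf * D + C * B + \<rho> * L) * norm (x - x') * (w x + w x')" by (simp add: algebra_simps)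
    finally show ?case unfolding L(2) .
  qed
  have "\<bar>u x - u x'\<bar> \<le> L * norm (x - x') * (w x + w x')" if "norm (x - x') < \<epsilon>'" for x x'
    by (rule LIMSEQ_le_const2[OF tendsto_rabs[OF tendsto_diff[OF S(5) S(5)]]]) (use lipS[OF that] in auto)
  then show ?thesis using that[OF u L(1) e'(1)] by blast
qed

end

section \<open>Stability of the discretized Poisson equation\<close>

text \<open>The cell \<open>J 0\<close> may be unbounded, so that only the weight is compared there. The weight enters through
  ratios, hence \<open>W\<close> may be replaced by a positive multiple.\<close>

definition cells :: "('a::euclidean_space \<Rightarrow> real) \<Rightarrow> nat \<Rightarrow> (nat \<Rightarrow> 'a set) \<Rightarrow> (nat \<Rightarrow> 'a) \<Rightarrow> real \<Rightarrow> bool" where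
  "cells W m J a \<delta> \<longleftrightarrow> 0 \<le> \<delta> \<and> (\<Union>j\<le>m. J j) = UNIV \<and> disjoint_family_on J {..m} \<and>
     (\<forall>j\<le>m. J j \<in> sets borel \<and> a j \<in> J j) \<and> (\<forall>j\<in>{1..m}. \<forall>x\<in>J j. norm (x - a j) \<le> \<delta>) \<and>
     (\<forall>j\<le>m. \<forall>x\<in>J j. W (a j) \<le> (1 + \<delta>) * W x)"

text \<open>A sum over the cells, so that measurability is evident.\<close>

definition representative :: "nat \<Rightarrow> (nat \<Rightarrow> 'a set) \<Rightarrow> (nat \<Rightarrow> 'a::euclidean_space) \<Rightarrow> 'a \<Rightarrow> 'a" where
  "representative m J a x = (\<Sum>j\<le>m. indicator (J j) x *\<^sub>R a j)"

lemma cells_cell: "cells W m J a \<delta> \<Longrightarrow> \<exists>j\<le>m. x \<in> J j"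
  unfolding cells_def by blast

lemma cells_sum:
  assumes "cells W m J a \<delta>" "j \<le> m" "x \<in> J j"
  shows "(\<Sum>i\<le>m. f i * indicator (J i) x) = (f j :: real)" "representative m J a x = a j"
proof -
  have other: "x \<notin> J i" if "i \<le> m" "i \<noteq> j" for i
    using assms that unfolding cells_def disjoint_family_on_def by blast
  have "(\<Sum>i\<le>m. f i * indicator (J i) x) = (\<Sum>i\<in>{j}. f i * indicator (J i) x)"
    using assms other by (intro sum.mono_neutral_right) (auto simp: indicator_def)
  then show "(\<Sum>i\<le>m. f i * indicator (J i) x) = f j" using assms by simp
  have "representative m J a x = (\<Sum>i\<in>{j}. indicator (J i) x *\<^sub>R a i)"
    unfolding representative_def using assms other by (intro sum.mono_neutral_right) (auto simp: indicator_def)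
  then show "representative m J a x = a j" using assms by simp
qed

lemma representative_meas:
  assumes "cells W m J a \<delta>"
  shows "representative m J a \<in> borel_measurable borel"
  unfolding representative_def[abs_def]
  using assms by (intro borel_measurable_sum borel_measurable_scaleR borel_measurable_indicator) (auto simp: cells_def)

lemma sum_sq_le4: "((a::real) + b + c + d)\<^sup>2 \<le> 4 * (a\<^sup>2 + b\<^sup>2 + c\<^sup>2 + d\<^sup>2)"
proof -
  have "0 \<le> (a - b)\<^sup>2 + (a - c)\<^sup>2 + (a - d)\<^sup>2 + (b - c)\<^sup>2 + (b - d)\<^sup>2 + (c - d)\<^sup>2" by simp
  then show ?thesis by (simp add: power2_eq_square algebra_simps)
qed

lemma sum_sq_le5: "((a::real) + b + c + d + e)\<^sup>2 \<le> 5 * (a\<^sup>2 + b\<^sup>2 + c\<^sup>2 + d\<^sup>2 + e\<^sup>2)"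
proof -
  have "0 \<le> (a - b)\<^sup>2 + (a - c)\<^sup>2 + (a - d)\<^sup>2 + (a - e)\<^sup>2 + (b - c)\<^sup>2 + (b - d)\<^sup>2 + (b - e)\<^sup>2 + (c - d)\<^sup>2 + (c - e)\<^sup>2 + (d - e)\<^sup>2"
    by simp
  then show ?thesis by (simp add: power2_eq_square algebra_simps)
qed

lemma sum_sq_le2: "((a::real) + b)\<^sup>2 \<le> 2 * (a\<^sup>2 + b\<^sup>2)"
proof -
  have "0 \<le> (a - b)\<^sup>2" by simp
  then show ?thesis by (simp add: power2_eq_square algebra_simps)
qed

context rwm_smooth begin

abbreviation V :: "'a \<Rightarrow> real" where "V \<equiv> Vs \<gamma>"

text \<open>The bound depends on the discretization only through \<open>\<delta>\<close>: on the representatives the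
  discrete equation is the equation for \<open>transop\<close>, whose contraction factor survives a mesh that
  distorts \<open>V\<close> by little.\<close>

lemma scheme_solution_bound:
  assumes F: "F \<in> growth \<gamma>"
  obtains K \<delta>0 where "0 \<le> K" "0 < \<delta>0"
    "\<And>m J a \<delta> f c x y. cells V m J a \<delta> \<Longrightarrow> \<delta> \<le> \<delta>0 \<Longrightarrow> f \<in> borel_measurable borel \<Longrightarrow>
       (\<And>j x. j \<le> m \<Longrightarrow> x \<in> J j \<Longrightarrow> f x = f (a j)) \<Longrightarrow>
       (\<And>j. j \<le> m \<Longrightarrow> f (a j) - transop f (a j) = F (a j) - c) \<Longrightarrow> \<bar>f x - f y\<bar> \<le> K * (V x + V y)"
proof -
  obtain b q1 where bq: "0 < b" "0 < q1" "q1 < 1" and contr: "\<And>f L x y. f \<in> borel_measurable borel \<Longrightarrow>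
    (\<And>x y. \<bar>f x - f y\<bar> \<le> L * (2 + b * V x + b * V y)) \<Longrightarrow>
    \<bar>transop f x - transop f y\<bar> \<le> q1 * L * (2 + b * V x + b * V y)"
    using oscillation_contraction[OF gamma(1) gamma2(2)] by blast
  obtain BF where BF: "0 \<le> BF" "\<And>x. \<bar>F x\<bar> \<le> BF * V x" using growthE[OF F] by metis
  obtain E where E: "0 \<le> E" "\<And>x. \<bar>1\<bar> \<le> E * V x" using growthE[OF const_growth[OF gamma2(3), of 1]] by metis
  define q2 where "q2 = (1 + q1) / 2"
  have q2: "q2 < 1" "0 < q2" unfolding q2_def using bq by auto
  \<comment> \<open>Passing from a state to its representative may inflate \<open>V\<close> by the factor \<open>1 + \<delta>\<close>, which must not use up
    the contraction factor \<open>q1\<close>.\<close>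
  define \<delta>0 where "\<delta>0 = min 1 (q2 / q1 - 1)"
  have d0: "0 < \<delta>0" "\<delta>0 \<le> 1" "q1 * (1 + \<delta>0) \<le> q2"
  proof -
    have "1 < q2 / q1" using bq unfolding q2_def by (simp add: field_simps)
    then show "0 < \<delta>0" "\<delta>0 \<le> 1" unfolding \<delta>0_def by auto
    have "q1 * (1 + \<delta>0) \<le> q1 * (q2 / q1)" unfolding \<delta>0_def using bq by (intro mult_left_mono) auto
    then show "q1 * (1 + \<delta>0) \<le> q2" using bq by simp
  qed
  define L0 where "L0 = BF / b / (1 - q2)"
  have L0: "0 \<le> L0" unfolding L0_def using BF bq q2 by simp
  define K where "K = L0 * 2 * (E + b)"
  have "\<bar>f x - f y\<bar> \<le> K * (V x + V y)"
    if c: "cells V m J a \<delta>" and de: "\<delta> \<le> \<delta>0" and f: "f \<in> borel_measurable borel"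
      and const: "\<And>j x. j \<le> m \<Longrightarrow> x \<in> J j \<Longrightarrow> f x = f (a j)"
      and eq: "\<And>j. j \<le> m \<Longrightarrow> f (a j) - transop f (a j) = F (a j) - c0" for m J a \<delta> f c0 x y
  proof -
    have d: "0 \<le> \<delta>" using c by (simp add: cells_def)
    let ?d = "\<lambda>x y. 2 + b * V x + b * V y"
    have dpos: "0 < ?d x y" for x y using bq by (intro add_pos_nonneg) auto
    define S where "S = (\<lambda>(i, j). \<bar>f (a i) - f (a j)\<bar> / ?d (a i) (a j)) ` ({..m} \<times> {..m})"
    have S: "finite S" "S \<noteq> {}" unfolding S_def by auto
    \<comment> \<open>The best oscillation constant on the representatives; the equation improves it by \<open>q2\<close>.\<close>
    define L where "L = Max S"
    have Lle: "\<bar>f (a i) - f (a j)\<bar> \<le> L * ?d (a i) (a j)" if "i \<le> m" "j \<le> m" for i j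
    proof -
      have "\<bar>f (a i) - f (a j)\<bar> / ?d (a i) (a j) \<in> S" unfolding S_def using that by force
      then have "\<bar>f (a i) - f (a j)\<bar> / ?d (a i) (a j) \<le> L" unfolding L_def using S by simp
      then show ?thesis using dpos[of "a i" "a j"] by (simp only: pos_divide_le_eq)
    qed
    have Lnn: "0 \<le> L"
    proof -
      have "0 \<le> L * ?d (a 0) (a 0)" using Lle[of 0 0] by simp
      then show ?thesis using dpos[of "a 0" "a 0"] by (simp add: zero_le_mult_iff)
    qed
    have osc: "\<bar>f x - f y\<bar> \<le> (L * (1 + \<delta>)) * ?d x y" for x y
    proof -
      obtain i j where ij: "i \<le> m" "x \<in> J i" "j \<le> m" "y \<in> J j" using cells_cell[OF c] by blast
      have "V (a i) \<le> (1 + \<delta>) * V x" "V (a j) \<le> (1 + \<delta>) * V y" using c ij unfolding cells_def by blast+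
      then have "?d (a i) (a j) \<le> 2 * (1 + \<delta>) + b * ((1 + \<delta>) * V x) + b * ((1 + \<delta>) * V y)"
        using bq d by (intro add_mono mult_left_mono) auto
      then have "L * ?d (a i) (a j) \<le> L * ((1 + \<delta>) * ?d x y)"
        using Lnn by (intro mult_left_mono) (auto simp: algebra_simps)
      then show ?thesis using Lle[OF ij(1,3)] const[OF ij(1,2)] const[OF ij(3,4)] by (simp add: mult.assoc)
    qed
    have "s \<le> BF / b + q2 * L" if "s \<in> S" for s
    proof -
      obtain i j where ij: "i \<le> m" "j \<le> m" "s = \<bar>f (a i) - f (a j)\<bar> / ?d (a i) (a j)"
        using \<open>s \<in> S\<close> unfolding S_def by auto
      have "\<bar>transop f (a i) - transop f (a j)\<bar> \<le> q1 * (L * (1 + \<delta>)) * ?d (a i) (a j)"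
        by (rule contr[OF f osc])
      also have "\<dots> \<le> q2 * L * ?d (a i) (a j)"
      proof (rule mult_right_mono)
        have "q1 * (1 + \<delta>) \<le> q1 * (1 + \<delta>0)" using de bq by (intro mult_left_mono) auto
        then have "q1 * (1 + \<delta>) * L \<le> q2 * L" using d0 Lnn by (intro mult_right_mono) auto
        then show "q1 * (L * (1 + \<delta>)) \<le> q2 * L" by (simp add: mult_ac)
      qed (use dpos less_imp_le in blast)
      finally have t: "\<bar>transop f (a i) - transop f (a j)\<bar> \<le> q2 * L * ?d (a i) (a j)" .
      have "\<bar>F (a i) - F (a j)\<bar> \<le> BF * V (a i) + BF * V (a j)" using BF(2)[of "a i"] BF(2)[of "a j"] by linarith
      also have "\<dots> \<le> BF / b * ?d (a i) (a j)" using BF bq by (simp add: field_simps)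
      finally have "\<bar>f (a i) - f (a j)\<bar> \<le> (BF / b + q2 * L) * ?d (a i) (a j)"
        using t eq[OF ij(1)] eq[OF ij(2)] by (simp only: distrib_right)
      then show ?thesis unfolding ij(3) using dpos[of "a i" "a j"] by (simp only: pos_divide_le_eq)
    qed
    then have "L \<le> BF / b + q2 * L" unfolding L_def using S by simp
    then have "L * (1 - q2) \<le> BF / b" by (simp add: algebra_simps)
    then have "L \<le> L0" unfolding L0_def using q2 by (subst pos_le_divide_eq) auto
    then have "L * (1 + \<delta>) \<le> L0 * 2" using d de d0 Lnn L0 by (intro mult_mono) auto
    then have "\<bar>f x - f y\<bar> \<le> (L0 * 2) * ?d x y"
      using osc[of x y] dpos[of x y] by (meson mult_right_mono less_imp_le order_trans)
    also have "(L0 * 2) * ?d x y \<le> (L0 * 2) * ((E + b) * (V x + V y))"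
    proof (rule mult_left_mono)
      show "?d x y \<le> (E + b) * (V x + V y)" using E(2)[of x] E(2)[of y] by (simp add: algebra_simps)
    qed (use L0 in simp)
    finally show ?thesis unfolding K_def by (simp only: mult.assoc)
  qed
  then show ?thesis using that[of K \<delta>0] L0 E bq d0 unfolding K_def by (auto simp: less_imp_le)
qed

lemma Vs_transfer:
  assumes "Vs \<gamma> y \<le> (1 + \<delta>) * Vs \<gamma> x" "0 \<le> \<delta>" "\<delta> \<le> 1" "0 \<le> t"
  shows "Vs t y \<le> 2 powr (t / \<gamma>) * Vs t x"
proof -
  have e: "Vs t z = (Vs \<gamma> z) powr (t / \<gamma>)" for z using gamma by (simp add: powr_powr)
  have "Vs \<gamma> y \<le> 2 * Vs \<gamma> x"
    using order_trans[OF assms(1) mult_right_mono[of "1 + \<delta>" 2 "Vs \<gamma> x"]] assms(3) by simp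
  then have "(Vs \<gamma> y) powr (t / \<gamma>) \<le> (2 * Vs \<gamma> x) powr (t / \<gamma>)" using gamma assms by (intro powr_mono2) auto
  then show ?thesis unfolding e by (simp add: powr_mult)
qed

lemma jump_weighted_cauchy_schwarz:
  assumes u: "u \<in> growth \<gamma>" and Y[measurable]: "Y \<in> sets borel"
  shows "(jump (\<lambda>y. indicator Y y * \<bar>u y\<bar>) x)\<^sup>2 \<le> jump (\<lambda>y. indicator Y y * V y) x * jump (\<lambda>y. (u y)\<^sup>2 * \<pi> y powr \<gamma>) x"
proof (rule cauchy_schwarz_from_quadratic)
  have [measurable]: "u \<in> borel_measurable borel" by (rule growth_meas[OF u])
  have g2: "(\<lambda>y. (u y)\<^sup>2 * \<pi> y powr \<gamma>) \<in> growth \<gamma>"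
  proof -
    have "(\<lambda>y. \<pi> y powr \<gamma>) \<in> growth (- \<gamma>)" by (rule growthI[where B=1]) auto
    from growth_mult[OF growth_power2[OF u] this] show ?thesis by simp
  qed
  have g1: "(\<lambda>y. indicator Y y * \<bar>u y\<bar>) \<in> growth \<gamma>"
  proof -
    obtain B where "\<And>x. \<bar>u x\<bar> \<le> B * V x" "0 \<le> B" using growthE[OF u] by metis
    then show ?thesis by (intro growthI[where B=B]) (auto simp: indicator_def)
  qed
  have g3: "(\<lambda>y. indicator Y y * V y) \<in> growth \<gamma>" by (rule growthI[where B=1]) (auto simp: indicator_def)
  note i = growth_integrable_k[OF g1 gamma2(3,4), of x] growth_integrable_k[OF g2 gamma2(3,4), of x] growth_integrable_k[OF g3 gamma2(3,4), of x]
  fix t :: real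
  have "0 \<le> (\<integral>y. k x y * (indicator Y y * V y - 2 * t * (indicator Y y * \<bar>u y\<bar>) + t\<^sup>2 * ((u y)\<^sup>2 * \<pi> y powr \<gamma>)) \<partial>lborel)"
  proof (intro integral_nonneg_AE AE_I2 mult_nonneg_nonneg k_nonneg)
    fix y
    have VV: "V y * \<pi> y powr \<gamma> = 1" by (simp add: powr_add[symmetric])
    show "0 \<le> indicator Y y * V y - 2 * t * (indicator Y y * \<bar>u y\<bar>) + t\<^sup>2 * ((u y)\<^sup>2 * \<pi> y powr \<gamma>)"
    proof (cases "y \<in> Y")
      case True
      have "0 \<le> V y * (1 - t * \<bar>u y\<bar> * \<pi> y powr \<gamma>)\<^sup>2" by simp
      also have "\<dots> = V y - 2 * t * \<bar>u y\<bar> * (V y * \<pi> y powr \<gamma>) + t\<^sup>2 * (u y)\<^sup>2 * \<pi> y powr \<gamma> * (V y * \<pi> y powr \<gamma>)"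
        by (simp add: power2_eq_square algebra_simps)
      finally show ?thesis using True unfolding VV by (simp add: mult_ac)
    qed simp
  qed
  also have "\<dots> = jump (\<lambda>y. indicator Y y * V y) x - 2 * t * jump (\<lambda>y. indicator Y y * \<bar>u y\<bar>) x + t\<^sup>2 * jump (\<lambda>y. (u y)\<^sup>2 * \<pi> y powr \<gamma>) x"
  proof -
    have "k x y * (A - 2 * t * B + t\<^sup>2 * C) = k x y * A - (2 * t) * (k x y * B) + t\<^sup>2 * (k x y * C)" for y A B C
      by (simp add: algebra_simps)
    then show ?thesis unfolding jump_def using i by simp
  qed
  finally show "0 \<le> jump (\<lambda>y. indicator Y y * V y) x - 2 * t * jump (\<lambda>y. indicator Y y * \<bar>u y\<bar>) x + t\<^sup>2 * jump (\<lambda>y. (u y)\<^sup>2 * \<pi> y powr \<gamma>) x" .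
qed (auto simp: jump_def intro!: integral_nonneg_AE)

text \<open>A Schur test with the weight \<open>V\<close>. The row at \<open>x\<close> may be taken at a nearby point \<open>r x\<close>, because
  reversibility turns the weighted row into a column at \<open>y\<close> and the proposal density at \<open>r x - y\<close> is
  dominated by integrable functions of \<open>x - y\<close>.\<close>

lemma row_schur:
  obtains C1 where "1 \<le> C1"
    "\<And>u r E Y \<eta>. u \<in> growth \<gamma> \<Longrightarrow> r \<in> borel_measurable borel \<Longrightarrow> E \<in> sets borel \<Longrightarrow> Y \<in> sets borel \<Longrightarrow> 0 \<le> \<eta> \<Longrightarrow>
      (\<And>x. x \<in> E \<Longrightarrow> norm (x - r x) \<le> 1) \<Longrightarrow> (\<And>x. x \<in> E \<Longrightarrow> norm (x - r x) < \<epsilon>q) \<Longrightarrow>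
      (\<And>x. x \<in> E \<Longrightarrow> Vs 1 (r x) \<le> 2 powr (1 / \<gamma>) * Vs 1 x) \<Longrightarrow>
      (\<And>x. x \<in> E \<Longrightarrow> jump (\<lambda>y. indicator Y y * V y) (r x) \<le> \<eta> * V (r x)) \<Longrightarrow>
      mean (\<lambda>x. (indicator E x * jump (\<lambda>y. indicator Y y * \<bar>u y\<bar>) (r x))\<^sup>2) \<le> \<eta> * C1 * mean (\<lambda>x. (u x)\<^sup>2)"
proof -
  define C0 where "C0 = 2 powr (1 / \<gamma>)"
  have C0: "1 \<le> C0" unfolding C0_def using gamma by (simp add: ge_one_powr_ge_zero)
  define \<zeta> where "\<zeta> t = qq t + Kq t + Kq (- t)" for t
  have zeta_int: "integrable lborel \<zeta>"
    unfolding \<zeta>_def[abs_def] by (intro Bochner_Integration.integrable_add qq_integrable Kq_int integrable_reflect)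
  have zeta_nn: "0 \<le> \<zeta> t" for t unfolding \<zeta>_def by (simp add: Kq_nonneg)
  have [measurable]: "\<zeta> \<in> borel_measurable borel" using zeta_int by simp
  define Iz where "Iz = (\<integral>t. \<zeta> t \<partial>lborel)"
  have Iz: "2 \<le> Iz"
  proof -
    have "(\<integral>t. qq t \<partial>lborel) \<le> Iz" unfolding Iz_def
      using Kq_nonneg by (intro integral_mono qq_integrable zeta_int) (auto simp: \<zeta>_def)
    then show ?thesis by (simp add: qq_mass)
  qed
  define C1 where "C1 = C0 * Iz"
  have C1: "1 \<le> C1" unfolding C1_def using C0 Iz mult_mono[of 1 C0 1 Iz] by simp
  have "mean (\<lambda>x. (indicator E x * jump (\<lambda>y. indicator Y y * \<bar>u y\<bar>) (r x))\<^sup>2) \<le> \<eta> * C1 * mean (\<lambda>x. (u x)\<^sup>2)"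
    if u: "u \<in> growth \<gamma>" and r[measurable]: "r \<in> borel_measurable borel" and E[measurable]: "E \<in> sets borel"
      and Y[measurable]: "Y \<in> sets borel" and eta: "0 \<le> \<eta>" and r1: "\<And>x. x \<in> E \<Longrightarrow> norm (x - r x) \<le> 1"
      and r2: "\<And>x. x \<in> E \<Longrightarrow> norm (x - r x) < \<epsilon>q" and r3: "\<And>x. x \<in> E \<Longrightarrow> Vs 1 (r x) \<le> 2 powr (1 / \<gamma>) * Vs 1 x"
      and row: "\<And>x. x \<in> E \<Longrightarrow> jump (\<lambda>y. indicator Y y * V y) (r x) \<le> \<eta> * V (r x)" for u r E Y \<eta>
  proof (rule integral_real_bounded)
    have [measurable]: "u \<in> borel_measurable borel" by (rule growth_meas[OF u])
    have iu: "integrable lborel (\<lambda>y. (u y)\<^sup>2 * \<pi> y)" using gamma2 by (intro growth_integrable[OF growth_power2[OF u]]) simp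
    have g2: "(\<lambda>y. (u y)\<^sup>2 * \<pi> y powr \<gamma>) \<in> growth \<gamma>"
    proof -
      have "(\<lambda>y. \<pi> y powr \<gamma>) \<in> growth (- \<gamma>)" by (rule growthI[where B=1]) auto
      from growth_mult[OF growth_power2[OF u] this] show ?thesis by simp
    qed
    have pt: "ennreal ((indicator E x * jump (\<lambda>y. indicator Y y * \<bar>u y\<bar>) (r x))\<^sup>2 * \<pi> x)
       \<le> (\<integral>\<^sup>+y. ennreal (\<eta> * C0) * (ennreal ((u y)\<^sup>2 * \<pi> y) * ennreal (\<zeta> (x - y))) \<partial>lborel)" for x
    proof (cases "x \<in> E")
      case False
      then show ?thesis by simp
    next
      case True
      let ?r = "r x"
      have pr: "\<pi> x \<le> C0 * \<pi> ?r"
      proof -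
        have "1 / \<pi> ?r \<le> C0 * (1 / \<pi> x)" using r3[OF True] unfolding C0_def by (simp add: powr_minus_divide)
        then show ?thesis using pi_pos[of x] pi_pos[of ?r] by (simp add: field_simps)
      qed
      have pw: "\<pi> ?r * V ?r * (k ?r y * ((u y)\<^sup>2 * \<pi> y powr \<gamma>)) \<le> (u y)\<^sup>2 * \<pi> y * \<zeta> (x - y)" for y
      proof -
        have "\<pi> ?r * V ?r * (k ?r y * ((u y)\<^sup>2 * \<pi> y powr \<gamma>)) = (\<pi> ?r * k ?r y) * V ?r * ((u y)\<^sup>2 * \<pi> y powr \<gamma>)" by simp
        also have "\<dots> = \<pi> y * (k y ?r * V ?r) * ((u y)\<^sup>2 * \<pi> y powr \<gamma>)" unfolding k_reversible by simp
        also have "\<dots> \<le> \<pi> y * (V y * qq (?r - y)) * ((u y)\<^sup>2 * \<pi> y powr \<gamma>)"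
          by (intro mult_right_mono mult_left_mono k_weight gamma2) auto
        also have "\<dots> = (u y)\<^sup>2 * \<pi> y * (V y * \<pi> y powr \<gamma>) * qq (?r - y)" by (simp add: mult_ac)
        also have "V y * \<pi> y powr \<gamma> = 1" by (simp add: powr_add[symmetric])
        also have "(u y)\<^sup>2 * \<pi> y * 1 * qq (?r - y) \<le> (u y)\<^sup>2 * \<pi> y * \<zeta> (x - y)"
        proof -
          have "\<bar>q (x - y) - q (?r - y)\<bar> \<le> norm (x - ?r) * Kq (x - y)" using q_lip[of "x - y" "?r - y"] r2[OF True] by simp
          also have "\<dots> \<le> 1 * Kq (x - y)" using r1[OF True] Kq_nonneg by (intro mult_right_mono) auto
          finally have a: "q (?r - y) \<le> q (x - y) + Kq (x - y)" by linarith
          have "\<bar>q (y - x) - q (y - ?r)\<bar> \<le> norm (x - ?r) * Kq (y - x)" using q_lip[of "y - x" "y - ?r"] r2[OF True] by (simp add: norm_minus_commute)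
          also have "\<dots> \<le> 1 * Kq (y - x)" using r1[OF True] Kq_nonneg by (intro mult_right_mono) auto
          finally have b: "q (y - ?r) \<le> q (y - x) + Kq (y - x)" by linarith
          have "qq (?r - y) \<le> \<zeta> (x - y)" using a b unfolding \<zeta>_def qq_def by simp
          then show ?thesis by (simp add: mult_left_mono)
        qed
        finally show ?thesis .
      qed
      have "(jump (\<lambda>y. indicator Y y * \<bar>u y\<bar>) ?r)\<^sup>2 * \<pi> x
          \<le> (jump (\<lambda>y. indicator Y y * V y) ?r * jump (\<lambda>y. (u y)\<^sup>2 * \<pi> y powr \<gamma>) ?r) * \<pi> x"
        by (intro mult_right_mono jump_weighted_cauchy_schwarz u Y) simp
      also have "\<dots> \<le> (\<eta> * V ?r * jump (\<lambda>y. (u y)\<^sup>2 * \<pi> y powr \<gamma>) ?r) * (C0 * \<pi> ?r)"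
        using row[OF True] pr eta by (intro mult_mono mult_right_mono mult_nonneg_nonneg) (auto simp: jump_def intro!: integral_nonneg_AE)
      also have "\<dots> = \<eta> * C0 * (\<integral>y. \<pi> ?r * V ?r * (k ?r y * ((u y)\<^sup>2 * \<pi> y powr \<gamma>)) \<partial>lborel)"
        unfolding jump_def by simp
      finally have "ennreal ((jump (\<lambda>y. indicator Y y * \<bar>u y\<bar>) ?r)\<^sup>2 * \<pi> x)
         \<le> ennreal (\<eta> * C0 * (\<integral>y. \<pi> ?r * V ?r * (k ?r y * ((u y)\<^sup>2 * \<pi> y powr \<gamma>)) \<partial>lborel))" by (rule ennreal_leI)
      also have "\<dots> = ennreal (\<eta> * C0) * (\<integral>\<^sup>+y. ennreal (\<pi> ?r * V ?r * (k ?r y * ((u y)\<^sup>2 * \<pi> y powr \<gamma>))) \<partial>lborel)"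
      proof -
        have "integrable lborel (\<lambda>y. \<pi> ?r * V ?r * (k ?r y * ((u y)\<^sup>2 * \<pi> y powr \<gamma>)))"
          using growth_integrable_k[OF g2 gamma2(3,4), of ?r] by (rule integrable_mult_right)
        then show ?thesis using eta C0 by (subst nn_integral_eq_integral) (auto simp: ennreal_mult' intro!: integral_nonneg_AE)
      qed
      also have "\<dots> \<le> ennreal (\<eta> * C0) * (\<integral>\<^sup>+y. ennreal ((u y)\<^sup>2 * \<pi> y) * ennreal (\<zeta> (x - y)) \<partial>lborel)"
        using pw zeta_nn by (intro mult_left_mono nn_integral_mono) (auto simp: ennreal_mult[symmetric] intro!: ennreal_leI)
      also have "\<dots> = (\<integral>\<^sup>+y. ennreal (\<eta> * C0) * (ennreal ((u y)\<^sup>2 * \<pi> y) * ennreal (\<zeta> (x - y))) \<partial>lborel)"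
        by (rule nn_integral_cmult[symmetric]) measurable
      finally show ?thesis using True by simp
    qed
    have "(\<integral>\<^sup>+x. ennreal ((indicator E x * jump (\<lambda>y. indicator Y y * \<bar>u y\<bar>) (r x))\<^sup>2 * \<pi> x) \<partial>lborel)
      \<le> (\<integral>\<^sup>+x. (\<integral>\<^sup>+y. ennreal (\<eta> * C0) * (ennreal ((u y)\<^sup>2 * \<pi> y) * ennreal (\<zeta> (x - y))) \<partial>lborel) \<partial>lborel)"
      by (intro nn_integral_mono pt)
    also have "\<dots> = (\<integral>\<^sup>+y. (\<integral>\<^sup>+x. ennreal (\<eta> * C0) * (ennreal ((u y)\<^sup>2 * \<pi> y) * ennreal (\<zeta> (x - y))) \<partial>lborel) \<partial>lborel)"
      by (rule lborel_pair.Fubini') measurable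
    also have "\<dots> = (\<integral>\<^sup>+y. ennreal (\<eta> * C0) * (ennreal ((u y)\<^sup>2 * \<pi> y) * ennreal Iz) \<partial>lborel)"
    proof (rule nn_integral_cong)
      fix y
      have "(\<integral>\<^sup>+x. ennreal (\<zeta> (x - y)) \<partial>lborel) = ennreal Iz"
        unfolding Iz_def using integrable_translate[OF zeta_int, of y] zeta_nn
        by (subst nn_integral_eq_integral) (auto simp: integral_translate)
      then show "(\<integral>\<^sup>+x. ennreal (\<eta> * C0) * (ennreal ((u y)\<^sup>2 * \<pi> y) * ennreal (\<zeta> (x - y))) \<partial>lborel) = ennreal (\<eta> * C0) * (ennreal ((u y)\<^sup>2 * \<pi> y) * ennreal Iz)"
        by (simp add: nn_integral_cmult)
    qed
    also have "\<dots> = ennreal (\<eta> * C0) * ((\<integral>\<^sup>+y. ennreal ((u y)\<^sup>2 * \<pi> y) \<partial>lborel) * ennreal Iz)"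
      by (simp add: nn_integral_cmult nn_integral_multc)
    also have "\<dots> = ennreal (\<eta> * C1 * mean (\<lambda>x. (u x)\<^sup>2))"
      using iu eta C0 Iz unfolding C1_def
      by (subst nn_integral_eq_integral) (auto simp: ennreal_mult[symmetric] mult_ac intro!: integral_nonneg_AE)
    finally show "(\<integral>\<^sup>+x. ennreal ((indicator E x * jump (\<lambda>y. indicator Y y * \<bar>u y\<bar>) (r x))\<^sup>2 * \<pi> x) \<partial>lborel)
      \<le> ennreal (\<eta> * C1 * mean (\<lambda>x. (u x)\<^sup>2))" .
    show "0 \<le> \<eta> * C1 * mean (\<lambda>x. (u x)\<^sup>2)" using eta C1 by (intro mult_nonneg_nonneg mean_nonneg) auto
  qed
  then show ?thesis by (rule that[OF C1])
qed

text \<open>The gap bounds \<open>mean (u * (u - transop u))\<close> from below by \<open>(1 - \<rho>) * mean (u\<^sup>2)\<close>, and Cauchy-Schwarz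
  bounds it from above.\<close>

lemma mean_sq_le_gap:
  assumes u: "u \<in> growth \<gamma>" and rho: "\<rho> < 1"
    and gap: "mean (\<lambda>x. (transop u x)\<^sup>2) \<le> \<rho>\<^sup>2 * mean (\<lambda>x. (u x)\<^sup>2)" and rho0: "0 < \<rho>"
  shows "(1 - \<rho>)\<^sup>2 * mean (\<lambda>x. (u x)\<^sup>2) \<le> mean (\<lambda>x. (u x - transop u x)\<^sup>2)"
proof -
  let ?n = "mean (\<lambda>x. (u x)\<^sup>2)"
  let ?D = "\<lambda>x. u x - transop u x"
  have tu: "transop u \<in> growth \<gamma>" using u gamma2 by (intro transop_growth) auto
  have D: "?D \<in> growth \<gamma>" by (rule growth_diff[OF u tu])
  have n0: "0 \<le> ?n" by (rule mean_nonneg) simp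
  have i1: "integrable lborel (\<lambda>x. (u x)\<^sup>2 * \<pi> x)" using gamma2 by (intro growth_integrable[OF growth_power2[OF u]]) simp
  have i2: "integrable lborel (\<lambda>x. u x * transop u x * \<pi> x)" using gamma2 by (intro growth_integrable[OF growth_mult[OF u tu]]) simp
  have "(mean (\<lambda>x. u x * transop u x))\<^sup>2 \<le> ?n * (\<rho>\<^sup>2 * ?n)"
    using mean_cauchy_schwarz[OF u tu gamma2(1)] mult_left_mono[OF gap n0] by linarith
  also have "\<dots> = (\<rho> * ?n)\<^sup>2" by (simp add: power2_eq_square mult_ac)
  finally have "mean (\<lambda>x. u x * transop u x) \<le> \<rho> * ?n" using rho0 n0 by (simp add: abs_le_square_iff[symmetric] abs_le_iff)
  moreover have "mean (\<lambda>x. u x * ?D x) = ?n - mean (\<lambda>x. u x * transop u x)"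
    using i1 i2 by (simp add: right_diff_distrib left_diff_distrib power2_eq_square)
  ultimately have "(1 - \<rho>) * ?n \<le> mean (\<lambda>x. u x * ?D x)" by (simp add: algebra_simps)
  then have "((1 - \<rho>) * ?n)\<^sup>2 \<le> (mean (\<lambda>x. u x * ?D x))\<^sup>2" using n0 rho by (intro power_mono) auto
  also have "\<dots> \<le> ?n * mean (\<lambda>x. (?D x)\<^sup>2)" by (rule mean_cauchy_schwarz[OF u D gamma2(1)])
  finally have "?n * ((1 - \<rho>)\<^sup>2 * ?n) \<le> ?n * mean (\<lambda>x. (?D x)\<^sup>2)" by (simp add: power2_eq_square mult_ac)
  then show ?thesis
  proof (cases "?n = 0")
    case True
    then show ?thesis using mean_nonneg[of "\<lambda>x. (?D x)\<^sup>2"] by simp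
  next
    case False
    then have "0 < ?n" using n0 by (metis less_le)
    then show ?thesis using \<open>?n * ((1 - \<rho>)\<^sup>2 * ?n) \<le> ?n * mean (\<lambda>x. (?D x)\<^sup>2)\<close> by (simp only: mult_le_cancel_left_pos)
  qed
qed

text \<open>The defect \<open>u - transop u\<close> is a constant \<open>c\<close> at the representatives. In a bounded region it stays
  close to \<open>c\<close> on the cells, up to the oscillation of \<open>u\<close> and small multiples of \<open>u\<close>, because the kernel
  is uniformly continuous there and rarely leaves a larger ball. In the tails the equation at the
  representative bounds \<open>u\<close> itself by its oscillation, \<open>c\<close> and a small multiple of \<open>u\<close>; in \<open>J 0\<close> the
  pointwise bound of \<open>u\<close> is used. Since the defect has mean zero, \<open>c\<close> is small as well, and the spectral
  gap absorbs the small multiples of \<open>u\<close>.\<close>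

lemma stability:
  assumes K: "0 \<le> K" and CL: "0 \<le> CL"
  obtains C \<delta>0 R where "0 < C" "0 < \<delta>0"
    "\<And>m J a \<delta> u c. cells V m J a \<delta> \<Longrightarrow> \<delta> \<le> \<delta>0 \<Longrightarrow> (\<And>x. x \<in> J 0 \<Longrightarrow> R < norm x) \<Longrightarrow>
       u \<in> borel_measurable borel \<Longrightarrow> (\<And>x. \<bar>u x\<bar> \<le> K * V x) \<Longrightarrow> mean u = 0 \<Longrightarrow>
       (\<And>j. j \<le> m \<Longrightarrow> u (a j) - transop u (a j) = c) \<Longrightarrow>
       (\<And>j x. 1 \<le> j \<Longrightarrow> j \<le> m \<Longrightarrow> x \<in> J j \<Longrightarrow> \<bar>u x - u (a j)\<bar> \<le> CL * \<delta> * (w x + w (a j))) \<Longrightarrow>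
       mean (\<lambda>x. (u x)\<^sup>2) \<le> C * (\<delta>\<^sup>2 + (\<integral>x. indicator (J 0) x * \<pi> x powr (1 - 2 * \<gamma>) \<partial>lborel))"
proof -
  obtain A0 where A0: "0 < A0" "\<And>x. A0 \<le> acc x" using acc_lower by blast
  obtain \<rho> where rho: "0 < \<rho>" "\<rho> < 1" "\<And>f. f \<in> growth \<gamma> \<Longrightarrow> mean f = 0 \<Longrightarrow> mean (\<lambda>x. (transop f x)\<^sup>2) \<le> \<rho>\<^sup>2 * mean (\<lambda>x. (f x)\<^sup>2)"
    using spectral_gap[OF gamma(1) gamma2(1)] by blast
  obtain C1 where C1: "1 \<le> C1" and schur: "\<And>u r E Y \<eta>. u \<in> growth \<gamma> \<Longrightarrow> r \<in> borel_measurable borel \<Longrightarrow> E \<in> sets borel \<Longrightarrow> Y \<in> sets borel \<Longrightarrow> 0 \<le> \<eta> \<Longrightarrow>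
      (\<And>x. x \<in> E \<Longrightarrow> norm (x - r x) \<le> 1) \<Longrightarrow> (\<And>x. x \<in> E \<Longrightarrow> norm (x - r x) < \<epsilon>q) \<Longrightarrow>
      (\<And>x. x \<in> E \<Longrightarrow> Vs 1 (r x) \<le> 2 powr (1 / \<gamma>) * Vs 1 x) \<Longrightarrow>
      (\<And>x. x \<in> E \<Longrightarrow> jump (\<lambda>y. indicator Y y * V y) (r x) \<le> \<eta> * V (r x)) \<Longrightarrow>
      mean (\<lambda>x. (indicator E x * jump (\<lambda>y. indicator Y y * \<bar>u y\<bar>) (r x))\<^sup>2) \<le> \<eta> * C1 * mean (\<lambda>x. (u x)\<^sup>2)"
    using row_schur by blast
  define c1 where "c1 = 2 powr (\<sigma> / \<gamma>)"
  have c1: "0 < c1" unfolding c1_def by simp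
  define Cd where "Cd = 4 * CL\<^sup>2 * (1 + c1)\<^sup>2 * mean (\<lambda>x. (w x)\<^sup>2)"
  have Cd: "0 \<le> Cd" unfolding Cd_def by (intro mult_nonneg_nonneg mean_nonneg) auto
  define C5 where "C5 = 16 / A0\<^sup>2"
  have C5: "0 \<le> C5" unfolding C5_def by simp
  \<comment> \<open>\<open>Ce\<close> and \<open>Cdl\<close> collect the coefficients with which \<open>\<eta> * n2\<close> and \<open>\<delta>\<^sup>2\<close> occur in the final estimate; \<open>\<eta>\<close> is
    chosen so that the former is absorbed by half of the gap.\<close>
  define Ce where "Ce = (2 + 8 * (2 + C5)) * (20 * C1) + 32 * (2 + C5) + (C5 + 4) * C1"
  have Ce: "0 < Ce" unfolding Ce_def using C1 C5 by (intro add_pos_nonneg mult_pos_pos mult_nonneg_nonneg) auto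
  define Cdl where "Cdl = (2 + 8 * (2 + C5)) * (5 * Cd) + 4 * Cd"
  have Cdl: "0 \<le> Cdl" unfolding Cdl_def using Cd C5 by simp
  define \<eta> where "\<eta> = min (1 / 2) ((1 - \<rho>)\<^sup>2 / (2 * Ce))"
  have eta: "0 < \<eta>" "\<eta> \<le> 1 / 2" "\<eta> * Ce \<le> (1 - \<rho>)\<^sup>2 / 2"
  proof -
    show "0 < \<eta>" "\<eta> \<le> 1 / 2" unfolding \<eta>_def using rho Ce by auto
    have "\<eta> * Ce \<le> (1 - \<rho>)\<^sup>2 / (2 * Ce) * Ce" unfolding \<eta>_def using Ce by (intro mult_right_mono) auto
    then show "\<eta> * Ce \<le> (1 - \<rho>)\<^sup>2 / 2" using Ce by simp
  qed
  obtain Ra where Ra: "\<And>x. Ra \<le> norm x \<Longrightarrow> jump V x \<le> \<eta> * V x" using jump_tail[OF gamma(1) gamma2(2) eta(1)] by blast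
  obtain Rb where Rb: "0 < Rb" "(\<integral>x. indicator {z. Rb < norm z} x * \<pi> x \<partial>lborel) \<le> \<eta>"
    using integral_tail_small[OF pi_integrable eta(1)] by blast
  \<comment> \<open>Bulk and tail are separated at radius \<open>R1 + 1\<close>, because representatives are at distance at most 1.\<close>
  define R1 where "R1 = max Ra Rb"
  define Bk where "Bk = {x::'a. norm x < R1 + 1}"
  define Tl where "Tl = {x::'a. R1 + 1 \<le> norm x}"
  have BT[measurable]: "Bk \<in> sets borel" "Tl \<in> sets borel" unfolding Bk_def Tl_def by measurable
  have BT1: "indicator Bk x + indicator Tl x = (1::real)" for x unfolding Bk_def Tl_def by (auto simp: indicator_def)
  have piTl: "mean (indicator Tl) \<le> \<eta>"
  proof -
    have iS: "integrable lborel (\<lambda>x. indicator S x * \<pi> x)" if "S \<in> sets borel" for S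
      using integrable_mult_indicator[OF _ pi_integrable, of S] that by simp
    have "mean (indicator Tl) \<le> (\<integral>x. indicator {z. Rb < norm z} x * \<pi> x \<partial>lborel)"
    proof (rule integral_mono[OF iS[OF BT(2)] iS])
      show "indicator Tl x * \<pi> x \<le> indicator {z. Rb < norm z} x * \<pi> x" for x
        unfolding Tl_def R1_def by (auto simp: indicator_def)
    qed measurable
    then show ?thesis using Rb by linarith
  qed
  obtain R' where R': "\<And>x s. norm x \<le> R1 + 2 \<Longrightarrow> 0 \<le> s \<Longrightarrow> s \<le> 1 \<Longrightarrow> jump (\<lambda>y. indicator {y. R' < norm y} y * Vs s y) x \<le> \<eta> * Vs s x"
    using jump_outside[OF eta(1), of "R1 + 2"] by blast
  define Y where "Y = {y::'a. R' < norm y}"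
  have Y[measurable]: "Y \<in> sets borel" unfolding Y_def by measurable
  \<comment> \<open>The weight that turns a Lebesgue integral over the complement of \<open>Y\<close> into a mean under \<open>\<pi>\<close>.\<close>
  define fi where "fi = (\<lambda>y. indicator (- Y) y * Vs 1 y)"
  have fi: "fi \<in> growth \<gamma>"
  proof -
    obtain B where B: "0 < B" "\<And>x. norm x \<le> R' \<Longrightarrow> Vs 1 x \<le> B" using Vs_bounded_on_ball by blast
    have "fi \<in> growth 0" unfolding fi_def
      by (rule growthI[where B=B]) (use B in \<open>auto simp: indicator_def Y_def not_less\<close>)
    then show ?thesis by (rule growth_mono[OF _ gamma2(3)])
  qed
  define Mf where "Mf = mean (\<lambda>x. (fi x)\<^sup>2)"
  have Mf: "0 \<le> Mf" unfolding Mf_def by (rule mean_nonneg) simp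
  define \<eta>' where "\<eta>' = sqrt (\<eta> / (Mf + 1))"
  have eta': "0 < \<eta>'" "\<eta>'\<^sup>2 * Mf \<le> \<eta>" "\<eta>'\<^sup>2 \<le> \<eta>"
  proof -
    have e: "\<eta>'\<^sup>2 = \<eta> / (Mf + 1)" unfolding \<eta>'_def using eta Mf by simp
    show "0 < \<eta>'" unfolding \<eta>'_def using eta Mf by simp
    have "\<eta> * Mf \<le> \<eta> * (Mf + 1)" using eta by (intro mult_left_mono) auto
    then show "\<eta>'\<^sup>2 * Mf \<le> \<eta>" unfolding e using Mf by (simp add: pos_divide_le_eq)
    have "\<eta> * 1 \<le> \<eta> * (Mf + 1)" using eta Mf by (intro mult_left_mono) auto
    then show "\<eta>'\<^sup>2 \<le> \<eta>" unfolding e using Mf by (simp add: pos_divide_le_eq)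
  qed
  have "uniformly_continuous_on (cball 0 (R1 + 2) \<times> cball 0 R') (\<lambda>z. k (fst z) (snd z))"
    by (intro compact_uniformly_continuous continuous_on_subset[OF k_continuous] compact_Times) auto
  then obtain d1 where d1: "0 < d1" "\<And>z z'. z \<in> cball 0 (R1 + 2) \<times> cball 0 R' \<Longrightarrow> z' \<in> cball 0 (R1 + 2) \<times> cball 0 R' \<Longrightarrow> dist z' z < d1 \<Longrightarrow>
      dist (k (fst z') (snd z')) (k (fst z) (snd z)) < \<eta>'"
    unfolding uniformly_continuous_on_def using eta' by metis
  obtain Bd where Bd: "0 < Bd" "\<And>x. norm x \<le> R1 + 2 \<Longrightarrow> Vs (1 - \<beta>) x \<le> Bd" using Vs_bounded_on_ball by blast
  define \<delta>0 where "\<delta>0 = min (min 1 (\<epsilon>q / 2)) (min (d1 / 2) (min (\<epsilon>p / 2) (\<eta>' / (8 * cb * Bd))))"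
  have d0: "0 < \<delta>0" "\<delta>0 \<le> 1" "\<delta>0 < \<epsilon>q" "\<delta>0 < d1" "\<delta>0 < \<epsilon>p" "8 * cb * Bd * \<delta>0 \<le> \<eta>'"
  proof -
    show "0 < \<delta>0" "\<delta>0 \<le> 1" "\<delta>0 < \<epsilon>q" "\<delta>0 < d1" "\<delta>0 < \<epsilon>p" unfolding \<delta>0_def using eq_pos ep_pos d1(1) eta' cb Bd(1) by auto
    have "8 * cb * Bd * \<delta>0 \<le> 8 * cb * Bd * (\<eta>' / (8 * cb * Bd))" unfolding \<delta>0_def using cb Bd(1) by (intro mult_left_mono) auto
    then show "8 * cb * Bd * \<delta>0 \<le> \<eta>'" using cb Bd(1) by simp
  qed
  define C where "C = 2 / (1 - \<rho>)\<^sup>2 * (Cdl + 16 * K\<^sup>2 + 1)"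
  have C: "0 < C" unfolding C_def using rho Cdl by (intro mult_pos_pos) (auto intro: add_nonneg_pos)
  have "mean (\<lambda>x. (u x)\<^sup>2) \<le> C * (\<delta>\<^sup>2 + (\<integral>x. indicator (J 0) x * \<pi> x powr (1 - 2 * \<gamma>) \<partial>lborel))"
    if cl: "cells V m J a \<delta>" and de: "\<delta> \<le> \<delta>0" and J0: "\<And>x. x \<in> J 0 \<Longrightarrow> R1 + 1 < norm x"
      and um[measurable]: "u \<in> borel_measurable borel" and uK: "\<And>x. \<bar>u x\<bar> \<le> K * V x" and mu: "mean u = 0"
      and eq: "\<And>j. j \<le> m \<Longrightarrow> u (a j) - transop u (a j) = c"
      and osc: "\<And>j x. 1 \<le> j \<Longrightarrow> j \<le> m \<Longrightarrow> x \<in> J j \<Longrightarrow> \<bar>u x - u (a j)\<bar> \<le> CL * \<delta> * (w x + w (a j))" for m J a \<delta> u c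
  proof -
    have dl: "0 \<le> \<delta>" "\<delta> \<le> 1" "\<delta> < \<epsilon>q" "\<delta> < d1" "\<delta> < \<epsilon>p" using cl de d0 by (auto simp: cells_def)
    have ug: "u \<in> growth \<gamma>" using um uK by (rule growthI)
    have tug: "transop u \<in> growth \<gamma>" using ug gamma2 by (intro transop_growth) auto
    define D where "D = (\<lambda>x. u x - transop u x)"
    have Dg: "D \<in> growth \<gamma>" unfolding D_def by (rule growth_diff[OF ug tug])
    define n2 where "n2 = mean (\<lambda>x. (u x)\<^sup>2)"
    have n2: "0 \<le> n2" unfolding n2_def by (rule mean_nonneg) simp
    define r where "r = representative m J a"
    have rm[measurable]: "r \<in> borel_measurable borel" unfolding r_def by (rule representative_meas[OF cl])
    have J0m[measurable]: "J 0 \<in> sets borel" using cl by (simp add: cells_def)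
    have rV: "V (r x) \<le> (1 + \<delta>) * V x" for x
    proof -
      obtain j where j: "j \<le> m" "x \<in> J j" using cells_cell[OF cl] by blast
      then have "r x = a j" unfolding r_def using cells_sum(2)[OF cl] by blast
      then show ?thesis using cl j unfolding cells_def by auto
    qed
    have rVs: "Vs t (r x) \<le> 2 powr (t / \<gamma>) * Vs t x" if "0 \<le> t" for t x
      by (rule Vs_transfer[OF rV dl(1,2) that])
    have rcell: "norm (x - r x) \<le> \<delta> \<and> \<bar>u x - u (r x)\<bar> \<le> CL * \<delta> * (1 + c1) * w x \<and> u (r x) - transop u (r x) = c" if x: "x \<notin> J 0" for x
    proof -
      obtain j where j: "j \<le> m" "x \<in> J j" using cells_cell[OF cl] by blast
      then have "j \<noteq> 0" using x by (metis)
      then have j1: "1 \<le> j" by simp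
      have rx: "r x = a j" unfolding r_def using cells_sum(2)[OF cl j] .
      have "norm (x - a j) \<le> \<delta>" using cl j j1 unfolding cells_def by auto
      moreover have "\<bar>u x - u (a j)\<bar> \<le> CL * \<delta> * (1 + c1) * w x"
      proof -
        have "w (a j) \<le> c1 * w x" using rVs[of \<sigma> x] sigma unfolding rx c1_def by simp
        then have "CL * \<delta> * (w x + w (a j)) \<le> CL * \<delta> * (w x + c1 * w x)" using CL dl by (intro mult_left_mono) auto
        then show ?thesis using osc[OF j1 j] by (simp add: algebra_simps)
      qed
      ultimately show ?thesis using eq[OF j(1)] unfolding rx by blast
    qed
    define X where "X = (\<lambda>x. 2 * (CL * \<delta> * (1 + c1)) * w x)"
    have Xg: "X \<in> growth \<sigma>" unfolding X_def by (rule growth_cmult[OF Vs_growth])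
    have mX: "mean (\<lambda>x. (X x)\<^sup>2) = Cd * \<delta>\<^sup>2"
    proof -
      have "mean (\<lambda>x. (X x)\<^sup>2) = (\<integral>x. (4 * CL\<^sup>2 * (1 + c1)\<^sup>2 * \<delta>\<^sup>2) * ((w x)\<^sup>2 * \<pi> x) \<partial>lborel)"
        unfolding X_def by (intro Bochner_Integration.integral_cong refl) (simp add: power2_eq_square algebra_simps)
      also have "\<dots> = (4 * CL\<^sup>2 * (1 + c1)\<^sup>2 * \<delta>\<^sup>2) * mean (\<lambda>x. (w x)\<^sup>2)"
        by (rule integral_mult_right_zero)
      also have "\<dots> = Cd * \<delta>\<^sup>2" unfolding Cd_def by (simp only: mult.assoc mult.commute[of "\<delta>\<^sup>2"])
      finally show ?thesis .
    qed
    have jg: "(\<lambda>x. indicator E x * jump (\<lambda>y. indicator Z y * \<bar>u y\<bar>) (s x)) \<in> growth \<gamma>"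
      if [measurable]: "E \<in> sets borel" "Z \<in> sets borel" "s \<in> borel_measurable borel" and s: "\<And>x. V (s x) \<le> 2 * V x" for E Z s
    proof (rule growthI)
      have [measurable]: "jump (\<lambda>y. indicator Z y * \<bar>u y\<bar>) \<in> borel_measurable borel" by measurable
      show "(\<lambda>x. indicator E x * jump (\<lambda>y. indicator Z y * \<bar>u y\<bar>) (s x)) \<in> borel_measurable borel" by measurable
      show "\<bar>indicator E x * jump (\<lambda>y. indicator Z y * \<bar>u y\<bar>) (s x)\<bar> \<le> 4 * K * V x" for x
      proof -
        have "\<bar>jump (\<lambda>y. indicator Z y * \<bar>u y\<bar>) (s x)\<bar> \<le> K * jump V (s x)"
        proof (rule jump_abs_le[OF _ _ gamma2(3,4)])
          show "\<bar>indicator Z y * \<bar>u y\<bar>\<bar> \<le> K * V y" for y using order_trans[OF abs_ge_zero uK[of y]] uK[of y] by (auto simp: indicator_def)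
        qed measurable
        also have "\<dots> \<le> K * (2 * (2 * V x))"
          using jump_Vs_le[OF gamma2(3,4), of "s x"] s[of x] K by (intro mult_left_mono) auto
        finally have "\<bar>jump (\<lambda>y. indicator Z y * \<bar>u y\<bar>) (s x)\<bar> \<le> 4 * K * V x" by simp
        moreover have "0 \<le> 4 * K * V x" using K by simp
        ultimately show ?thesis by (auto simp: indicator_def)
      qed
    qed
    have rV2: "V (r x) \<le> 2 * V x" for x
      using order_trans[OF rV[of x] mult_right_mono[of "1 + \<delta>" 2 "V x"]] dl by simp
    have xV2: "V x \<le> 2 * V x" for x by simp
    have x1: "Vs 1 x \<le> 2 powr (1 / \<gamma>) * Vs 1 x" for x
      using mult_right_mono[of 1 "2 powr (1 / \<gamma>)" "Vs 1 x"] gamma by (simp add: ge_one_powr_ge_zero)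
    define Te where "Te = Tl - J 0"
    have Te[measurable]: "Te \<in> sets borel" unfolding Te_def by measurable
    \<comment> \<open>The rows of jumps that \<open>row_schur\<close> makes small in the mean, at the representative and at \<open>x\<close>, in the bulk
      and in the tail.\<close>
    define gaB where "gaB = (\<lambda>x. indicator Bk x * jump (\<lambda>y. indicator Y y * \<bar>u y\<bar>) (r x))"
    define gxB where "gxB = (\<lambda>x. indicator Bk x * jump (\<lambda>y. indicator Y y * \<bar>u y\<bar>) x)"
    define gaT where "gaT = (\<lambda>x. indicator Te x * jump (\<lambda>y. indicator UNIV y * \<bar>u y\<bar>) (r x))"
    define gxT where "gxT = (\<lambda>x. indicator Tl x * jump (\<lambda>y. indicator UNIV y * \<bar>u y\<bar>) x)"
    have gg: "gaB \<in> growth \<gamma>" "gxB \<in> growth \<gamma>" "gaT \<in> growth \<gamma>" "gxT \<in> growth \<gamma>"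
      unfolding gaB_def gxB_def gaT_def gxT_def by (rule jg; (rule rV2 xV2 | measurable))+
    have BkJ: "x \<notin> J 0" if "x \<in> Bk" for x using J0[of x] that unfolding Bk_def by auto
    have near: "norm (x - r x) \<le> 1" "norm (x - r x) < \<epsilon>q" if "x \<notin> J 0" for x using rcell[OF that] dl by auto
    have rBk: "norm (r x) \<le> R1 + 2" if "x \<in> Bk" for x
      using near(1)[OF BkJ[OF that]] norm_triangle_sub[of "r x" x] that unfolding Bk_def by (simp add: norm_minus_commute)
    have rTe: "R1 \<le> norm (r x)" if "x \<in> Te" for x
      using near(1)[of x] norm_triangle_sub[of x "r x"] that unfolding Te_def Tl_def by auto
    have g1: "mean (\<lambda>x. (gaB x)\<^sup>2) \<le> \<eta> * C1 * n2"
      unfolding gaB_def n2_def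
      by (rule schur[OF ug rm BT(1) Y]) (use eta near BkJ rVs[of 1] rBk R'[of _ \<gamma>] gamma2 in \<open>auto simp: Y_def\<close>)
    have g2: "mean (\<lambda>x. (gxB x)\<^sup>2) \<le> \<eta> * C1 * n2"
      unfolding gxB_def n2_def
      by (rule schur[OF ug _ BT(1) Y, where r="\<lambda>x. x"]) (use eta eq_pos x1 R'[of _ \<gamma>] gamma2 in \<open>auto simp: Y_def Bk_def\<close>)
    have g3: "mean (\<lambda>x. (gaT x)\<^sup>2) \<le> \<eta> * C1 * n2"
      unfolding gaT_def n2_def
      by (rule schur[OF ug rm Te]) (use eta near rVs[of 1] rTe Ra in \<open>auto simp: Te_def R1_def\<close>)
    have g4: "mean (\<lambda>x. (gxT x)\<^sup>2) \<le> \<eta> * C1 * n2"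
      unfolding gxT_def n2_def
      by (rule schur[OF ug _ BT(2), where r="\<lambda>x. x"]) (use eta eq_pos x1 Ra in \<open>auto simp: Tl_def R1_def\<close>)
    define U where "U = (\<integral>y. indicator (- Y) y * \<bar>u y\<bar> \<partial>lborel)"
    have Yu: "(\<lambda>y. fi y * \<bar>u y\<bar>) \<in> growth (\<gamma> + \<gamma>)" by (rule growth_mult[OF fi growth_abs[OF ug]])
    have fiu: "fi y * \<bar>u y\<bar> * \<pi> y = indicator (- Y) y * \<bar>u y\<bar>" for y
      unfolding fi_def by (simp add: powr_minus_divide)
    have Uint: "integrable lborel (\<lambda>y. indicator (- Y) y * \<bar>u y\<bar>)"
      using growth_integrable[OF Yu] gamma2 unfolding fiu by simp
    have U2: "U\<^sup>2 \<le> Mf * n2"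
    proof -
      have "U = mean (\<lambda>y. fi y * \<bar>u y\<bar>)" unfolding U_def fiu ..
      then show ?thesis using mean_cauchy_schwarz[OF fi growth_abs[OF ug] gamma2(1)] unfolding Mf_def n2_def by simp
    qed
    have U0: "0 \<le> U" unfolding U_def by (intro integral_nonneg_AE) auto
    have sq_int: "integrable lborel (\<lambda>x. (f x)\<^sup>2 * \<pi> x)" if "f \<in> growth \<sigma>" for f
      using sigma by (intro growth_integrable[OF growth_power2[OF that]]) simp
    note gs = growth_mono[OF _ sigma(4)]
    note sq = sq_int[OF Xg] sq_int[OF gs[OF gg(1)]] sq_int[OF gs[OF gg(2)]] sq_int[OF gs[OF gg(3)]] sq_int[OF gs[OF gg(4)]] sq_int[OF gs[OF ug]]
    define E1 where "E1 = 5 * (Cd * \<delta>\<^sup>2 + 4 * (\<eta> * C1 * n2))"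
    have DB: "\<bar>indicator Bk x * (D x - c)\<bar> \<le> X x + \<eta>' * U + gaB x + gxB x + \<eta>' * \<bar>u x\<bar>" for x
    proof (cases "x \<in> Bk")
      case False
      then show ?thesis using U0 eta' CL dl c1 by (simp add: gaB_def gxB_def X_def)
    next
      case True
      let ?a = "r x"
      have rc: "norm (x - ?a) \<le> \<delta>" "\<bar>u x - u ?a\<bar> \<le> CL * \<delta> * (1 + c1) * w x" "u ?a - transop u ?a = c"
        using rcell[OF BkJ[OF True]] by auto
      have nx: "norm x \<le> R1 + 2" "norm ?a \<le> R1 + 2" using True rBk[OF True] unfolding Bk_def by auto
      have jd: "\<bar>jump u ?a - jump u x\<bar> \<le> \<eta>' * U + jump (\<lambda>y. indicator Y y * \<bar>u y\<bar>) ?a + jump (\<lambda>y. indicator Y y * \<bar>u y\<bar>) x"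
      proof -
        have iu: "integrable lborel (\<lambda>y. k z y * u y)" for z by (rule growth_integrable_k[OF ug gamma2(3,4)])
        have Yg: "(\<lambda>y. indicator Y y * \<bar>u y\<bar>) \<in> growth \<gamma>"
          by (rule growthI[where B=K]) (use uK order_trans[OF abs_ge_zero uK] in \<open>auto simp: indicator_def\<close>)
        have iY: "integrable lborel (\<lambda>y. k z y * (indicator Y y * \<bar>u y\<bar>))" for z by (rule growth_integrable_k[OF Yg gamma2(3,4)])
        have "\<bar>jump u ?a - jump u x\<bar> = \<bar>\<integral>y. k ?a y * u y - k x y * u y \<partial>lborel\<bar>"
          unfolding jump_def using iu by simp
        also have "\<dots> \<le> (\<integral>y. \<bar>k ?a y * u y - k x y * u y\<bar> \<partial>lborel)" by (rule integral_abs_bound)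
        also have "\<dots> \<le> (\<integral>y. \<eta>' * (indicator (- Y) y * \<bar>u y\<bar>) + k ?a y * (indicator Y y * \<bar>u y\<bar>) + k x y * (indicator Y y * \<bar>u y\<bar>) \<partial>lborel)"
        proof (rule integral_mono)
          show "integrable lborel (\<lambda>y. \<bar>k ?a y * u y - k x y * u y\<bar>)" using iu by (intro integrable_abs Bochner_Integration.integrable_diff)
          show "integrable lborel (\<lambda>y. \<eta>' * (indicator (- Y) y * \<bar>u y\<bar>) + k ?a y * (indicator Y y * \<bar>u y\<bar>) + k x y * (indicator Y y * \<bar>u y\<bar>))"
            using Uint iY by simp
          fix y
          have e: "\<bar>k ?a y * u y - k x y * u y\<bar> = \<bar>k ?a y - k x y\<bar> * \<bar>u y\<bar>" by (simp add: left_diff_distrib[symmetric] abs_mult)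
          show "\<bar>k ?a y * u y - k x y * u y\<bar> \<le> \<eta>' * (indicator (- Y) y * \<bar>u y\<bar>) + k ?a y * (indicator Y y * \<bar>u y\<bar>) + k x y * (indicator Y y * \<bar>u y\<bar>)"
          proof (cases "y \<in> Y")
            case True
            have "\<bar>k ?a y - k x y\<bar> \<le> k ?a y + k x y" using k_nonneg[of ?a y] k_nonneg[of x y] by linarith
            then have "\<bar>k ?a y - k x y\<bar> * \<bar>u y\<bar> \<le> (k ?a y + k x y) * \<bar>u y\<bar>" by (rule mult_right_mono) simp
            then show ?thesis unfolding e using True by (simp add: distrib_right)
          next
            case False
            have "dist (?a, y) (x, y) < d1" using rc dl by (simp add: dist_Pair_Pair dist_norm norm_minus_commute)
            then have "\<bar>k ?a y - k x y\<bar> < \<eta>'"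
              using d1(2)[of "(x, y)" "(?a, y)"] nx False by (simp add: Y_def dist_real_def not_less)
            then have "\<bar>k ?a y - k x y\<bar> * \<bar>u y\<bar> \<le> \<eta>' * \<bar>u y\<bar>" by (intro mult_right_mono) auto
            then show ?thesis unfolding e using False by simp
          qed
        qed
        also have "\<dots> = \<eta>' * U + jump (\<lambda>y. indicator Y y * \<bar>u y\<bar>) ?a + jump (\<lambda>y. indicator Y y * \<bar>u y\<bar>) x"
          unfolding U_def jump_def using Uint iY by simp
        finally show ?thesis .
      qed
      have ad: "\<bar>acc x - acc ?a\<bar> \<le> \<eta>'"
      proof -
        have "\<bar>acc x - acc ?a\<bar> \<le> 4 * cb * norm (x - ?a) * (Vs (1 - \<beta>) x + Vs (1 - \<beta>) ?a)"
          using rc dl by (intro acc_lipschitz) simp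
        also have "\<dots> \<le> 4 * cb * \<delta>0 * (Bd + Bd)"
          using rc de cb Bd(2)[OF nx(1)] Bd(2)[OF nx(2)] d0 by (intro mult_mono add_mono mult_left_mono) auto
        also have "\<dots> \<le> \<eta>'" using d0(6) by (simp add: mult_ac)
        finally show ?thesis .
      qed
      have "D x - c = (u x - u ?a) + (jump u ?a - jump u x) + (1 - acc ?a) * (u ?a - u x) + (acc x - acc ?a) * u x"
        unfolding D_def rc(3)[symmetric] transop_def by (simp add: algebra_simps)
      then have "\<bar>D x - c\<bar> \<le> \<bar>u x - u ?a\<bar> + \<bar>jump u ?a - jump u x\<bar> + \<bar>(1 - acc ?a) * (u ?a - u x)\<bar> + \<bar>(acc x - acc ?a) * u x\<bar>"
        by linarith
      also have "\<bar>(1 - acc ?a) * (u ?a - u x)\<bar> \<le> 1 * \<bar>u x - u ?a\<bar>"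
        unfolding abs_mult using acc_le_1[of ?a] acc_nonneg[of ?a] by (intro mult_mono) (auto simp: abs_minus_commute)
      also have "\<bar>(acc x - acc ?a) * u x\<bar> \<le> \<eta>' * \<bar>u x\<bar>" unfolding abs_mult using ad by (intro mult_right_mono) auto
      finally have "\<bar>D x - c\<bar> \<le> 2 * \<bar>u x - u ?a\<bar> + \<bar>jump u ?a - jump u x\<bar> + \<eta>' * \<bar>u x\<bar>" by simp
      then show ?thesis using True rc(2) jd by (simp add: X_def gaB_def gxB_def)
    qed
    have B1: "mean (\<lambda>x. (indicator Bk x * (D x - c))\<^sup>2) \<le> E1"
    proof -
      have bg: "(\<lambda>x. indicator Bk x * (D x - c)) \<in> growth \<gamma>"
      proof -
        have "indicator Bk \<in> growth 0" by (rule growthI[where B=1]) (auto simp: indicator_def)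
        from growth_mult[OF this growth_diff[OF Dg const_growth[OF gamma2(3)]]] show ?thesis by simp
      qed
      have "mean (\<lambda>x. (indicator Bk x * (D x - c))\<^sup>2)
         \<le> (\<integral>x. 5 * ((X x)\<^sup>2 * \<pi> x + (\<eta>' * U)\<^sup>2 * \<pi> x + (gaB x)\<^sup>2 * \<pi> x + (gxB x)\<^sup>2 * \<pi> x + \<eta>'\<^sup>2 * ((u x)\<^sup>2 * \<pi> x)) \<partial>lborel)"
      proof (rule integral_mono[OF sq_int[OF gs[OF bg]]])
        show "integrable lborel (\<lambda>x. 5 * ((X x)\<^sup>2 * \<pi> x + (\<eta>' * U)\<^sup>2 * \<pi> x + (gaB x)\<^sup>2 * \<pi> x + (gxB x)\<^sup>2 * \<pi> x + \<eta>'\<^sup>2 * ((u x)\<^sup>2 * \<pi> x)))"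
          using sq pi_integrable by simp
        fix x
        have "(indicator Bk x * (D x - c))\<^sup>2 \<le> (X x + \<eta>' * U + gaB x + gxB x + \<eta>' * \<bar>u x\<bar>)\<^sup>2"
          using power_mono[OF DB[of x] abs_ge_zero, of 2] by simp
        also have "\<dots> \<le> 5 * ((X x)\<^sup>2 + (\<eta>' * U)\<^sup>2 + (gaB x)\<^sup>2 + (gxB x)\<^sup>2 + (\<eta>' * \<bar>u x\<bar>)\<^sup>2)" by (rule sum_sq_le5)
        finally have "(indicator Bk x * (D x - c))\<^sup>2 * \<pi> x \<le> (5 * ((X x)\<^sup>2 + (\<eta>' * U)\<^sup>2 + (gaB x)\<^sup>2 + (gxB x)\<^sup>2 + (\<eta>' * \<bar>u x\<bar>)\<^sup>2)) * \<pi> x"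
          by (rule mult_right_mono) simp
        then show "(indicator Bk x * (D x - c))\<^sup>2 * \<pi> x
            \<le> 5 * ((X x)\<^sup>2 * \<pi> x + (\<eta>' * U)\<^sup>2 * \<pi> x + (gaB x)\<^sup>2 * \<pi> x + (gxB x)\<^sup>2 * \<pi> x + \<eta>'\<^sup>2 * ((u x)\<^sup>2 * \<pi> x))"
          by (simp add: algebra_simps power_mult_distrib)
      qed
      also have "\<dots> = 5 * (Cd * \<delta>\<^sup>2 + (\<eta>' * U)\<^sup>2 + mean (\<lambda>x. (gaB x)\<^sup>2) + mean (\<lambda>x. (gxB x)\<^sup>2) + \<eta>'\<^sup>2 * n2)"
        using sq pi_integrable unfolding n2_def by (simp add: mX[symmetric] pi_mass)
      also have "\<dots> \<le> 5 * (Cd * \<delta>\<^sup>2 + \<eta> * C1 * n2 + \<eta> * C1 * n2 + \<eta> * C1 * n2 + \<eta> * C1 * n2)"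
      proof -
        have ec: "\<eta> * n2 \<le> \<eta> * C1 * n2" using mult_right_mono[OF mult_left_mono[OF C1, of \<eta>] n2] eta by simp
        have "(\<eta>' * U)\<^sup>2 \<le> \<eta>'\<^sup>2 * (Mf * n2)" unfolding power_mult_distrib by (rule mult_left_mono[OF U2]) simp
        also have "\<dots> \<le> \<eta> * n2" using mult_right_mono[OF eta'(2) n2] by (simp add: mult.assoc)
        finally have "(\<eta>' * U)\<^sup>2 \<le> \<eta> * C1 * n2" using ec by linarith
        moreover have "\<eta>'\<^sup>2 * n2 \<le> \<eta> * C1 * n2" using mult_right_mono[OF eta'(3) n2] ec by linarith
        ultimately show ?thesis using g1 g2 by (intro mult_left_mono add_mono order_refl) auto
      qed
      also have "\<dots> = E1" unfolding E1_def by simp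
      finally show ?thesis .
    qed
    define I where "I = (\<integral>x. indicator (J 0) x * \<pi> x powr (1 - 2 * \<gamma>) \<partial>lborel)"
    define E2 where "E2 = 4 * (Cd * \<delta>\<^sup>2) + C5 * c\<^sup>2 + (C5 + 4) * (\<eta> * C1 * n2) + 16 * K\<^sup>2 * I"
    have DT: "(indicator Tl x * D x)\<^sup>2 * \<pi> x \<le> 4 * ((X x)\<^sup>2 * \<pi> x) + C5 * c\<^sup>2 * \<pi> x + C5 * ((gaT x)\<^sup>2 * \<pi> x) + 4 * ((gxT x)\<^sup>2 * \<pi> x)
       + 16 * K\<^sup>2 * (indicator (J 0) x * \<pi> x powr (1 - 2 * \<gamma>))" for x
    proof -
      have ju: "\<bar>transop u x\<bar> \<le> jump (\<lambda>y. indicator UNIV y * \<bar>u y\<bar>) x + \<bar>u x\<bar>" for x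
      proof -
        have "\<bar>jump u x\<bar> \<le> jump (\<lambda>y. \<bar>u y\<bar>) x"
          unfolding jump_def using integral_abs_bound[of lborel "\<lambda>y. k x y * u y"] by (simp add: abs_mult)
        moreover have "\<bar>(1 - acc x) * u x\<bar> \<le> 1 * \<bar>u x\<bar>"
          unfolding abs_mult using acc_le_1[of x] acc_nonneg[of x] by (intro mult_right_mono) auto
        ultimately show ?thesis unfolding transop_def by simp
      qed
      have nn: "0 \<le> C5 * c\<^sup>2 * \<pi> x" "0 \<le> C5 * ((gaT x)\<^sup>2 * \<pi> x)" "0 \<le> 4 * ((X x)\<^sup>2 * \<pi> x)" "0 \<le> 4 * ((gxT x)\<^sup>2 * \<pi> x)"
         "0 \<le> 16 * K\<^sup>2 * (indicator (J 0) x * \<pi> x powr (1 - 2 * \<gamma>))"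
        using C5 by auto
      consider "x \<notin> Tl" | "x \<in> J 0" | "x \<in> Te" unfolding Te_def by blast
      then show ?thesis
      proof cases
        case 1
        then show ?thesis using nn by simp
      next
        case 2
        have "jump (\<lambda>y. indicator UNIV y * \<bar>u y\<bar>) x \<le> K * jump V x"
          using jump_abs_le[of "\<lambda>y. \<bar>u y\<bar>" K \<gamma> x] uK gamma2 by (simp add: abs_le_iff)
        also have "\<dots> \<le> K * (2 * V x)" by (intro mult_left_mono jump_Vs_le gamma2 K)
        finally have "\<bar>D x\<bar> \<le> 4 * K * V x" using ju[of x] uK[of x] unfolding D_def by linarith
        then have "\<bar>D x\<bar>\<^sup>2 \<le> (4 * K * V x)\<^sup>2" by (rule power_mono) simp
        then have "(D x)\<^sup>2 * \<pi> x \<le> (4 * K * V x)\<^sup>2 * \<pi> x" by (intro mult_right_mono) auto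
        also have "\<dots> = 16 * K\<^sup>2 * ((V x * V x) * \<pi> x powr 1)" by (simp add: power2_eq_square)
        also have "(V x * V x) * \<pi> x powr 1 = \<pi> x powr (1 - 2 * \<gamma>)" unfolding powr_add[symmetric] by simp
        finally have "(D x)\<^sup>2 * \<pi> x \<le> 16 * K\<^sup>2 * (indicator (J 0) x * \<pi> x powr (1 - 2 * \<gamma>))" using 2 by simp
        moreover have "(indicator Tl x * D x)\<^sup>2 * \<pi> x \<le> (D x)\<^sup>2 * \<pi> x" by (auto simp: indicator_def)
        ultimately show ?thesis using nn by linarith
      next
        case 3
        then have xJ: "x \<notin> J 0" "x \<in> Tl" unfolding Te_def by auto
        let ?a = "r x"
        have rc: "\<bar>u x - u ?a\<bar> \<le> CL * \<delta> * (1 + c1) * w x" "u ?a - transop u ?a = c" using rcell[OF xJ(1)] by auto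
        have ga: "gaT x = jump (\<lambda>y. \<bar>u y\<bar>) ?a" "gxT x = jump (\<lambda>y. \<bar>u y\<bar>) x" unfolding gaT_def gxT_def using 3 xJ by auto
        have "acc ?a * u ?a = c + jump u ?a" using rc(2) unfolding transop_def by (simp add: algebra_simps)
        moreover have "\<bar>jump u ?a\<bar> \<le> gaT x"
          unfolding ga jump_def using integral_abs_bound[of lborel "\<lambda>y. k ?a y * u y"] by (simp add: abs_mult)
        ultimately have "acc ?a * \<bar>u ?a\<bar> \<le> \<bar>c\<bar> + gaT x" using acc_nonneg[of ?a] by (metis abs_mult abs_of_nonneg abs_triangle_ineq add_left_mono order_trans)
        then have "A0 * \<bar>u ?a\<bar> \<le> \<bar>c\<bar> + gaT x" using mult_right_mono[OF A0(2)[of ?a], of "\<bar>u ?a\<bar>"] by simp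
        then have "\<bar>u ?a\<bar> \<le> (\<bar>c\<bar> + gaT x) / A0" using A0(1) by (simp add: pos_le_divide_eq mult.commute)
        moreover have "X x = 2 * (CL * \<delta> * (1 + c1) * w x)" unfolding X_def by (simp only: mult.assoc)
        ultimately have 2: "2 * \<bar>u x\<bar> \<le> X x + 2 * ((\<bar>c\<bar> + gaT x) / A0)" using rc(1) by linarith
        have "\<bar>D x\<bar> \<le> 2 * \<bar>u x\<bar> + gxT x" using ju[of x] unfolding D_def ga by simp
        also have "\<dots> \<le> X x + 2 * ((\<bar>c\<bar> + gaT x) / A0) + gxT x" using 2 by simp
        also have "\<dots> = X x + 2 / A0 * \<bar>c\<bar> + 2 / A0 * gaT x + gxT x" by (simp add: add_divide_distrib)
        finally have "\<bar>D x\<bar> \<le> X x + 2 / A0 * \<bar>c\<bar> + 2 / A0 * gaT x + gxT x" .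
        then have "\<bar>D x\<bar>\<^sup>2 \<le> (X x + 2 / A0 * \<bar>c\<bar> + 2 / A0 * gaT x + gxT x)\<^sup>2" by (rule power_mono) simp
        also have "\<dots> \<le> 4 * ((X x)\<^sup>2 + (2 / A0 * \<bar>c\<bar>)\<^sup>2 + (2 / A0 * gaT x)\<^sup>2 + (gxT x)\<^sup>2)" by (rule sum_sq_le4)
        also have "\<dots> = 4 * (X x)\<^sup>2 + C5 * c\<^sup>2 + C5 * (gaT x)\<^sup>2 + 4 * (gxT x)\<^sup>2"
          unfolding C5_def by (simp add: power_mult_distrib power_divide)
        finally have "(D x)\<^sup>2 * \<pi> x \<le> (4 * (X x)\<^sup>2 + C5 * c\<^sup>2 + C5 * (gaT x)\<^sup>2 + 4 * (gxT x)\<^sup>2) * \<pi> x"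
          by (intro mult_right_mono) auto
        then show ?thesis using xJ nn(5) by (simp add: algebra_simps)
      qed
    qed
    have Ji: "integrable lborel (\<lambda>x. indicator (J 0) x * \<pi> x powr (1 - 2 * \<gamma>))"
      using integrable_mult_indicator[OF _ pi_powr_integrable, of "J 0" "1 - 2 * \<gamma>"] gamma2 by simp
    have tg: "(\<lambda>x. indicator Tl x * D x) \<in> growth \<gamma>" and bDg: "(\<lambda>x. indicator Bk x * (D x - c)) \<in> growth \<gamma>"
    proof -
      have i: "indicator S \<in> growth 0" if "S \<in> sets borel" for S using that by (intro growthI[where B=1]) (auto simp: indicator_def)
      show "(\<lambda>x. indicator Tl x * D x) \<in> growth \<gamma>" using growth_mult[OF i[OF BT(2)] Dg] by simp
      show "(\<lambda>x. indicator Bk x * (D x - c)) \<in> growth \<gamma>"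
        using growth_mult[OF i[OF BT(1)] growth_diff[OF Dg const_growth[OF gamma2(3)]]] by simp
    qed
    have B2: "mean (\<lambda>x. (indicator Tl x * D x)\<^sup>2) \<le> E2"
    proof -
      have "mean (\<lambda>x. (indicator Tl x * D x)\<^sup>2) \<le> (\<integral>x. 4 * ((X x)\<^sup>2 * \<pi> x) + C5 * c\<^sup>2 * \<pi> x + C5 * ((gaT x)\<^sup>2 * \<pi> x) + 4 * ((gxT x)\<^sup>2 * \<pi> x)
       + 16 * K\<^sup>2 * (indicator (J 0) x * \<pi> x powr (1 - 2 * \<gamma>)) \<partial>lborel)"
        by (rule integral_mono[OF sq_int[OF gs[OF tg]] _ DT]) (use sq pi_integrable Ji in simp)
      also have "\<dots> = 4 * (Cd * \<delta>\<^sup>2) + C5 * c\<^sup>2 + C5 * mean (\<lambda>x. (gaT x)\<^sup>2) + 4 * mean (\<lambda>x. (gxT x)\<^sup>2) + 16 * K\<^sup>2 * I"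
        using sq pi_integrable Ji unfolding I_def by (simp add: mX[symmetric] pi_mass)
      also have "\<dots> \<le> 4 * (Cd * \<delta>\<^sup>2) + C5 * c\<^sup>2 + C5 * (\<eta> * C1 * n2) + 4 * (\<eta> * C1 * n2) + 16 * K\<^sup>2 * I"
        using g3 g4 C5 by (intro add_mono mult_left_mono order_refl) auto
      finally show ?thesis unfolding E2_def by (simp add: algebra_simps)
    qed
    define nD where "nD = mean (\<lambda>x. (D x)\<^sup>2)"
    have i1: "integrable lborel (\<lambda>x. (indicator Bk x * (D x - c))\<^sup>2 * \<pi> x)" "integrable lborel (\<lambda>x. (indicator Tl x * D x)\<^sup>2 * \<pi> x)"
      "integrable lborel (\<lambda>x. (D x)\<^sup>2 * \<pi> x)"
      by (rule sq_int[OF gs[OF bDg]] sq_int[OF gs[OF tg]] sq_int[OF gs[OF Dg]])+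
    have nD1: "nD \<le> 2 * E1 + 2 * c\<^sup>2 + E2"
    proof -
      have "nD \<le> (\<integral>x. 2 * ((indicator Bk x * (D x - c))\<^sup>2 * \<pi> x) + 2 * c\<^sup>2 * \<pi> x + (indicator Tl x * D x)\<^sup>2 * \<pi> x \<partial>lborel)"
        unfolding nD_def
      proof (rule integral_mono[OF i1(3)])
        fix x
        have "(D x)\<^sup>2 \<le> 2 * (indicator Bk x * (D x - c))\<^sup>2 + 2 * c\<^sup>2 + (indicator Tl x * D x)\<^sup>2"
          using BT1[of x] sum_sq_le2[of "D x - c" c] by (cases "x \<in> Bk") (auto simp: indicator_def split: if_splits)
        then have "(D x)\<^sup>2 * \<pi> x \<le> (2 * (indicator Bk x * (D x - c))\<^sup>2 + 2 * c\<^sup>2 + (indicator Tl x * D x)\<^sup>2) * \<pi> x" by (rule mult_right_mono) simp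
        then show "(D x)\<^sup>2 * \<pi> x \<le> 2 * ((indicator Bk x * (D x - c))\<^sup>2 * \<pi> x) + 2 * c\<^sup>2 * \<pi> x + (indicator Tl x * D x)\<^sup>2 * \<pi> x"
          by (simp add: algebra_simps)
      qed (use i1 pi_integrable in simp)
      also have "\<dots> = 2 * mean (\<lambda>x. (indicator Bk x * (D x - c))\<^sup>2) + 2 * c\<^sup>2 + mean (\<lambda>x. (indicator Tl x * D x)\<^sup>2)"
        using i1 pi_integrable by (simp add: pi_mass)
      finally show ?thesis using B1 B2 by linarith
    qed
    have gapu: "mean (\<lambda>x. (transop u x)\<^sup>2) \<le> \<rho>\<^sup>2 * n2" unfolding n2_def by (rule rho(3)[OF ug mu])
    have nD2: "nD \<le> 4 * n2"
    proof -
      have "nD \<le> (\<integral>x. 2 * ((u x)\<^sup>2 * \<pi> x) + 2 * ((transop u x)\<^sup>2 * \<pi> x) \<partial>lborel)"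
        unfolding nD_def
      proof (rule integral_mono[OF i1(3)])
        show "integrable lborel (\<lambda>x. 2 * ((u x)\<^sup>2 * \<pi> x) + 2 * ((transop u x)\<^sup>2 * \<pi> x))"
          using sq(6) sq_int[OF gs[OF tug]] by simp
        fix x
        have "(D x)\<^sup>2 \<le> 2 * ((u x)\<^sup>2 + (transop u x)\<^sup>2)" unfolding D_def using sum_sq_le2[of "u x" "- transop u x"] by simp
        then have "(D x)\<^sup>2 * \<pi> x \<le> (2 * ((u x)\<^sup>2 + (transop u x)\<^sup>2)) * \<pi> x" by (rule mult_right_mono) simp
        then show "(D x)\<^sup>2 * \<pi> x \<le> 2 * ((u x)\<^sup>2 * \<pi> x) + 2 * ((transop u x)\<^sup>2 * \<pi> x)" by (simp add: algebra_simps)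
      qed
      also have "\<dots> = 2 * n2 + 2 * mean (\<lambda>x. (transop u x)\<^sup>2)" unfolding n2_def using sq(6) sq_int[OF gs[OF tug]] by simp
      also have "\<dots> \<le> 2 * n2 + 2 * (1 * n2)"
      proof -
        have "\<rho>\<^sup>2 * n2 \<le> 1 * n2" using rho n2 by (intro mult_right_mono) (auto simp: power_le_one)
        then show ?thesis using gapu by simp
      qed
      finally show ?thesis by simp
    qed
    \<comment> \<open>The mean of \<open>D\<close> vanishes, and \<open>D\<close> is close to \<open>c\<close> in the bulk, which has mass at least 1/2.\<close>
    have csq: "c\<^sup>2 \<le> 32 * \<eta> * n2 + 8 * E1"
    proof -
      have ind: "indicator S \<in> growth \<gamma>" if "S \<in> sets borel" for S
      proof (rule growth_mono[OF _ gamma2(3)])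
        show "indicator S \<in> growth 0" using that by (intro growthI[where B=1]) (auto simp: indicator_def)
      qed
      have mD: "mean D = 0" unfolding D_def using mean_diff[OF ug tug gamma2(2)] mean_transop[OF ug gamma2(3,2)] mu by simp
      have mTB: "mean (indicator Bk) = 1 - mean (indicator Tl)"
      proof -
        have "mean (\<lambda>x. indicator Bk x + indicator Tl x) = mean (indicator Bk) + mean (indicator Tl)"
          by (rule mean_add[OF ind[OF BT(1)] ind[OF BT(2)] gamma2(2)])
        then show ?thesis unfolding BT1 using pi_mass by simp
      qed
      have half: "1 / 2 \<le> mean (indicator Bk)" using mTB piTl eta by linarith
      let ?T = "mean (\<lambda>x. indicator Tl x * D x)"
      let ?B = "mean (\<lambda>x. indicator Bk x * (D x - c))"
      have iB: "integrable lborel (\<lambda>x. indicator Bk x * (D x - c) * \<pi> x)" "integrable lborel (\<lambda>x. indicator Tl x * D x * \<pi> x)"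
          "integrable lborel (\<lambda>x. indicator Bk x * \<pi> x)"
        by (rule growth_integrable[OF bDg gamma2(2)] growth_integrable[OF tg gamma2(2)] growth_integrable[OF ind[OF BT(1)] gamma2(2)])+
      have "0 = (\<integral>x. indicator Bk x * (D x - c) * \<pi> x + indicator Tl x * D x * \<pi> x + c * (indicator Bk x * \<pi> x) \<partial>lborel)"
        unfolding mD[symmetric]
      proof (rule Bochner_Integration.integral_cong[OF refl])
        fix x
        show "D x * \<pi> x = indicator Bk x * (D x - c) * \<pi> x + indicator Tl x * D x * \<pi> x + c * (indicator Bk x * \<pi> x)"
          using BT1[of x] by (auto simp: indicator_def algebra_simps split: if_splits)
      qed
      also have "\<dots> = ?B + ?T + c * mean (indicator Bk)" using iB by simp
      finally have "c * mean (indicator Bk) = - (?B + ?T)" by simp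
      then have "(c * mean (indicator Bk))\<^sup>2 \<le> 2 * (?B\<^sup>2 + ?T\<^sup>2)" using sum_sq_le2[of ?B ?T] by (simp only: power2_minus)
      moreover have "?B\<^sup>2 \<le> E1"
        using mean_cauchy_schwarz[OF const_growth[OF gamma2(3), of 1] bDg gamma2(1)] B1 by (simp add: pi_mass)
      moreover have "?T\<^sup>2 \<le> \<eta> * nD"
      proof -
        have "?T\<^sup>2 \<le> mean (\<lambda>x. (indicator Tl x)\<^sup>2) * nD"
          unfolding nD_def by (rule mean_cauchy_schwarz[OF ind[OF BT(2)] Dg gamma2(1)])
        moreover have "(indicator Tl x)\<^sup>2 = (indicator Tl x :: real)" for x by (simp add: indicator_def)
        moreover have "0 \<le> nD" unfolding nD_def by (rule mean_nonneg) simp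
        ultimately show ?thesis using mult_right_mono[OF piTl, of nD] by simp
      qed
      moreover have "c\<^sup>2 * (1 / 4) \<le> (c * mean (indicator Bk))\<^sup>2"
      proof -
        have "(1 / 2)\<^sup>2 \<le> (mean (indicator Bk))\<^sup>2" using half by (intro power_mono) auto
        then show ?thesis unfolding power_mult_distrib by (intro mult_left_mono) (auto simp: power2_eq_square)
      qed
      moreover have "\<eta> * nD \<le> \<eta> * (4 * n2)" using nD2 eta by (intro mult_left_mono) auto
      ultimately show ?thesis by simp
    qed
    have "(1 - \<rho>)\<^sup>2 * n2 \<le> nD"
      using mean_sq_le_gap[OF ug rho(2) _ rho(1)] gapu unfolding n2_def nD_def D_def by blast
    also have "\<dots> \<le> 2 * E1 + (2 + C5) * c\<^sup>2 + 4 * (Cd * \<delta>\<^sup>2) + (C5 + 4) * (\<eta> * C1 * n2) + 16 * K\<^sup>2 * I"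
      using nD1 unfolding E2_def by (simp add: algebra_simps)
    also have "\<dots> \<le> 2 * E1 + (2 + C5) * (32 * \<eta> * n2 + 8 * E1) + 4 * (Cd * \<delta>\<^sup>2) + (C5 + 4) * (\<eta> * C1 * n2) + 16 * K\<^sup>2 * I"
      using csq C5 by (intro add_mono mult_left_mono order_refl) auto
    also have "\<dots> = (\<eta> * Ce) * n2 + Cdl * \<delta>\<^sup>2 + 16 * K\<^sup>2 * I"
      unfolding E1_def Ce_def Cdl_def by (simp add: algebra_simps)
    also have "(\<eta> * Ce) * n2 \<le> ((1 - \<rho>)\<^sup>2 / 2) * n2" using eta(3) n2 by (rule mult_right_mono)
    finally have fin: "(1 - \<rho>)\<^sup>2 / 2 * n2 \<le> Cdl * \<delta>\<^sup>2 + 16 * K\<^sup>2 * I" by simp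
    have I0: "0 \<le> I" unfolding I_def by (intro integral_nonneg_AE) auto
    have "Cdl * \<delta>\<^sup>2 + 16 * K\<^sup>2 * I \<le> (Cdl + 16 * K\<^sup>2 + 1) * \<delta>\<^sup>2 + (Cdl + 16 * K\<^sup>2 + 1) * I"
      using Cdl I0 by (intro add_mono mult_right_mono) auto
    then have "(1 - \<rho>)\<^sup>2 / 2 * n2 \<le> (Cdl + 16 * K\<^sup>2 + 1) * (\<delta>\<^sup>2 + I)" using fin by (simp add: distrib_left)
    then have "n2 \<le> C * (\<delta>\<^sup>2 + I)" unfolding C_def using rho by (simp add: field_simps)
    then show ?thesis unfolding n2_def I_def .
  qed
  then show ?thesis by (rule that[OF C d0(1)])
qed

end

section \<open>The central limit theorem for the Metropolis chain\<close>

context rwm begin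

lemma kernel_measurable: "P \<in> borel \<rightarrow>\<^sub>M subprob_algebra borel"
proof (rule measurable_subprob_algebra)
  show "subprob_space (P a)" for a using prob_space_P by (rule prob_space_imp_subprob_space)
  show "sets (P a) = sets borel" for a by simp
  fix A :: "'a set" assume A: "A \<in> sets borel"
  have "emeasure (P x) A = ennreal (measure (P x) A)" for x
    using prob_space_P[of x] by (simp add: finite_measure.emeasure_eq_measure prob_space.finite_measure)
  then show "(\<lambda>a. emeasure (P a) A) \<in> borel_measurable borel" using A by simp
qed

lemma variance_nonneg:
  assumes s: "0 < s" "2 * s < 1" and u: "u \<in> growth s" and mu: "mean u = 0"
  shows "mean (\<lambda>x. (transop u x)\<^sup>2) \<le> mean (\<lambda>x. (u x)\<^sup>2)"
proof -
  obtain \<rho> where rho: "0 < \<rho>" "\<rho> < 1" "mean (\<lambda>x. (transop u x)\<^sup>2) \<le> \<rho>\<^sup>2 * mean (\<lambda>x. (u x)\<^sup>2)"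
    using spectral_gap[OF s] u mu by blast
  have "\<rho>\<^sup>2 * mean (\<lambda>x. (u x)\<^sup>2) \<le> 1 * mean (\<lambda>x. (u x)\<^sup>2)"
    using rho by (intro mult_right_mono mean_nonneg) (auto simp: power_le_one)
  then show ?thesis using rho(3) by linarith
qed

text \<open>The conditional variance \<open>h\<close> has growth exponent \<open>2 * s < 1\<close>, so that its Poisson equation is solvable
  as well.\<close>

lemma metropolis_clt:
  assumes chain: "markov_chain M \<Phi> P" and s: "0 < s" "2 * s < 1" and u: "u \<in> growth s" and mu: "mean u = 0"
  shows "weak_conv_m (\<lambda>n. distr M borel (\<lambda>\<omega>. (\<Sum>i=1..n. u (\<Phi> i \<omega>) - transop u (\<Phi> i \<omega>)) / sqrt n))
    (distr std_normal_distribution borel (\<lambda>z. sqrt (mean (\<lambda>x. (u x)\<^sup>2) - mean (\<lambda>x. (transop u x)\<^sup>2)) * z))"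
proof -
  define v where "v = mean (\<lambda>x. (u x)\<^sup>2) - mean (\<lambda>x. (transop u x)\<^sup>2)"
  have s01: "0 \<le> s" "s \<le> 1" "s < 1" using s by auto
  have t01: "0 < 2 * s" "0 \<le> 2 * s" "2 * s \<le> 1" using s by auto
  have tu: "transop u \<in> growth s" by (rule transop_growth[OF u s01(1,2)])
  have u2: "(\<lambda>x. (u x)\<^sup>2) \<in> growth (2 * s)" by (rule growth_power2[OF u])
  have tu2: "(\<lambda>x. (transop u x)\<^sup>2) \<in> growth (2 * s)" by (rule growth_power2[OF tu])
  define h where "h = (\<lambda>x. transop (\<lambda>x. (u x)\<^sup>2) x - (transop u x)\<^sup>2)"
  have hg: "h \<in> growth (2 * s)" unfolding h_def by (intro growth_diff tu2 transop_growth[OF u2 t01(2,3)])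
  have mh: "mean h = v"
    unfolding h_def v_def using mean_diff[OF transop_growth[OF u2 t01(2,3)] tu2 s(2)] mean_transop[OF u2 t01(2) s(2)] by simp
  have hv: "(\<lambda>x. h x - v) \<in> growth (2 * s)" by (intro growth_diff hg const_growth t01)
  have mhv: "mean (\<lambda>x. h x - v) = 0" using mean_diff[OF hg const_growth[OF t01(2)] s(2)] mh mean_const[of v] by simp
  obtain w where w: "w \<in> growth (2 * s)" "\<And>x. w x - transop w x = h x - v"
    using poisson_equation[OF t01(1) s(2) hv mhv] by metis
  obtain B where B: "0 \<le> B" "\<And>x. \<bar>u x\<bar> \<le> B * Vs s x" using growthE[OF u] by metis
  obtain Bw where Bw: "0 \<le> Bw" "\<And>x. \<bar>w x\<bar> \<le> Bw * Vs (2 * s) x" using growthE[OF w(1)] by metis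
  define Cc where "Cc = 3 * B + Bw + 1"
  have Cc: "1 \<le> Cc" "3 * B \<le> Cc" "B \<le> Cc" "Bw \<le> Cc\<^sup>2"
  proof -
    show c1: "1 \<le> Cc" "3 * B \<le> Cc" "B \<le> Cc" unfolding Cc_def using B Bw by auto
    have "Bw \<le> Cc" unfolding Cc_def using B by simp
    also have "Cc \<le> Cc\<^sup>2" using mult_left_mono[OF c1(1), of Cc] c1(1) by (simp add: power2_eq_square)
    finally show "Bw \<le> Cc\<^sup>2" .
  qed
  \<comment> \<open>The drift is available for exponents below 1, hence \<open>s * (2 + \<eta>)\<close> has to stay below 1.\<close>
  define \<eta> where "\<eta> = min 1 ((1 - 2 * s) / (2 * s))"
  have eta: "0 < \<eta>" "\<eta> \<le> 1" unfolding \<eta>_def using s by auto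
  define s3 where "s3 = s * (2 + \<eta>)"
  have s3: "0 < s3" "s3 < 1"
  proof -
    show "0 < s3" unfolding s3_def using s eta by simp
    have "s * \<eta> \<le> s * ((1 - 2 * s) / (2 * s))" unfolding \<eta>_def using s by (intro mult_left_mono) auto
    also have "\<dots> = (1 - 2 * s) / 2" using s by simp
    finally show "s3 < 1" unfolding s3_def using s by (simp add: distrib_left)
  qed
  obtain l \<kappa> where dr: "0 < l" "l < 1" "0 < \<kappa>" "\<And>x. transop (Vs s3) x \<le> l * Vs s3 x + \<kappa>" using drift[OF s3] by blast
  define U where "U = (\<lambda>x. Cc * Vs s x)"
  have UW: "U x powr (2 + \<eta>) = Cc powr (2 + \<eta>) * Vs s3 x" for x
    unfolding U_def s3_def using Cc by (simp add: powr_mult powr_powr)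
  have Wg: "(\<lambda>x. U x powr (2 + \<eta>)) \<in> growth s3" unfolding UW by (rule growth_cmult[OF Vs_growth])
  interpret kc: kernel_chain M \<Phi> P
    by (rule kernel_chain.intro[OF chain kernel_measurable prob_space_P])
  interpret cc: clt_chain M \<Phi> P u w U v l "Cc powr (2 + \<eta>) * \<kappa>" \<eta>
  proof
    show "u \<in> borel_measurable borel" "w \<in> borel_measurable borel" by (rule growth_meas[OF u] growth_meas[OF w(1)])+
    show "U \<in> borel_measurable borel" unfolding U_def by measurable
    show "0 \<le> U x" for x unfolding U_def using Cc by simp
    show "\<bar>u x\<bar> \<le> U x" for x
      unfolding U_def by (rule order_trans[OF B(2) mult_right_mono[OF Cc(3)]]) simp
    show "\<bar>\<integral>y. u y \<partial>P x\<bar> \<le> U x" for x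
      unfolding integral_P[OF u s01(1,2)] U_def
      by (rule order_trans[OF transop_abs_le[OF growth_meas[OF u] B(2) s01(1,2)] mult_right_mono[OF Cc(2)]]) simp
    show "\<bar>w x\<bar> \<le> (U x)\<^sup>2" for x
    proof -
      have eq: "(U x)\<^sup>2 = Cc\<^sup>2 * Vs (2 * s) x" unfolding U_def by (simp add: power_mult_distrib powr_add[symmetric] power2_eq_square)
      have "\<bar>w x\<bar> \<le> Cc\<^sup>2 * Vs (2 * s) x"
        by (rule order_trans[OF Bw(2) mult_right_mono[OF Cc(4)]]) simp
      then show ?thesis unfolding eq .
    qed
    show "0 < \<eta>" "\<eta> \<le> 1" by (rule eta)+
    show "integrable (P x) (\<lambda>y. U y powr (2 + \<eta>))" for x using integrable_P[OF Wg] s3 by simp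
    show "(\<integral>y. U y powr (2 + \<eta>) \<partial>P x) \<le> l * U x powr (2 + \<eta>) + Cc powr (2 + \<eta>) * \<kappa>" for x
    proof -
      have "(\<integral>y. U y powr (2 + \<eta>) \<partial>P x) = transop (\<lambda>x. U x powr (2 + \<eta>)) x" using integral_P[OF Wg] s3 by simp
      also have "\<dots> = Cc powr (2 + \<eta>) * transop (Vs s3) x" unfolding UW by (rule transop_cmult)
      also have "\<dots> \<le> Cc powr (2 + \<eta>) * (l * Vs s3 x + \<kappa>)" using dr by (intro mult_left_mono) auto
      finally show ?thesis unfolding UW by (simp add: algebra_simps)
    qed
    show "0 \<le> l" "l < 1" "0 \<le> Cc powr (2 + \<eta>) * \<kappa>" using dr by auto
    show "0 \<le> v" unfolding v_def using variance_nonneg[OF s u mu] by simp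
    show "w x - (\<integral>y. w y \<partial>P x) = (\<integral>y. (u y)\<^sup>2 \<partial>P x) - (\<integral>y. u y \<partial>P x)\<^sup>2 - v" for x
      using w(2)[of x] unfolding integral_P[OF w(1) t01(2,3)] integral_P[OF u2 t01(2,3)] integral_P[OF u s01(1,2)] h_def by simp
  qed
  have "cc.S n \<omega> = (\<Sum>i=1..n. u (\<Phi> i \<omega>) - transop u (\<Phi> i \<omega>))" for n \<omega>
    unfolding cc.S_def integral_P[OF u s01(1,2)] ..
  then show ?thesis using cc.chain_clt unfolding v_def by simp
qed

lemma clt_with_variance_poisson:
  assumes chain: "markov_chain M \<Phi> P" and s: "0 < s" "2 * s < 1" and u: "u \<in> growth s" and mu: "mean u = 0"
    and eq: "\<And>x. u x - transop u x = H x - density_mean \<pi> H"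
  shows "clt_with_variance M \<Phi> \<pi> H (mean (\<lambda>x. (u x)\<^sup>2) - mean (\<lambda>x. (transop u x)\<^sup>2))"
proof -
  have "sqrt (real n) * (ergodic_average \<Phi> H n \<omega> - density_mean \<pi> H) = (\<Sum>i=1..n. u (\<Phi> i \<omega>) - transop u (\<Phi> i \<omega>)) / sqrt n" for n \<omega>
  proof (cases "n = 0")
    case False
    have "(\<Sum>i=1..n. u (\<Phi> i \<omega>) - transop u (\<Phi> i \<omega>)) = (\<Sum>i=1..n. H (\<Phi> i \<omega>)) - real n * density_mean \<pi> H"
      unfolding eq by (simp add: sum_subtractf)
    moreover have "sqrt (real n) * (A / real n - b) = (A - real n * b) / sqrt n" for A b
    proof -
      have 1: "sqrt (real n) / real n = 1 / sqrt n" using False by (simp add: field_simps)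
      have "sqrt (real n) * (A / real n - b) = (A - real n * b) * (sqrt (real n) / real n)"
        using False by (simp add: field_simps)
      then show ?thesis unfolding 1 by simp
    qed
    ultimately show ?thesis unfolding ergodic_average_def by simp
  qed simp
  then show ?thesis unfolding clt_with_variance_def
    using metropolis_clt[OF chain s u mu] variance_nonneg[OF s u mu] by simp
qed

end

section \<open>From gradients to increments\<close>

lemma GDERIV_unique:
  fixes f :: "'a::euclidean_space \<Rightarrow> real"
  assumes "GDERIV f x :> D" "GDERIV f x :> E"
  shows "D = E"
proof -
  have "(\<lambda>h. inner h D) = (\<lambda>h. inner h E)"
    using assms unfolding gderiv_def by (rule has_derivative_unique)
  then have "inner (D - E) D = inner (D - E) E" by (rule fun_cong)
  then have "inner (D - E) (D - E) = 0" by (simp add: inner_diff_right)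
  then show ?thesis by simp
qed

lemma grad_eq: "GDERIV f x :> D \<Longrightarrow> grad f x = D"
  unfolding grad_def using GDERIV_unique by blast

lemma GDERIV_grad: "continuously_differentiable f \<Longrightarrow> GDERIV f x :> grad f x"
  unfolding continuously_differentiable_def using grad_eq by metis

lemma GDERIV_line:
  assumes "GDERIV f (b + s *\<^sub>R z) :> D"
  shows "((\<lambda>s. f (b + s *\<^sub>R z)) has_real_derivative inner z D) (at s)"
proof -
  have "((\<lambda>s. b + s *\<^sub>R z) has_derivative (\<lambda>h. h *\<^sub>R z)) (at s)"
    by (auto intro!: derivative_eq_intros)
  from has_derivative_compose[OF this assms[unfolded gderiv_def]]
  have "((\<lambda>s. f (b + s *\<^sub>R z)) has_derivative (\<lambda>h. inner (h *\<^sub>R z) D)) (at s)" .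
  moreover have "(\<lambda>h. inner (h *\<^sub>R z) D) = (*) (inner z D)" by (auto simp: mult.commute)
  ultimately show ?thesis unfolding has_field_derivative_def by simp
qed

lemma increment_le_of_grad:
  fixes f :: "'a::euclidean_space \<Rightarrow> real"
  assumes f: "continuously_differentiable f" and L: "\<And>y. norm (x - y) < \<epsilon> \<Longrightarrow> norm (grad f y) \<le> L" and x': "norm (x - x') < \<epsilon>"
  shows "\<bar>f x - f x'\<bar> \<le> norm (x - x') * L"
proof -
  have "norm (f x - f x') \<le> L * norm (x - x')"
  proof (rule differentiable_bound[of "ball x \<epsilon>" f "\<lambda>y h. inner h (grad f y)"])
    show "(f has_derivative (\<lambda>h. inner h (grad f y))) (at y within ball x \<epsilon>)" for y
      using GDERIV_grad[OF f, of y] unfolding gderiv_def by (rule has_derivative_at_withinI)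
    show "onorm (\<lambda>h. inner h (grad f y)) \<le> L" if "y \<in> ball x \<epsilon>" for y
    proof (rule onorm_le)
      fix h
      have "norm (inner h (grad f y)) \<le> norm h * norm (grad f y)" using Cauchy_Schwarz_ineq2[of h "grad f y"] by simp
      also have "\<dots> \<le> norm h * L" using L[of y] that by (intro mult_left_mono) (auto simp: dist_norm)
      finally show "norm (inner h (grad f y)) \<le> L * norm h" by (simp add: mult.commute)
    qed
    show "x \<in> ball x \<epsilon>" "x' \<in> ball x \<epsilon>" using x' order_le_less_trans[OF norm_ge_zero x'] by (auto simp: dist_norm)
  qed (rule convex_ball)
  then show ?thesis by (simp add: mult.commute)
qed

text \<open>The derivative of \<open>ln (p (s *\<^sub>R x)) + L * norm x * s\<close> in \<open>s\<close> is nonpositive as long as \<open>s *\<^sub>R x\<close> stays in the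
  region where the radial derivative of \<open>ln p\<close> is at most \<open>- L\<close>.\<close>

lemma radial_decay_of_log_gradient:
  fixes p :: "'a::euclidean_space \<Rightarrow> real"
  assumes p: "continuously_differentiable p" "\<And>x. 0 < p x"
    and tail: "filterlim (\<lambda>x. (x /\<^sub>R norm x) \<bullet> grad (\<lambda>y. ln (p y)) x) at_bot at_infinity"
  shows "\<exists>R. \<forall>x t. R \<le> norm x \<longrightarrow> 1 \<le> t \<longrightarrow> p (t *\<^sub>R x) \<le> p x * exp (- (L * (t - 1) * norm x))"
proof -
  have gl: "GDERIV (\<lambda>y. ln (p y)) x :> grad (\<lambda>y. ln (p y)) x" for x
  proof -
    have "GDERIV (\<lambda>y. ln (p y)) x :> (1 / p x) *\<^sub>R grad p x"
      using p by (intro GDERIV_DERIV_compose GDERIV_grad DERIV_ln_divide)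
    then show ?thesis using grad_eq by metis
  qed
  obtain R where R: "\<And>x. R \<le> norm x \<Longrightarrow> (x /\<^sub>R norm x) \<bullet> grad (\<lambda>y. ln (p y)) x \<le> - L"
    using tail unfolding filterlim_at_bot eventually_at_infinity by blast
  have "p (t *\<^sub>R x) \<le> p x * exp (- (L * (t - 1) * norm x))" if x: "max R 1 \<le> norm x" and t: "1 \<le> t" for x t
  proof -
    let ?g = "\<lambda>s. ln (p (0 + s *\<^sub>R x)) + L * norm x * s"
    have x0: "0 < norm x" using x by linarith
    have "?g t \<le> ?g 1"
    proof (rule DERIV_nonpos_imp_nonincreasing[OF t])
      fix s :: real assume s: "1 \<le> s" "s \<le> t"
      let ?G = "grad (\<lambda>y. ln (p y)) (s *\<^sub>R x)"
      have "R \<le> norm (s *\<^sub>R x)"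
      proof -
        have "1 * norm x \<le> \<bar>s\<bar> * norm x" using s by (intro mult_right_mono) auto
        then show ?thesis using x by simp
      qed
      from R[OF this] have r: "((s *\<^sub>R x) /\<^sub>R norm (s *\<^sub>R x)) \<bullet> ?G \<le> - L" .
      have e: "(s *\<^sub>R x) /\<^sub>R norm (s *\<^sub>R x) = x /\<^sub>R norm x" using s by simp
      have "(x \<bullet> ?G) / norm x \<le> - L" using r unfolding e by (simp add: divide_inverse mult.commute)
      then have "x \<bullet> ?G \<le> - L * norm x" using x0 by (simp only: pos_divide_le_eq)
      then have le: "x \<bullet> ?G + L * norm x \<le> 0" by simp
      have "(?g has_real_derivative (x \<bullet> ?G + L * norm x * 1)) (at s)"
        by (intro DERIV_add GDERIV_line DERIV_cmult DERIV_ident) (use gl[of "s *\<^sub>R x"] in simp)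
      then show "\<exists>y. (?g has_real_derivative y) (at s) \<and> y \<le> 0" using le by (intro exI[of _ "x \<bullet> ?G + L * norm x * 1"]) simp
    qed
    then have "ln (p (t *\<^sub>R x)) \<le> ln (p x) + (- (L * (t - 1) * norm x))" by (simp add: algebra_simps)
    then have "exp (ln (p (t *\<^sub>R x))) \<le> exp (ln (p x) + (- (L * (t - 1) * norm x)))" by (simp only: exp_le_cancel_iff)
    then show ?thesis using p(2) by (simp only: exp_add exp_ln)
  qed
  then show ?thesis by blast
qed

lemma direction_diff_le:
  fixes x y :: "'a::euclidean_space"
  assumes "x \<noteq> 0" "y \<noteq> 0"
  shows "norm (x /\<^sub>R norm x - y /\<^sub>R norm y) \<le> 2 * norm (x - y) / norm x"
proof -
  have "x /\<^sub>R norm x - y /\<^sub>R norm y = (x - y) /\<^sub>R norm x + ((norm y - norm x) / (norm x * norm y)) *\<^sub>R y"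
    using assms by (simp add: algebra_simps diff_divide_distrib divide_inverse)
  also have "norm \<dots> \<le> norm ((x - y) /\<^sub>R norm x) + norm (((norm y - norm x) / (norm x * norm y)) *\<^sub>R y)" by (rule norm_triangle_ineq)
  also have "norm ((x - y) /\<^sub>R norm x) = norm (x - y) / norm x" by (simp add: divide_inverse mult.commute)
  also have "norm (((norm y - norm x) / (norm x * norm y)) *\<^sub>R y) = \<bar>norm y - norm x\<bar> / norm x" using assms by simp
  also have "\<bar>norm y - norm x\<bar> / norm x \<le> norm (x - y) / norm x"
    using norm_triangle_ineq3[of y x] by (intro divide_right_mono) (auto simp: norm_minus_commute)
  finally show ?thesis by simp
qed

text \<open>A direction close to \<open>- x / norm x\<close> has a nonnegative inner product with the gradient at all
  points near \<open>x\<close>, so that \<open>p\<close> increases along it.\<close>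

lemma inward_ball_of_curvature:
  fixes p :: "'a::euclidean_space \<Rightarrow> real"
  assumes p: "continuously_differentiable p"
    and curv: "Limsup at_infinity (\<lambda>x. ereal ((x /\<^sub>R norm x) \<bullet> (grad p x /\<^sub>R norm (grad p x)))) < 0"
  shows "\<exists>R. \<exists>\<epsilon>>0. \<forall>x z. R \<le> norm x \<longrightarrow> z \<in> ball (- (1 / (2 * norm x)) *\<^sub>R x) \<epsilon> \<longrightarrow> p x \<le> p (x + z)"
proof -
  obtain c where c: "Limsup at_infinity (\<lambda>x. ereal ((x /\<^sub>R norm x) \<bullet> (grad p x /\<^sub>R norm (grad p x)))) < ereal c" "ereal c < 0"
    using ereal_dense2[OF curv] by blast
  obtain R where R: "\<And>x. R \<le> norm x \<Longrightarrow> (x /\<^sub>R norm x) \<bullet> (grad p x /\<^sub>R norm (grad p x)) < c"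
    using Limsup_lessD[OF c(1)] unfolding eventually_at_infinity by auto
  define e where "e = min (- c) 1"
  have e: "0 < e" "e \<le> 1" "c \<le> - e" unfolding e_def using c(2) by auto
  define R1 where "R1 = max (R + 1) (max 2 (8 / e))"
  have "p x \<le> p (x + z)" if x: "R1 \<le> norm x" and z: "z \<in> ball (- (1 / (2 * norm x)) *\<^sub>R x) (e / 4)" for x z
  proof -
    have x2: "2 \<le> norm x" "R + 1 \<le> norm x" "8 / e \<le> norm x" using x unfolding R1_def by auto
    have x0: "x \<noteq> 0" using x2 by auto
    let ?n = "\<lambda>y::'a. y /\<^sub>R norm y"
    have zz: "norm (z + (1 / 2) *\<^sub>R ?n x) < e / 4"
    proof -
      have "z + (1 / 2) *\<^sub>R ?n x = - (- (1 / (2 * norm x)) *\<^sub>R x - z)" by (simp add: inverse_eq_divide)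
      then have "norm (z + (1 / 2) *\<^sub>R ?n x) = dist (- (1 / (2 * norm x)) *\<^sub>R x) z"
        unfolding dist_norm by (simp only: norm_minus_cancel)
      then show ?thesis using z by (simp only: mem_ball)
    qed
    have "norm z \<le> norm (z + (1 / 2) *\<^sub>R ?n x) + norm ((1 / 2) *\<^sub>R ?n x)"
      using norm_triangle_ineq4[of "z + (1 / 2) *\<^sub>R ?n x" "(1 / 2) *\<^sub>R ?n x"] by simp
    also have "norm ((1 / 2) *\<^sub>R ?n x) = 1 / 2" using x0 by simp
    finally have z1: "norm z \<le> 1" using zz e by linarith
    have "p (x + 0 *\<^sub>R z) \<le> p (x + 1 *\<^sub>R z)"
    proof (rule DERIV_nonneg_imp_nondecreasing[where f="\<lambda>s. p (x + s *\<^sub>R z)"])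
      fix s :: real assume s: "0 \<le> s" "s \<le> 1"
      let ?y = "x + s *\<^sub>R z"
      let ?G = "grad p ?y"
      have xy: "norm (x - ?y) \<le> 1"
      proof -
        have "norm (x - ?y) = s * norm z" using s by simp
        also have "\<dots> \<le> 1" using s z1 by (intro mult_le_one) auto
        finally show ?thesis .
      qed
      have ny: "R \<le> norm ?y" "1 \<le> norm ?y" using norm_triangle_sub[of x ?y] xy x2 by linarith+
      then have y0: "?y \<noteq> 0" by auto
      have "?n ?y \<bullet> ?G \<le> - e * norm ?G"
      proof (cases "?G = 0")
        case False
        have "(?n ?y \<bullet> ?G) / norm ?G = ?n ?y \<bullet> (?G /\<^sub>R norm ?G)" by (simp add: divide_inverse mult.commute)
        also have "\<dots> \<le> - e" using R[OF ny(1)] e by linarith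
        finally show ?thesis using False by (simp add: pos_divide_le_eq)
      qed simp
      moreover define d where "d = z + (1 / 2) *\<^sub>R ?n ?y"
      have nd: "norm d \<le> e / 2"
      proof -
        have "d = (z + (1 / 2) *\<^sub>R ?n x) - (1 / 2) *\<^sub>R (?n x - ?n ?y)" unfolding d_def by (simp add: algebra_simps)
        then have "norm d \<le> norm (z + (1 / 2) *\<^sub>R ?n x) + norm ((1 / 2) *\<^sub>R (?n x - ?n ?y))" using norm_triangle_ineq4 by metis
        also have "norm ((1 / 2) *\<^sub>R (?n x - ?n ?y)) = (1 / 2) * norm (?n x - ?n ?y)" by simp
        also have "norm (?n x - ?n ?y) \<le> 2 * norm (x - ?y) / norm x" by (rule direction_diff_le[OF x0 y0])
        also have "2 * norm (x - ?y) / norm x \<le> 2 * 1 / (8 / e)"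
          using xy x2 e x0 by (intro frac_le mult_left_mono) auto
        finally show ?thesis using zz e by simp
      qed
      have "\<bar>d \<bullet> ?G\<bar> \<le> e / 2 * norm ?G"
        by (rule order_trans[OF Cauchy_Schwarz_ineq2 mult_right_mono[OF nd norm_ge_zero]])
      moreover have "z \<bullet> ?G = d \<bullet> ?G - (1 / 2) * (?n ?y \<bullet> ?G)" unfolding d_def by (simp add: inner_add_left)
      ultimately have "0 \<le> z \<bullet> ?G" by linarith
      then show "\<exists>y. ((\<lambda>s. p (x + s *\<^sub>R z)) has_real_derivative y) (at s) \<and> 0 \<le> y"
        using GDERIV_line[OF GDERIV_grad[OF p]] by blast
    qed simp
    then show ?thesis by simp
  qed
  then show ?thesis using e by (intro exI[of _ R1] exI[of _ "e / 4"]) auto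
qed

lemma probability_density_integral:
  assumes "probability_density f"
  shows "integrable lborel f" "(\<integral>x. f x \<partial>lborel) = 1"
proof -
  have f[measurable]: "f \<in> borel_measurable borel" and f0: "\<And>x. 0 \<le> f x" using assms by (auto simp: probability_density_def)
  interpret prob_space "density lborel (\<lambda>x. ennreal (f x))" using assms by (simp add: probability_density_def)
  have nn: "(\<integral>\<^sup>+x. ennreal (f x) \<partial>lborel) = 1" using emeasure_space_1 by (simp add: emeasure_density)
  show i: "integrable lborel f" using nn f0 by (intro integrableI_nonneg) auto
  show "(\<integral>x. f x \<partial>lborel) = 1" using nn f0 by (simp add: integral_eq_nn_integral)
qed

section \<open>Meshes and scheme outputs\<close>

lemma mesh_bounds:
  assumes al: "allotment m J a" and W: "\<And>x. 1 \<le> W x"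
  shows "\<And>j y. 1 \<le> j \<Longrightarrow> j \<le> m \<Longrightarrow> y \<in> J j \<Longrightarrow> norm (y - a j) \<le> mesh m J a W"
    and "\<And>j y. j \<le> m \<Longrightarrow> y \<in> J j \<Longrightarrow> W (a j) \<le> (1 + mesh m J a W) * W y"
    and "0 \<le> mesh m J a W"
proof -
  let ?S = "(\<lambda>j. SUP y\<in>J j. norm (y - a j)) ` {1..m} \<union> (\<lambda>j. SUP y\<in>J j. W (a j) / W y - 1) ` {0..m}"
  have fin: "finite ?S" by simp
  show "norm (y - a j) \<le> mesh m J a W" if j: "1 \<le> j" "j \<le> m" and y: "y \<in> J j" for j y
  proof -
    have bd: "bounded (J j)" using al j unfolding allotment_def by (meson UN_upper atLeastAtMost_iff bounded_subset)
    then obtain B where B: "\<And>y. y \<in> J j \<Longrightarrow> norm y \<le> B" unfolding bounded_iff by blast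
    have "bdd_above ((\<lambda>y. norm (y - a j)) ` J j)"
    proof (rule bdd_aboveI2[where M="B + norm (a j)"])
      show "norm (y - a j) \<le> B + norm (a j)" if "y \<in> J j" for y
        using norm_triangle_ineq4[of y "a j"] B[OF that] by linarith
    qed
    then have "norm (y - a j) \<le> (SUP y\<in>J j. norm (y - a j))" using y by (rule cSUP_upper[rotated])
    also have "\<dots> \<le> mesh m J a W" unfolding mesh_def using fin j by (intro Max_ge) auto
    finally show ?thesis .
  qed
  have rat: "W (a j) / W y - 1 \<le> mesh m J a W" if j: "j \<le> m" and y: "y \<in> J j" for j y
  proof -
    have "bdd_above ((\<lambda>y. W (a j) / W y - 1) ` J j)"
    proof (rule bdd_aboveI2[where M="W (a j)"])
      fix y
      have "W (a j) / W y \<le> W (a j) / 1" using W[of y] W[of "a j"] by (intro divide_left_mono) auto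
      then show "W (a j) / W y - 1 \<le> W (a j)" by simp
    qed
    then have "W (a j) / W y - 1 \<le> (SUP y\<in>J j. W (a j) / W y - 1)" using y by (rule cSUP_upper[rotated])
    also have "\<dots> \<le> mesh m J a W" unfolding mesh_def using fin j by (intro Max_ge) auto
    finally show ?thesis .
  qed
  show "W (a j) \<le> (1 + mesh m J a W) * W y" if "j \<le> m" "y \<in> J j" for j y
    using rat[OF that] W[of y] by (simp add: field_simps)
  show "0 \<le> mesh m J a W" using rat[of 0 "a 0"] al W[of "a 0"] by (auto simp: allotment_def)
qed

lemma allotment_cells:
  assumes al: "allotment m J a" and c: "0 < c" and W: "\<And>x. 1 \<le> c * W x"
  shows "cells W m J a (mesh m J a (\<lambda>x. c * W x))"
proof -
  note mb = mesh_bounds[OF al, where W="\<lambda>x. c * W x", OF W]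
  have "W (a j) \<le> (1 + mesh m J a (\<lambda>x. c * W x)) * W y" if "j \<le> m" "y \<in> J j" for j y
  proof -
    have "c * W (a j) \<le> c * ((1 + mesh m J a (\<lambda>x. c * W x)) * W y)" using mb(2)[OF that] by (simp add: mult.left_commute)
    then show ?thesis using c by (simp only: mult_le_cancel_left_pos)
  qed
  then show ?thesis using al mb(1,3) unfolding cells_def allotment_def by auto
qed

context rwm begin

text \<open>For a function that is constant on the cells, the row of the allotment matrix at \<open>a j\<close> acts like the
  kernel at \<open>a j\<close>. The constant \<open>c\<close> is the mean of \<open>F\<close> under the invariant vector.\<close>

lemma scheme_output_equation:
  assumes so: "scheme_output P F m J a G" and cl: "cells W m J a \<delta>"
  obtains c where "G \<in> borel_measurable borel" "G \<in> growth 0" "\<And>j x. j \<le> m \<Longrightarrow> x \<in> J j \<Longrightarrow> G x = G (a j)"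
    "\<And>j. j \<le> m \<Longrightarrow> G (a j) - transop G (a j) = F (a j) - c"
proof -
  obtain wt fh where fh: "\<And>i. i \<le> m \<Longrightarrow> fh (a i) - (\<Sum>j\<le>m. allotment_matrix P J a i j * fh (a j)) = F (a i) - (\<Sum>j\<le>m. wt j * F (a j))"
    and G: "G = (\<lambda>x. \<Sum>j\<le>m. fh (a j) * indicator (J j) x)"
    using so unfolding scheme_output_def by blast
  have Jm: "J j \<in> sets borel" "a j \<in> J j" if "j \<le> m" for j using cl that by (auto simp: cells_def)
  have Gx: "G x = fh (a j)" if "j \<le> m" "x \<in> J j" for j x unfolding G using cells_sum(1)[OF cl that] .
  have Gm: "G \<in> borel_measurable borel" unfolding G using Jm by (intro borel_measurable_sum borel_measurable_times borel_measurable_indicator) auto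
  have Gg: "G \<in> growth 0"
  proof (rule growthI[OF Gm])
    fix x
    obtain j where j: "j \<le> m" "x \<in> J j" using cells_cell[OF cl] by blast
    have "\<bar>fh (a j)\<bar> \<le> (\<Sum>j\<le>m. \<bar>fh (a j)\<bar>)" using j by (intro member_le_sum) auto
    then show "\<bar>G x\<bar> \<le> (\<Sum>j\<le>m. \<bar>fh (a j)\<bar>) * Vs 0 x" using Gx[OF j] by simp
  qed
  have tr: "transop G x = (\<Sum>j\<le>m. measure (P x) (J j) * fh (a j))" for x
  proof -
    interpret Px: prob_space "P x" by (rule prob_space_P)
    have "transop G x = (\<integral>y. G y \<partial>P x)" using integral_P[OF Gg] by simp
    also have "\<dots> = (\<Sum>j\<le>m. \<integral>y. fh (a j) * indicator (J j) y \<partial>P x)"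
      unfolding G using Jm by (intro Bochner_Integration.integral_sum integrable_mult_right integrable_real_indicator) (auto simp: Px.emeasure_eq_measure)
    also have "\<dots> = (\<Sum>j\<le>m. measure (P x) (J j) * fh (a j))" by (intro sum.cong) auto
    finally show ?thesis .
  qed
  show ?thesis
  proof (rule that[of "\<Sum>j\<le>m. wt j * F (a j)"])
    show "G x = G (a j)" if "j \<le> m" "x \<in> J j" for j x using Gx[OF that] Gx[OF that(1) Jm(2)[OF that(1)]] by simp
    show "G (a j) - transop G (a j) = F (a j) - (\<Sum>j\<le>m. wt j * F (a j))" if "j \<le> m" for j
      using fh[OF that] Gx[OF that Jm(2)[OF that]] unfolding tr allotment_matrix_def by simp
  qed (use Gm Gg in auto)
qed

end

section \<open>The asymptotic variance of the corrected ergodic averages\<close>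

context rwm_smooth begin

text \<open>The error \<open>u n\<close> realizes the difference of the corrected function and its mean as \<open>u n - transop (u n)\<close>,
  and \<open>stability\<close> applies to it: its increments on the cells are those of the Lipschitz solution \<open>h\<close>,
  and its growth is controlled by \<open>h\<close> and by the oscillation bound of the scheme.\<close>

lemma scheme_variance_bound:
  assumes chain: "markov_chain M \<Phi> P"
    and cl: "\<And>n. cells V (m n) (J n) (a n) (\<delta> n)" and J0: "\<And>n. 0 < emeasure lborel (J n 0)"
    and \<delta>: "\<delta> \<longlonglongrightarrow> 0" and far: "\<And>R. \<forall>\<^sub>F n in sequentially. \<forall>x\<in>J n 0. R < norm x"
    and F: "F \<in> growth \<gamma>" and F_lip: "0 < \<epsilon>F" "0 \<le> cF"
      "\<And>x x'. norm (x - x') < \<epsilon>F \<Longrightarrow> \<bar>F x - F x'\<bar> \<le> norm (x - x') * (cF * \<pi> x powr (\<gamma> - 1 / 2))"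
    and G: "\<And>n. scheme_output P F (m n) (J n) (a n) (G n)"
  shows "\<exists>C>0. \<forall>n. \<exists>v. clt_with_variance M \<Phi> \<pi> (\<lambda>x. F x + kernel_op P (G n) x - G n x) v \<and>
    v \<le> C * max ((\<delta> n)\<^sup>2) (\<integral>x\<in>J n 0. \<pi> x powr (1 - 2 * \<gamma>) \<partial>lborel)"
proof -
  have g01: "0 \<le> \<gamma>" "\<gamma> \<le> 1" "\<gamma> < 1" "0 < \<gamma>" "2 * \<gamma> < 1" using gamma gamma2 by auto
  define I where "I n = (\<integral>x. indicator (J n 0) x * \<pi> x powr (1 - 2 * \<gamma>) \<partial>lborel)" for n
  have f0: "(\<lambda>x. F x - mean F) \<in> growth \<gamma>" by (intro growth_diff F const_growth g01)
  have mf0: "mean (\<lambda>x. F x - mean F) = 0"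
    using mean_diff[OF F const_growth[OF g01(1)] g01(3)] mean_const[of "mean F"] by simp
  obtain h CL \<epsilon> where h: "h \<in> growth \<gamma>" "\<And>x. h x - transop h x = F x - mean F" and CL: "0 \<le> CL" "0 < \<epsilon>"
    "\<And>x x'. norm (x - x') < \<epsilon> \<Longrightarrow> \<bar>h x - h x'\<bar> \<le> CL * norm (x - x') * (w x + w x')"
    by (rule poisson_solution_lipschitz[OF f0 mf0 F_lip(1,2)]) (use F_lip(3) in auto)
  have ex: "\<exists>c. G n \<in> growth \<gamma> \<and> (\<forall>j x. j \<le> m n \<longrightarrow> x \<in> J n j \<longrightarrow> G n x = G n (a n j)) \<and>
      (\<forall>j\<le>m n. G n (a n j) - transop (G n) (a n j) = F (a n j) - c)" for n
    using scheme_output_equation[OF G cl] growth_mono[OF _ g01(1)] by metis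
  then obtain c where Gg: "\<And>n. G n \<in> growth \<gamma>" and Gc: "\<And>n j x. j \<le> m n \<Longrightarrow> x \<in> J n j \<Longrightarrow> G n x = G n (a n j)"
    and Ge: "\<And>n j. j \<le> m n \<Longrightarrow> G n (a n j) - transop (G n) (a n j) = F (a n j) - c n"
    by metis
  define u where "u n x = h x - G n x - mean (\<lambda>x. h x - G n x)" for n x
  define v where "v n = mean (\<lambda>x. (u n x)\<^sup>2) - mean (\<lambda>x. (transop (u n) x)\<^sup>2)" for n
  have dg: "(\<lambda>x. h x - G n x) \<in> growth \<gamma>" for n by (intro growth_diff h Gg)
  have ug: "u n \<in> growth \<gamma>" for n unfolding u_def[abs_def] by (intro growth_diff dg const_growth g01)
  have um: "mean (u n) = 0" for n
    unfolding u_def using mean_diff[OF dg const_growth[OF g01(1)] g01(3)] mean_const[of "mean (\<lambda>x. h x - G n x)"] by simp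
  have ue: "u n x - transop (u n) x = F x - mean F - (G n x - transop (G n) x)" for n x
  proof -
    have "transop (u n) x = transop h x - transop (G n) x - mean (\<lambda>x. h x - G n x)"
      unfolding u_def[abs_def] transop_diff[OF dg const_growth[OF g01(1)] g01(1,2)] transop_diff[OF h(1) Gg g01(1,2)] transop_const ..
    then show ?thesis using h(2)[of x] unfolding u_def by linarith
  qed
  have clt: "clt_with_variance M \<Phi> \<pi> (\<lambda>x. F x + kernel_op P (G n) x - G n x) (v n)" for n
    unfolding v_def
  proof (rule clt_with_variance_poisson[OF chain g01(4,5) ug um])
    fix x
    have ko: "kernel_op P (G n) = transop (G n)" unfolding kernel_op_def using integral_P[OF Gg g01(1,2)] by (intro ext)
    have "mean (\<lambda>x. F x + kernel_op P (G n) x - G n x) = mean F"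
      unfolding ko using mean_diff[OF growth_add[OF F transop_growth[OF Gg g01(1,2)]] Gg g01(3)]
        mean_add[OF F transop_growth[OF Gg g01(1,2)] g01(3)] mean_transop[OF Gg g01(1,3)] by simp
    then show "u n x - transop (u n) x = F x + kernel_op P (G n) x - G n x - density_mean \<pi> (\<lambda>x. F x + kernel_op P (G n) x - G n x)"
      unfolding ue density_mean_def ko by simp
  qed
  have I_pos: "0 < I n" for n
  proof -
    have s: "0 < 1 - 2 * \<gamma>" using g01 by simp
    have Jm: "J n 0 \<in> sets borel" using cl[of n] by (auto simp: cells_def)
    have i: "integrable lborel (\<lambda>x. indicator (J n 0) x * \<pi> x powr (1 - 2 * \<gamma>))"
      using integrable_mult_indicator[OF _ pi_powr_integrable[OF s], of "J n 0"] Jm by simp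
    have "I n \<noteq> 0"
    proof
      assume "I n = 0"
      then have "AE x in lborel. indicator (J n 0) x * \<pi> x powr (1 - 2 * \<gamma>) = 0"
        unfolding I_def using integral_nonneg_eq_0_iff_AE[OF i] by simp
      then have "AE x in lborel. x \<notin> J n 0" by (rule AE_mp) (auto intro!: AE_I2 split: split_indicator)
      then have "emeasure lborel (J n 0) = 0" using Jm by (subst (asm) AE_iff_measurable[of "J n 0"]) auto
      then show False using J0[of n] by simp
    qed
    moreover have "0 \<le> I n" unfolding I_def by (intro integral_nonneg_AE) auto
    ultimately show ?thesis by simp
  qed
  \<comment> \<open>From here on the bounds hold uniformly over all allotments with a small mesh.\<close>
  obtain K \<delta>1 where K: "0 \<le> K" "0 < \<delta>1" "\<And>n x y. \<delta> n \<le> \<delta>1 \<Longrightarrow> \<bar>G n x - G n y\<bar> \<le> K * (V x + V y)"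
  proof (rule scheme_solution_bound[OF F])
    fix K \<delta>1 assume K: "0 \<le> K" "0 < \<delta>1" and *: "\<And>m J a \<delta> f c x y. cells V m J a \<delta> \<Longrightarrow> \<delta> \<le> \<delta>1 \<Longrightarrow> f \<in> borel_measurable borel \<Longrightarrow>
       (\<And>j x. j \<le> m \<Longrightarrow> x \<in> J j \<Longrightarrow> f x = f (a j)) \<Longrightarrow>
       (\<And>j. j \<le> m \<Longrightarrow> f (a j) - transop f (a j) = F (a j) - c) \<Longrightarrow> \<bar>f x - f y\<bar> \<le> K * (V x + V y)"
    show thesis
    proof (rule that[OF K])
      show "\<bar>G n x - G n y\<bar> \<le> K * (V x + V y)" if "\<delta> n \<le> \<delta>1" for n x y
        by (rule *[OF cl that growth_meas[OF Gg] Gc Ge])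
    qed
  qed
  obtain B where B: "0 \<le> B" "\<And>x. \<bar>h x\<bar> \<le> B * V x" using growthE[OF h(1)] by metis
  obtain CV where CV: "\<And>x. 1 \<le> CV * V x" "0 \<le> CV"
    using growthE[OF const_growth[OF g01(1), of 1]] by (metis abs_one)
  define K' where "K' = (B + K) * (2 * CV + 1 + mean V * CV)"
  have mV: "0 \<le> mean V" by (rule mean_nonneg) simp
  have K'0: "0 \<le> K'" unfolding K'_def using B(1) K(1) CV(2) mV by (intro mult_nonneg_nonneg add_nonneg_nonneg) auto
  have u_le: "\<bar>u n x\<bar> \<le> K' * V x" if "\<delta> n \<le> \<delta>1" for n x
  proof -
    have "\<bar>u n x - u n y\<bar> \<le> (B + K) * (2 + 1 * V x + 1 * V y)" for x y
    proof -
      have "\<bar>u n x - u n y\<bar> \<le> \<bar>h x\<bar> + \<bar>h y\<bar> + \<bar>G n x - G n y\<bar>" unfolding u_def by linarith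
      also have "\<dots> \<le> B * V x + B * V y + K * (V x + V y)" by (intro add_mono B K(3) that)
      also have "\<dots> = (B + K) * (V x + V y)" by (simp add: algebra_simps)
      also have "\<dots> \<le> (B + K) * (2 + 1 * V x + 1 * V y)" using B(1) K(1) by (intro mult_left_mono) auto
      finally show ?thesis .
    qed
    from osc_to_abs[OF ug g01(1,3) um this]
    have "\<bar>u n x\<bar> \<le> (B + K) * (2 + 1 * V x + 1 * mean V)" .
    also have "\<dots> \<le> (B + K) * ((2 * CV + 1 + mean V * CV) * V x)"
    proof (intro mult_left_mono)
      show "2 + 1 * V x + 1 * mean V \<le> (2 * CV + 1 + mean V * CV) * V x"
        using CV(1)[of x] mult_left_mono[OF CV(1)[of x] mV] by (simp add: algebra_simps)
    qed (use B(1) K(1) in simp)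
    finally show ?thesis unfolding K'_def by (simp add: mult.assoc)
  qed
  obtain C \<delta>2 R where C: "0 < C" "0 < \<delta>2"
    and st: "\<And>n. \<delta> n \<le> \<delta>2 \<Longrightarrow> (\<And>x. x \<in> J n 0 \<Longrightarrow> R < norm x) \<Longrightarrow> (\<And>x. \<bar>u n x\<bar> \<le> K' * V x) \<Longrightarrow>
       (\<And>j x. 1 \<le> j \<Longrightarrow> j \<le> m n \<Longrightarrow> x \<in> J n j \<Longrightarrow> \<bar>u n x - u n (a n j)\<bar> \<le> CL * \<delta> n * (w x + w (a n j))) \<Longrightarrow>
       mean (\<lambda>x. (u n x)\<^sup>2) \<le> C * ((\<delta> n)\<^sup>2 + I n)"
  proof (rule stability[OF K'0 CL(1)])
    fix C \<delta>2 R assume C: "0 < C" "0 < \<delta>2" and *: "\<And>m J a \<delta> u c. cells V m J a \<delta> \<Longrightarrow> \<delta> \<le> \<delta>2 \<Longrightarrow> (\<And>x. x \<in> J 0 \<Longrightarrow> R < norm x) \<Longrightarrow>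
       u \<in> borel_measurable borel \<Longrightarrow> (\<And>x. \<bar>u x\<bar> \<le> K' * V x) \<Longrightarrow> mean u = 0 \<Longrightarrow>
       (\<And>j. j \<le> m \<Longrightarrow> u (a j) - transop u (a j) = c) \<Longrightarrow>
       (\<And>j x. 1 \<le> j \<Longrightarrow> j \<le> m \<Longrightarrow> x \<in> J j \<Longrightarrow> \<bar>u x - u (a j)\<bar> \<le> CL * \<delta> * (w x + w (a j))) \<Longrightarrow>
       mean (\<lambda>x. (u x)\<^sup>2) \<le> C * (\<delta>\<^sup>2 + (\<integral>x. indicator (J 0) x * \<pi> x powr (1 - 2 * \<gamma>) \<partial>lborel))"
    show thesis
    proof (rule that[OF C])
      fix n assume a: "\<delta> n \<le> \<delta>2" "\<And>x. x \<in> J n 0 \<Longrightarrow> R < norm x" "\<And>x. \<bar>u n x\<bar> \<le> K' * V x"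
        "\<And>j x. 1 \<le> j \<Longrightarrow> j \<le> m n \<Longrightarrow> x \<in> J n j \<Longrightarrow> \<bar>u n x - u n (a n j)\<bar> \<le> CL * \<delta> n * (w x + w (a n j))"
      have "u n (a n j) - transop (u n) (a n j) = c n - mean F" if "j \<le> m n" for j unfolding ue using Ge[OF that] by simp
      from *[OF cl a(1,2) growth_meas[OF ug] a(3) um this a(4)]
      show "mean (\<lambda>x. (u n x)\<^sup>2) \<le> C * ((\<delta> n)\<^sup>2 + I n)" unfolding I_def .
    qed
  qed
  have "0 < min (min \<delta>1 \<delta>2) \<epsilon>" using K(2) C(2) CL(2) by simp
  then have "\<forall>\<^sub>F n in sequentially. \<delta> n < min (min \<delta>1 \<delta>2) \<epsilon>" by (rule order_tendstoD(2)[OF \<delta>])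
  then have "\<forall>\<^sub>F n in sequentially. v n \<le> C * ((\<delta> n)\<^sup>2 + I n)"
    using far[of R]
  proof eventually_elim
    case (elim n)
    have "mean (\<lambda>x. (u n x)\<^sup>2) \<le> C * ((\<delta> n)\<^sup>2 + I n)"
    proof (rule st)
      show "\<delta> n \<le> \<delta>2" "\<And>x. x \<in> J n 0 \<Longrightarrow> R < norm x" using elim by auto
      show "\<bar>u n x\<bar> \<le> K' * V x" for x using elim by (intro u_le) auto
      fix j x assume j: "1 \<le> j" "j \<le> m n" "x \<in> J n j"
      have xa: "norm (x - a n j) \<le> \<delta> n" using cl[of n] j by (auto simp: cells_def)
      have "\<bar>u n x - u n (a n j)\<bar> = \<bar>h x - h (a n j)\<bar>" unfolding u_def using Gc[OF j(2,3)] by simp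
      also have "\<dots> \<le> CL * norm (x - a n j) * (w x + w (a n j))" using xa elim by (intro CL(3)) simp
      also have "\<dots> \<le> CL * \<delta> n * (w x + w (a n j))" using xa CL(1) by (intro mult_right_mono mult_left_mono) auto
      finally show "\<bar>u n x - u n (a n j)\<bar> \<le> CL * \<delta> n * (w x + w (a n j))" .
    qed
    moreover have "0 \<le> mean (\<lambda>x. (transop (u n) x)\<^sup>2)" by (rule mean_nonneg) simp
    ultimately show ?case unfolding v_def by linarith
  qed
  then obtain N where N: "\<And>n. N \<le> n \<Longrightarrow> v n \<le> C * ((\<delta> n)\<^sup>2 + I n)" unfolding eventually_sequentially by blast
  \<comment> \<open>The finitely many remaining indices are absorbed into the constant, since \<open>I n\<close> is positive.\<close>
  define D where "D = 2 * C + (\<Sum>n<N. \<bar>v n\<bar> / I n)"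
  have Dn: "0 \<le> (\<Sum>n<N. \<bar>v n\<bar> / I n)" using I_pos by (intro sum_nonneg divide_nonneg_pos) auto
  have bound: "v n \<le> D * max ((\<delta> n)\<^sup>2) (I n)" for n
  proof (cases "N \<le> n")
    case True
    have "v n \<le> C * ((\<delta> n)\<^sup>2 + I n)" by (rule N[OF True])
    also have "\<dots> \<le> C * (2 * max ((\<delta> n)\<^sup>2) (I n))" using C by (intro mult_left_mono) auto
    also have "\<dots> = 2 * C * max ((\<delta> n)\<^sup>2) (I n)" by simp
    also have "\<dots> \<le> D * max ((\<delta> n)\<^sup>2) (I n)" unfolding D_def using Dn by (intro mult_right_mono) (auto simp: le_max_iff_disj)
    finally show ?thesis .
  next
    case False
    have "\<bar>v n\<bar> / I n \<le> (\<Sum>n<N. \<bar>v n\<bar> / I n)" using False I_pos less_imp_le by (intro member_le_sum divide_nonneg_pos) auto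
    then have "\<bar>v n\<bar> / I n \<le> D" unfolding D_def using C by simp
    then have "\<bar>v n\<bar> \<le> D * I n" using I_pos[of n] by (simp add: pos_divide_le_eq)
    also have "\<dots> \<le> D * max ((\<delta> n)\<^sup>2) (I n)" unfolding D_def using C Dn by (intro mult_left_mono) auto
    finally show ?thesis by simp
  qed
  have "0 < D" unfolding D_def using C Dn by simp
  moreover have "(\<integral>x\<in>J n 0. \<pi> x powr (1 - 2 * \<gamma>) \<partial>lborel) = I n" for n
    unfolding I_def set_lebesgue_integral_def by simp
  ultimately show ?thesis using clt bound by (intro exI[of _ D]) (auto intro!: exI[of _ "v _"])
qed

end

theorem proposition4p3:
  fixes qstar \<pi> K\<^sub>q F V :: "'a::euclidean_space \<Rightarrow> real"
    and P :: "'a \<Rightarrow> 'a measure"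
    and M :: "'w measure" and \<Phi> :: "nat \<Rightarrow> 'w \<Rightarrow> 'a"
    and \<epsilon>\<^sub>q \<beta> c\<^sub>\<beta> \<epsilon>\<^sub>\<pi> \<gamma> c\<^sub>\<gamma> c\<^sub>F \<epsilon>\<^sub>F :: real
    and m :: "nat \<Rightarrow> nat" and J :: "nat \<Rightarrow> nat \<Rightarrow> 'a set" and a :: "nat \<Rightarrow> nat \<Rightarrow> 'a"
    and Ftilde :: "nat \<Rightarrow> 'a \<Rightarrow> real"
  assumes qstar: "continuous_on UNIV qstar" "\<And>z. 0 < qstar z" "bounded (range qstar)"
      "probability_density qstar"
    and target: "continuously_differentiable \<pi>" "\<And>x. 0 < \<pi> x" "probability_density \<pi>"
    and log_tail: "filterlim (\<lambda>x. (x /\<^sub>R norm x) \<bullet> grad (\<lambda>y. ln (\<pi> y)) x) at_bot at_infinity"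
    and curvature: "Limsup at_infinity
      (\<lambda>x. ereal ((x /\<^sub>R norm x) \<bullet> (grad \<pi> x /\<^sub>R norm (grad \<pi> x)))) < 0"
    and P_def: "P = MH_kernel \<pi> (\<lambda>x y. qstar (y - x))"
    and chain: "markov_chain M \<Phi> P"
    and cond_i: "0 < \<epsilon>\<^sub>q" "integrable lborel K\<^sub>q"
      "\<And>z z'. norm (z - z') < \<epsilon>\<^sub>q \<Longrightarrow> \<bar>qstar z - qstar z'\<bar> \<le> norm (z - z') * K\<^sub>q z"
    and cond_ii: "\<beta> \<in> {1/2<..<1}" "0 < c\<^sub>\<beta>" "0 < \<epsilon>\<^sub>\<pi>"
      "\<And>x x'. norm (x - x') < \<epsilon>\<^sub>\<pi> \<Longrightarrow> norm (grad \<pi> x') < c\<^sub>\<beta> * \<pi> x powr \<beta>"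
    and gamma: "\<gamma> \<in> {0<..<\<beta> - 1/2}"
    and V: "V = (\<lambda>x. c\<^sub>\<gamma> * \<pi> x powr (- \<gamma>))" "\<And>x. 1 < V x"
    and allotments: "\<And>n. allotment (m n) (J n) (a n)" "exhaustive m J a V"
    and F: "F \<in> L_infty_V V" "continuously_differentiable F" "0 < c\<^sub>F" "0 < \<epsilon>\<^sub>F"
      "\<And>x x'. norm (x - x') < \<epsilon>\<^sub>F \<Longrightarrow> norm (grad F x') < c\<^sub>F * \<pi> x powr (\<gamma> - 1/2)"
    and scheme: "\<And>n. scheme_output P F (m n) (J n) (a n) (Ftilde n)"
  shows "\<exists>C>0. \<forall>n. \<exists>v.
    clt_with_variance M \<Phi> \<pi> (\<lambda>x. F x + kernel_op P (Ftilde n) x - Ftilde n x) v \<and>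
    v \<le> C * max ((mesh (m n) (J n) (a n) V)\<^sup>2)
              (\<integral>x\<in>J n 0. \<pi> x powr (1 - 2 * \<gamma>) \<partial>lborel)"
proof -
  have pi_c: "continuous_on UNIV \<pi>"
    using GDERIV_grad[OF target(1)] unfolding gderiv_def
    by (auto intro!: has_derivative_continuous continuous_at_imp_continuous_on)
  interpret X: rwm_smooth qstar \<pi> K\<^sub>q \<epsilon>\<^sub>q \<beta> c\<^sub>\<beta> \<epsilon>\<^sub>\<pi> \<gamma>
  proof (intro rwm_smooth.intro rwm.intro rwm_smooth_axioms.intro)
    show "integrable lborel qstar" "(\<integral>z. qstar z \<partial>lborel) = 1" by (rule probability_density_integral[OF qstar(4)])+
    show "integrable lborel \<pi>" "(\<integral>z. \<pi> z \<partial>lborel) = 1" by (rule probability_density_integral[OF target(3)])+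
    show "\<exists>R. \<forall>x t. R \<le> norm x \<longrightarrow> 1 \<le> t \<longrightarrow> \<pi> (t *\<^sub>R x) \<le> \<pi> x * exp (- (L * (t - 1) * norm x))" for L
      by (rule radial_decay_of_log_gradient[OF target(1,2) log_tail])
    show "\<exists>R. \<exists>\<epsilon>>0. \<forall>x z. R \<le> norm x \<longrightarrow> z \<in> ball (- (1 / (2 * norm x)) *\<^sub>R x) \<epsilon> \<longrightarrow> \<pi> x \<le> \<pi> (x + z)"
      by (rule inward_ball_of_curvature[OF target(1) curvature])
    show "\<bar>\<pi> x - \<pi> x'\<bar> \<le> norm (x - x') * (c\<^sub>\<beta> * \<pi> x powr \<beta>)" if "norm (x - x') < \<epsilon>\<^sub>\<pi>" for x x'
      using increment_le_of_grad[OF target(1) less_imp_le[OF cond_ii(4)] that] .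
  qed (use qstar target pi_c cond_i cond_ii gamma in auto)
  have c0: "0 < c\<^sub>\<gamma>"
    using V(2)[of 0] zero_less_mult_pos2[of "c\<^sub>\<gamma>" "\<pi> 0 powr - \<gamma>"] target(2)[of 0] unfolding V(1) by simp
  let ?mesh = "\<lambda>n. mesh (m n) (J n) (a n) V"
  have V1: "1 \<le> c\<^sub>\<gamma> * \<pi> x powr - \<gamma>" for x using V(2)[of x] unfolding V(1) by simp
  show ?thesis
    unfolding P_def
  proof (rule X.scheme_variance_bound)
    show "cells (\<lambda>x. \<pi> x powr - \<gamma>) (m n) (J n) (a n) (?mesh n)" for n
      unfolding V(1) by (rule allotment_cells[OF allotments(1) c0 V1])
    show "?mesh \<longlonglongrightarrow> 0" using allotments(2) by (simp add: exhaustive_def)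
    show "\<forall>\<^sub>F n in sequentially. \<forall>x\<in>J n 0. R < norm x" for R
    proof -
      obtain B where B: "\<And>x. norm x \<le> R \<Longrightarrow> \<pi> x powr - \<gamma> \<le> B" using X.Vs_bounded_on_ball by blast
      have "filterlim (\<lambda>n. rad (J n) V) at_top sequentially" using allotments(2) by (simp add: exhaustive_def)
      then have "\<forall>\<^sub>F n in sequentially. c\<^sub>\<gamma> * B < rad (J n) V" by (simp add: filterlim_at_top_dense)
      then show ?thesis
      proof eventually_elim
        case (elim n)
        have "R < norm x" if "x \<in> J n 0" for x
        proof (rule ccontr)
          assume "\<not> R < norm x"
          then have "V x \<le> c\<^sub>\<gamma> * B" unfolding V(1) using B c0 by (intro mult_left_mono) auto
          moreover have "rad (J n) V \<le> V x"
            unfolding rad_def using that V(2) by (intro cINF_lower bdd_belowI2[where m=1] less_imp_le)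
          ultimately show False using elim by simp
        qed
        then show ?case by blast
      qed
    qed
    show "F \<in> X.growth \<gamma>"
    proof -
      obtain B where B: "\<And>x. \<bar>F x\<bar> / V x \<le> B" using F(1) unfolding L_infty_V_def bdd_above_def by auto
      show ?thesis
      proof (rule X.growthI[where B="B * c\<^sub>\<gamma>"])
        show "F \<in> borel_measurable borel" using F(1) by (simp add: L_infty_V_def)
        fix x
        have "0 < V x" using V(2)[of x] by simp
        then have "\<bar>F x\<bar> \<le> B * V x" using B[of x] by (simp add: pos_divide_le_eq)
        then show "\<bar>F x\<bar> \<le> B * c\<^sub>\<gamma> * \<pi> x powr - \<gamma>" unfolding V(1) by (simp add: mult.assoc)
      qed
    qed
    show "\<bar>F x - F x'\<bar> \<le> norm (x - x') * (c\<^sub>F * \<pi> x powr (\<gamma> - 1 / 2))" if "norm (x - x') < \<epsilon>\<^sub>F" for x x'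
      using increment_le_of_grad[OF F(2) less_imp_le[OF F(5)] that] .
    show "0 < emeasure lborel (J n 0)" for n using allotments(1)[of n] by (simp add: allotment_def)
  qed (use F scheme chain P_def in auto)
qed

end
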